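(* Let $n\geq 2$, let $\Omega\subset\mathbb{C}^n$ be a $C^2$-smooth bounded pseudoconvex domain, let $\varphi\in\mathcal{O}(\Omega)\cap C^2(\overline{\Omega})$, and let $0<p\leq 2n$. Then the Hankel operator $H_{\overline{\varphi}}:A^2(\Omega)\to L^2(\Omega)$ is in the Schatten $p$-class $S_p$ if and only if $\varphi$ is a constant function.
   Context: $\mathcal{O}(\Omega)$ is the space of holomorphic functions on $\Omega$, and $C^2(\overline{\Omega})$ is the space of functions that are $C^2$-smooth on the closure $\overline{\Omega}$. $L^2(\Omega)$ is taken with respect to Lebesgue measure, and $A^2(\Omega)$ is the Bergman space, i.e. the closed subspace of $L^2(\Omega)$ consisting of square integrable holomorphic functions on $\Omega$. $P:L^2(\Omega)\to A^2(\Omega)$ is the Bergman projection (the orthogonal projection). For $\psi\in L^\infty(\Omega)$ the Hankel operator $H_\psi:A^2(\Omega)\to L^2(\Omega)$ with symbol $\psi$ is $H_\psi f=(I-P)(\psi f)$, where $I$ is the identity map; $H_{\overline{\varphi}}$ is the Hankel operator whose symbol is the complex conjugate $\overline{\varphi}$. A self-adjoint compact operator on a separable Hilbert space is in the trace class $S_1$ if its eigenvalues (counted with multiplicity) are absolutely summable. For $0<p<\infty$, an operator $T$ is in the Schatten $p$-class $S_p$ if $(T^*T)^{p/2}$ is in the trace class $S_1$ (in particular, $(T^*T)^{p/2}$ is compact). *)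

theory Defs
  imports "HOL-Analysis.Analysis" "HOL-Library.Function_Algebras"
    "HOL-Computational_Algebra.Polynomial"
begin

section \<open>Smoothness and holomorphy\<close>

text \<open>Differentiability is over the reals. For functions on \<open>complex ^ 'n\<close> these are the usual
  real \<open>C\<^sup>2\<close> classes.\<close>

definition C2_on :: "'a::real_normed_vector set \<Rightarrow> ('a \<Rightarrow> 'b::real_normed_vector) \<Rightarrow> bool" where
  "C2_on U f \<longleftrightarrow>
    (\<exists>(f1 :: 'a \<Rightarrow> 'a \<Rightarrow>\<^sub>L 'b) (f2 :: 'a \<Rightarrow> 'a \<Rightarrow>\<^sub>L 'a \<Rightarrow>\<^sub>L 'b).
       (\<forall>x\<in>U. (f has_derivative blinfun_apply (f1 x)) (at x)) \<and>
       (\<forall>x\<in>U. (f1 has_derivative blinfun_apply (f2 x)) (at x)) \<and>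
       continuous_on U f2)"

text \<open>The space \<open>C\<^sup>2(closure \<Omega>)\<close> for open \<open>\<Omega>\<close>: the function and its derivatives of order at most two
  extend continuously from \<open>\<Omega>\<close> to the closure. Only the values of \<open>f\<close> on \<open>\<Omega>\<close> matter; \<open>f0\<close> is the
  continuous extension of \<open>f\<close>.\<close>

definition C2_on_closure :: "'a::real_normed_vector set \<Rightarrow> ('a \<Rightarrow> 'b::real_normed_vector) \<Rightarrow> bool" where
  "C2_on_closure \<Omega> f \<longleftrightarrow>
    (\<exists>(f0 :: 'a \<Rightarrow> 'b) (f1 :: 'a \<Rightarrow> 'a \<Rightarrow>\<^sub>L 'b) (f2 :: 'a \<Rightarrow> 'a \<Rightarrow>\<^sub>L 'a \<Rightarrow>\<^sub>L 'b).
       (\<forall>x\<in>\<Omega>. f0 x = f x) \<and>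
       (\<forall>x\<in>\<Omega>. (f has_derivative blinfun_apply (f1 x)) (at x)) \<and>
       (\<forall>x\<in>\<Omega>. (f1 has_derivative blinfun_apply (f2 x)) (at x)) \<and>
       continuous_on (closure \<Omega>) f0 \<and>
       continuous_on (closure \<Omega>) f1 \<and>
       continuous_on (closure \<Omega>) f2)"

definition Cn_holomorphic_on :: "(complex ^ 'n \<Rightarrow> complex) \<Rightarrow> (complex ^ 'n) set \<Rightarrow> bool"
    (infixl "Cn'_holomorphic'_on" 50) where
  "f Cn_holomorphic_on \<Omega> \<longleftrightarrow>
    (\<forall>z\<in>\<Omega>. \<exists>D. (f has_derivative D) (at z) \<and> (\<forall>c v. D (c *s v) = c * D v))"


section \<open>Domains\<close>

text \<open>Local \<open>C\<^sup>2\<close> defining functions with nowhere vanishing gradient. Since \<open>\<Omega> \<inter> U\<close> is all of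
  \<open>{r < 0}\<close>, the domain lies locally on one side of its boundary.\<close>

definition C2_boundary :: "'a::real_normed_vector set \<Rightarrow> bool" where
  "C2_boundary \<Omega> \<longleftrightarrow>
    (\<forall>p\<in>frontier \<Omega>. \<exists>U (r :: 'a \<Rightarrow> real).
       open U \<and> p \<in> U \<and> C2_on U r \<and>
       \<Omega> \<inter> U = {x \<in> U. r x < 0} \<and>
       (\<forall>x\<in>U. \<not> (r has_derivative (\<lambda>_. 0)) (at x)))"

text \<open>Continuous plurisubharmonic functions: the sub-mean-value inequality on every closed complex
  disc contained in the domain.\<close>

definition continuous_psh_on :: "(complex ^ 'n) set \<Rightarrow> (complex ^ 'n \<Rightarrow> real) \<Rightarrow> bool" where
  "continuous_psh_on \<Omega> u \<longleftrightarrow>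
    continuous_on \<Omega> u \<and>
    (\<forall>z w. (\<forall>\<zeta>. cmod \<zeta> \<le> 1 \<longrightarrow> z + \<zeta> *s w \<in> \<Omega>) \<longrightarrow>
       u z \<le> 1 / (2 * pi) * integral {0..2 * pi} (\<lambda>t. u (z + cis t *s w)))"

text \<open>Pseudoconvexity: existence of a continuous plurisubharmonic exhaustion function.\<close>

definition pseudoconvex :: "(complex ^ 'n) set \<Rightarrow> bool" where
  "pseudoconvex \<Omega> \<longleftrightarrow>
    (\<exists>u. continuous_psh_on \<Omega> u \<and>
       (\<forall>c. compact (closure {z \<in> \<Omega>. u z < c}) \<and> closure {z \<in> \<Omega>. u z < c} \<subseteq> \<Omega>))"

definition C2_bounded_pseudoconvex_domain :: "(complex ^ 'n) set \<Rightarrow> bool" where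
  "C2_bounded_pseudoconvex_domain \<Omega> \<longleftrightarrow>
    open \<Omega> \<and> connected \<Omega> \<and> \<Omega> \<noteq> {} \<and> bounded \<Omega> \<and> C2_boundary \<Omega> \<and> pseudoconvex \<Omega>"


section \<open>Operators on spaces of functions\<close>

text \<open>Hilbert spaces are given by a carrier \<open>S\<close> of complex-valued functions, with pointwise vector
  space operations, and an inner product \<open>ip\<close>, linear in the first argument. On codomains \<open>ip\<close> may
  be only semidefinite (as for square integrable functions not identified up to null sets); on the
  spaces where adjoints, powers and eigenvalues are formed it is definite.\<close>

definition cscale :: "complex \<Rightarrow> ('x \<Rightarrow> complex) \<Rightarrow> 'x \<Rightarrow> complex" where
  "cscale c f = (\<lambda>x. c * f x)"

lemma vector_space_cscale: "vector_space (cscale :: complex \<Rightarrow> ('x \<Rightarrow> complex) \<Rightarrow> 'x \<Rightarrow> complex)"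
  by unfold_locales (auto simp: cscale_def fun_eq_iff algebra_simps)

type_synonym 'x inner_prod = "('x \<Rightarrow> complex) \<Rightarrow> ('x \<Rightarrow> complex) \<Rightarrow> complex"
type_synonym 'x operator = "('x \<Rightarrow> complex) \<Rightarrow> 'x \<Rightarrow> complex"

definition ip_norm :: "'x inner_prod \<Rightarrow> ('x \<Rightarrow> complex) \<Rightarrow> real" where
  "ip_norm ip f = sqrt (Re (ip f f))"

definition bounded_operator ::
    "('x \<Rightarrow> complex) set \<Rightarrow> ('x \<Rightarrow> complex) set \<Rightarrow> 'x inner_prod \<Rightarrow> 'x operator \<Rightarrow> bool" where
  "bounded_operator S K ip T \<longleftrightarrow>
    (\<forall>f\<in>S. T f \<in> K) \<and>
    (\<forall>f\<in>S. \<forall>g\<in>S. ip_norm ip (T (f + g) - (T f + T g)) = 0) \<and>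
    (\<forall>c. \<forall>f\<in>S. ip_norm ip (T (cscale c f) - cscale c (T f)) = 0) \<and>
    (\<exists>M. \<forall>f\<in>S. ip_norm ip (T f) \<le> M * ip_norm ip f)"

definition adjoint_op :: "('x \<Rightarrow> complex) set \<Rightarrow> 'x inner_prod \<Rightarrow> 'x operator \<Rightarrow> 'x operator" where
  "adjoint_op S ip T g = (THE f. f \<in> S \<and> (\<forall>h\<in>S. ip (T h) g = ip h f))"

definition self_adjoint_op :: "('x \<Rightarrow> complex) set \<Rightarrow> 'x inner_prod \<Rightarrow> 'x operator \<Rightarrow> bool" where
  "self_adjoint_op S ip B \<longleftrightarrow> (\<forall>f\<in>S. \<forall>g\<in>S. ip (B f) g = ip f (B g))"

definition compact_op :: "('x \<Rightarrow> complex) set \<Rightarrow> 'x inner_prod \<Rightarrow> 'x operator \<Rightarrow> bool" where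
  "compact_op S ip B \<longleftrightarrow>
    (\<forall>F :: nat \<Rightarrow> 'x \<Rightarrow> complex. (\<forall>k. F k \<in> S \<and> ip_norm ip (F k) \<le> 1) \<longrightarrow>
      (\<exists>g\<in>S. \<exists>r. strict_mono r \<and> (\<lambda>k. ip_norm ip (B (F (r k)) - g)) \<longlonglongrightarrow> 0))"

definition op_poly :: "real poly \<Rightarrow> 'x operator \<Rightarrow> 'x operator" where
  "op_poly q A f = (\<Sum>i\<le>degree q. cscale (of_real (coeff q i)) ((A ^^ i) f))"

text \<open>\<open>B\<close> is the power \<open>A\<^sup>s\<close> (for \<open>s > 0\<close>) of the bounded positive operator \<open>A\<close> on \<open>S\<close> in the sense of
  the continuous functional calculus: the limit in operator norm of \<open>q\<^sub>k(A)\<close>, for polynomials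
  \<open>q\<^sub>k\<close> converging to \<open>t powr s\<close> uniformly on an interval \<open>[0, M]\<close> with \<open>M\<close> at least the norm of \<open>A\<close>,
  which contains the spectrum. The interval and the polynomials do not affect the limit.\<close>

definition is_op_powr ::
    "('x \<Rightarrow> complex) set \<Rightarrow> 'x inner_prod \<Rightarrow> 'x operator \<Rightarrow> real \<Rightarrow> 'x operator \<Rightarrow> bool" where
  "is_op_powr S ip A s B \<longleftrightarrow>
    bounded_operator S S ip B \<and>
    (\<exists>M\<ge>0. \<exists>q :: nat \<Rightarrow> real poly.
       (\<forall>f\<in>S. ip_norm ip (A f) \<le> M * ip_norm ip f) \<and>
       uniform_limit {0..M} (\<lambda>k t. poly (q k) t) (\<lambda>t. t powr s) sequentially \<and>
       (\<forall>\<epsilon>>0. \<forall>\<^sub>F k in sequentially.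
          \<forall>f\<in>S. ip_norm ip (op_poly (q k) A f - B f) \<le> \<epsilon> * ip_norm ip f))"

definition eigenspace :: "('x \<Rightarrow> complex) set \<Rightarrow> 'x operator \<Rightarrow> complex \<Rightarrow> ('x \<Rightarrow> complex) set" where
  "eigenspace S B l = {f \<in> S. B f = cscale l f}"

text \<open>The multiplicity of an eigenvalue is the complex dimension of its eigenspace. For nonzero
  eigenvalues of a compact operator it is finite, so that the convention \<open>dim = 0\<close> for
  infinite-dimensional spaces has no effect on the sum.\<close>

definition sa_trace_class :: "('x \<Rightarrow> complex) set \<Rightarrow> 'x inner_prod \<Rightarrow> 'x operator \<Rightarrow> bool" where
  "sa_trace_class S ip B \<longleftrightarrow>
    self_adjoint_op S ip B \<and> compact_op S ip B \<and>
    (\<lambda>l. real (vector_space.dim cscale (eigenspace S B l)) * cmod l)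
      summable_on {l. \<exists>f\<in>eigenspace S B l. f \<noteq> 0}"

definition schatten_class ::
    "('x \<Rightarrow> complex) set \<Rightarrow> ('x \<Rightarrow> complex) set \<Rightarrow> 'x inner_prod \<Rightarrow> real \<Rightarrow> 'x operator \<Rightarrow> bool" where
  "schatten_class S K ip p T \<longleftrightarrow>
    bounded_operator S K ip T \<and>
    (\<exists>B. is_op_powr S ip (\<lambda>f. adjoint_op S ip T (T f)) (p / 2) B \<and> sa_trace_class S ip B)"


section \<open>Bergman spaces and Hankel operators\<close>

definition L2_space :: "(complex ^ 'n) set \<Rightarrow> (complex ^ 'n \<Rightarrow> complex) set" where
  "L2_space \<Omega> = {f \<in> borel_measurable (lebesgue_on \<Omega>).
      integrable (lebesgue_on \<Omega>) (\<lambda>z. (cmod (f z))\<^sup>2)}"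

definition L2_inner :: "(complex ^ 'n) set \<Rightarrow> (complex ^ 'n) inner_prod" where
  "L2_inner \<Omega> f g = (LINT z|lebesgue_on \<Omega>. f z * cnj (g z))"

text \<open>Functions on \<open>\<Omega>\<close> are represented by their extension by zero, which makes \<open>L2_inner \<Omega>\<close> definite
  on the Bergman space of an open set \<open>\<Omega>\<close>.\<close>

definition bergman_space :: "(complex ^ 'n) set \<Rightarrow> (complex ^ 'n \<Rightarrow> complex) set" where
  "bergman_space \<Omega> = {f \<in> L2_space \<Omega>. f Cn_holomorphic_on \<Omega> \<and> (\<forall>z. z \<notin> \<Omega> \<longrightarrow> f z = 0)}"

definition bergman_projection :: "(complex ^ 'n) set \<Rightarrow> (complex ^ 'n) operator" where
  "bergman_projection \<Omega> f =
    (THE g. g \<in> bergman_space \<Omega> \<and> (\<forall>h\<in>bergman_space \<Omega>. L2_inner \<Omega> (f - g) h = 0))"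

definition hankel_operator ::
    "(complex ^ 'n) set \<Rightarrow> (complex ^ 'n \<Rightarrow> complex) \<Rightarrow> (complex ^ 'n) operator" where
  "hankel_operator \<Omega> \<psi> f = \<psi> * f - bergman_projection \<Omega> (\<psi> * f)"

end

theory Submission imports Defs "HOL-Complex_Analysis.Complex_Analysis"
  "HOL-Computational_Algebra.Fundamental_Theorem_Algebra" begin

text \<open>
  Only a boundary point \<open>q\<close> farthest from the origin is needed, not pseudoconvexity. Let \<open>A = H\<^sup>* H\<close> and let
  \<open>K\<^sub>z\<close> be the Bergman kernel at \<open>z\<close>. If \<open>A\<close> has the power \<open>p / 2\<close> of trace class, then \<open>A\<^sup>n\<close> is dominated by it,
  and convexity of moments gives \<open>\<langle>A K\<^sub>z, K\<^sub>z\<rangle>\<^sup>n \<le> W(z) |K\<^sub>z|\<^sup>2\<^sup>(\<^sup>n\<^sup>-\<^sup>1\<^sup>)\<close> up to a constant, where \<open>W\<close> is integrable because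
  \<open>\<integral> |e(z)|\<^sup>2 = 1\<close> for each eigenvector \<open>e\<close>. On the other hand \<open>\<langle>A K\<^sub>z, K\<^sub>z\<rangle> = |(\<phi> - \<phi>(z)) K\<^sub>z|\<^sup>2\<close>. Near \<open>q\<close>
  the domain is strictly convex, which bounds \<open>|K\<^sub>z|\<^sup>2\<close> below by \<open>dist(z)\<^sup>-\<^sup>n\<^sup>-\<^sup>1\<close> and, by Cauchy estimates on an
  anisotropic neighbourhood of \<open>z\<close>, \<open>|(\<phi> - \<phi>(z)) K\<^sub>z|\<^sup>2\<close> below by \<open>|D\<phi>(\<tau>)|\<^sup>2 |K\<^sub>z|\<^sup>4 dist(z)\<^sup>n\<^sup>+\<^sup>2\<close> for complex
  tangential unit vectors \<open>\<tau>\<close>. Together, \<open>|D\<phi>(\<tau>)|\<^sup>2\<^sup>n / dist(z)\<close> is dominated by \<open>W\<close>; since \<open>1 / dist\<close> is not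
  integrable, \<open>D\<phi>(\<tau>)\<close> vanishes on the boundary near \<open>q\<close>. The maximum principle on small slices by complex lines
  then kills the normal derivative as well, so \<open>D\<phi> = 0\<close> near \<open>q\<close> and \<open>\<phi>\<close> is constant.
\<close>

section \<open>Spaces of functions with a semidefinite inner product\<close>

text \<open>\<open>schatten_class\<close> supplies the power of \<open>HH\<close> only as a norm
  limit of polynomials in \<open>HH\<close>. Spectral inequalities for \<open>HH\<close> are
  therefore proved as inequalities between real polynomials on [0, M]; an eigenvector expansion is
  used only for the compact power.

  At a farthest boundary point a ball touches the domain from outside. Strict convexity is inherited
  from this ball, and complex supporting hyperplanes at nearby points stay clear of the whole
  domain. Test functions with a pole beyond such a hyperplane are then globally bounded and
  holomorphic, with no d-bar equation to solve.

  Cauchy estimates reach a distance of order sqrt t along complex tangents but only t across them,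
  where t is the distance to the boundary. With radius t the same computation bounds W below only by
  a multiple of t^(n-1), which is integrable: nothing follows for the normal derivative. Hence the
  separate argument by the maximum principle after the trace estimate, and hence n >= 2: for n = 1
  there are no complex tangents.\<close>

locale semi_ip =
  fixes S :: "('x \<Rightarrow> complex) set" and ip :: "'x inner_prod"
  assumes zero_in: "0 \<in> S"
    and add_in: "\<And>f g. f \<in> S \<Longrightarrow> g \<in> S \<Longrightarrow> f + g \<in> S"
    and scale_in: "\<And>c f. f \<in> S \<Longrightarrow> cscale c f \<in> S"
    and ip_add: "\<And>f g h. f \<in> S \<Longrightarrow> g \<in> S \<Longrightarrow> h \<in> S \<Longrightarrow> ip (f + g) h = ip f h + ip g h"
    and ip_scale: "\<And>c f g. f \<in> S \<Longrightarrow> g \<in> S \<Longrightarrow> ip (cscale c f) g = c * ip f g"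
    and ip_commute: "\<And>f g. f \<in> S \<Longrightarrow> g \<in> S \<Longrightarrow> ip g f = cnj (ip f g)"
    and ip_ge0: "\<And>f. f \<in> S \<Longrightarrow> 0 \<le> Re (ip f f)"
begin

abbreviation nrm :: "('x \<Rightarrow> complex) \<Rightarrow> real" where "nrm \<equiv> ip_norm ip"

lemma diff_scale: "f - g = f + cscale (-1) g"
  by (simp add: cscale_def fun_eq_iff)

lemma diff_in: "f \<in> S \<Longrightarrow> g \<in> S \<Longrightarrow> f - g \<in> S"
  by (simp add: diff_scale add_in scale_in)

lemma sum_in: "finite I \<Longrightarrow> (\<And>i. i \<in> I \<Longrightarrow> F i \<in> S) \<Longrightarrow> (\<Sum>i\<in>I. F i) \<in> S"
  by (induction I rule: finite_induct) (auto simp: zero_in add_in)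

lemma ip_diff: "f \<in> S \<Longrightarrow> g \<in> S \<Longrightarrow> h \<in> S \<Longrightarrow> ip (f - g) h = ip f h - ip g h"
  by (simp add: diff_scale ip_add ip_scale scale_in)

lemma ip_zero: "g \<in> S \<Longrightarrow> ip 0 g = 0"
  using ip_add[of 0 0 g] zero_in by simp

lemma ip_add_right: "f \<in> S \<Longrightarrow> g \<in> S \<Longrightarrow> h \<in> S \<Longrightarrow> ip h (f + g) = ip h f + ip h g"
  by (metis add_in complex_cnj_add ip_add ip_commute)

lemma ip_diff_right: "f \<in> S \<Longrightarrow> g \<in> S \<Longrightarrow> h \<in> S \<Longrightarrow> ip h (f - g) = ip h f - ip h g"
  by (metis diff_in complex_cnj_diff ip_diff ip_commute)

lemma ip_scale_right: "f \<in> S \<Longrightarrow> g \<in> S \<Longrightarrow> ip g (cscale c f) = cnj c * ip g f"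
  by (metis scale_in complex_cnj_mult ip_scale ip_commute)

lemma ip_zero_right: "g \<in> S \<Longrightarrow> ip g 0 = 0"
  by (metis ip_zero ip_commute zero_in complex_cnj_zero)

lemma ip_sum: "finite I \<Longrightarrow> (\<And>i. i \<in> I \<Longrightarrow> F i \<in> S) \<Longrightarrow> g \<in> S \<Longrightarrow> ip (\<Sum>i\<in>I. F i) g = (\<Sum>i\<in>I. ip (F i) g)"
  by (induction I rule: finite_induct) (auto simp: ip_zero ip_add sum_in)

lemma ip_self: "f \<in> S \<Longrightarrow> ip f f = of_real ((nrm f)\<^sup>2)"
  using ip_commute[of f f] ip_ge0[of f] by (simp add: ip_norm_def complex_eq_iff)

lemma nrm_ge0: "f \<in> S \<Longrightarrow> 0 \<le> nrm f"
  using ip_ge0 by (simp add: ip_norm_def)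

lemma nrm_zero: "nrm 0 = 0"
  using zero_in by (simp add: ip_norm_def ip_zero)

lemma nrm_sq: "f \<in> S \<Longrightarrow> (nrm f)\<^sup>2 = Re (ip f f)"
  using ip_ge0 by (simp add: ip_norm_def)

lemma nrm_scale: "f \<in> S \<Longrightarrow> nrm (cscale c f) = cmod c * nrm f"
proof -
  assume f: "f \<in> S"
  have "ip (cscale c f) (cscale c f) = of_real ((cmod c * nrm f)\<^sup>2)"
    using ip_self[OF f] f complex_norm_square[of c]
    by (simp add: ip_scale ip_scale_right scale_in power_mult_distrib mult.assoc mult.commute)
  then have "(nrm (cscale c f))\<^sup>2 = (cmod c * nrm f)\<^sup>2"
    using f by (metis nrm_sq scale_in Re_complex_of_real)
  then show ?thesis
    using f nrm_ge0 scale_in by (simp add: power2_eq_iff_nonneg)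
qed

lemma nrm_add_sq: "f \<in> S \<Longrightarrow> g \<in> S \<Longrightarrow> (nrm (f + g))\<^sup>2 = (nrm f)\<^sup>2 + 2 * Re (ip f g) + (nrm g)\<^sup>2"
  using ip_commute[of f g] by (simp add: nrm_sq ip_add ip_add_right add_in)

lemma nrm_diff_sq: "f \<in> S \<Longrightarrow> g \<in> S \<Longrightarrow> (nrm (f - g))\<^sup>2 = (nrm f)\<^sup>2 - 2 * Re (ip f g) + (nrm g)\<^sup>2"
  using ip_commute[of f g] by (simp add: nrm_sq ip_diff ip_diff_right diff_in)

text \<open>The usual quadratic in a real parameter t, taken along f - t w g with w = ip f g. The
  form may be degenerate, so a null vector g needs its own argument.\<close>

lemma cauchy_schwarz:
  assumes f: "f \<in> S" and g: "g \<in> S"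
  shows "cmod (ip f g) \<le> nrm f * nrm g"
proof -
  define w where "w = ip f g"
  have key: "0 \<le> (nrm f)\<^sup>2 - 2 * t * (cmod w)\<^sup>2 + t\<^sup>2 * (cmod w)\<^sup>2 * (nrm g)\<^sup>2" for t :: real
  proof -
    have "(nrm (f - cscale (of_real t * w) g))\<^sup>2
      = (nrm f)\<^sup>2 - 2 * Re (cnj (of_real t * w) * w) + (cmod (of_real t * w) * nrm g)\<^sup>2"
      using f g by (simp add: nrm_diff_sq scale_in nrm_scale ip_scale_right w_def)
    moreover have "cnj (of_real t * w) * w = of_real (t * (cmod w)\<^sup>2)"
      using complex_norm_square[of w] by (simp add: mult.commute)
    ultimately have "(nrm (f - cscale (of_real t * w) g))\<^sup>2
      = (nrm f)\<^sup>2 - 2 * (t * (cmod w)\<^sup>2) + (\<bar>t\<bar> * cmod w * nrm g)\<^sup>2"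
      by (simp only: Re_complex_of_real norm_mult norm_of_real)
    then have "(nrm (f - cscale (of_real t * w) g))\<^sup>2
      = (nrm f)\<^sup>2 - 2 * t * (cmod w)\<^sup>2 + t\<^sup>2 * (cmod w)\<^sup>2 * (nrm g)\<^sup>2"
      by (simp only: power_mult_distrib power2_abs mult.assoc)
    then show ?thesis by (metis zero_le_power2)
  qed
  have "(cmod w)\<^sup>2 \<le> (nrm f * nrm g)\<^sup>2"
  proof (cases "nrm g = 0")
    case True
    have "w = 0"
    proof (rule ccontr)
      assume "w \<noteq> 0"
      \<comment> \<open>For a null g the right side of \<open>key\<close> is affine in t, and this t
        makes it equal to -1.\<close>
      then show False
        using key[of "((nrm f)\<^sup>2 + 1) / (2 * (cmod w)\<^sup>2)"] True by (simp add: field_simps)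
    qed
    then show ?thesis by simp
  next
    case False
    have "0 \<le> ((nrm f * nrm g)\<^sup>2 - (cmod w)\<^sup>2) / (nrm g)\<^sup>2"
      using key[of "1 / (nrm g)\<^sup>2"] False
      by (simp add: field_simps power2_eq_square)
    then show ?thesis using False by (simp add: zero_le_divide_iff)
  qed
  then show ?thesis
    using f g nrm_ge0 by (simp add: w_def power2_le_iff_abs_le)
qed

lemma nrm_triangle:
  assumes f: "f \<in> S" and g: "g \<in> S"
  shows "nrm (f + g) \<le> nrm f + nrm g"
proof -
  have "Re (ip f g) \<le> nrm f * nrm g"
    using cauchy_schwarz[OF f g] complex_Re_le_cmod order_trans by blast
  then have "(nrm (f + g))\<^sup>2 \<le> (nrm f + nrm g)\<^sup>2"
    using f g by (simp add: nrm_add_sq power2_sum)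
  then show ?thesis
    using f g nrm_ge0 by (simp add: power2_le_iff_abs_le add_in)
qed

lemma nrm_commute:
  assumes "f \<in> S" and "g \<in> S"
  shows "nrm (f - g) = nrm (g - f)"
proof -
  have "f - g = cscale (-1) (g - f)" by (simp add: cscale_def fun_eq_iff)
  then show ?thesis using assms by (simp add: nrm_scale diff_in)
qed

lemma nrm_triangle3:
  assumes "f \<in> S" and "g \<in> S" and "h \<in> S"
  shows "nrm (f - h) \<le> nrm (f - g) + nrm (g - h)"
  using nrm_triangle[of "f - g" "g - h"] assms by (simp add: diff_in)

end

text \<open>Meant for the Bergman space, whose members are continuous on the domain and vanish off
  it. Square integrable functions are not identified almost everywhere and satisfy only
  \<open>semi_ip\<close>.\<close>

locale def_ip = semi_ip +
  assumes ip_definite: "\<And>f. f \<in> S \<Longrightarrow> Re (ip f f) = 0 \<Longrightarrow> f = 0"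
begin

lemma nrm_eq0: "f \<in> S \<Longrightarrow> nrm f = 0 \<longleftrightarrow> f = 0"
  using nrm_sq[of f] ip_definite[of f] nrm_zero by auto

lemma nrm_pos: "f \<in> S \<Longrightarrow> f \<noteq> 0 \<Longrightarrow> 0 < nrm f"
  using nrm_eq0[of f] nrm_ge0[of f] by simp

lemma ip_ext: "f \<in> S \<Longrightarrow> g \<in> S \<Longrightarrow> (\<And>h. h \<in> S \<Longrightarrow> ip h f = ip h g) \<Longrightarrow> f = g"
  using ip_definite[of "f - g"] by (simp add: ip_diff_right diff_in)

end

text \<open>\<open>bounded_operator\<close> asks for linearity up to null vectors; over a definite
  space this is the exact linearity assumed here. Positivity is left out so that both
  \<open>HH\<close> and its power are instances.\<close>

locale ip_operator = def_ip +
  fixes B :: "'a operator"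
  assumes op_in: "\<And>f. f \<in> S \<Longrightarrow> B f \<in> S"
    and op_add: "\<And>f g. f \<in> S \<Longrightarrow> g \<in> S \<Longrightarrow> B (f + g) = B f + B g"
    and op_scale: "\<And>c f. f \<in> S \<Longrightarrow> B (cscale c f) = cscale c (B f)"
    and op_bounded: "\<exists>M. \<forall>f\<in>S. nrm (B f) \<le> M * nrm f"
    and op_sa: "\<And>f g. f \<in> S \<Longrightarrow> g \<in> S \<Longrightarrow> ip (B f) g = ip f (B g)"
begin

lemma op_diff: "f \<in> S \<Longrightarrow> g \<in> S \<Longrightarrow> B (f - g) = B f - B g"
  by (simp add: diff_scale op_add op_scale scale_in)

lemma op_zero: "B 0 = 0"
  using op_add[of 0 0] zero_in by (simp add: fun_eq_iff)

lemma op_sum: "finite I \<Longrightarrow> (\<And>i. i \<in> I \<Longrightarrow> F i \<in> S) \<Longrightarrow> B (\<Sum>i\<in>I. F i) = (\<Sum>i\<in>I. B (F i))"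
  by (induction I rule: finite_induct) (auto simp: op_zero op_add sum_in)

lemma op_bound_pos: "\<exists>M>0. \<forall>f\<in>S. nrm (B f) \<le> M * nrm f"
proof -
  obtain M where M: "\<And>f. f \<in> S \<Longrightarrow> nrm (B f) \<le> M * nrm f" using op_bounded by blast
  have "nrm (B f) \<le> (\<bar>M\<bar> + 1) * nrm f" if "f \<in> S" for f
    using M[OF that] nrm_ge0[OF that] by (smt (verit, ccfv_SIG) mult_right_mono)
  then show ?thesis by (intro exI[of _ "\<bar>M\<bar> + 1"]) auto
qed

lemma eigenvalue_real:
  assumes "f \<in> S" "f \<noteq> 0" "B f = cscale l f"
  shows "l \<in> \<real>"
proof -
  have "l * ip f f = cnj l * ip f f"
    using op_sa[of f f] assms by (simp add: ip_scale ip_scale_right)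
  moreover have "ip f f \<noteq> 0" using assms ip_definite[of f] by auto
  ultimately have "cnj l = l" by simp
  then show ?thesis by (simp add: Reals_cnj_iff)
qed

lemma eigenvectors_orthogonal:
  assumes "f \<in> S" "f \<noteq> 0" "B f = cscale l f" "g \<in> S" "g \<noteq> 0" "B g = cscale m g" "l \<noteq> m"
  shows "ip f g = 0"
proof -
  have "cnj m = m" using eigenvalue_real[of g m] assms by (simp add: Reals_cnj_iff)
  then have "l * ip f g = m * ip f g"
    using op_sa[of f g] assms by (simp add: ip_scale ip_scale_right)
  then show ?thesis using assms by simp
qed

end

section \<open>Spectral theory of compact self-adjoint operators\<close>

locale compact_sa_operator = ip_operator +
  assumes compact: "compact_op S ip B"
begin

definition orthonormal_eigen :: "('a \<Rightarrow> complex) set \<Rightarrow> bool" where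
  "orthonormal_eigen E \<longleftrightarrow> E \<subseteq> S \<and> (\<forall>e\<in>E. nrm e = 1 \<and> (\<exists>l. l \<noteq> 0 \<and> B e = cscale l e)) \<and>
     (\<forall>e\<in>E. \<forall>f\<in>E. e \<noteq> f \<longrightarrow> ip e f = 0)"

lemma invariant_complement:
  assumes "orthonormal_eigen F" "f \<in> S" "\<And>e. e \<in> F \<Longrightarrow> ip f e = 0" "e \<in> F"
  shows "ip (B f) e = 0"
proof -
  obtain l where l: "B e = cscale l e" "e \<in> S" using assms unfolding orthonormal_eigen_def by blast
  have "ip (B f) e = ip f (B e)" using assms l by (intro op_sa)
  also have "\<dots> = cnj l * ip f e" using l assms(2) by (simp only: ip_scale_right)
  finally show ?thesis using assms(3,4) by simp
qed

text \<open>Let m be the norm of B on the orthogonal complement of F, so that m > \<epsilon>. By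
  compactness a maximising sequence has a subsequence with limit h satisfying B (B h) = m^2 h;
  factoring B^2 - m^2 then produces an eigenvector for m or -m. Passing through B^2 avoids choosing
  the sign in advance.\<close>

lemma eigenvector_in_complement:
  assumes F: "orthonormal_eigen F" and f0: "f0 \<in> S" "\<And>e. e \<in> F \<Longrightarrow> ip f0 e = 0"
    and \<epsilon>: "0 \<le> \<epsilon>" "\<epsilon> * nrm f0 < nrm (B f0)"
  obtains f l where "f \<in> S" "f \<noteq> 0" "\<And>e. e \<in> F \<Longrightarrow> ip f e = 0" "B f = cscale l f" "\<epsilon> < cmod l"
proof -
  define S' where "S' = {f \<in> S. \<forall>e\<in>F. ip f e = 0}"
  have FS: "F \<subseteq> S" using F by (simp add: orthonormal_eigen_def)
  have S'S: "f \<in> S" if "f \<in> S'" for f using that by (simp add: S'_def)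
  have BS': "B f \<in> S'" if "f \<in> S'" for f
    using invariant_complement[OF F] that op_in by (auto simp: S'_def)
  have scS': "cscale c f \<in> S'" if "f \<in> S'" for c f
    using that FS by (auto simp: S'_def scale_in ip_scale subset_iff)
  have addS': "f + g \<in> S'" if "f \<in> S'" "g \<in> S'" for f g
    using that FS by (auto simp: S'_def add_in ip_add subset_iff)
  obtain M where M: "M > 0" "\<And>f. f \<in> S \<Longrightarrow> nrm (B f) \<le> M * nrm f" using op_bound_pos by blast
  define X where "X = (\<lambda>f. nrm (B f)) ` {f \<in> S'. nrm f \<le> 1}"
  define m where "m = Sup X"
  have bdd: "bdd_above X"
  proof (rule bdd_aboveI[of _ M])
    fix x assume "x \<in> X"
    then obtain f where f: "f \<in> S'" "nrm f \<le> 1" "x = nrm (B f)" by (auto simp: X_def)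
    have "x \<le> M * nrm f" using M f S'S by auto
    also have "\<dots> \<le> M" using f M(1) by simp
    finally show "x \<le> M" .
  qed
  have "0 \<in> S'" using zero_in FS by (auto simp: S'_def ip_zero subset_iff)
  moreover have "nrm 0 \<le> 1" by (simp only: nrm_zero zero_le_one)
  ultimately have "nrm (B 0) \<in> X" unfolding X_def by blast
  then have m0: "0 \<le> m" and Xne: "X \<noteq> {}"
    using bdd cSup_upper[of 0 X] by (auto simp: m_def op_zero nrm_zero)
  have mle: "nrm (B f) \<le> m * nrm f" if f: "f \<in> S'" for f
  proof (cases "f = 0")
    case True then show ?thesis by (simp add: op_zero nrm_zero)
  next
    case False
    then have p: "nrm f > 0" using S'S[OF f] nrm_pos by blast
    define g where "g = cscale (of_real (1 / nrm f)) f"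
    have "g \<in> S'" using scS' f by (simp add: g_def)
    moreover have "nrm g = 1" using p S'S[OF f] by (simp add: g_def nrm_scale norm_divide)
    ultimately have "nrm (B g) \<le> m" unfolding m_def X_def using bdd
      by (intro cSup_upper) (auto simp: X_def)
    moreover have "nrm (B g) = nrm (B f) / nrm f"
      using p S'S[OF f] by (simp add: g_def op_scale nrm_scale op_in norm_divide)
    ultimately show ?thesis using p by (simp add: field_simps)
  qed
  have "f0 \<in> S'" using f0 by (simp add: S'_def)
  then have "nrm (B f0) \<le> m * nrm f0" by (rule mle)
  then have m: "\<epsilon> < m" using \<epsilon> nrm_ge0[OF f0(1)] by (smt (verit) mult_right_mono)
  have mpos: "0 < m" using m \<epsilon> by simp
  have "\<exists>f. f \<in> S' \<and> nrm f \<le> 1 \<and> nrm (B f) > m - inverse (real (Suc k))" for k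
  proof -
    have "m - inverse (real (Suc k)) < Sup X" by (simp add: m_def)
    then obtain x where "x \<in> X" "m - inverse (real (Suc k)) < x" using less_cSupE Xne by metis
    then show ?thesis by (auto simp: X_def)
  qed
  then obtain f where f: "\<And>k. f k \<in> S'" "\<And>k. nrm (f k) \<le> 1"
    "\<And>k. nrm (B (f k)) > m - inverse (real (Suc k))" by metis
  have fS: "f k \<in> S" for k using f S'S by blast
  have Bfm: "nrm (B (f k)) \<le> m" for k
    using mle[OF f(1), of k] f(2)[of k] m0 by (smt (verit) mult_left_le)
  have "(\<lambda>k. nrm (B (f k))) \<longlonglongrightarrow> m"
  proof (rule real_tendsto_sandwich)
    show "\<forall>\<^sub>F k in sequentially. m - inverse (real (Suc k)) \<le> nrm (B (f k))"
      using f(3) by (auto intro!: always_eventually less_imp_le)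
    show "\<forall>\<^sub>F k in sequentially. nrm (B (f k)) \<le> m" using Bfm by simp
    have "(\<lambda>k. m - inverse (real (Suc k))) \<longlonglongrightarrow> m - 0"
      by (intro tendsto_intros LIMSEQ_inverse_real_of_nat)
    then show "(\<lambda>k. m - inverse (real (Suc k))) \<longlonglongrightarrow> m" by simp
  qed simp
  note lim = this
  obtain g r where g: "g \<in> S" "strict_mono r" "(\<lambda>k. nrm (B (f (r k)) - g)) \<longlonglongrightarrow> 0"
    using compact f fS unfolding compact_op_def by blast
  have lim_r: "(\<lambda>k. nrm (B (f (r k)))) \<longlonglongrightarrow> m"
    using LIMSEQ_subseq_LIMSEQ[OF lim g(2)] by (simp add: o_def)
  \<comment> \<open>In the expanded square, |B B f|^2 and m^4 |f|^2 are each at most m^4, and the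
    cross term is m^2 |B f|^2. As |B f| tends to m, the sequence consists of approximate
    eigenvectors of B^2 for m^2.\<close>
  have sq: "(nrm (B (B (f k)) - cscale (of_real (m\<^sup>2)) (f k)))\<^sup>2 \<le> 2 * m^4 - 2 * m\<^sup>2 * (nrm (B (f k)))\<^sup>2" for k
  proof -
    have "nrm (B (B (f k))) \<le> m * m"
      using mle[OF BS'[OF f(1)], of k] Bfm[of k] m0 by (smt (verit) mult_left_mono)
    then have 1: "(nrm (B (B (f k))))\<^sup>2 \<le> (m * m)\<^sup>2"
      using nrm_ge0 op_in fS by (intro power_mono) auto
    have 2: "(m\<^sup>2 * nrm (f k))\<^sup>2 \<le> (m\<^sup>2 * 1)\<^sup>2"
      using f(2) nrm_ge0 fS by (intro power_mono mult_left_mono) auto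
    have "ip (B (B (f k))) (f k) = of_real ((nrm (B (f k)))\<^sup>2)"
      using ip_self[of "B (f k)"] fS op_in op_sa[of "B (f k)" "f k"] by simp
    then have "(nrm (B (B (f k)) - cscale (of_real (m\<^sup>2)) (f k)))\<^sup>2
      = (nrm (B (B (f k))))\<^sup>2 - 2 * (m\<^sup>2 * (nrm (B (f k)))\<^sup>2) + (m\<^sup>2 * nrm (f k))\<^sup>2"
      using fS op_in by (simp add: nrm_diff_sq scale_in nrm_scale ip_scale_right norm_power flip: of_real_power)
    also have "\<dots> \<le> (m * m)\<^sup>2 - 2 * (m\<^sup>2 * (nrm (B (f k)))\<^sup>2) + (m\<^sup>2 * 1)\<^sup>2"
      using 1 2 by linarith
    finally show ?thesis by (simp add: power2_eq_square power4_eq_xxxx algebra_simps)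
  qed
  define d where "d k = nrm (B (B (f (r k))) - cscale (of_real (m\<^sup>2)) (f (r k)))" for k
  have d0: "d \<longlonglongrightarrow> 0"
  proof -
    have "(\<lambda>k. (d k)\<^sup>2) \<longlonglongrightarrow> 0"
    proof (rule real_tendsto_sandwich[where f = "\<lambda>_. 0"])
      show "\<forall>\<^sub>F k in sequentially. (d k)\<^sup>2 \<le> 2 * m^4 - 2 * m\<^sup>2 * (nrm (B (f (r k))))\<^sup>2"
        using sq by (simp add: d_def)
      have "(\<lambda>k. 2 * m^4 - 2 * m\<^sup>2 * (nrm (B (f (r k))))\<^sup>2) \<longlonglongrightarrow> 2 * m^4 - 2 * m\<^sup>2 * m\<^sup>2"
        by (intro tendsto_intros lim_r)
      then show "(\<lambda>k. 2 * m^4 - 2 * m\<^sup>2 * (nrm (B (f (r k))))\<^sup>2) \<longlonglongrightarrow> 0"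
        by (simp add: power2_eq_square power4_eq_xxxx)
    qed auto
    then have "(\<lambda>k. sqrt ((d k)\<^sup>2)) \<longlonglongrightarrow> sqrt 0" by (intro tendsto_intros)
    then show ?thesis by (simp add: tendsto_rabs_zero_iff)
  qed
  \<comment> \<open>Since m^2 f (r k) is close to B (B (f (r k))) and B (f (r k)) tends to g, the
    limit of f (r k) has to be B g / m^2.\<close>
  define h where "h = cscale (of_real (1 / m\<^sup>2)) (B g)"
  have hS: "h \<in> S" by (simp add: h_def scale_in op_in g)
  have fh: "(\<lambda>k. nrm (f (r k) - h)) \<longlonglongrightarrow> 0"
  proof (rule real_tendsto_sandwich[where f = "\<lambda>_. 0"])
    show "\<forall>\<^sub>F k in sequentially. nrm (f (r k) - h) \<le> (1 / m\<^sup>2) * (d k + M * nrm (B (f (r k)) - g))"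
    proof (intro always_eventually allI)
      fix k
      have "f (r k) - h = cscale (of_real (1 / m\<^sup>2)) (cscale (of_real (m\<^sup>2)) (f (r k)) - B g)"
        using mpos by (simp add: h_def cscale_def fun_eq_iff field_simps)
      then have 1: "nrm (f (r k) - h) = (1 / m\<^sup>2) * nrm (cscale (of_real (m\<^sup>2)) (f (r k)) - B g)"
        using mpos fS g op_in by (simp only: nrm_scale diff_in scale_in) (simp add: norm_divide norm_power)
      have 2: "nrm (cscale (of_real (m\<^sup>2)) (f (r k)) - B g)
          \<le> nrm (cscale (of_real (m\<^sup>2)) (f (r k)) - B (B (f (r k)))) + nrm (B (B (f (r k))) - B g)"
        using fS g op_in by (intro nrm_triangle3 scale_in) auto
      have 3: "nrm (cscale (of_real (m\<^sup>2)) (f (r k)) - B (B (f (r k)))) = d k"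
        unfolding d_def using fS g op_in by (intro nrm_commute scale_in) auto
      have "nrm (B (B (f (r k))) - B g) \<le> M * nrm (B (f (r k)) - g)"
        using M(2)[of "B (f (r k)) - g"] fS g op_in by (simp add: op_diff diff_in)
      then have "nrm (cscale (of_real (m\<^sup>2)) (f (r k)) - B g) \<le> d k + M * nrm (B (f (r k)) - g)"
        using 2 3 by linarith
      then show "nrm (f (r k) - h) \<le> (1 / m\<^sup>2) * (d k + M * nrm (B (f (r k)) - g))"
        unfolding 1 using mpos by (intro mult_left_mono) auto
    qed
    have "(\<lambda>k. (1 / m\<^sup>2) * (d k + M * nrm (B (f (r k)) - g))) \<longlonglongrightarrow> (1 / m\<^sup>2) * (0 + M * 0)"
      by (intro tendsto_intros d0 g)
    then show "(\<lambda>k. (1 / m\<^sup>2) * (d k + M * nrm (B (f (r k)) - g))) \<longlonglongrightarrow> 0" by simp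
    show "\<forall>\<^sub>F k in sequentially. 0 \<le> nrm (f (r k) - h)"
      using fS hS by (simp add: nrm_ge0 diff_in)
  qed simp
  have Bh: "B h = g"
  proof -
    have le: "nrm (B h - g) \<le> M * nrm (f (r k) - h) + nrm (B (f (r k)) - g)" for k
    proof -
      have 1: "nrm (B h - g) \<le> nrm (B h - B (f (r k))) + nrm (B (f (r k)) - g)"
        using fS hS g op_in by (intro nrm_triangle3) auto
      have 2: "nrm (B h - B (f (r k))) \<le> M * nrm (h - f (r k))"
        using M(2)[of "h - f (r k)"] fS hS by (simp add: op_diff diff_in)
      have 3: "nrm (h - f (r k)) = nrm (f (r k) - h)" using fS hS by (intro nrm_commute) auto
      show ?thesis using 1 2 unfolding 3 by linarith
    qed
    have "(\<lambda>k. M * nrm (f (r k) - h) + nrm (B (f (r k)) - g)) \<longlonglongrightarrow> M * 0 + 0"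
      by (intro tendsto_intros fh g)
    then have "nrm (B h - g) \<le> 0" using le by (intro LIMSEQ_le_const) auto
    then have "B h - g = 0" using nrm_pos[of "B h - g"] hS g op_in diff_in by force
    then show ?thesis by simp
  qed
  have "g \<noteq> 0"
  proof
    assume "g = 0"
    then have "(\<lambda>k. nrm (B (f (r k)))) \<longlonglongrightarrow> 0" using g by simp
    then show False using lim_r mpos LIMSEQ_unique by blast
  qed
  then have h0: "h \<noteq> 0" using Bh op_zero by auto
  have hS': "h \<in> S'"
  proof -
    have "ip h e = 0" if e: "e \<in> F" for e
    proof -
      have eS: "e \<in> S" and "nrm e = 1" using e F unfolding orthonormal_eigen_def by auto
      have "cmod (ip h e) \<le> nrm (f (r k) - h)" for k
      proof -
        have "ip h e = - ip (f (r k) - h) e"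
          using f(1)[of "r k"] e eS fS hS by (simp add: ip_diff S'_def)
        then show ?thesis
          using cauchy_schwarz[of "f (r k) - h" e] eS fS hS \<open>nrm e = 1\<close> by (simp add: diff_in)
      qed
      then have "cmod (ip h e) \<le> 0" using fh by (intro LIMSEQ_le_const) auto
      then show ?thesis by simp
    qed
    then show ?thesis using hS by (simp add: S'_def)
  qed
  have BBh: "B (B h) = cscale (of_real (m\<^sup>2)) h"
    unfolding Bh using mpos by (simp add: h_def cscale_def fun_eq_iff)
  \<comment> \<open>(B - m) u = (B^2 - m^2) h = 0, so u is an eigenvector for m unless it vanishes;
    u = 0 says B h = -m h.\<close>
  define u where "u = B h + cscale (of_real m) h"
  have uS': "u \<in> S'" using hS' by (simp add: u_def BS' scS' addS')
  show ?thesis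
  proof (cases "u = 0")
    case True
    then have "B h = cscale (- of_real m) h"
      by (simp add: u_def cscale_def fun_eq_iff add_eq_0_iff)
    then show ?thesis using that[of h "- of_real m"] h0 hS' m mpos by (auto simp: S'_def)
  next
    case False
    have "B u = cscale (of_real m) u"
      using hS by (simp add: u_def op_add op_in scale_in op_scale BBh)
        (simp add: cscale_def fun_eq_iff algebra_simps power2_eq_square)
    then show ?thesis using that[of u "of_real m"] False uS' m mpos by (auto simp: S'_def)
  qed
qed

end

context compact_sa_operator begin

lemma
  assumes E: "orthonormal_eigen E" and e: "e \<in> E"
  shows orthonormal_eigen_in: "e \<in> S" and orthonormal_eigen_nrm: "nrm e = 1"
    and orthonormal_eigen_ex: "\<exists>l. l \<noteq> 0 \<and> B e = cscale l e"
    and orthonormal_eigen_orth: "f \<in> E \<Longrightarrow> e \<noteq> f \<Longrightarrow> ip e f = 0"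
proof -
  note D = E[unfolded orthonormal_eigen_def]
  show "e \<in> S" by (rule subsetD[OF conjunct1[OF D] e])
  show "nrm e = 1" "\<exists>l. l \<noteq> 0 \<and> B e = cscale l e"
    using bspec[OF conjunct1[OF conjunct2[OF D]] e] by simp_all
  show "ip e f = 0" if "f \<in> E" "e \<noteq> f"
    using bspec[OF bspec[OF conjunct2[OF conjunct2[OF D]] e] that(1)] that(2) by simp
qed

lemma orthonormal_eigen_subset:
  assumes "orthonormal_eigen E" "F \<subseteq> E"
  shows "orthonormal_eigen F"
  unfolding orthonormal_eigen_def
proof (intro conjI ballI impI)
  fix e f assume "e \<in> F" "f \<in> F" "e \<noteq> f"
  then show "ip e f = 0" using orthonormal_eigen_orth[OF assms(1)] assms(2) by (meson subsetD)
next
  fix e assume "e \<in> F"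
  then have "e \<in> E" using assms(2) by (rule rev_subsetD)
  then show "nrm e = 1" "\<exists>l. l \<noteq> 0 \<and> B e = cscale l e"
    using orthonormal_eigen_nrm[OF assms(1)] orthonormal_eigen_ex[OF assms(1)] by simp_all
qed (use assms orthonormal_eigen_in[OF assms(1)] in \<open>meson subset_iff\<close>)

lemma orthonormal_ip_sum:
  assumes "orthonormal_eigen E" "finite F" "F \<subseteq> E" "e \<in> F"
  shows "ip (\<Sum>x\<in>F. cscale (a x) x) e = a e"
proof -
  have S: "x \<in> S" if "x \<in> F" for x using assms that orthonormal_eigen_in by blast
  have "ip (\<Sum>x\<in>F. cscale (a x) x) e = (\<Sum>x\<in>F. a x * ip x e)"
    using assms(2,4) S by (simp add: ip_sum scale_in ip_scale)
  also have "\<dots> = (\<Sum>x\<in>F. if x = e then a e else 0)"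
  proof (intro sum.cong refl)
    fix x assume "x \<in> F"
    have "x \<noteq> e \<Longrightarrow> ip x e = 0"
      using \<open>x \<in> F\<close> assms by (meson orthonormal_eigen_orth subsetD)
    moreover have "ip e e = 1"
      using assms S[OF assms(4)] ip_self[of e] orthonormal_eigen_nrm[OF assms(1), of e] by auto
    ultimately show "a x * ip x e = (if x = e then a e else 0)" by auto
  qed
  also have "\<dots> = a e" using assms(2,4) by simp
  finally show ?thesis .
qed

text \<open>Two orthonormal eigenvectors for l have images at distance |l| sqrt 2, so an infinite
  family would have no subsequence with convergent images.\<close>

lemma finite_eigen_part:
  assumes E: "orthonormal_eigen E" and l: "l \<noteq> 0"
  shows "finite {e \<in> E. B e = cscale l e}"
proof (rule ccontr)
  assume "infinite {e \<in> E. B e = cscale l e}"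
  then obtain e :: "nat \<Rightarrow> _" where e: "inj e" "range e \<subseteq> {e \<in> E. B e = cscale l e}"
    using infinite_countable_subset by blast
  have eE: "e k \<in> E" and eB: "B (e k) = cscale l (e k)" for k using e by auto
  have eS: "e k \<in> S" and e1: "nrm (e k) = 1" for k
    using eE[of k] E orthonormal_eigen_in orthonormal_eigen_nrm by blast+
  have ort: "ip (e j) (e k) = 0" if "j \<noteq> k" for j k
  proof -
    have "e j \<noteq> e k" using e(1) that by (auto dest: injD)
    then show ?thesis using eE E orthonormal_eigen_orth by blast
  qed
  obtain g r where g: "g \<in> S" "strict_mono r" "(\<lambda>k. nrm (B (e (r k)) - g)) \<longlonglongrightarrow> 0"
    using compact eS e1 unfolding compact_op_def by (metis order_refl)
  have "\<forall>\<^sub>F k in sequentially. nrm (B (e (r k)) - g) < cmod l / 2"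
    using g(3) l by (intro order_tendstoD) auto
  then obtain N where N: "\<And>k. k \<ge> N \<Longrightarrow> nrm (B (e (r k)) - g) < cmod l / 2"
    by (auto simp: eventually_sequentially)
  define a b where "a = e (r N)" and "b = e (r (Suc N))"
  have ne: "r N \<noteq> r (Suc N)" using g(2) strict_mono_eq by (metis n_not_Suc_n)
  have aS: "a \<in> S" "b \<in> S" "B a = cscale l a" "B b = cscale l b" by (auto simp: a_def b_def eS eB)
  have "(nrm (a - b))\<^sup>2 = 2"
    using ort[OF ne] by (simp add: a_def b_def eS e1 nrm_diff_sq)
  then have "1 < (nrm (a - b))\<^sup>2" by simp
  then have n1: "1 < nrm (a - b)"
    using nrm_ge0[OF diff_in[OF aS(1,2)]] by (smt (verit) power2_less_imp_less one_power2)
  have "B a - B b = cscale l (a - b)"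
    using aS op_diff[of a b] op_scale[of "a - b" l] by (simp add: cscale_def fun_eq_iff algebra_simps)
  then have 1: "cmod l * nrm (a - b) = nrm (B a - B b)" using aS by (simp only: nrm_scale diff_in)
  have 2: "nrm (B a - B b) \<le> nrm (B a - g) + nrm (g - B b)" using aS g by (intro nrm_triangle3 op_in)
  have 3: "nrm (g - B b) = nrm (B b - g)" using aS g by (intro nrm_commute op_in)
  have "nrm (B a - g) + nrm (B b - g) < cmod l"
    using N[of N] N[of "Suc N"] by (simp add: a_def b_def)
  then have "cmod l * nrm (a - b) < cmod l * 1" using 1 2 3 by linarith
  then show False using n1 l by simp
qed

text \<open>Zorn's lemma. Maximality enters later only through the second conclusion: a nonzero
  eigenvector orthogonal to E could be normalised and adjoined.\<close>

lemma maximal_orthonormal_eigen: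
  obtains E where "orthonormal_eigen E"
    "\<And>f l. f \<in> S \<Longrightarrow> B f = cscale l f \<Longrightarrow> l \<noteq> 0 \<Longrightarrow> (\<And>e. e \<in> E \<Longrightarrow> ip f e = 0) \<Longrightarrow> f = 0"
proof -
  have "\<exists>M\<in>Collect orthonormal_eigen. \<forall>X\<in>Collect orthonormal_eigen. M \<subseteq> X \<longrightarrow> X = M"
  proof (rule subset_Zorn_nonempty)
    have "orthonormal_eigen {}" by (simp add: orthonormal_eigen_def)
    then show "Collect orthonormal_eigen \<noteq> {}" by blast
  next
    fix \<C> assume \<C>: "\<C> \<noteq> {}" "subset.chain (Collect orthonormal_eigen) \<C>"
    have C: "orthonormal_eigen C" if "C \<in> \<C>" for C
      using that \<C>(2) by (simp add: subset_chain_def subset_iff)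
    have "orthonormal_eigen (\<Union>\<C>)"
      unfolding orthonormal_eigen_def
    proof (intro conjI ballI impI subsetI)
      fix e f assume ef: "e \<in> \<Union>\<C>" "f \<in> \<Union>\<C>" "e \<noteq> f"
      then obtain X Y where "X \<in> \<C>" "e \<in> X" "Y \<in> \<C>" "f \<in> Y" by (elim UnionE)
      moreover from this have "X \<subseteq> Y \<or> Y \<subseteq> X" using \<C>(2) by (simp add: subset_chain_def)
      ultimately show "ip e f = 0" using C orthonormal_eigen_orth ef(3) by (meson subsetD)
    next
      fix e assume "e \<in> \<Union>\<C>"
      then obtain X where X: "X \<in> \<C>" "e \<in> X" by (elim UnionE)
      note D = orthonormal_eigen_in[OF C[OF X(1)] X(2)] orthonormal_eigen_nrm[OF C[OF X(1)] X(2)]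
        orthonormal_eigen_ex[OF C[OF X(1)] X(2)]
      show "e \<in> S" "nrm e = 1" "\<exists>l. l \<noteq> 0 \<and> B e = cscale l e" by (fact D)+
    qed
    then show "\<Union>\<C> \<in> Collect orthonormal_eigen" by simp
  qed
  then obtain E where E: "orthonormal_eigen E" "\<And>X. orthonormal_eigen X \<Longrightarrow> E \<subseteq> X \<Longrightarrow> X = E" by blast
  show ?thesis
  proof (rule that[OF E(1)])
    fix f l assume f: "f \<in> S" "B f = cscale l f" "l \<noteq> 0" "\<And>e. e \<in> E \<Longrightarrow> ip f e = 0"
    show "f = 0"
    proof (rule ccontr)
      assume "f \<noteq> 0"
      then have p: "nrm f > 0" using f nrm_pos by blast
      define g where "g = cscale (of_real (1 / nrm f)) f"
      have gS: "g \<in> S" using f by (simp add: g_def scale_in)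
      have g1: "nrm g = 1" using p f by (simp add: g_def nrm_scale norm_divide)
      have gB: "B g = cscale l g" using f by (simp add: g_def op_scale) (simp add: cscale_def fun_eq_iff)
      have ES: "e \<in> S" if "e \<in> E" for e using orthonormal_eigen_in[OF E(1) that] .
      have ge: "ip g e = 0" "ip e g = 0" if "e \<in> E" for e
        using f ES[OF that] that ip_commute[of g e] gS by (auto simp: g_def ip_scale)
      have "orthonormal_eigen (insert g E)"
        using E(1) gS g1 gB \<open>l \<noteq> 0\<close> ge unfolding orthonormal_eigen_def by auto
      then have "insert g E = E" using E(2) by blast
      then have "g \<in> E" by blast
      then have "ip g g = 0" using ge by blast
      then show False using ip_self[OF gS] g1 by simp
    qed
  qed
qed

text \<open>Translates the multiplicities in \<open>sa_trace_class\<close> into a count of members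
  of E. Subtracting from an eigenvector its projection onto F leaves an eigenvector orthogonal to
  all of E, since members of E with another eigenvalue are orthogonal to it anyway; maximality makes
  it zero.\<close>

lemma dim_eigenspace:
  assumes E: "orthonormal_eigen E" and l: "l \<noteq> 0"
    and max: "\<And>f l. f \<in> S \<Longrightarrow> B f = cscale l f \<Longrightarrow> l \<noteq> 0 \<Longrightarrow> (\<And>e. e \<in> E \<Longrightarrow> ip f e = 0) \<Longrightarrow> f = 0"
  shows "vector_space.dim cscale (eigenspace S B l) = card {e \<in> E. B e = cscale l e}"
proof -
  interpret V: vector_space "cscale :: complex \<Rightarrow> ('a \<Rightarrow> complex) \<Rightarrow> 'a \<Rightarrow> complex"
    by (rule vector_space_cscale)
  define F where "F = {e \<in> E. B e = cscale l e}"
  have fin: "finite F" unfolding F_def by (rule finite_eigen_part[OF E l])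
  have FE: "F \<subseteq> E" by (auto simp: F_def)
  have ES: "e \<in> S" if "e \<in> E" for e using orthonormal_eigen_in[OF E that] .
  have sub: "F \<subseteq> eigenspace S B l" using ES by (auto simp: F_def eigenspace_def)
  have ind: "V.independent F"
  proof
    assume "V.dependent F"
    then obtain u e where u: "e \<in> F" "u e \<noteq> 0" "(\<Sum>v\<in>F. cscale (u v) v) = 0"
      using V.dependent_finite[OF fin] by blast
    then show False
      using orthonormal_ip_sum[OF E fin FE u(1), of u] ES[of e] FE ip_zero[of e] by auto
  qed
  have "f \<in> V.span F" if f: "f \<in> eigenspace S B l" for f
  proof -
    have fS: "f \<in> S" and fB: "B f = cscale l f" using f by (auto simp: eigenspace_def)
    define p where "p = (\<Sum>e\<in>F. cscale (ip f e) e)"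
    have pS: "p \<in> S" unfolding p_def using fin FE ES by (intro sum_in scale_in) auto
    have "B p = (\<Sum>e\<in>F. cscale (ip f e) (B e))"
      unfolding p_def using fin FE ES by (subst op_sum) (auto intro!: scale_in sum.cong op_scale)
    also have "\<dots> = (\<Sum>e\<in>F. cscale l (cscale (ip f e) e))"
      by (intro sum.cong) (auto simp: F_def cscale_def fun_eq_iff)
    also have "\<dots> = cscale l p" unfolding p_def by (simp add: V.scale_sum_right)
    finally have pB: "B p = cscale l p" .
    have "f - p = 0"
    proof (rule max[OF _ _ l])
      show "f - p \<in> S" using fS pS by (rule diff_in)
      show "B (f - p) = cscale l (f - p)"
        using fS pS by (simp add: op_diff fB pB V.scale_right_diff_distrib)
      fix e assume e: "e \<in> E"
      show "ip (f - p) e = 0"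
      proof (cases "e \<in> F")
        case True
        then show ?thesis using orthonormal_ip_sum[OF E fin FE True, of "ip f"] fS pS ES[OF e]
          by (simp add: ip_diff p_def)
      next
        case False
        obtain m where m: "B e = cscale m e" using orthonormal_eigen_ex[OF E e] by blast
        have "m \<noteq> l" using False m e by (auto simp: F_def)
        have e0: "e \<noteq> 0" using orthonormal_eigen_nrm[OF E e] nrm_zero by force
        show ?thesis
        proof (cases "f - p = 0")
          case True then show ?thesis using ES[OF e] by (simp only: ip_zero)
        next
          case False
          then show ?thesis using \<open>m \<noteq> l\<close>
            eigenvectors_orthogonal[of "f - p" l e m] fS pS ES[OF e] e0 m
            by (simp add: diff_in op_diff fB pB V.scale_right_diff_distrib)
        qed
      qed
    qed
    then have fp: "f = p" by (simp only: right_minus_eq)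
    have "p \<in> V.span F"
      unfolding p_def by (rule V.span_sum, rule V.span_scale, rule V.span_base)
    then show ?thesis by (subst fp)
  qed
  then have "V.span F = V.span (eigenspace S B l)"
    using V.span_mono[OF sub] V.span_minimal[OF _ V.subspace_span] by (simp add: subset_antisym subsetI)
  then have "V.dim (eigenspace S B l) = card F"
    using ind by (rule V.dim_eq_card)
  then show ?thesis by (simp add: F_def)
qed

end

context compact_sa_operator begin

text \<open>A truncated spectral expansion. The orthogonal complement of F is invariant, and on it B
  has norm at most \<epsilon>: otherwise there would be an eigenvector with |l| > \<epsilon>,
  orthogonal to F and, having a different eigenvalue, to the rest of E.\<close>

lemma eigen_expansion_bound:
  assumes E: "orthonormal_eigen E"
    and max: "\<And>f l. f \<in> S \<Longrightarrow> B f = cscale l f \<Longrightarrow> l \<noteq> 0 \<Longrightarrow> (\<And>e. e \<in> E \<Longrightarrow> ip f e = 0) \<Longrightarrow> f = 0"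
    and mu: "\<And>e. e \<in> E \<Longrightarrow> B e = cscale (mu e) e"
    and F: "finite F" "F = {e \<in> E. \<epsilon> \<le> cmod (mu e)}" and \<epsilon>: "0 < \<epsilon>" and f: "f \<in> S"
  shows "cmod (ip (B f) f) \<le> (\<Sum>e\<in>F. cmod (mu e) * (cmod (ip f e))\<^sup>2) + \<epsilon> * (nrm f)\<^sup>2"
proof -
  have FE: "F \<subseteq> E" unfolding F(2) by (rule Collect_restrict)
  have ES: "e \<in> S" if "e \<in> E" for e using orthonormal_eigen_in[OF E that] .
  have FO: "orthonormal_eigen F" by (rule orthonormal_eigen_subset[OF E FE])
  define p where "p = (\<Sum>e\<in>F. cscale (ip f e) e)"
  have pS: "p \<in> S" unfolding p_def using F(1) FE ES by (intro sum_in scale_in) auto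
  define q where "q = f - p"
  have qS: "q \<in> S" unfolding q_def using f pS by (rule diff_in)
  have fpq: "f = p + q" by (simp add: q_def)
  have pe: "ip p e = ip f e" if "e \<in> F" for e
    unfolding p_def by (rule orthonormal_ip_sum[OF E F(1) FE that])
  have qe: "ip q e = 0" if "e \<in> F" for e
    unfolding q_def using pe[OF that] f pS ES FE that by (simp add: ip_diff subset_iff)
  have orth: "ip p g = 0" if g: "g \<in> S" "\<And>e. e \<in> F \<Longrightarrow> ip g e = 0" for g
  proof -
    have "ip e g = 0" if "e \<in> F" for e
      using g that ES FE ip_commute[of g e] by (metis complex_cnj_zero subsetD)
    then show ?thesis unfolding p_def using F(1) FE ES g
      by (subst ip_sum) (auto intro!: scale_in sum.neutral simp: ip_scale subset_iff)
  qed
  have Bq: "nrm (B q) \<le> \<epsilon> * nrm q"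
  proof (rule ccontr)
    assume "\<not> nrm (B q) \<le> \<epsilon> * nrm q"
    then obtain g l where g: "g \<in> S" "g \<noteq> 0" "\<And>e. e \<in> F \<Longrightarrow> ip g e = 0" "B g = cscale l g" "\<epsilon> < cmod l"
      using eigenvector_in_complement[OF FO qS qe, of \<epsilon>] \<epsilon> by (metis less_imp_le not_le)
    have "l \<noteq> 0" using g(5) \<epsilon> by auto
    then have "g = 0"
    proof (rule max[OF g(1) g(4)])
      fix e assume e: "e \<in> E"
      show "ip g e = 0"
      proof (cases "e \<in> F")
        case False
        then have "mu e \<noteq> l" using F(2) e g(5) by auto
        moreover have "e \<noteq> 0" using orthonormal_eigen_nrm[OF E e] nrm_zero by force
        ultimately show ?thesis
          using eigenvectors_orthogonal[OF g(1,2,4) ES[OF e] _ mu[OF e]] by blast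
      qed (use g in auto)
    qed
    then show False using g by simp
  qed
  have Bp: "B p = (\<Sum>e\<in>F. cscale (mu e * ip f e) e)"
  proof -
    have "B p = (\<Sum>e\<in>F. B (cscale (ip f e) e))"
      unfolding p_def using F(1) FE ES by (intro op_sum scale_in) auto
    also have "\<dots> = (\<Sum>e\<in>F. cscale (mu e * ip f e) e)"
    proof (intro sum.cong refl)
      fix e assume e: "e \<in> F"
      then have "B (cscale (ip f e) e) = cscale (ip f e) (B e)" using FE ES by (intro op_scale) auto
      then show "B (cscale (ip f e) e) = cscale (mu e * ip f e) e"
        using mu[of e] e FE by (auto simp: cscale_def fun_eq_iff)
    qed
    finally show ?thesis .
  qed
  have Bpp: "ip (B p) p = (\<Sum>e\<in>F. mu e * (cmod (ip f e))\<^sup>2)"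
  proof -
    have "ip (B p) p = (\<Sum>e\<in>F. ip (cscale (mu e * ip f e) e) p)"
      unfolding Bp using F(1) FE ES pS by (intro ip_sum scale_in) auto
    also have "\<dots> = (\<Sum>e\<in>F. mu e * (cmod (ip f e))\<^sup>2)"
    proof (intro sum.cong refl)
      fix e assume e: "e \<in> F"
      have eS: "e \<in> S" using e FE ES by blast
      have "ip (cscale (mu e * ip f e) e) p = mu e * ip f e * cnj (ip f e)"
        using ip_scale[OF eS pS] ip_commute[OF pS eS] pe[OF e] by simp
      then show "ip (cscale (mu e * ip f e) e) p = mu e * (cmod (ip f e))\<^sup>2"
        using complex_norm_square[of "ip f e"] by (simp add: mult.assoc)
    qed
    finally show ?thesis .
  qed
  have BqS: "B q \<in> S" "B p \<in> S" using qS pS op_in by auto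
  have c0: "ip p (B q) = 0"
    by (rule orth[OF BqS(1)]) (rule invariant_complement[OF FO qS qe])
  have c1: "ip (B p) q = 0" using c0 op_sa[OF pS qS] by simp
  have c2: "ip (B q) p = 0" using c0 ip_commute[OF pS BqS(1)] by simp
  have "ip (B f) f = ip (B p + B q) (p + q)" unfolding fpq op_add[OF pS qS] ..
  also have "\<dots> = ip (B p) p + ip (B q) q"
    using BqS pS qS c1 c2 by (simp add: ip_add ip_add_right add_in)
  finally have eq: "ip (B f) f = ip (B p) p + ip (B q) q" .
  have "cmod (ip (B p) p) \<le> (\<Sum>e\<in>F. cmod (mu e) * (cmod (ip f e))\<^sup>2)"
    unfolding Bpp by (rule order_trans[OF norm_sum]) (simp add: norm_mult norm_power)
  moreover have "cmod (ip (B q) q) \<le> \<epsilon> * (nrm f)\<^sup>2"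
  proof -
    have "ip p q = 0" by (rule orth[OF qS qe])
    then have "(nrm f)\<^sup>2 = (nrm p)\<^sup>2 + (nrm q)\<^sup>2" unfolding fpq using pS qS by (simp add: nrm_add_sq)
    then have "(nrm q)\<^sup>2 \<le> (nrm f)\<^sup>2" by simp
    moreover have "cmod (ip (B q) q) \<le> nrm (B q) * nrm q" by (rule cauchy_schwarz[OF BqS(1) qS])
    moreover have "nrm (B q) * nrm q \<le> \<epsilon> * nrm q * nrm q"
      using Bq nrm_ge0[OF qS] by (rule mult_right_mono)
    moreover have "\<epsilon> * nrm q * nrm q = \<epsilon> * (nrm q)\<^sup>2" by (simp add: power2_eq_square)
    ultimately show ?thesis using \<epsilon> by (smt (verit) mult_left_mono)
  qed
  ultimately show ?thesis unfolding eq using norm_triangle_ineq order_trans by (smt (verit))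
qed

text \<open>Let \<epsilon> tend to 0 in the truncated expansion. The sum is written as an integral
  over the counting measure, so that it may be infinite and can later be exchanged with the integral
  over the domain.\<close>

lemma trace_class_form_bound:
  assumes sum: "(\<lambda>l. real (vector_space.dim cscale (eigenspace S B l)) * cmod l)
      summable_on {l. \<exists>f\<in>eigenspace S B l. f \<noteq> 0}"
  obtains E m where "E \<subseteq> S" "countable E" "\<And>e. e \<in> E \<Longrightarrow> nrm e = 1" "\<And>e. 0 \<le> m e"
    "(\<integral>\<^sup>+e. ennreal (m e) \<partial>count_space E) < \<infinity>"
    "\<And>f. f \<in> S \<Longrightarrow> ennreal (cmod (ip (B f) f)) \<le> (\<integral>\<^sup>+e. ennreal (m e * (cmod (ip f e))\<^sup>2) \<partial>count_space E)"
proof -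
  obtain E where E: "orthonormal_eigen E"
    and max: "\<And>f l. f \<in> S \<Longrightarrow> B f = cscale l f \<Longrightarrow> l \<noteq> 0 \<Longrightarrow> (\<And>e. e \<in> E \<Longrightarrow> ip f e = 0) \<Longrightarrow> f = 0"
    using maximal_orthonormal_eigen by metis
  have ES: "e \<in> S" if "e \<in> E" for e using orthonormal_eigen_in[OF E that] .
  obtain mu where mu: "\<And>e. e \<in> E \<Longrightarrow> mu e \<noteq> 0 \<and> B e = cscale (mu e) e"
    using orthonormal_eigen_ex[OF E] by metis
  define \<Lambda> where "\<Lambda> = {l. \<exists>f\<in>eigenspace S B l. f \<noteq> 0}"
  define D where "D l = real (vector_space.dim cscale (eigenspace S B l)) * cmod l" for l
  have sumD: "D summable_on \<Lambda>" using sum unfolding D_def[abs_def] \<Lambda>_def .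
  have mu_eq: "mu e = l" if "e \<in> E" "B e = cscale l e" for e l
  proof -
    have "e \<noteq> 0" using orthonormal_eigen_nrm[OF E that(1)] nrm_zero by force
    then obtain x where "e x \<noteq> 0" by (auto simp: fun_eq_iff)
    moreover have "mu e * e x = l * e x" using mu[OF that(1)] that(2) by (metis cscale_def)
    ultimately show ?thesis by simp
  qed
  have fibre: "D l = (\<Sum>e\<in>{e \<in> E. mu e = l}. cmod (mu e))" "finite {e \<in> E. mu e = l}" if "l \<noteq> 0" for l
  proof -
    have iff: "mu e = l \<longleftrightarrow> B e = cscale l e" if "e \<in> E" for e
    proof
      show "B e = cscale l e" if "mu e = l" using conjunct2[OF mu[OF \<open>e \<in> E\<close>]] unfolding that .
      show "mu e = l" if "B e = cscale l e" by (rule mu_eq[OF \<open>e \<in> E\<close> that])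
    qed
    have eq: "{e \<in> E. mu e = l} = {e \<in> E. B e = cscale l e}"
      by (rule Collect_cong) (simp add: iff cong: conj_cong)
    show fin: "finite {e \<in> E. mu e = l}" unfolding eq by (rule finite_eigen_part[OF E that])
    have "vector_space.dim cscale (eigenspace S B l) = card {e \<in> E. mu e = l}"
      unfolding eq by (rule dim_eigenspace[OF E that max])
    then show "D l = (\<Sum>e\<in>{e \<in> E. mu e = l}. cmod (mu e))" by (simp add: D_def)
  qed
  \<comment> \<open>Grouping by eigenvalue turns a finite part of the sum over E into a part of the
    sum with multiplicities, because each fibre of \<open>mu\<close> has as many elements as the
    dimension of the eigenspace.\<close>
  have bd: "(\<Sum>e\<in>F. cmod (mu e)) \<le> infsum D \<Lambda>" if F: "finite F" "F \<subseteq> E" for F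
  proof -
    have nz: "l \<noteq> 0" if lF: "l \<in> mu ` F" for l
    proof -
      obtain e where e: "l = mu e" "e \<in> F" using lF by (rule imageE)
      have "e \<in> E" using e(2) F(2) by (rule rev_subsetD)
      then show ?thesis using mu e(1) by simp
    qed
    have "(\<Sum>e\<in>F. cmod (mu e)) = (\<Sum>l\<in>mu ` F. \<Sum>e\<in>{e \<in> F. mu e = l}. cmod (mu e))"
      by (rule sum.image_gen[OF F(1)])
    also have "\<dots> \<le> (\<Sum>l\<in>mu ` F. D l)"
    proof (rule sum_mono)
      fix l assume "l \<in> mu ` F"
      then have "l \<noteq> 0" by (rule nz)
      then show "(\<Sum>e\<in>{e \<in> F. mu e = l}. cmod (mu e)) \<le> D l"
        unfolding fibre(1)[OF \<open>l \<noteq> 0\<close>] using F fibre(2) by (intro sum_mono2) auto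
    qed
    also have "\<dots> \<le> infsum D \<Lambda>"
    proof (rule finite_sum_le_infsum[OF sumD])
      show "mu ` F \<subseteq> \<Lambda>"
      proof
        fix l assume "l \<in> mu ` F"
        then obtain e where e: "l = mu e" "e \<in> F" by (rule imageE)
        have "e \<in> E" using e(2) F(2) by (rule rev_subsetD)
        have "e \<noteq> 0" using orthonormal_eigen_nrm[OF E \<open>e \<in> E\<close>] nrm_zero by force
        moreover have "e \<in> eigenspace S B l"
          unfolding eigenspace_def e(1) using conjunct2[OF mu[OF \<open>e \<in> E\<close>]] ES[OF \<open>e \<in> E\<close>] by simp
        ultimately show "l \<in> \<Lambda>" unfolding \<Lambda>_def by blast
      qed
    qed (use F in \<open>auto simp: D_def\<close>)
    finally show ?thesis .
  qed
  have smu: "(\<lambda>e. cmod (mu e)) summable_on E"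
    by (rule nonneg_bdd_above_summable_on) (auto intro!: bdd_aboveI2[of _ _ "infsum D \<Lambda>"] bd)
  have cnt: "countable E"
  proof -
    have "countable {e \<in> E. cmod (mu e) \<noteq> 0}"
      by (rule summable_countable_real[OF smu])
    moreover have "{e \<in> E. cmod (mu e) \<noteq> 0} = E"
      by (rule set_eqI) (simp add: mu cong: conj_cong)
    ultimately show ?thesis by (simp only:)
  qed
  show ?thesis
  proof (rule that[of E "\<lambda>e. cmod (mu e)"])
    show "E \<subseteq> S" using ES by blast
    show "countable E" by (rule cnt)
    show "\<And>e. e \<in> E \<Longrightarrow> nrm e = 1" using orthonormal_eigen_nrm[OF E] .
    show "(\<integral>\<^sup>+e. ennreal (cmod (mu e)) \<partial>count_space E) < \<infinity>"
    proof -
      have "Infinite_Set_Sum.abs_summable_on (\<lambda>e. cmod (mu e)) E"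
        using smu by (simp add: abs_summable_equivalent[symmetric])
      then have "integrable (count_space E) (\<lambda>e. cmod (mu e))"
        by (simp add: Infinite_Set_Sum.abs_summable_on_def)
      then show ?thesis by (simp add: integrable_iff_bounded)
    qed
    fix f assume f: "f \<in> S"
    define R where "R = (\<integral>\<^sup>+e. ennreal (cmod (mu e) * (cmod (ip f e))\<^sup>2) \<partial>count_space E)"
    have le: "ennreal (cmod (ip (B f) f)) \<le> R + ennreal (\<epsilon> * (nrm f)\<^sup>2)" if \<epsilon>: "\<epsilon> > 0" for \<epsilon>
    proof -
      define F where "F = {e \<in> E. \<epsilon> \<le> cmod (mu e)}"
      \<comment> \<open>Each member of F contributes at least \<epsilon> to sums that are bounded by
        \<open>infsum D \<Lambda>\<close>.\<close>
      have fin: "finite F"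
      proof (rule ccontr)
        assume inf: "infinite F"
        obtain N :: nat where N: "infsum D \<Lambda> < real N * \<epsilon>" using reals_Archimedean3[OF \<epsilon>] by blast
        obtain G where G: "G \<subseteq> F" "finite G" "card G = N" using infinite_arbitrarily_large[OF inf] by blast
        have "real N * \<epsilon> \<le> (\<Sum>e\<in>G. cmod (mu e))"
          using sum_bounded_below[of G \<epsilon> "\<lambda>e. cmod (mu e)"] G by (auto simp: F_def)
        also have "\<dots> \<le> infsum D \<Lambda>" using G F_def by (intro bd) auto
        finally show False using N by simp
      qed
      have "cmod (ip (B f) f) \<le> (\<Sum>e\<in>F. cmod (mu e) * (cmod (ip f e))\<^sup>2) + \<epsilon> * (nrm f)\<^sup>2"
        by (rule eigen_expansion_bound[OF E max conjunct2[OF mu] fin F_def \<epsilon> f])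
      then have "ennreal (cmod (ip (B f) f)) \<le> ennreal (\<Sum>e\<in>F. cmod (mu e) * (cmod (ip f e))\<^sup>2) + ennreal (\<epsilon> * (nrm f)\<^sup>2)"
        using \<epsilon> by (subst ennreal_plus[symmetric]) (auto intro!: sum_nonneg ennreal_leI)
      also have "ennreal (\<Sum>e\<in>F. cmod (mu e) * (cmod (ip f e))\<^sup>2) \<le> R"
      proof -
        have "ennreal (\<Sum>e\<in>F. cmod (mu e) * (cmod (ip f e))\<^sup>2) = (\<Sum>e\<in>F. ennreal (cmod (mu e) * (cmod (ip f e))\<^sup>2))"
          by (intro sum_ennreal[symmetric]) auto
        also have "\<dots> = (\<integral>\<^sup>+e. ennreal (cmod (mu e) * (cmod (ip f e))\<^sup>2) \<partial>count_space F)"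
          using fin by (simp add: nn_integral_count_space_finite)
        also have "\<dots> \<le> R"
        proof -
          have eq: "(\<integral>\<^sup>+e. g e \<partial>count_space X) = (\<integral>\<^sup>+e. g e * indicator X e \<partial>count_space UNIV)"
            for X :: "('a \<Rightarrow> complex) set" and g
            by (rule nn_integral_count_space_indicator) (simp add: NO_MATCH_def)
          show ?thesis
            unfolding R_def eq[where X = F] eq[where X = E] by (intro nn_integral_mono) (auto simp: F_def indicator_def)
        qed
        finally show ?thesis .
      qed
      finally show ?thesis by (simp add: add_right_mono)
    qed
    show "ennreal (cmod (ip (B f) f)) \<le> R"
    proof (rule ennreal_le_epsilon)
      fix e :: real assume e: "0 < e"
      define \<epsilon> where "\<epsilon> = e / ((nrm f)\<^sup>2 + 1)"
      have "0 < (nrm f)\<^sup>2 + 1" by (smt (verit) zero_le_power2)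
      then have "\<epsilon> > 0" "\<epsilon> * (nrm f)\<^sup>2 \<le> e" using e by (auto simp: \<epsilon>_def field_simps)
      then show "ennreal (cmod (ip (B f) f)) \<le> R + ennreal e"
        using le[of \<epsilon>] by (meson add_left_mono ennreal_leI order_trans)
    qed
  qed simp
qed

end

section \<open>Positivity of polynomials in a positive operator\<close>

text \<open>The preordering of the interval \<open>[0, M]\<close>; a polynomial that is nonnegative on the interval
  lies in it (Lukacs), so positivity of \<open>r(A)\<close> needs no spectral theorem.\<close>

inductive_set interval_cone :: "real \<Rightarrow> real poly set" for M where
  gen: "w \<in> {1, [:0, 1:], [:M, -1:], [:0, 1:] * [:M, -1:]} \<Longrightarrow> s * s * w \<in> interval_cone M"
| add: "p \<in> interval_cone M \<Longrightarrow> q \<in> interval_cone M \<Longrightarrow> p + q \<in> interval_cone M"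

lemma interval_cone_const: "0 \<le> c \<Longrightarrow> [:c:] \<in> interval_cone M"
  using interval_cone.gen[of 1 M "[:sqrt c:]"] by (simp add: one_pCons)

lemma interval_cone_basic: "[:0, 1:] \<in> interval_cone M" "[:M, -1:] \<in> interval_cone M"
  using interval_cone.gen[of "[:0,1:]" M 1] interval_cone.gen[of "[:M,-1:]" M 1] by simp_all

lemma interval_cone_square: "s * s \<in> interval_cone M"
  using interval_cone.gen[of 1 M s] by simp

text \<open>Only the parities of the exponents of X and Y matter, as even powers are absorbed in the
  square factor. So up to squares the four generators are closed under multiplication.\<close>

lemma interval_cone_mult_gen:
  assumes w: "w \<in> {1, [:0, 1:], [:M, -1:], [:0, 1:] * [:M, -1:]}"
    and v: "v \<in> {1, [:0, 1:], [:M, -1:], [:0, 1:] * [:M, -1:]}"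
  shows "(s * s * w) * (t * t * v) \<in> interval_cone M"
proof -
  define X Y where "X = [:0, 1::real:]" and "Y = [:M, -1:]"
  have I: "u * u * w \<in> interval_cone M" if "w \<in> {1, X, Y, X * Y}" for u w
    using interval_cone.gen[of w M u] that by (simp add: X_def Y_def)
  have eqs: "(s * s * a) * (t * t * b) = ((s * t) * (s * t)) * (a * b)" for a b :: "real poly"
    by (simp add: algebra_simps)
  have "(s * t) * (s * t) * (a * b) \<in> interval_cone M"
    if ab: "a \<in> {1, X, Y, X * Y}" "b \<in> {1, X, Y, X * Y}" for a b
  proof -
    have c: "a * b = b * a" by (simp add: mult.commute)
    have J: "(s * t) * (s * t) * (a * b) \<in> interval_cone M" if "a * b = u * u * w" "w \<in> {1, X, Y, X * Y}" for u w
      using I[of w "s * t * u"] that by (simp add: algebra_simps)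
    consider "a = 1" | "b = 1" | "a = X" "b = X" | "a = X" "b = Y" | "a = X" "b = X * Y"
      | "a = Y" "b = X" | "a = Y" "b = Y" | "a = Y" "b = X * Y"
      | "a = X * Y" "b = X" | "a = X * Y" "b = Y" | "a = X * Y" "b = X * Y"
      using ab unfolding insert_iff by blast
    then show ?thesis
    proof cases
      case 1 then show ?thesis using J[of 1 b] ab by simp
    next
      case 2 then show ?thesis using J[of 1 a] ab by simp
    next
      case 3 then show ?thesis using J[of X 1] by simp
    next
      case 4 then show ?thesis using J[of 1 "X * Y"] by simp
    next
      case 5 then show ?thesis using J[of X Y] by (simp add: ac_simps)
    next
      case 6 then show ?thesis using J[of 1 "X * Y"] by (simp add: ac_simps)
    next
      case 7 then show ?thesis using J[of Y 1] by simp
    next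
      case 8 then show ?thesis using J[of Y X] by (simp add: ac_simps)
    next
      case 9 then show ?thesis using J[of X Y] by (simp add: ac_simps)
    next
      case 10 then show ?thesis using J[of Y X] by (simp add: ac_simps)
    next
      case 11 then show ?thesis using J[of "X * Y" 1] by (simp add: ac_simps)
    qed
  qed
  then show ?thesis unfolding eqs using w v by (simp add: X_def Y_def)
qed

lemma interval_cone_mult:
  assumes "p \<in> interval_cone M" "q \<in> interval_cone M"
  shows "p * q \<in> interval_cone M"
  using assms(1)
proof induction
  case (gen w s)
  note w = gen
  show ?case using assms(2)
  proof induction
    case (gen v t) then show ?case using interval_cone_mult_gen[OF w] by blast
  next
    case (add p q) then show ?case by (simp add: distrib_left interval_cone.add)
  qed
next
  case (add p q) then show ?case by (simp add: distrib_right interval_cone.add)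
qed

text \<open>After division by t - x the sign of the quotient is known only away from x; continuity
  recovers it at x itself.\<close>

lemma poly_nonneg_except_point:
  fixes r :: "real poly"
  assumes M: "0 < M" and nn: "\<And>t. t \<in> {0..M} \<Longrightarrow> t \<noteq> x \<Longrightarrow> 0 \<le> poly r t" and t: "t \<in> {0..M}"
  shows "0 \<le> poly r t"
proof (cases "t = x")
  case True
  show ?thesis
  proof (rule ccontr)
    assume "\<not> 0 \<le> poly r t"
    then have "poly r x < 0" using True by simp
    moreover have "isCont (poly r) x" by simp
    ultimately have "\<forall>\<^sub>F u in at x. poly r u < 0"
      by (intro order_tendstoD) (auto simp: isCont_def)
    then obtain d where d: "d > 0" "\<And>u. u \<noteq> x \<Longrightarrow> dist u x < d \<Longrightarrow> poly r u < 0"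
      by (auto simp: eventually_at)
    \<comment> \<open>A point near x inside the interval: to the right if there is room, otherwise
      to the left.\<close>
    define u where "u = (if x < M then x + min (d/2) (M - x) else x - min (d/2) M)"
    have "u \<noteq> x" "dist u x < d" "u \<in> {0..M}"
      using d(1) M t True by (auto simp: u_def dist_real_def min_def)
    then show False using d(2)[of u] nn[of u] by simp
  qed
qed (use nn t in auto)

lemma
  shows poly_of_real_add: "poly (map_poly complex_of_real (p + q)) z = poly (map_poly complex_of_real p) z + poly (map_poly complex_of_real q) z"
    and poly_of_real_mult: "poly (map_poly complex_of_real (p * q)) z = poly (map_poly complex_of_real p) z * poly (map_poly complex_of_real q) z"
proof -
  have add: "poly (map_poly complex_of_real (p + q)) z = poly (map_poly complex_of_real p) z + poly (map_poly complex_of_real q) z" for p q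
  proof -
    have "map_poly complex_of_real (p + q) = map_poly complex_of_real p + map_poly complex_of_real q"
      by (rule poly_eqI) (simp add: coeff_map_poly)
    then show ?thesis by simp
  qed
  have smult: "map_poly complex_of_real (smult a q) = smult (of_real a) (map_poly complex_of_real q)" for a q
    by (rule poly_eqI) (simp add: coeff_map_poly)
  show "poly (map_poly complex_of_real (p + q)) z = poly (map_poly complex_of_real p) z + poly (map_poly complex_of_real q) z"
    by (rule add)
  show "poly (map_poly complex_of_real (p * q)) z = poly (map_poly complex_of_real p) z * poly (map_poly complex_of_real q) z"
    by (induction p) (simp_all add: add smult map_poly_pCons algebra_simps)
qed

lemma poly_of_real_of_real: "poly (map_poly complex_of_real p) (of_real x) = of_real (poly p x)"
  by (induction p) (simp_all add: map_poly_pCons)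

text \<open>Induction on the degree, splitting off a complex root. A real root outside (0, M) gives
  a linear factor of constant sign on the interval, a root inside is at least double and gives a
  square, and a non-real one gives (t - a)^2 + b^2. These factors lie in the cone, which is closed
  under products.\<close>

lemma poly_nonneg_in_interval_cone:
  fixes r :: "real poly"
  assumes M: "0 < M" and "\<And>t. t \<in> {0..M} \<Longrightarrow> 0 \<le> poly r t"
  shows "r \<in> interval_cone M"
  using assms(2)
proof (induction "degree r" arbitrary: r rule: less_induct)
  case less
  show ?case
  proof (cases "degree r = 0")
    case True
    then obtain c where "r = [:c:]" by (metis degree_eq_zeroE)
    then show ?thesis using less.prems[of 0] M by (auto intro: interval_cone_const)
  next
    case False
    define R where "R = map_poly complex_of_real r"
    have degR: "degree R = degree r" by (simp add: R_def degree_map_poly)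
    then have "\<not> constant (poly R)" using False constant_degree[of R] by simp
    then obtain z where z: "poly R z = 0" using fundamental_theorem_of_algebra by blast
    have r0: "r \<noteq> 0" using False by auto
    show ?thesis
    proof (cases "Im z = 0")
      case True
      define x where "x = Re z"
      have "z = of_real x" using True by (simp add: x_def complex_eq_iff)
      then have "poly r x = 0" using z by (simp add: R_def poly_of_real_of_real)
      then obtain r' where r': "r = [:-x, 1:] * r'" by (metis poly_eq_0_iff_dvd dvdE)
      have "r' \<noteq> 0" using r0 r' by auto
      then have deg': "degree r = Suc (degree r')" unfolding r' by (subst degree_mult_eq) auto
      have pr: "poly r t = (t - x) * poly r' t" for t by (simp add: r' algebra_simps)
      consider "x \<le> 0" | "M \<le> x" | "0 < x" "x < M" by linarith
      then show ?thesis
      proof cases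
        case 1
        have "0 \<le> poly r' t" if "t \<in> {0..M}" "t \<noteq> x" for t
          using less.prems[OF that(1)] that 1 by (auto simp: pr zero_le_mult_iff)
        then have "r' \<in> interval_cone M"
          using poly_nonneg_except_point[OF M] deg' by (intro less.hyps) auto
        moreover have "[:-x, 1:] \<in> interval_cone M"
          using interval_cone.add[OF interval_cone_const[of "-x" M] interval_cone_basic(1)] 1 by simp
        ultimately show ?thesis unfolding r' by (rule interval_cone_mult[rotated])
      next
        case 2
        have "0 \<le> poly (- r') t" if "t \<in> {0..M}" "t \<noteq> x" for t
          using less.prems[OF that(1)] that 2 by (auto simp: pr zero_le_mult_iff)
        then have "- r' \<in> interval_cone M"
          using poly_nonneg_except_point[OF M, of x "- r'"] deg' by (intro less.hyps) auto
        moreover have "[:x, -1:] \<in> interval_cone M"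
          using interval_cone.add[OF interval_cone_const[of "x - M" M] interval_cone_basic(2)] 2 by simp
        moreover have "r = [:x, -1:] * (- r')" by (simp add: r')
        ultimately show ?thesis using interval_cone_mult by metis
      next
        case 3
        \<comment> \<open>At a simple root inside the interval r would change sign. The size of h
          keeps both test points x - h and x + h in [0, M].\<close>
        have "poly r' x = 0"
        proof (rule ccontr)
          assume ne: "poly r' x \<noteq> 0"
          define d where "d t = poly r' x * poly r' t" for t
          have "isCont d x" unfolding d_def by (intro continuous_intros)
          moreover have "d x > 0" using ne by (simp add: d_def flip: power2_eq_square)
          ultimately have "\<forall>\<^sub>F u in at x. d u > 0"
            by (intro order_tendstoD) (auto simp: isCont_def)
          then obtain e where e: "e > 0" "\<And>u. u \<noteq> x \<Longrightarrow> dist u x < e \<Longrightarrow> d u > 0"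
            by (auto simp: eventually_at)
          define h where "h = min (e/2) (min (x/2) ((M - x)/2))"
          have h: "h > 0" "h < e" "x - h \<in> {0..M}" "x + h \<in> {0..M}" using e 3 by (auto simp: h_def min_def field_simps)
          have "d (x + h) > 0" "d (x - h) > 0" using e(2)[of "x+h"] e(2)[of "x-h"] h by (auto simp: dist_real_def)
          moreover have "0 \<le> poly r' (x + h)" "poly r' (x - h) \<le> 0"
            using less.prems[OF h(4)] less.prems[OF h(3)] h(1) by (auto simp: pr zero_le_mult_iff mult_le_0_iff)
          ultimately show False by (auto simp: d_def zero_less_mult_iff)
        qed
        then obtain r'' where r'': "r' = [:-x, 1:] * r''" by (metis poly_eq_0_iff_dvd dvdE)
        have "r'' \<noteq> 0" using \<open>r' \<noteq> 0\<close> r'' by auto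
        then have deg'': "degree r' = Suc (degree r'')" unfolding r'' by (subst degree_mult_eq) auto
        have pr2: "poly r t = (t - x) * (t - x) * poly r'' t" for t by (simp add: r' r'' algebra_simps)
        have "0 \<le> poly r'' t" if "t \<in> {0..M}" "t \<noteq> x" for t
        proof -
          have "0 < (t - x) * (t - x)" using that by (simp add: zero_less_mult_iff) linarith
          then show ?thesis using less.prems[OF that(1)] unfolding pr2 by (metis mult_le_0_iff zero_le_mult_iff not_less)
        qed
        then have "r'' \<in> interval_cone M"
          using poly_nonneg_except_point[OF M] deg' deg'' by (intro less.hyps) auto
        moreover have "r = ([:-x, 1:] * [:-x, 1:]) * r''" by (simp only: r' r'' mult.assoc)
        ultimately show ?thesis using interval_cone_mult interval_cone_square by metis
      qed
    next
      case False
      define a b where "a = Re z" and "b = Im z"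
      \<comment> \<open>The real quadratic whose roots are z and its conjugate, that is (t - a)^2 +
        b^2.\<close>
      define Q where "Q = [:a\<^sup>2 + b\<^sup>2, - 2 * a, 1:]"
      have Q0: "Q \<noteq> 0" and dQ: "degree Q = 2" by (simp_all add: Q_def)
      have Qz: "poly (map_poly complex_of_real Q) z = 0"
        by (simp add: Q_def a_def b_def complex_eq_iff map_poly_pCons power2_eq_square algebra_simps)
      define m where "m = r mod Q"
      have "degree m < 2 \<or> m = 0" using degree_mod_less[OF Q0, of r] dQ by (auto simp: m_def)
      then obtain c d where m: "m = [:c, d:]"
      proof -
        have "degree m < Suc (Suc 0)" using \<open>degree m < 2 \<or> m = 0\<close> by auto
        then have "m = [:coeff m 0, coeff m 1:]"
          by (intro poly_eqI) (auto simp: coeff_pCons coeff_eq_0 split: nat.splits)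
        then show ?thesis using that by blast
      qed
      have rQ: "r = Q * (r div Q) + m" by (simp add: m_def)
      have "poly R z = poly (map_poly complex_of_real Q) z * poly (map_poly complex_of_real (r div Q)) z
          + poly (map_poly complex_of_real m) z"
        unfolding R_def by (subst rQ) (simp only: poly_of_real_add poly_of_real_mult)
      then have "poly (map_poly complex_of_real m) z = 0" using z Qz by simp
      then have "of_real c + z * of_real d = 0" by (simp add: m map_poly_pCons)
      \<comment> \<open>A real polynomial of degree at most one with a non-real root vanishes, so Q
        divides r.\<close>
      then have "d = 0" "c = 0" using False by (auto simp: complex_eq_iff)
      then have rQ': "r = Q * (r div Q)" using rQ m by simp
      have Qpos: "poly Q t > 0" for t
      proof -
        have "poly Q t = (t - a)\<^sup>2 + b\<^sup>2" by (simp add: Q_def power2_eq_square algebra_simps)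
        then show ?thesis using False by (simp add: b_def sum_power2_gt_zero_iff)
      qed
      have "r div Q \<noteq> 0" using rQ' r0 by auto
      then have "degree r = 2 + degree (r div Q)"
        using Q0 dQ rQ' degree_mult_eq[of Q "r div Q"] by simp
      moreover have "0 \<le> poly (r div Q) t" if "t \<in> {0..M}" for t
      proof -
        have "poly r t = poly Q t * poly (r div Q) t" by (subst rQ') (rule poly_mult)
        then show ?thesis using less.prems[OF that] Qpos[of t] by (simp add: zero_le_mult_iff)
      qed
      ultimately have "r div Q \<in> interval_cone M" by (intro less.hyps) auto
      moreover have "Q \<in> interval_cone M"
      proof -
        have eq: "Q = [:-a, 1:] * [:-a, 1:] + [:b\<^sup>2:]" by (simp add: Q_def power2_eq_square)
        show ?thesis unfolding eq
          by (intro interval_cone.add interval_cone_square interval_cone_const) simp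
      qed
      ultimately show ?thesis using rQ' interval_cone_mult by metis
    qed
  qed
qed

text \<open>Convexity: a power lies above its tangent at a. The induction step multiplies the
  inequality by t and adds the nonnegative term (n+1) a^n (t - a)^2.\<close>

lemma tangent_power_le:
  fixes t a :: real
  assumes "0 \<le> t" "0 \<le> a"
  shows "real (Suc n) * a ^ n * t \<le> t ^ Suc n + real n * a ^ Suc n"
proof (induction n)
  case 0 then show ?case by simp
next
  case (Suc n)
  have "0 \<le> t * (t ^ Suc n + real n * a ^ Suc n - real (Suc n) * a ^ n * t) + real (Suc n) * a ^ n * (t - a)\<^sup>2"
    using Suc assms by (intro add_nonneg_nonneg mult_nonneg_nonneg) auto
  also have "\<dots> = t ^ Suc (Suc n) + real (Suc n) * a ^ Suc (Suc n) - real (Suc (Suc n)) * a ^ Suc n * t"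
    by (simp add: power2_eq_square algebra_simps)
  finally show ?case by simp
qed

section \<open>Polynomials in a self-adjoint operator and comparison with a power\<close>

context ip_operator begin

lemma funpow_in: "f \<in> S \<Longrightarrow> (B ^^ i) f \<in> S"
  by (induction i) (auto simp: op_in)

lemma op_poly_upto:
  assumes "degree q \<le> n"
  shows "op_poly q B f = (\<Sum>i\<le>n. cscale (of_real (coeff q i)) ((B ^^ i) f))"
  unfolding op_poly_def
proof (rule sum.mono_neutral_left)
  show "\<forall>i\<in>{..n} - {..degree q}. cscale (of_real (coeff q i)) ((B ^^ i) f) = 0"
    by (auto simp: coeff_eq_0 cscale_def fun_eq_iff)
qed (use assms in auto)

lemma op_poly_in: "f \<in> S \<Longrightarrow> op_poly q B f \<in> S"
  unfolding op_poly_def by (intro sum_in scale_in funpow_in) auto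

lemma op_poly_add: "op_poly (p + q) B f = op_poly p B f + op_poly q B f"
proof -
  interpret V: vector_space "cscale :: complex \<Rightarrow> ('a \<Rightarrow> complex) \<Rightarrow> 'a \<Rightarrow> complex"
    by (rule vector_space_cscale)
  define n where "n = max (degree p) (degree q)"
  have "degree (p + q) \<le> n" "degree p \<le> n" "degree q \<le> n" by (auto simp: n_def degree_add_le_max)
  then show ?thesis
    by (simp only: op_poly_upto[of _ n] coeff_add of_real_add V.scale_left_distrib sum.distrib)
qed

lemma op_poly_smult: "op_poly (smult c p) B f = cscale (of_real c) (op_poly p B f)"
proof -
  interpret V: vector_space "cscale :: complex \<Rightarrow> ('a \<Rightarrow> complex) \<Rightarrow> 'a \<Rightarrow> complex"
    by (rule vector_space_cscale)
  show ?thesis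
    using op_poly_upto[of "smult c p" "degree p" f]
    by (simp add: degree_smult_le op_poly_def V.scale_sum_right)
qed

lemma op_poly_pCons:
  assumes f: "f \<in> S"
  shows "op_poly (pCons a p) B f = cscale (of_real a) f + B (op_poly p B f)"
proof -
  have "op_poly (pCons a p) B f = (\<Sum>i\<le>Suc (degree p). cscale (of_real (coeff (pCons a p) i)) ((B ^^ i) f))"
    by (rule op_poly_upto) (rule degree_pCons_le)
  also have "\<dots> = cscale (of_real a) f + (\<Sum>i\<le>degree p. cscale (of_real (coeff p i)) (B ((B ^^ i) f)))"
    by (subst sum.atMost_Suc_shift) simp
  also have "(\<Sum>i\<le>degree p. cscale (of_real (coeff p i)) (B ((B ^^ i) f)))
     = (\<Sum>i\<le>degree p. B (cscale (of_real (coeff p i)) ((B ^^ i) f)))"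
    using f by (intro sum.cong refl op_scale[symmetric] funpow_in)
  also have "\<dots> = B (op_poly p B f)"
    unfolding op_poly_def using f by (intro op_sum[symmetric] scale_in funpow_in) auto
  finally show ?thesis .
qed

lemma op_poly_0: "op_poly 0 B f = 0"
  by (simp add: op_poly_def cscale_def fun_eq_iff)

lemma op_poly_mult:
  assumes f: "f \<in> S"
  shows "op_poly (p * q) B f = op_poly p B (op_poly q B f)"
proof (induction p)
  case 0
  then show ?case by (simp only: mult_zero_left op_poly_0)
next
  case (pCons a p)
  have "op_poly (pCons a p * q) B f = op_poly (smult a q) B f + op_poly (pCons 0 (p * q)) B f"
    by (simp only: mult_pCons_left op_poly_add)
  also have "op_poly (pCons 0 (p * q)) B f = B (op_poly p B (op_poly q B f))"
    using op_poly_pCons[OF f, of 0 "p * q"] pCons.IH by (simp add: cscale_def fun_eq_iff)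
  finally show ?case
    using op_poly_pCons[OF op_poly_in[OF f, of q], of a p] by (simp only: op_poly_smult)
qed

lemma funpow_sa: "f \<in> S \<Longrightarrow> g \<in> S \<Longrightarrow> ip ((B ^^ i) f) g = ip f ((B ^^ i) g)"
proof (induction i arbitrary: g)
  case (Suc i)
  have "ip ((B ^^ Suc i) f) g = ip ((B ^^ i) f) (B g)" using Suc.prems by (simp add: op_sa funpow_in)
  also have "\<dots> = ip f ((B ^^ i) (B g))" using Suc by (simp add: op_in)
  finally show ?case by (simp add: funpow_swap1)
qed simp

lemma op_poly_sa:
  assumes f: "f \<in> S" and g: "g \<in> S"
  shows "ip (op_poly p B f) g = ip f (op_poly p B g)"
proof -
  have "ip (op_poly p B f) g = (\<Sum>i\<le>degree p. of_real (coeff p i) * ip ((B ^^ i) f) g)"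
    unfolding op_poly_def using f g by (simp add: ip_sum scale_in funpow_in ip_scale)
  also have "\<dots> = (\<Sum>i\<le>degree p. cnj (of_real (coeff p i) * ip ((B ^^ i) g) f))"
  proof (intro sum.cong refl)
    fix i
    have "ip ((B ^^ i) f) g = cnj (ip ((B ^^ i) g) f)"
      unfolding funpow_sa[OF f g] by (rule ip_commute[OF funpow_in[OF g] f])
    then show "of_real (coeff p i) * ip ((B ^^ i) f) g = cnj (of_real (coeff p i) * ip ((B ^^ i) g) f)"
      by simp
  qed
  also have "\<dots> = cnj (ip (op_poly p B g) f)"
    unfolding op_poly_def using f g by (simp add: ip_sum scale_in funpow_in ip_scale)
  also have "\<dots> = ip f (op_poly p B g)" using f g by (intro ip_commute[symmetric] op_poly_in)
  finally show ?thesis .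
qed

text \<open>Polynomials in B commute and are self-adjoint, so one factor s moves to the other side
  of the form. A square factor thus preserves positivity.\<close>

lemma op_poly_square_form:
  assumes f: "f \<in> S"
  shows "ip (op_poly (s * s * w) B f) f = ip (op_poly w B (op_poly s B f)) (op_poly s B f)"
proof -
  have "s * s * w = s * (w * s)" by (simp add: ac_simps)
  then have "op_poly (s * s * w) B f = op_poly s B (op_poly w B (op_poly s B f))"
    by (simp only: op_poly_mult f op_poly_in)
  then show ?thesis using f by (simp only: op_poly_sa op_poly_in)
qed

text \<open>Among the generators of the cone, t is nonnegative by hypothesis, M - t by
  Cauchy-Schwarz and the norm bound, and t (M - t) reduces to these two. Membership in the cone
  carries this to every polynomial nonnegative on [0, M].\<close>

lemma op_poly_form_nonneg:
  assumes pos: "\<And>f. f \<in> S \<Longrightarrow> 0 \<le> Re (ip (B f) f)"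
    and M: "0 < M" "\<And>f. f \<in> S \<Longrightarrow> nrm (B f) \<le> M * nrm f"
    and r: "\<And>t. t \<in> {0..M} \<Longrightarrow> 0 \<le> poly r t" and f: "f \<in> S"
  shows "0 \<le> Re (ip (op_poly r B f) f)"
proof -
  have one: "op_poly 1 B f = f" if "f \<in> S" for f
    by (simp add: op_poly_def cscale_def fun_eq_iff)
  have X: "op_poly [:0, 1:] B f = B f" if "f \<in> S" for f
  proof -
    have "[:0, 1:] = pCons 0 (1 :: real poly)" by (simp add: one_pCons)
    then have "op_poly [:0, 1:] B f = cscale 0 f + B f"
      using op_poly_pCons[OF that, of 0 1] one[OF that] by (simp only: of_real_0)
    then show ?thesis by (simp add: cscale_def fun_eq_iff)
  qed
  have neg: "op_poly [:-1:] B f = cscale (-1) f" if "f \<in> S" for f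
    by (simp add: op_poly_def)
  have Y: "op_poly [:M, -1:] B f = cscale (of_real M) f - B f" if "f \<in> S" for f
    using op_poly_pCons[OF that, of M "[:-1:]"] neg[OF that] that op_scale[OF that, of "-1"]
    by (simp add: cscale_def fun_eq_iff)
  have Ypos: "0 \<le> Re (ip (op_poly [:M, -1:] B f) f)" if f: "f \<in> S" for f
  proof -
    have "Re (ip (B f) f) \<le> nrm (B f) * nrm f"
      using cauchy_schwarz[OF op_in[OF f] f] complex_Re_le_cmod order_trans by blast
    also have "\<dots> \<le> M * nrm f * nrm f" using M(2)[OF f] nrm_ge0[OF f] by (rule mult_right_mono)
    finally have "Re (ip (B f) f) \<le> M * (nrm f)\<^sup>2" by (simp add: power2_eq_square)
    then show ?thesis using f by (simp add: Y ip_diff op_in scale_in ip_scale nrm_sq)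
  qed
  have Xpos: "0 \<le> Re (ip (op_poly [:0, 1:] B f) f)" if "f \<in> S" for f
    using pos that by (simp add: X)
  have XYpos: "0 \<le> Re (ip (op_poly ([:0, 1:] * [:M, -1:]) B f) f)" if f: "f \<in> S" for f
  proof -
    define X Y where "X = [:0, 1::real:]" and "Y = [:M, -1:]"
    \<comment> \<open>X + Y = M, so M X Y = X^2 Y + Y^2 X, and both terms are a square times a
      generator already known to be positive.\<close>
    have "smult M (X * Y) = X * X * Y + Y * Y * X" by (simp add: X_def Y_def algebra_simps)
    then have "cscale (of_real M) (op_poly (X * Y) B f) = op_poly (X * X * Y) B f + op_poly (Y * Y * X) B f"
      by (simp only: op_poly_smult[symmetric] op_poly_add[symmetric])
    then have "of_real M * ip (op_poly (X * Y) B f) f = ip (op_poly (X * X * Y) B f) f + ip (op_poly (Y * Y * X) B f) f"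
      using f by (simp only: ip_scale[symmetric] ip_add[symmetric] op_poly_in)
    then have "M * Re (ip (op_poly (X * Y) B f) f) = Re (ip (op_poly (X * X * Y) B f) f) + Re (ip (op_poly (Y * Y * X) B f) f)"
      by (simp only: complex_eq_iff) simp
    also have "\<dots> \<ge> 0"
      unfolding op_poly_square_form[OF f]
      using Xpos[of "op_poly Y B f"] Ypos[of "op_poly X B f"] f by (simp add: op_poly_in X_def Y_def)
    finally show ?thesis using M(1) by (simp add: zero_le_mult_iff X_def Y_def)
  qed
  have "0 \<le> Re (ip (op_poly r B f) f)" if "r \<in> interval_cone M" for r
    using that
  proof induction
    case (gen w s)
    define g where "g = op_poly s B f"
    have g: "g \<in> S" unfolding g_def by (rule op_poly_in[OF f])
    have "0 \<le> Re (ip (op_poly w B g) g)"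
      using gen Xpos[OF g] Ypos[OF g] XYpos[OF g] ip_ge0[OF g] one[OF g] by auto
    then show ?case unfolding op_poly_square_form[OF f] g_def .
  next
    case (add p q)
    then show ?case using f by (simp only: op_poly_add ip_add op_poly_in plus_complex.sel add_nonneg_nonneg)
  qed
  then show ?thesis using poly_nonneg_in_interval_cone[OF M(1) r] by blast
qed

text \<open>Jensen's inequality without a spectral measure. If a is the Rayleigh quotient of f, the
  tangent to t^n at a lies below t^n, hence below C t^s, hence below C (q_k + \<epsilon>). The
  difference is a polynomial nonnegative on [0, M], so its form at f is nonnegative.\<close>

lemma power_form_bound:
  assumes pos: "\<And>f. f \<in> S \<Longrightarrow> 0 \<le> Re (ip (B f) f)"
    and powr: "is_op_powr S ip B s T" and n: "0 < n" and s: "s \<le> real n"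
  obtains C where "0 < C"
    "\<And>f. f \<in> S \<Longrightarrow> (Re (ip (B f) f)) ^ n \<le> C * (nrm f) ^ (2 * (n - 1)) * cmod (ip (T f) f)"
proof -
  obtain M q where M: "M \<ge> 0" "\<And>f. f \<in> S \<Longrightarrow> nrm (B f) \<le> M * nrm f"
    and q: "uniform_limit {0..M} (\<lambda>k t. poly (q k) t) (\<lambda>t. t powr s) sequentially"
    and qT: "\<And>\<epsilon>. \<epsilon> > 0 \<Longrightarrow> \<forall>\<^sub>F k in sequentially. \<forall>f\<in>S. nrm (op_poly (q k) B f - T f) \<le> \<epsilon> * nrm f"
    using powr unfolding is_op_powr_def by blast
  have TS: "T f \<in> S" if "f \<in> S" for f using powr that by (auto simp: is_op_powr_def bounded_operator_def)
  \<comment> \<open>Bounds t^(n - s) on [0, M], the exponent being nonnegative; M + 1 in place of M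
    keeps C positive when M = 0.\<close>
  define C where "C = (M + 1) powr (real n - s)"
  have C: "C > 0" using M by (simp add: C_def)
  have tC: "t ^ n \<le> C * t powr s" if "t \<in> {0..M}" for t
  proof (cases "t = 0")
    case False
    then have "t ^ n = t powr (real n - s) * t powr s" using that by (simp flip: powr_add powr_realpow)
    also have "\<dots> \<le> C * t powr s"
      unfolding C_def using that s by (intro mult_right_mono powr_mono2) auto
    finally show ?thesis .
  next
    case True
    then have "t ^ n = 0" using n power_0_left by simp
    moreover have "C * t powr s = 0" using True by simp
    ultimately show ?thesis by linarith
  qed
  have "(Re (ip (B f) f)) ^ n \<le> C * (nrm f) ^ (2 * (n - 1)) * cmod (ip (T f) f)" if f: "f \<in> S" for f
  proof (cases "M = 0 \<or> f = 0")
    case True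
    have "nrm (B f) \<le> 0" using True M(2)[OF f] nrm_zero by (auto simp: op_zero)
    then have "B f = 0" using nrm_pos[OF op_in[OF f]] by fastforce
    then have "ip (B f) f = 0" by (simp only: ip_zero[OF f])
    then show ?thesis using n C nrm_ge0[OF f] by (simp add: zero_power)
  next
    case False
    then have Mp: "0 < M" using M by simp
    define N where "N = (nrm f)\<^sup>2"
    have N: "N > 0" using False nrm_pos[OF f] by (simp add: N_def)
    define x where "x = Re (ip (B f) f)"
    \<comment> \<open>With the tangent point at the Rayleigh quotient, the linear and constant terms
      of the tangent, evaluated at f, combine to exactly a^n N.\<close>
    define a where "a = x / N"
    have a: "0 \<le> a" "x = a * N" using pos[OF f] N by (auto simp: a_def x_def)
    obtain m where m: "n = Suc m" using n gr0_conv_Suc by blast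
    have key: "a ^ n * N \<le> C * cmod (ip (T f) f) + \<epsilon> * (2 * C * N)" if \<epsilon>: "\<epsilon> > 0" for \<epsilon>
    proof -
      have "\<forall>\<^sub>F k in sequentially. (\<forall>t\<in>{0..M}. dist (poly (q k) t) (t powr s) < \<epsilon>) \<and> (\<forall>f\<in>S. nrm (op_poly (q k) B f - T f) \<le> \<epsilon> * nrm f)"
        using qT[OF \<epsilon>] uniform_limitD[OF q \<epsilon>] by eventually_elim auto
      then obtain k where k': "(\<forall>t\<in>{0..M}. dist (poly (q k) t) (t powr s) < \<epsilon>) \<and> (\<forall>f\<in>S. nrm (op_poly (q k) B f - T f) \<le> \<epsilon> * nrm f)"
        unfolding eventually_sequentially by blast
      have k: "\<And>t. t \<in> {0..M} \<Longrightarrow> dist (poly (q k) t) (t powr s) < \<epsilon>"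
        "\<And>f. f \<in> S \<Longrightarrow> nrm (op_poly (q k) B f - T f) \<le> \<epsilon> * nrm f"
        using k' by blast+
      define r where "r = smult C (q k) + [:C * \<epsilon> + real m * a ^ n, - (real n * a ^ m):]"
      have nn: "0 \<le> poly r t" if t: "t \<in> {0..M}" for t
      proof -
        have "t powr s \<le> poly (q k) t + \<epsilon>" using k(1)[OF t] by (auto simp: dist_real_def)
        then have "C * t powr s \<le> C * (poly (q k) t + \<epsilon>)" using C by simp
        moreover have "real n * a ^ m * t \<le> t ^ n + real m * a ^ n"
          using tangent_power_le[of t a m] t a by (simp add: m)
        ultimately show ?thesis using tC[OF t] by (simp add: r_def algebra_simps)
      qed
      have "0 \<le> Re (ip (op_poly r B f) f)"
        by (rule op_poly_form_nonneg[OF pos Mp M(2) nn f])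
      also have "op_poly r B f = cscale (of_real C) (op_poly (q k) B f)
         + (cscale (of_real (C * \<epsilon> + real m * a ^ n)) f + cscale (of_real (- (real n * a ^ m))) (B f))"
      proof -
        have "op_poly [:- (real n * a ^ m):] B f = cscale (of_real (- (real n * a ^ m))) f"
          by (simp add: op_poly_def)
        then show ?thesis
          unfolding r_def op_poly_add op_poly_smult
          using op_poly_pCons[OF f, of "C * \<epsilon> + real m * a ^ n" "[:- (real n * a ^ m):]"] op_scale[OF f]
          by simp
      qed
      also have "Re (ip \<dots> f) = C * Re (ip (op_poly (q k) B f) f) + ((C * \<epsilon> + real m * a ^ n) * N - real n * a ^ m * x)"
        using f by (simp add: ip_add ip_scale add_in scale_in op_in op_poly_in nrm_sq N_def x_def del: of_real_add of_real_mult of_real_minus)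
      also have "\<dots> = C * Re (ip (op_poly (q k) B f) f) + C * \<epsilon> * N - a ^ n * N"
        unfolding a(2) by (simp add: m algebra_simps)
      finally have 1: "a ^ n * N \<le> C * Re (ip (op_poly (q k) B f) f) + C * \<epsilon> * N" by simp
      have "Re (ip (op_poly (q k) B f) f) \<le> cmod (ip (T f) f) + \<epsilon> * N"
      proof -
        have "ip (op_poly (q k) B f) f = ip (T f) f + ip (op_poly (q k) B f - T f) f"
          using f TS by (simp add: ip_diff op_poly_in)
        then have "Re (ip (op_poly (q k) B f) f) \<le> cmod (ip (T f) f) + cmod (ip (op_poly (q k) B f - T f) f)"
          by (metis complex_Re_le_cmod norm_triangle_ineq order_trans)
        also have "cmod (ip (op_poly (q k) B f - T f) f) \<le> nrm (op_poly (q k) B f - T f) * nrm f"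
          using f TS by (intro cauchy_schwarz diff_in op_poly_in)
        also have "\<dots> \<le> \<epsilon> * nrm f * nrm f" using k(2)[OF f] nrm_ge0[OF f] by (rule mult_right_mono)
        finally show ?thesis by (simp add: N_def power2_eq_square)
      qed
      then have "C * Re (ip (op_poly (q k) B f) f) \<le> C * (cmod (ip (T f) f) + \<epsilon> * N)" using C by simp
      then show ?thesis using 1 by (simp add: algebra_simps)
    qed
    have "a ^ n * N \<le> C * cmod (ip (T f) f)"
    proof (rule field_le_epsilon)
      fix e :: real assume "0 < e"
      then show "a ^ n * N \<le> C * cmod (ip (T f) f) + e"
        using key[of "e / (2 * C * N)"] C N by simp
    qed
    then have "a ^ n * N * N ^ m \<le> C * cmod (ip (T f) f) * N ^ m" using N by (intro mult_right_mono) auto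
    moreover have "x ^ n = a ^ n * N * N ^ m" unfolding a(2) by (simp add: m power_mult_distrib)
    moreover have "N ^ m = nrm f ^ (2 * (n - 1))" by (simp add: N_def m power_mult)
    ultimately show ?thesis by (simp add: x_def mult.commute mult.left_commute)
  qed
  then show ?thesis using that C by blast
qed

end

section \<open>Linear changes of variables in complex coordinate space\<close>

lemma borel_measurable_linear:
  fixes g :: "'u::euclidean_space \<Rightarrow> 'v::euclidean_space"
  assumes "linear g"
  shows "g \<in> borel_measurable borel"
  using assms by (intro borel_measurable_continuous_onI linear_continuous_on) (simp add: linear_conv_bounded_linear)

lemma Basis_complex_vec: "(Basis :: (complex ^ 'n) set) = (\<lambda>p. axis (fst p) (if snd p then \<i> else 1)) ` UNIV"
  by (auto simp: Basis_vec_def Basis_complex_def image_iff) (metis (full_types) fst_conv snd_conv)+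

lemma inj_axis_complex: "inj (\<lambda>p::'n::finite \<times> bool. axis (fst p) (if snd p then \<i> else 1) :: complex ^ 'n)"
  by (rule injI) (auto simp: axis_eq_axis split: if_splits prod.splits)

lemma nn_integral_lborel_translate:
  fixes u :: "'a::euclidean_space \<Rightarrow> ennreal"
  assumes "u \<in> borel_measurable borel"
  shows "(\<integral>\<^sup>+x. u (c + x) \<partial>lborel) = (\<integral>\<^sup>+x. u x \<partial>lborel)"
proof -
  have "(\<integral>\<^sup>+x. u x \<partial>lborel) = (\<integral>\<^sup>+x. u x \<partial>distr lborel borel ((+) c))" by (simp only: lborel_distr_plus)
  also have "\<dots> = (\<integral>\<^sup>+x. u (c + x) \<partial>lborel)" using assms by (intro nn_integral_distr) auto
  finally show ?thesis by simp
qed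

text \<open>Both sides of \<open>\<lambda>(A) \<lambda>(f -` B) = \<lambda>(B) \<lambda>(f -` A)\<close>, for a symmetric set \<open>A\<close>, are the integral
  of \<open>1\<^sub>A(x) 1\<^sub>B(x + f u)\<close> over \<open>(x, u)\<close>; take a ball for \<open>A\<close>.\<close>

lemma lborel_preimage_linear:
  fixes f :: "'a::euclidean_space \<Rightarrow> 'a"
  assumes lin: "linear f" and inj: "inj f"
  shows "\<exists>c>0. \<forall>A\<in>sets borel. emeasure lborel (f -` A) = ennreal c * emeasure lborel A"
proof -
  obtain g where g: "linear g" "g \<circ> f = id" "f \<circ> g = id"
    using linear_injective_isomorphism[OF lin inj] by (auto simp: fun_eq_iff)
  have gf: "g (f x) = x" and fg: "f (g x) = x" for x using g by (auto simp: fun_eq_iff)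
  have fm[measurable]: "f \<in> borel_measurable borel" by (rule borel_measurable_linear[OF lin])
  define A :: "'a set" where "A = ball 0 1"
  have A[measurable]: "A \<in> sets borel" by (simp add: A_def)
  have key: "emeasure lborel A * emeasure lborel (f -` B) = emeasure lborel B * emeasure lborel (f -` A)"
    if B[measurable]: "B \<in> sets borel" for B
  proof -
    have fB: "f -` B \<in> sets borel" "f -` A \<in> sets borel" using measurable_sets_borel[OF fm] A B by auto
    have "(\<integral>\<^sup>+x. \<integral>\<^sup>+u. indicator A x * indicator B (x + f u) \<partial>lborel \<partial>lborel)
        = (\<integral>\<^sup>+x. indicator A x * emeasure lborel (f -` B) \<partial>lborel)"
    proof (rule nn_integral_cong)
      fix x
      have "(\<integral>\<^sup>+u. indicator A x * indicator B (x + f u) \<partial>lborel) = (indicator A x :: ennreal) * (\<integral>\<^sup>+u. indicator B (x + f u) \<partial>lborel)"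
        by (intro nn_integral_cmult) auto
      also have "(\<integral>\<^sup>+u. indicator B (x + f u) \<partial>lborel) = (\<integral>\<^sup>+u. indicator (f -` B) (g x + u) \<partial>lborel)"
        by (intro nn_integral_cong) (simp add: indicator_def linear_add[OF lin] fg)
      also have "\<dots> = (\<integral>\<^sup>+u. indicator (f -` B) u \<partial>lborel)"
        using fB by (intro nn_integral_lborel_translate) auto
      also have "\<dots> = emeasure lborel (f -` B)" using fB by simp
      finally show "(\<integral>\<^sup>+u. indicator A x * indicator B (x + f u) \<partial>lborel) = indicator A x * emeasure lborel (f -` B)" .
    qed
    then have 1: "(\<integral>\<^sup>+x. \<integral>\<^sup>+u. indicator A x * indicator B (x + f u) \<partial>lborel \<partial>lborel) = emeasure lborel A * emeasure lborel (f -` B)"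
      by (simp add: nn_integral_multc)
    have "(\<integral>\<^sup>+x. \<integral>\<^sup>+u. indicator A x * indicator B (x + f u) \<partial>lborel \<partial>lborel)
        = (\<integral>\<^sup>+u. \<integral>\<^sup>+x. indicator A x * indicator B (x + f u) \<partial>lborel \<partial>lborel)"
      by (rule lborel_pair.Fubini'[symmetric]) measurable
    also have "\<dots> = (\<integral>\<^sup>+u. \<integral>\<^sup>+x. indicator A (x - f u) * indicator B x \<partial>lborel \<partial>lborel)"
    proof (rule nn_integral_cong)
      fix u
      have "(\<integral>\<^sup>+x. indicator A x * indicator B (x + f u) \<partial>lborel)
         = (\<integral>\<^sup>+x. (\<lambda>x. indicator A (x - f u) * indicator B x :: ennreal) (f u + x) \<partial>lborel)"
        by (intro nn_integral_cong) (simp add: add.commute)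
      also have "\<dots> = (\<integral>\<^sup>+x. indicator A (x - f u) * indicator B x \<partial>lborel)"
        by (intro nn_integral_lborel_translate) measurable
      finally show "(\<integral>\<^sup>+x. indicator A x * indicator B (x + f u) \<partial>lborel) = (\<integral>\<^sup>+x. indicator A (x - f u) * indicator B x \<partial>lborel)" .
    qed
    also have "\<dots> = (\<integral>\<^sup>+x. \<integral>\<^sup>+u. indicator A (x - f u) * indicator B x \<partial>lborel \<partial>lborel)"
      by (rule lborel_pair.Fubini') measurable
    also have "\<dots> = (\<integral>\<^sup>+x. emeasure lborel (f -` A) * indicator B x \<partial>lborel)"
    proof (rule nn_integral_cong)
      fix x
      have "(\<integral>\<^sup>+u. indicator A (x - f u) * indicator B x \<partial>lborel) = (\<integral>\<^sup>+u. indicator A (x - f u) \<partial>lborel) * (indicator B x :: ennreal)"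
        by (intro nn_integral_multc) measurable
      also have "(\<integral>\<^sup>+u. indicator A (x - f u) \<partial>lborel) = (\<integral>\<^sup>+u. indicator (f -` A) (- g x + u) \<partial>lborel)"
        by (intro nn_integral_cong)
          (simp add: indicator_def linear_add[OF lin] linear_diff[OF lin] fg A_def dist_norm norm_minus_commute)
      also have "\<dots> = (\<integral>\<^sup>+u. indicator (f -` A) u \<partial>lborel)"
        using fB by (intro nn_integral_lborel_translate) auto
      also have "\<dots> = emeasure lborel (f -` A)" using fB by simp
      finally show "(\<integral>\<^sup>+u. indicator A (x - f u) * indicator B x \<partial>lborel) = emeasure lborel (f -` A) * indicator B x" .
    qed
    also have "\<dots> = emeasure lborel (f -` A) * emeasure lborel B" by (simp add: nn_integral_cmult)
    finally show ?thesis using 1 by (simp add: mult.commute)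
  qed
  define v where "v = measure lborel A"
  have v: "v > 0" by (simp add: v_def A_def)
  have eA: "emeasure lborel A = ennreal v"
    unfolding v_def A_def using emeasure_lborel_ball_finite[of "0 :: 'a" 1]
    by (intro emeasure_eq_ennreal_measure) (auto simp: top.not_eq_extremum)
  define w where "w = measure lborel (f -` A)"
  obtain d where d: "d > 0" "ball 0 d \<subseteq> f -` A"
  proof -
    have "open (f -` A)" unfolding A_def using linear_continuous_on[of f] lin
      by (intro open_vimage) (auto simp: linear_conv_bounded_linear)
    moreover have "0 \<in> f -` A" using linear_0[OF lin] by (simp add: A_def)
    ultimately show ?thesis using that open_contains_ball by blast
  qed
  have "bounded (f -` A)"
  proof -
    obtain K where K: "\<And>x. norm (g x) \<le> norm x * K" using linear_bounded_pos[OF g(1)] by (metis mult.commute)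
    have "norm x \<le> \<bar>K\<bar>" if "x \<in> f -` A" for x
    proof -
      have "norm x \<le> norm (f x) * K" using K[of "f x"] by (simp add: gf)
      also have "\<dots> \<le> 1 * \<bar>K\<bar>" 
      proof (rule order_trans)
        show "norm (f x) * K \<le> norm (f x) * \<bar>K\<bar>" by (intro mult_left_mono) auto
        show "norm (f x) * \<bar>K\<bar> \<le> 1 * \<bar>K\<bar>" using that by (intro mult_right_mono) (auto simp: A_def)
      qed
      finally show ?thesis by simp
    qed
    then show ?thesis by (auto simp: bounded_iff)
  qed
  then have fin: "emeasure lborel (f -` A) < \<infinity>" by (rule emeasure_bounded_finite)
  then have ew: "emeasure lborel (f -` A) = ennreal w"
    unfolding w_def by (intro emeasure_eq_ennreal_measure) (auto simp: top.not_eq_extremum)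
  have "0 < measure lborel (ball (0 :: 'a) d)" using d by simp
  also have "\<dots> \<le> w" unfolding w_def using d(2) fin measurable_sets_borel[OF fm A]
    by (intro measure_mono_fmeasurable) (auto simp: fmeasurable_def)
  finally have w: "w > 0" .
  have "emeasure lborel (f -` B) = ennreal (w / v) * emeasure lborel B" if "B \<in> sets borel" for B
  proof -
    have "ennreal (1 / v) * (ennreal v * emeasure lborel (f -` B)) = ennreal (1 / v) * (emeasure lborel B * ennreal w)"
      using key[OF that] unfolding eA ew by simp
    moreover have "ennreal (1 / v) * (ennreal v * X) = X" for X
      using v by (simp add: mult.assoc[symmetric] flip: ennreal_mult)
    moreover have "ennreal (1 / v) * (emeasure lborel B * ennreal w) = ennreal (w / v) * emeasure lborel B"
    proof -
      have "ennreal (1 / v) * (emeasure lborel B * ennreal w) = (ennreal (1 / v) * ennreal w) * emeasure lborel B"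
        by (simp only: ac_simps)
      also have "ennreal (1 / v) * ennreal w = ennreal (w / v)" using v w by (simp flip: ennreal_mult)
      finally show ?thesis .
    qed
    ultimately show ?thesis by simp
  qed
  moreover have "w / v > 0" using v w by simp
  ultimately show ?thesis by blast
qed

lemma norm_vector_scalar_mult: "norm (c *s (w :: complex ^ 'n)) = cmod c * norm w"
  by (simp add: norm_vec_def vector_scalar_mult_def norm_mult L2_set_right_distrib)

lemma bounded_linear_scalar_mult: "bounded_linear (\<lambda>w :: complex ^ 'n. c *s w)"
  by (rule bounded_linear_intro[where K = "cmod c"])
    (auto simp: vec_eq_iff algebra_simps norm_vector_scalar_mult)

lemma bounded_linear_scalar_mult_left: "bounded_linear (\<lambda>c. c *s (w :: complex ^ 'n))"
  by (rule bounded_linear_intro[where K = "norm w"])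
    (auto simp: vec_eq_iff algebra_simps norm_vector_scalar_mult)

text \<open>The constant of \<open>lborel_preimage_linear\<close> is 1 here, because a rotation maps
  the unit ball onto itself and the ball has finite positive measure.\<close>

lemma nn_integral_rotate:
  fixes u :: "complex ^ 'n \<Rightarrow> ennreal"
  assumes u: "u \<in> borel_measurable borel" and c: "cmod c = 1"
  shows "(\<integral>\<^sup>+w. u (c *s w) \<partial>lborel) = (\<integral>\<^sup>+w. u w \<partial>lborel)"
proof -
  define f where "f w = c *s w" for w :: "complex ^ 'n"
  have lin: "linear f" unfolding f_def using bounded_linear_scalar_mult[of c] bounded_linear.linear by blast
  have inj: "inj f" using c by (auto simp: f_def inj_def vec_eq_iff)
  have m: "f \<in> borel_measurable borel"
    by (intro borel_measurable_linear lin)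
  obtain k where k: "k > 0" "\<And>A. A \<in> sets borel \<Longrightarrow> emeasure lborel (f -` A) = ennreal k * emeasure lborel A"
    using lborel_preimage_linear[OF lin inj] by blast
  have "f -` ball 0 1 = ball 0 1" using c by (auto simp: f_def norm_vector_scalar_mult)
  then have eq: "emeasure lborel (ball 0 1 :: (complex ^ 'n) set) = ennreal k * emeasure lborel (ball 0 1 :: (complex ^ 'n) set)"
    using k(2)[of "ball 0 1"] by simp
  define v where "v = measure lborel (ball 0 1 :: (complex ^ 'n) set)"
  have v: "v > 0" by (simp add: v_def)
  have "emeasure lborel (ball 0 1 :: (complex ^ 'n) set) = ennreal v"
    unfolding v_def using emeasure_lborel_ball_finite[of "0 :: complex ^ 'n" 1]
    by (intro emeasure_eq_ennreal_measure) (auto simp: top.not_eq_extremum)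
  then have "ennreal v = ennreal (k * v)" using eq k v by (simp add: ennreal_mult')
  then have "k = 1" using k v by simp
  then have "distr lborel borel f = lborel"
    using k m by (intro measure_eqI) (auto simp: emeasure_distr)
  then show ?thesis using nn_integral_distr[of f lborel borel u] m u by (simp add: f_def)
qed

text \<open>Without conjugation, so that \<open>linform a\<close> is complex linear and hence
  holomorphic. The vector a plays the role of a complex gradient.\<close>

definition linform :: "complex ^ 'n \<Rightarrow> complex ^ 'n \<Rightarrow> complex" where
  "linform a w = (\<Sum>j\<in>UNIV. a $ j * w $ j)"

lemma linform_add: "linform a (v + w) = linform a v + linform a w"
  by (simp add: linform_def algebra_simps sum.distrib)

lemma linform_scaleR: "linform a (r *\<^sub>R w) = of_real r * linform a w"
  by (simp add: linform_def sum_distrib_left scaleR_conv_of_real[where 'a = complex, symmetric] algebra_simps)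

lemma linform_scale: "linform a (c *s w) = c * linform a w"
  by (simp add: linform_def sum_distrib_left algebra_simps)

lemma linform_axis: "linform (a :: complex ^ 'n) (axis k c) = a $ k * c"
proof -
  have "linform a (axis k c) = (\<Sum>j\<in>UNIV. if j = k then a $ k * c else 0)"
    unfolding linform_def by (intro sum.cong) (auto simp: axis_def)
  then show ?thesis by simp
qed

lemma linform_bound: "cmod (linform a w) \<le> real CARD('n) * norm a * norm (w :: complex ^ 'n)"
proof -
  have "cmod (linform a w) \<le> (\<Sum>j\<in>(UNIV::'n set). norm a * norm w)"
    unfolding linform_def
    by (intro order_trans[OF norm_sum] sum_mono) (auto simp: norm_mult intro!: mult_mono Finite_Cartesian_Product.norm_nth_le)
  then show ?thesis by simp
qed

lemma bounded_linear_linform: "bounded_linear (linform (a :: complex ^ 'n))"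
  by (rule bounded_linear_intro[where K = "real CARD('n) * norm a"])
    (auto simp: linform_add linform_scaleR scaleR_conv_of_real[where 'a = complex] linform_bound mult.commute[of _ "real CARD('n) * norm a"])

text \<open>The anisotropic dilation with factor \<open>t\<close> in the direction transversal to the hyperplane
  \<open>linform a w = 0\<close> and \<open>sqrt t\<close> along it.\<close>

definition dilate :: "complex ^ 'n \<Rightarrow> 'n \<Rightarrow> real \<Rightarrow> complex ^ 'n \<Rightarrow> complex ^ 'n" where
  "dilate a k t w = sqrt t *\<^sub>R w + axis k (of_real (t - sqrt t) / a $ k * linform a w)"

lemma linform_dilate: "(a :: complex ^ 'n) $ k \<noteq> 0 \<Longrightarrow> linform a (dilate a k t w) = of_real t * linform a w"
  by (simp add: dilate_def linform_add linform_scaleR linform_axis field_simps)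

text \<open>For positive parameters the dilations form a group; together with
  \<open>dilate_1\<close> this makes \<open>dilate a k (1 / t)\<close> the inverse of
  \<open>dilate a k t\<close>.\<close>

lemma dilate_compose:
  fixes a :: "complex ^ 'n"
  assumes "a $ k \<noteq> 0" "s \<ge> 0" "t \<ge> 0"
  shows "dilate a k s (dilate a k t w) = dilate a k (s * t) w"
proof -
  have "dilate a k s (dilate a k t w) = sqrt s *\<^sub>R dilate a k t w + axis k (of_real (s - sqrt s) / a $ k * (of_real t * linform a w))"
    using assms(1) by (simp add: dilate_def[of a k s "dilate a k t w"] linform_dilate)
  then show ?thesis
    using assms by (simp add: dilate_def vec_eq_iff axis_def real_sqrt_mult scaleR_conv_of_real[where 'a = complex] field_simps)
qed

lemma dilate_1: "dilate (a :: complex ^ 'n)  k 1 w = w"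
  by (simp add: dilate_def axis_def vec_eq_iff)

text \<open>Each complex coordinate is two real ones: coordinate k contributes t^2 and every other
  one (sqrt t)^2 = t, in total t^(n+1).\<close>

lemma dilate_diag_volume:
  fixes k :: "'n::finite"
  assumes t: "0 < t" and A: "A \<in> sets borel"
  shows "emeasure lborel ((\<lambda>w :: complex ^ 'n. \<chi> j. (if j = k then t else sqrt t) *\<^sub>R w $ j) -` A)
    = ennreal ((1 / t) ^ Suc CARD('n)) * emeasure lborel A"
proof -
  define c :: "complex ^ 'n \<Rightarrow> real" where "c b = (if b $ k \<noteq> 0 then t else sqrt t)" for b
  define T :: "complex ^ 'n \<Rightarrow> complex ^ 'n" where "T x = 0 + (\<Sum>b\<in>Basis. (c b * (x \<bullet> b)) *\<^sub>R b)" for x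
  have c0: "c b \<noteq> 0" for b using t by (simp add: c_def)
  have T: "T x = (\<chi> j. (if j = k then t else sqrt t) *\<^sub>R x $ j)" for x
  proof (rule euclidean_eqI)
    fix b :: "complex ^ 'n" assume b: "b \<in> Basis"
    then obtain p where p: "b = axis (fst p) (if snd p then \<i> else 1)" by (auto simp: Basis_complex_vec)
    have "T x \<bullet> b = c b * (x \<bullet> b)" using b by (simp add: T_def inner_sum_left_Basis)
    also have "c b = (if fst p = k then t else sqrt t)" unfolding p by (auto simp: c_def axis_def)
    also have "\<dots> * (x \<bullet> b) = (\<chi> j. (if j = k then t else sqrt t) *\<^sub>R x $ j) \<bullet> b"
      unfolding p inner_axis by simp
    finally show "T x \<bullet> b = (\<chi> j. (if j = k then t else sqrt t) *\<^sub>R x $ j) \<bullet> b" .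
  qed
  have Tm: "T \<in> borel_measurable borel" unfolding T_def by measurable
  have "(\<Prod>b\<in>Basis. \<bar>c b\<bar>) = (\<Prod>p\<in>(UNIV :: 'n set) \<times> (UNIV :: bool set). if fst p = k then t else sqrt t)"
  proof -
    have "\<bar>c (axis (fst p) (if snd p then \<i> else 1))\<bar> = (if fst p = k then t else sqrt t)" for p :: "'n \<times> bool"
      using t by (auto simp: c_def axis_def)
    then show ?thesis
      unfolding Basis_complex_vec UNIV_Times_UNIV by (subst prod.reindex[OF inj_axis_complex]) (simp only: o_def)
  qed
  also have "\<dots> = (\<Prod>j\<in>UNIV. \<Prod>b\<in>(UNIV::bool set). if j = k then t else sqrt t)"
    by (simp only: prod.cartesian_product split_def)
  also have "\<dots> = (\<Prod>j\<in>UNIV. if j = k then t * t else t)"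
    using t by (intro prod.cong refl) (simp add: UNIV_bool)
  also have "\<dots> = t * t * (\<Prod>j\<in>UNIV - {k}. t)"
    by (subst prod.remove[of _ k]) (auto intro!: prod.cong)
  also have "\<dots> = t ^ Suc CARD('n)"
  proof -
    obtain m where "CARD('n) = Suc m" using zero_less_card_finite gr0_conv_Suc by metis
    then show ?thesis by (simp add: card_Diff_singleton)
  qed
  finally have pr: "(\<Prod>b\<in>Basis. \<bar>c b\<bar>) = t ^ Suc CARD('n)" .
  have "lborel = density (distr lborel borel T) (\<lambda>_. (\<Prod>j\<in>Basis. \<bar>c j\<bar>))"
    unfolding T_def using c0 by (rule lborel_affine_euclidean)
  then have "emeasure lborel A = emeasure (density (distr lborel borel T) (\<lambda>_. t ^ Suc CARD('n))) A"
    unfolding pr by simp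
  also have "\<dots> = ennreal (t ^ Suc CARD('n)) * emeasure lborel (T -` A)"
    using A Tm by (simp add: emeasure_density nn_integral_cmult emeasure_distr del: power_Suc)
  finally have eq: "emeasure lborel A = ennreal (t ^ Suc CARD('n)) * emeasure lborel (T -` A)" .
  have "ennreal ((1 / t) ^ Suc CARD('n)) * emeasure lborel A
      = ennreal ((1 / t) ^ Suc CARD('n) * t ^ Suc CARD('n)) * emeasure lborel (T -` A)"
    unfolding eq using t by (subst ennreal_mult') (auto simp: mult.assoc)
  also have "(1 / t) ^ Suc CARD('n) * t ^ Suc CARD('n) = 1"
    using t by (simp flip: power_mult_distrib del: power_Suc)
  finally show ?thesis unfolding T[abs_def] by simp
qed

text \<open>X replaces coordinate k by the value of \<open>linform a\<close> and turns the dilation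
  into a diagonal map. The volume factor c of X stays unknown, as it occurs on both sides.\<close>

lemma dilate_volume:
  fixes a :: "complex ^ 'n"
  assumes a: "a $ k \<noteq> 0" and t: "0 < t" and A: "A \<in> sets borel"
  shows "emeasure lborel (dilate a k t -` A) = ennreal ((1 / t) ^ Suc CARD('n)) * emeasure lborel A"
proof -
  define X :: "complex ^ 'n \<Rightarrow> complex ^ 'n" where "X w = (\<chi> j. if j = k then linform a w else w $ j)" for w
  define Y :: "complex ^ 'n \<Rightarrow> complex ^ 'n" where "Y y = y + axis k ((y $ k - linform a y) / a $ k)" for y
  define \<Delta> :: "complex ^ 'n \<Rightarrow> complex ^ 'n" where "\<Delta> w = (\<chi> j. (if j = k then t else sqrt t) *\<^sub>R w $ j)" for w
  have lY: "linform a (Y y) = y $ k" for y using a by (simp add: Y_def linform_add linform_axis)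
  have XY: "X (Y y) = y" for y by (simp add: X_def lY vec_eq_iff) (simp add: Y_def axis_def)
  have inj_lin: "w = w'" if "linform a w = linform a w'" "\<And>j. j \<noteq> k \<Longrightarrow> w $ j = w' $ j" for w w'
  proof -
    have "w = w' + axis k (w $ k - w' $ k)" using that(2) by (auto simp: vec_eq_iff axis_def)
    then have "linform a w = linform a w' + a $ k * (w $ k - w' $ k)" by (metis linform_add linform_axis)
    then have "w $ k = w' $ k" using that(1) a by simp
    then show ?thesis using that(2) by (metis vec_eq_iff)
  qed
  have YX: "Y (X w) = w" for w
    by (rule inj_lin) (simp_all add: lY, simp_all add: X_def Y_def axis_def)
  have linX: "linear X"
    by (rule linearI) (auto simp: X_def vec_eq_iff linform_add linform_scaleR scaleR_conv_of_real[where 'a = complex])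
  have linY: "linear Y"
    by (rule linearI) (auto simp: Y_def vec_eq_iff axis_def linform_add linform_scaleR scaleR_conv_of_real[where 'a = complex] add_divide_distrib diff_divide_distrib algebra_simps)
  have lm: "g \<in> borel_measurable borel" if "linear g" for g :: "complex ^ 'n \<Rightarrow> complex ^ 'n"
    by (rule borel_measurable_linear[OF that])
  have lin\<Delta>: "linear \<Delta>" by (rule linearI) (auto simp: \<Delta>_def vec_eq_iff algebra_simps)
  obtain c where c: "c > 0" "\<And>A. A \<in> sets borel \<Longrightarrow> emeasure lborel (X -` A) = ennreal c * emeasure lborel A"
    using lborel_preimage_linear[OF linX] YX by (metis inj_on_inverseI)
  have dil: "dilate a k t w = Y (\<Delta> (X w))" for w
  proof (rule inj_lin)
    show "linform a (dilate a k t w) = linform a (Y (\<Delta> (X w)))"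
      using a by (simp add: linform_dilate lY) (simp add: \<Delta>_def X_def scaleR_conv_of_real[where 'a = complex])
  qed (simp_all add: dilate_def Y_def \<Delta>_def X_def axis_def)
  have YA: "Y -` A \<in> sets borel" using measurable_sets_borel[OF lm[OF linY] A] .
  have DYA: "\<Delta> -` (Y -` A) \<in> sets borel" using measurable_sets_borel[OF lm[OF lin\<Delta>] YA] .
  have "emeasure lborel A = emeasure lborel (X -` (Y -` A))"
    by (rule arg_cong[where f = "emeasure lborel"]) (auto simp: YX)
  also have "\<dots> = ennreal c * emeasure lborel (Y -` A)" by (rule c(2)[OF YA])
  finally have 1: "emeasure lborel A = ennreal c * emeasure lborel (Y -` A)" .
  have "emeasure lborel (dilate a k t -` A) = emeasure lborel (X -` (\<Delta> -` (Y -` A)))"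
    by (rule arg_cong[where f = "emeasure lborel"]) (auto simp: dil)
  also have "\<dots> = ennreal c * emeasure lborel (\<Delta> -` (Y -` A))" by (rule c(2)[OF DYA])
  also have "emeasure lborel (\<Delta> -` (Y -` A)) = ennreal ((1 / t) ^ Suc CARD('n)) * emeasure lborel (Y -` A)"
    unfolding \<Delta>_def by (rule dilate_diag_volume[OF t YA])
  finally show ?thesis unfolding 1 by (simp only: mult.left_commute)
qed

lemma borel_measurable_dilate: "dilate a k t \<in> borel_measurable borel"
proof -
  have "linear (dilate a k t)"
    by (rule linearI)
      (auto simp: dilate_def vec_eq_iff axis_def linform_add linform_scaleR scaleR_conv_of_real[where 'a = complex]
         add_divide_distrib diff_divide_distrib algebra_simps)
  then show ?thesis by (rule borel_measurable_linear)
qed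

lemma norm_le_sum_nth: "norm (w :: complex ^ 'n) \<le> (\<Sum>j\<in>UNIV. cmod (w $ j))"
  unfolding norm_vec_def by (rule L2_set_le_sum) auto

text \<open>Dilation by 1 / t carries the region into a ball whose radius depends only on the
  dimension, \<alpha>, \<Lambda>, b and c, which is why V is uniform in a. The coordinates other
  than k are controlled by the norm, and coordinate k is solved from the value of the linear
  form.\<close>

lemma anisotropic_volume_upper:
  fixes k :: "'n::finite"
  assumes "0 < \<alpha>" "0 \<le> b" "0 \<le> c"
  obtains V where "0 < V" "\<And>(a :: complex ^ 'n) t. \<alpha> \<le> cmod (a $ k) \<Longrightarrow> norm a \<le> \<Lambda> \<Longrightarrow> 0 < t \<Longrightarrow>
     emeasure lborel {w. cmod (linform a w) \<le> b * t \<and> (norm w)\<^sup>2 \<le> c * t} \<le> ennreal (V * t ^ Suc CARD('n))"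
proof -
  define R where "R = real CARD('n) * sqrt c + (b + real CARD('n) * \<bar>\<Lambda>\<bar> * sqrt c) / \<alpha>"
  \<comment> \<open>R may be 0; the radius R + 1 keeps V positive.\<close>
  define V where "V = measure lborel (cball (0 :: complex ^ 'n) (R + 1))"
  have R: "R \<ge> 0" using assms by (simp add: R_def)
  have V: "V > 0" using R by (simp add: V_def)
  have eV: "emeasure lborel (cball (0 :: complex ^ 'n) (R + 1)) = ennreal V"
    unfolding V_def using emeasure_lborel_cball_finite[of "0 :: complex ^ 'n" "R + 1"]
    by (intro emeasure_eq_ennreal_measure) (auto simp: top.not_eq_extremum)
  have "emeasure lborel {w. cmod (linform a w) \<le> b * t \<and> (norm w)\<^sup>2 \<le> c * t} \<le> ennreal (V * t ^ Suc CARD('n))"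
    if a: "\<alpha> \<le> cmod (a $ k)" "norm a \<le> \<Lambda>" and t: "0 < t" for a :: "complex ^ 'n" and t
  proof -
    have ak: "a $ k \<noteq> 0" using a assms by auto
    define y where "y w = dilate a k (1 / t) w" for w
    have "y w \<in> cball 0 (R + 1)" if w: "cmod (linform a w) \<le> b * t" "(norm w)\<^sup>2 \<le> c * t" for w
    proof -
      have "norm w \<le> sqrt (c * t)" using w(2) real_le_rsqrt by blast
      then have nw: "norm w / sqrt t \<le> sqrt c" using t by (simp add: real_sqrt_mult field_simps)
      have yj: "cmod (y w $ j) \<le> sqrt c" if "j \<noteq> k" for j
      proof -
        have "y w $ j = sqrt (1 / t) *\<^sub>R w $ j" using that by (simp add: y_def dilate_def axis_def)
        then have "cmod (y w $ j) = cmod (w $ j) / sqrt t" using t by (simp add: real_sqrt_divide)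
        also have "\<dots> \<le> norm w / sqrt t" using t by (intro divide_right_mono Finite_Cartesian_Product.norm_nth_le) auto
        finally show ?thesis using nw by simp
      qed
      have "linform a (y w) = of_real (1 / t) * linform a w" unfolding y_def by (rule linform_dilate[OF ak])
      then have "t * cmod (linform a (y w)) = cmod (linform a w)" using t by (simp add: norm_mult norm_divide)
      then have "t * cmod (linform a (y w)) \<le> t * b" using w(1) by (simp only: mult.commute)
      then have ly: "cmod (linform a (y w)) \<le> b" using t by (simp only: mult_le_cancel_left_pos)
      have "linform a (y w) = a $ k * y w $ k + (\<Sum>j\<in>UNIV - {k}. a $ j * y w $ j)"
        unfolding linform_def by (rule sum.remove) auto
      then have "a $ k * y w $ k = linform a (y w) - (\<Sum>j\<in>UNIV - {k}. a $ j * y w $ j)" by simp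
      then have "cmod (a $ k) * cmod (y w $ k) \<le> cmod (linform a (y w)) + cmod (\<Sum>j\<in>UNIV - {k}. a $ j * y w $ j)"
        by (metis norm_mult norm_triangle_ineq4)
      also have "cmod (\<Sum>j\<in>UNIV - {k}. a $ j * y w $ j) \<le> (\<Sum>j\<in>UNIV - {k}. \<bar>\<Lambda>\<bar> * sqrt c)"
      proof (intro order_trans[OF norm_sum] sum_mono)
        fix j assume j: "j \<in> UNIV - {k}"
        have "cmod (a $ j) \<le> \<bar>\<Lambda>\<bar>" using a(2) Finite_Cartesian_Product.norm_nth_le[of a j] by simp
        then show "cmod (a $ j * y w $ j) \<le> \<bar>\<Lambda>\<bar> * sqrt c"
          using yj[of j] j unfolding norm_mult by (intro mult_mono) auto
      qed
      also have "\<dots> \<le> real CARD('n) * \<bar>\<Lambda>\<bar> * sqrt c"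
        using assms by (simp add: card_Diff_singleton of_nat_diff left_diff_distrib mult.assoc)
      finally have "cmod (a $ k) * cmod (y w $ k) \<le> b + real CARD('n) * \<bar>\<Lambda>\<bar> * sqrt c" using ly by simp
      moreover have "\<alpha> * cmod (y w $ k) \<le> cmod (a $ k) * cmod (y w $ k)" using a by (intro mult_right_mono) auto
      ultimately have yk: "cmod (y w $ k) \<le> (b + real CARD('n) * \<bar>\<Lambda>\<bar> * sqrt c) / \<alpha>"
        using assms by (simp add: field_simps)
      have "norm (y w) \<le> cmod (y w $ k) + (\<Sum>j\<in>UNIV - {k}. cmod (y w $ j))"
        using norm_le_sum_nth[of "y w"] by (simp add: sum.remove[of UNIV k])
      also have "(\<Sum>j\<in>UNIV - {k}. cmod (y w $ j)) \<le> (\<Sum>j\<in>UNIV - {k}. sqrt c)"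
        using yj by (intro sum_mono) auto
      also have "\<dots> \<le> real CARD('n) * sqrt c"
        using assms by (simp add: card_Diff_singleton of_nat_diff left_diff_distrib mult.assoc)
      finally show ?thesis using yk by (simp add: R_def)
    qed
    then have "{w. cmod (linform a w) \<le> b * t \<and> (norm w)\<^sup>2 \<le> c * t} \<subseteq> dilate a k (1 / t) -` cball 0 (R + 1)"
      by (auto simp: y_def)
    moreover have "dilate a k (1 / t) -` cball 0 (R + 1) \<in> sets lborel"
      using measurable_sets_borel[OF borel_measurable_dilate borel_closed[OF closed_cball]] by simp
    ultimately have "emeasure lborel {w. cmod (linform a w) \<le> b * t \<and> (norm w)\<^sup>2 \<le> c * t}
       \<le> emeasure lborel (dilate a k (1 / t) -` cball 0 (R + 1))" by (rule emeasure_mono)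
    also have "\<dots> = ennreal (t ^ Suc CARD('n)) * ennreal V"
      using dilate_volume[OF ak, of "1 / t" "cball 0 (R + 1)"] t by (simp add: eV)
    also have "\<dots> = ennreal (V * t ^ Suc CARD('n))" using V t by (simp add: ennreal_mult' mult.commute)
    finally show ?thesis .
  qed
  then show ?thesis using that V by blast
qed

text \<open>The opposite inclusion: the region contains the image, under dilation by t, of a ball
  whose radius does not depend on a.\<close>

lemma anisotropic_volume_lower:
  fixes k :: "'n::finite"
  assumes "0 < \<alpha>" "0 < b" "0 < c"
  obtains V where "0 < V" "\<And>(a :: complex ^ 'n) t. \<alpha> \<le> cmod (a $ k) \<Longrightarrow> norm a \<le> \<Lambda> \<Longrightarrow> 0 < t \<Longrightarrow> t \<le> 1 \<Longrightarrow>
     ennreal (V * t ^ Suc CARD('n)) \<le> emeasure lborel {w. cmod (linform a w) < b * t \<and> (norm w)\<^sup>2 < c * t}"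
proof -
  define L where "L = real CARD('n) * \<bar>\<Lambda>\<bar>"
  have L: "L \<ge> 0" by (simp add: L_def)
  \<comment> \<open>The first entry secures the condition on the linear form, the second the one on
    the norm. The 1 added to L avoids division by zero and makes the first inequality
    strict.\<close>
  define \<rho> where "\<rho> = min (b / (L + 1)) (sqrt c / (1 + L / \<alpha> + 1))"
  have q: "0 < 1 + L / \<alpha> + 1" using L assms by (smt (verit) divide_nonneg_pos)
  have \<rho>: "0 < \<rho>" using assms L q by (simp add: \<rho>_def)
  define V where "V = measure lborel (ball (0 :: complex ^ 'n) \<rho>)"
  have V: "V > 0" using \<rho> by (simp add: V_def)
  have eV: "emeasure lborel (ball (0 :: complex ^ 'n) \<rho>) = ennreal V"
    unfolding V_def using emeasure_lborel_ball_finite[of "0 :: complex ^ 'n" \<rho>]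
    by (intro emeasure_eq_ennreal_measure) (auto simp: top.not_eq_extremum)
  have "ennreal (V * t ^ Suc CARD('n)) \<le> emeasure lborel {w. cmod (linform a w) < b * t \<and> (norm w)\<^sup>2 < c * t}"
    if a: "\<alpha> \<le> cmod (a $ k)" "norm a \<le> \<Lambda>" and t: "0 < t" "t \<le> 1" for a :: "complex ^ 'n" and t
  proof -
    have ak: "a $ k \<noteq> 0" using a assms by auto
    have La: "cmod (linform a w) \<le> L * norm w" for w
    proof -
      have "real CARD('n) * norm a * norm w \<le> real CARD('n) * \<bar>\<Lambda>\<bar> * norm w"
        using a by (intro mult_right_mono mult_left_mono) auto
      then show ?thesis using linform_bound[of a w] order_trans unfolding L_def by blast
    qed
    have "cmod (linform a w) < b * t \<and> (norm w)\<^sup>2 < c * t" if w: "dilate a k (1 / t) w \<in> ball 0 \<rho>" for w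
    proof -
      define y where "y = dilate a k (1 / t) w"
      have ny: "norm y < \<rho>" using w by (simp add: y_def)
      have wy: "w = dilate a k t y"
        using t ak by (simp add: y_def dilate_compose dilate_1)
      have "cmod (linform a y) \<le> L * norm y" by (rule La)
      also have "\<dots> \<le> L * \<rho>" using ny L by (intro mult_left_mono) auto
      also have "\<dots> \<le> L * (b / (L + 1))" using L by (intro mult_left_mono) (auto simp: \<rho>_def)
      also have "\<dots> < b" using L assms by (simp add: field_simps)
      finally have "cmod (linform a y) < b" .
      then have 1: "cmod (linform a w) < b * t"
        using t ak by (simp add: wy linform_dilate norm_mult mult.commute)
      \<comment> \<open>Here t <= 1 enters: it fixes the sign of the coefficient t - sqrt t in
        \<open>dilate\<close>.\<close>
      have st: "t \<le> sqrt t" using t by (simp add: real_le_rsqrt power2_eq_square mult_left_le)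
      have nax: "norm (axis k z :: complex ^ 'n) \<le> cmod z" for z
      proof -
        have "(\<Sum>j\<in>UNIV. cmod ((axis k z :: complex ^ 'n) $ j)) = (\<Sum>j\<in>UNIV. if j = k then cmod z else 0)"
          by (intro sum.cong) (auto simp: axis_def)
        then show ?thesis using norm_le_sum_nth[of "axis k z :: complex ^ 'n"] by simp
      qed
      have "norm w \<le> sqrt t * norm y + (sqrt t - t) / cmod (a $ k) * cmod (linform a y)"
      proof -
        have "norm w \<le> norm (sqrt t *\<^sub>R y) + norm (axis k (of_real (t - sqrt t) / a $ k * linform a y) :: complex ^ 'n)"
          unfolding wy dilate_def by (rule norm_triangle_ineq)
        also have "\<dots> \<le> sqrt t * norm y + cmod (of_real (t - sqrt t) / a $ k * linform a y)"
          using t nax by (intro add_mono) auto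
        also have "\<dots> = sqrt t * norm y + (sqrt t - t) / cmod (a $ k) * cmod (linform a y)"
          using st by (simp add: norm_mult norm_divide del: of_real_diff)
        finally show ?thesis .
      qed
      also have "\<dots> \<le> sqrt t * norm y + sqrt t / \<alpha> * (L * norm y)"
      proof (intro add_left_mono mult_mono)
        show "(sqrt t - t) / cmod (a $ k) \<le> sqrt t / \<alpha>"
          using a t st assms by (intro frac_le) auto
      qed (use t L assms La in auto)
      also have "\<dots> = sqrt t * (norm y * (1 + L / \<alpha>))" using assms by (simp add: field_simps)
      also have "\<dots> < sqrt t * sqrt c"
      proof (rule mult_strict_left_mono)
        have "norm y * (1 + L / \<alpha>) \<le> norm y * (1 + L / \<alpha> + 1)" by (intro mult_left_mono) auto
        also have "\<dots> < \<rho> * (1 + L / \<alpha> + 1)" using ny q by (intro mult_strict_right_mono)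
        also have "\<dots> \<le> sqrt c / (1 + L / \<alpha> + 1) * (1 + L / \<alpha> + 1)"
          using q by (intro mult_right_mono) (auto simp: \<rho>_def)
        also have "\<dots> = sqrt c" using q by simp
        finally show "norm y * (1 + L / \<alpha>) < sqrt c" .
      qed (use t in simp)
      finally have "(norm w)\<^sup>2 < (sqrt t * sqrt c)\<^sup>2" by (intro power_strict_mono) auto
      then show ?thesis using 1 t assms by (simp add: power_mult_distrib mult.commute)
    qed
    then have "dilate a k (1 / t) -` ball 0 \<rho> \<subseteq> {w. cmod (linform a w) < b * t \<and> (norm w)\<^sup>2 < c * t}" by blast
    moreover have "{w. cmod (linform a w) < b * t \<and> (norm w)\<^sup>2 < c * t} \<in> sets lborel"
    proof -
      have "open {w. cmod (linform a w) < b * t \<and> (norm w)\<^sup>2 < c * t}"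
        by (intro open_Collect_conj open_Collect_less continuous_intros linear_continuous_on[OF bounded_linear_linform])
      then show ?thesis by simp
    qed
    ultimately have "emeasure lborel (dilate a k (1 / t) -` ball 0 \<rho>) \<le> emeasure lborel {w. cmod (linform a w) < b * t \<and> (norm w)\<^sup>2 < c * t}"
      by (rule emeasure_mono)
    moreover have "emeasure lborel (dilate a k (1 / t) -` ball 0 \<rho>) = ennreal (t ^ Suc CARD('n)) * ennreal V"
      using dilate_volume[OF ak, of "1 / t" "ball 0 \<rho>"] t by (simp add: eV)
    moreover have "\<dots> = ennreal (V * t ^ Suc CARD('n))" using V t by (simp add: ennreal_mult' mult.commute)
    ultimately show ?thesis by simp
  qed
  then show ?thesis using that V by blast
qed

section \<open>Holomorphic functions of several variables\<close>

lemma line_has_field_derivative: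
  fixes w :: "complex ^ 'n"
  assumes D: "(f has_derivative D) (at (z + \<zeta> *s w))" and hom: "\<And>c v. D (c *s v) = c * D v"
  shows "((\<lambda>\<zeta>. f (z + \<zeta> *s w)) has_field_derivative D w) (at \<zeta>)"
proof -
  have "((\<lambda>\<zeta>. z + \<zeta> *s w) has_derivative (\<lambda>h. h *s w)) (at \<zeta>)"
    using has_derivative_add[OF has_derivative_const bounded_linear_imp_has_derivative[OF bounded_linear_scalar_mult_left]]
    by simp
  from has_derivative_compose[OF this D] show ?thesis
    by (simp add: has_field_derivative_def hom mult.commute[of _ "D w"])
qed

lemma continuous_line: "continuous_on A (\<lambda>\<zeta>. z + \<zeta> *s (w :: complex ^ 'n))"
  by (intro continuous_intros linear_continuous_on bounded_linear_scalar_mult_left)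

lemma open_line: "open \<Omega> \<Longrightarrow> open {\<zeta>. z + \<zeta> *s (w :: complex ^ 'n) \<in> \<Omega>}"
  using open_vimage[OF _ continuous_line[of UNIV z w], of \<Omega>] by (simp add: vimage_def)

lemma line_holomorphic:
  fixes w :: "complex ^ 'n"
  assumes f: "f Cn_holomorphic_on \<Omega>" and \<Omega>: "open \<Omega>"
  shows "(\<lambda>\<zeta>. f (z + \<zeta> *s w)) holomorphic_on {\<zeta>. z + \<zeta> *s w \<in> \<Omega>}"
  unfolding holomorphic_on_open[OF open_line[OF \<Omega>]]
proof (intro ballI)
  fix \<zeta> assume "\<zeta> \<in> {\<zeta>. z + \<zeta> *s w \<in> \<Omega>}"
  then obtain D where "(f has_derivative D) (at (z + \<zeta> *s w))" "\<And>c v. D (c *s v) = c * D v"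
    using f unfolding Cn_holomorphic_on_def by blast
  then show "\<exists>f'. ((\<lambda>\<zeta>. f (z + \<zeta> *s w)) has_field_derivative f') (at \<zeta>)"
    using line_has_field_derivative by blast
qed

lemma Cn_holomorphic_continuous_on: "f Cn_holomorphic_on \<Omega> \<Longrightarrow> continuous_on \<Omega> f"
  unfolding Cn_holomorphic_on_def
  by (intro continuous_at_imp_continuous_on) (auto dest!: bspec intro: has_derivative_continuous)

lemma Cn_holomorphic_add:
  "f Cn_holomorphic_on \<Omega> \<Longrightarrow> g Cn_holomorphic_on \<Omega> \<Longrightarrow> (\<lambda>z. f z + g z) Cn_holomorphic_on \<Omega>"
  unfolding Cn_holomorphic_on_def
proof (intro ballI)
  fix z assume "\<forall>z\<in>\<Omega>. \<exists>D. (f has_derivative D) (at z) \<and> (\<forall>c v. D (c *s v) = c * D v)"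
    "\<forall>z\<in>\<Omega>. \<exists>D. (g has_derivative D) (at z) \<and> (\<forall>c v. D (c *s v) = c * D v)" "z \<in> \<Omega>"
  then obtain D E where "(f has_derivative D) (at z)" "\<forall>c v. D (c *s v) = c * D v"
    "(g has_derivative E) (at z)" "\<forall>c v. E (c *s v) = c * E v" by blast
  then show "\<exists>D. ((\<lambda>z. f z + g z) has_derivative D) (at z) \<and> (\<forall>c v. D (c *s v) = c * D v)"
    by (intro exI[of _ "\<lambda>v. D v + E v"]) (auto intro: has_derivative_add simp: algebra_simps)
qed

lemma Cn_holomorphic_mult:
  "f Cn_holomorphic_on \<Omega> \<Longrightarrow> g Cn_holomorphic_on \<Omega> \<Longrightarrow> (\<lambda>z. f z * g z) Cn_holomorphic_on \<Omega>"
  unfolding Cn_holomorphic_on_def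
proof (intro ballI)
  fix z assume "\<forall>z\<in>\<Omega>. \<exists>D. (f has_derivative D) (at z) \<and> (\<forall>c v. D (c *s v) = c * D v)"
    "\<forall>z\<in>\<Omega>. \<exists>D. (g has_derivative D) (at z) \<and> (\<forall>c v. D (c *s v) = c * D v)" "z \<in> \<Omega>"
  then obtain D E where D: "(f has_derivative D) (at z)" "\<forall>c v. D (c *s v) = c * D v"
    and E: "(g has_derivative E) (at z)" "\<forall>c v. E (c *s v) = c * E v" by blast
  show "\<exists>D. ((\<lambda>z. f z * g z) has_derivative D) (at z) \<and> (\<forall>c v. D (c *s v) = c * D v)"
    using has_derivative_mult[OF D(1) E(1)] D(2) E(2)
    by (intro exI[of _ "\<lambda>v. f z * E v + D v * g z"] conjI) (simp_all add: algebra_simps)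
qed

lemma Cn_holomorphic_const: "(\<lambda>z. c) Cn_holomorphic_on \<Omega>"
  unfolding Cn_holomorphic_on_def by (intro ballI exI[of _ "\<lambda>_. 0"]) auto

lemma Cn_holomorphic_cong:
  assumes "open \<Omega>" "\<And>z. z \<in> \<Omega> \<Longrightarrow> f z = g z" "f Cn_holomorphic_on \<Omega>"
  shows "g Cn_holomorphic_on \<Omega>"
  using assms unfolding Cn_holomorphic_on_def by (meson has_derivative_transform_within_open)

lemma Cn_holomorphic_diff:
  assumes "f Cn_holomorphic_on \<Omega>" "g Cn_holomorphic_on \<Omega>"
  shows "(\<lambda>z. f z - g z) Cn_holomorphic_on \<Omega>"
  using Cn_holomorphic_add[OF assms(1) Cn_holomorphic_mult[OF Cn_holomorphic_const[of "-1"] assms(2)]] by simp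

text \<open>Cauchy's formula for the square of g, which is holomorphic with modulus |g|^2. The
  circle is parametrised over [0, 1] to match \<open>circlepath\<close>.\<close>

lemma circle_sub_mean:
  fixes g :: "complex \<Rightarrow> complex"
  assumes g: "g holomorphic_on U" "open U" "cball 0 1 \<subseteq> U"
  shows "ennreal ((cmod (g 0))\<^sup>2) \<le> (\<integral>\<^sup>+t. ennreal ((cmod (g (cis (2 * pi * t))))\<^sup>2) * indicator {0..1} t \<partial>lborel)"
proof -
  have cis: "exp (2 * of_real pi * \<i> * of_real t) = cis (2 * pi * t)" for t :: real
    by (simp add: cis_conv_exp mult_ac)
  have "(\<lambda>u. (g u)\<^sup>2) holomorphic_on cball 0 1"
    using holomorphic_on_subset[OF g(1,3)] by (intro holomorphic_intros)
  then have "((\<lambda>u. (g u)\<^sup>2 / (u - 0)) has_contour_integral (2 * of_real pi * \<i> * (g 0)\<^sup>2)) (circlepath 0 1)"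
    by (intro Cauchy_integral_circlepath_simple) auto
  then have "((\<lambda>x. (g (circlepath 0 1 x))\<^sup>2 / circlepath 0 1 x * vector_derivative (circlepath 0 1) (at x within {0..1}))
      has_integral (2 * of_real pi * \<i> * (g 0)\<^sup>2)) {0..1}"
    by (simp add: has_contour_integral_def)
  then have "((\<lambda>x. 2 * of_real pi * \<i> * (g (cis (2 * pi * x)))\<^sup>2) has_integral (2 * of_real pi * \<i> * (g 0)\<^sup>2)) {0..1}"
  proof (rule has_integral_eq[rotated])
    fix x :: real assume "x \<in> {0..1}"
    then have vd: "vector_derivative (circlepath 0 1) (at x within {0..1}) = 2 * pi * \<i> * cis (2 * pi * x)"
      by (simp add: vector_derivative_circlepath01 cis)
    show "(g (circlepath 0 1 x))\<^sup>2 / circlepath 0 1 x * vector_derivative (circlepath 0 1) (at x within {0..1})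
      = 2 * of_real pi * \<i> * (g (cis (2 * pi * x)))\<^sup>2"
      unfolding vd by (simp add: circlepath cis)
  qed
  then have "((\<lambda>x. 1 / (2 * of_real pi * \<i>) * (2 * of_real pi * \<i> * (g (cis (2 * pi * x)))\<^sup>2)) has_integral
      1 / (2 * of_real pi * \<i>) * (2 * of_real pi * \<i> * (g 0)\<^sup>2)) {0..1}"
    by (rule has_integral_mult_right)
  then have 1: "((\<lambda>x. (g (cis (2 * pi * x)))\<^sup>2) has_integral (g 0)\<^sup>2) {0..1}" by simp
  have cont: "continuous_on {0..1} (\<lambda>x. g (cis (2 * pi * x)))"
  proof -
    have "continuous_on {0..1::real} (\<lambda>x. cis (2 * pi * x))" by (intro continuous_intros)
    then show ?thesis
      using g by (intro continuous_on_compose2[OF holomorphic_on_imp_continuous_on[OF g(1)]]) (auto simp: subset_iff)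
  qed
  have int: "(\<lambda>x. (cmod (g (cis (2 * pi * x))))\<^sup>2) integrable_on {0..1}"
    by (intro integrable_continuous_interval continuous_intros cont)
  have "cmod (integral {0..1} (\<lambda>x. (g (cis (2 * pi * x)))\<^sup>2)) \<le> integral {0..1} (\<lambda>x. (cmod (g (cis (2 * pi * x))))\<^sup>2)"
    using 1 int by (intro integral_norm_bound_integral) (auto simp: norm_power)
  then have "(cmod (g 0))\<^sup>2 \<le> integral {0..1} (\<lambda>x. (cmod (g (cis (2 * pi * x))))\<^sup>2)"
    using 1 by (simp add: integral_unique norm_power)
  moreover have "(\<integral>\<^sup>+t. ennreal ((cmod (g (cis (2 * pi * t))))\<^sup>2) * indicator {0..1} t \<partial>lborel)
      = ennreal (integral {0..1} (\<lambda>x. (cmod (g (cis (2 * pi * x))))\<^sup>2))"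
    using int by (intro nn_integral_has_integral_lebesgue') (auto simp: integrable_integral)
  ultimately show ?thesis by (simp add: ennreal_leI)
qed

lemma bounded_bilinear_scalar_mult: "bounded_bilinear (\<lambda>c (w :: complex ^ 'n). c *s w)"
  by (rule bounded_bilinear.intro)
    (auto simp: vec_eq_iff algebra_simps norm_vector_scalar_mult intro!: exI[of _ 1])

lemma borel_measurable_Cn_holomorphic:
  assumes "f Cn_holomorphic_on \<Omega>" "open \<Omega>"
  shows "(\<lambda>z. indicator \<Omega> z *\<^sub>R f z) \<in> borel_measurable borel"
  using assms Cn_holomorphic_continuous_on by (intro borel_measurable_continuous_on_indicator) auto

text \<open>Averaging the one-variable inequality over the circles \<open>t \<mapsto> z + e\<^sup>2\<^sup>\<pi>\<^sup>i\<^sup>t w\<close> and using rotation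
  invariance of the measure avoids any explicit parametrization of \<open>D\<close>.\<close>

lemma balanced_sub_mean:
  fixes f :: "complex ^ 'n \<Rightarrow> complex"
  assumes f: "f Cn_holomorphic_on \<Omega>" and \<Omega>: "open \<Omega>" and D: "D \<in> sets borel"
    and bal: "\<And>c w. w \<in> D \<Longrightarrow> cmod c \<le> 1 \<Longrightarrow> c *s w \<in> D" and sub: "\<And>w. w \<in> D \<Longrightarrow> z + w \<in> \<Omega>"
  shows "ennreal ((cmod (f z))\<^sup>2) * emeasure lborel D \<le> (\<integral>\<^sup>+x. ennreal ((cmod (f x))\<^sup>2) * indicator \<Omega> x \<partial>lborel)"
proof -
  define F where "F x = indicator \<Omega> x *\<^sub>R f x" for x
  have Fm[measurable]: "F \<in> borel_measurable borel"
    unfolding F_def by (rule borel_measurable_Cn_holomorphic[OF f \<Omega>])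
  note D[measurable]
  define u where "u w = ennreal ((cmod (F (z + w)))\<^sup>2) * indicator D w" for w
  have um[measurable]: "u \<in> borel_measurable borel" unfolding u_def by measurable
  have cm: "(\<lambda>p. cis (2 * pi * fst p) *s (snd p :: complex ^ 'n)) \<in> borel_measurable borel"
    by (intro borel_measurable_continuous_onI bounded_bilinear.continuous_on[OF bounded_bilinear_scalar_mult] continuous_intros)
  have m2[measurable]: "(\<lambda>(t, w). u (cis (2 * pi * t) *s w) * indicator {0..1::real} t) \<in> borel_measurable (lborel \<Otimes>\<^sub>M lborel)"
  proof -
    have "(\<lambda>p. u (cis (2 * pi * fst p) *s snd p)) \<in> borel_measurable (borel \<Otimes>\<^sub>M borel)"
      using measurable_compose[OF cm um] by (simp add: borel_prod)
    moreover have "(\<lambda>p. indicator {0..1::real} (fst p) :: ennreal) \<in> borel_measurable (borel \<Otimes>\<^sub>M (borel :: (complex ^ 'n) measure))"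
      by measurable
    ultimately have "(\<lambda>p. u (cis (2 * pi * fst p) *s snd p) * indicator {0..1::real} (fst p)) \<in> borel_measurable (borel \<Otimes>\<^sub>M borel)"
      by (rule borel_measurable_times_ennreal)
    then show ?thesis
      by (simp add: split_def cong: measurable_cong_sets)
  qed
  have "ennreal ((cmod (f z))\<^sup>2) * emeasure lborel D = (\<integral>\<^sup>+w. ennreal ((cmod (f z))\<^sup>2) * indicator D w \<partial>lborel)"
    by (simp add: nn_integral_cmult_indicator)
  also have "\<dots> \<le> (\<integral>\<^sup>+w. \<integral>\<^sup>+t. u (cis (2 * pi * t) *s w) * indicator {0..1::real} t \<partial>lborel \<partial>lborel)"
  proof (rule nn_integral_mono)
    fix w :: "complex ^ 'n"
    show "ennreal ((cmod (f z))\<^sup>2) * indicator D w \<le> (\<integral>\<^sup>+t. u (cis (2 * pi * t) *s w) * indicator {0..1::real} t \<partial>lborel)"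
    proof (cases "w \<in> D")
      case True
      have sub1: "cball 0 1 \<subseteq> {\<zeta>. z + \<zeta> *s w \<in> \<Omega>}" using bal[OF True] sub by auto
      have "ennreal ((cmod (f z))\<^sup>2) \<le> (\<integral>\<^sup>+t. ennreal ((cmod (f (z + cis (2 * pi * t) *s w)))\<^sup>2) * indicator {0..1} t \<partial>lborel)"
        using circle_sub_mean[OF line_holomorphic[OF f \<Omega>] open_line[OF \<Omega>] sub1] by simp
      also have "\<dots> = (\<integral>\<^sup>+t. u (cis (2 * pi * t) *s w) * indicator {0..1::real} t \<partial>lborel)"
        using bal[OF True] sub by (intro nn_integral_cong) (simp add: u_def F_def)
      finally show ?thesis using True by simp
    qed simp
  qed
  also have "\<dots> = (\<integral>\<^sup>+t. \<integral>\<^sup>+w. u (cis (2 * pi * t) *s w) * indicator {0..1::real} t \<partial>lborel \<partial>lborel)"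
    by (rule lborel_pair.Fubini'[OF m2])
  also have "\<dots> = (\<integral>\<^sup>+t. (\<integral>\<^sup>+w. u w \<partial>lborel) * indicator {0..1::real} t \<partial>lborel)"
  proof (rule nn_integral_cong)
    fix t :: real
    have "(\<lambda>w. u (cis (2 * pi * t) *s w)) \<in> borel_measurable borel"
      using measurable_compose[OF borel_measurable_linear[OF bounded_linear.linear[OF bounded_linear_scalar_mult]] um] .
    then have "(\<integral>\<^sup>+w. u (cis (2 * pi * t) *s w) * indicator {0..1::real} t \<partial>lborel)
        = (\<integral>\<^sup>+w. u (cis (2 * pi * t) *s w) \<partial>lborel) * indicator {0..1::real} t"
      by (intro nn_integral_multc) auto
    then show "(\<integral>\<^sup>+w. u (cis (2 * pi * t) *s w) * indicator {0..1::real} t \<partial>lborel) = (\<integral>\<^sup>+w. u w \<partial>lborel) * indicator {0..1::real} t"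
      by (simp add: nn_integral_rotate[OF um])
  qed
  also have "\<dots> = (\<integral>\<^sup>+w. u w \<partial>lborel)" by (simp add: nn_integral_cmult_indicator)
  also have "\<dots> \<le> (\<integral>\<^sup>+w. (\<lambda>x. ennreal ((cmod (F x))\<^sup>2)) (z + w) \<partial>lborel)"
    by (intro nn_integral_mono) (auto simp: u_def indicator_def)
  also have "\<dots> = (\<integral>\<^sup>+x. ennreal ((cmod (F x))\<^sup>2) \<partial>lborel)"
    by (intro nn_integral_lborel_translate) measurable
  also have "\<dots> = (\<integral>\<^sup>+x. ennreal ((cmod (f x))\<^sup>2) * indicator \<Omega> x \<partial>lborel)"
    by (intro nn_integral_cong) (auto simp: F_def indicator_def)
  finally show ?thesis .
qed

text \<open>Cauchy's inequality on a disc in the complex line through z in direction w. Direction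
  and radius are free, which later allows a radius of order sqrt t along complex tangents.\<close>

lemma directional_cauchy_bound:
  fixes f :: "complex ^ 'n \<Rightarrow> complex"
  assumes f: "f Cn_holomorphic_on \<Omega>" and \<Omega>: "open \<Omega>"
    and D: "(f has_derivative D) (at z)" "\<And>c v. D (c *s v) = c * D v"
    and s: "0 < s" and sub: "\<And>\<zeta>. cmod \<zeta> \<le> s \<Longrightarrow> z + \<zeta> *s w \<in> \<Omega>"
    and B: "\<And>\<zeta>. cmod \<zeta> = s \<Longrightarrow> cmod (f (z + \<zeta> *s w)) \<le> B"
  shows "cmod (D w) \<le> B / s"
proof -
  define g where "g \<zeta> = f (z + \<zeta> *s w)" for \<zeta>
  have hol: "g holomorphic_on cball 0 s"
    unfolding g_def by (rule holomorphic_on_subset[OF line_holomorphic[OF f \<Omega>]]) (use sub in auto)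
  have "(g has_field_derivative D w) (at 0)"
    unfolding g_def by (rule line_has_field_derivative) (use D in auto)
  then have "deriv g 0 = D w" by (rule DERIV_imp_deriv)
  moreover have gB: "cmod (g \<zeta>) \<le> B" if "cmod \<zeta> = s" for \<zeta> using B[OF that] by (simp add: g_def)
  moreover have "cmod ((deriv ^^ 1) g 0) \<le> fact 1 * B / s ^ 1"
    by (rule Cauchy_inequality[OF _ _ s])
      (use hol holomorphic_on_subset[OF hol, of "ball 0 s"] gB in \<open>auto intro: holomorphic_on_imp_continuous_on\<close>)
  ultimately show ?thesis by simp
qed

text \<open>Weierstrass's theorem. Cauchy's estimate turns the uniform Cauchy property of the
  functions on a ball into one of the derivatives on the ball of half the radius; complex
  homogeneity of the derivatives passes to the limit.\<close>

lemma Cn_holomorphic_uniform_limit: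
  fixes f :: "nat \<Rightarrow> complex ^ 'n \<Rightarrow> complex"
  assumes f: "\<And>k. f k Cn_holomorphic_on \<Omega>" and \<Omega>: "open \<Omega>"
    and lim: "\<And>z. z \<in> \<Omega> \<Longrightarrow> (\<lambda>k. f k z) \<longlonglongrightarrow> g z"
    and cau: "\<And>z. z \<in> \<Omega> \<Longrightarrow> \<exists>r>0. ball z r \<subseteq> \<Omega> \<and>
      (\<forall>e>0. \<exists>N. \<forall>m\<ge>N. \<forall>n\<ge>N. \<forall>x\<in>ball z r. cmod (f m x - f n x) \<le> e)"
  shows "g Cn_holomorphic_on \<Omega>"
  unfolding Cn_holomorphic_on_def
proof
  fix z assume z: "z \<in> \<Omega>"
  obtain r where r: "r > 0" "ball z r \<subseteq> \<Omega>"
    and C: "\<And>e. e > 0 \<Longrightarrow> \<exists>N. \<forall>m\<ge>N. \<forall>n\<ge>N. \<forall>x\<in>ball z r. cmod (f m x - f n x) \<le> e"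
    using cau[OF z] by blast
  have "\<exists>D. \<forall>x\<in>\<Omega>. (f k has_derivative D x) (at x) \<and> (\<forall>c v. D x (c *s v) = c * D x v)" for k
    using f[of k] unfolding Cn_holomorphic_on_def by metis
  then obtain D where D: "\<And>k x. x \<in> \<Omega> \<Longrightarrow> (f k has_derivative D k x) (at x)"
    "\<And>k x c v. x \<in> \<Omega> \<Longrightarrow> D k x (c *s v) = c * D k x v" by metis
  define T where "T = ball z (r / 2)"
  have T: "x \<in> \<Omega>" "ball x (r / 2) \<subseteq> ball z r" if "x \<in> T" for x
  proof -
    show 1: "ball x (r / 2) \<subseteq> ball z r"
    proof
      fix y assume "y \<in> ball x (r / 2)"
      then show "y \<in> ball z r" using that dist_triangle[of z y x] by (simp add: T_def)
    qed
    show "x \<in> \<Omega>" using that r by (auto simp: T_def)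
  qed
  have est: "\<exists>N. \<forall>m\<ge>N. \<forall>n\<ge>N. \<forall>x\<in>T. \<forall>h. cmod (D m x h - D n x h) \<le> e * norm h" if e: "e > 0" for e
  proof -
    \<comment> \<open>The discs below have radius r / (4 |h|) in direction h, so this bound on the
      functions gives exactly e |h| for the derivatives.\<close>
    have "e * r / 4 > 0" using e r by simp
    from C[OF this] obtain N where "\<forall>m\<ge>N. \<forall>n\<ge>N. \<forall>x\<in>ball z r. cmod (f m x - f n x) \<le> e * r / 4" by blast
    then have N: "cmod (f m x - f n x) \<le> e * r / 4" if "m \<ge> N" "n \<ge> N" "x \<in> ball z r" for m n x
      using that by blast
    have "cmod (D m x h - D n x h) \<le> e * norm h" if mn: "m \<ge> N" "n \<ge> N" and x: "x \<in> T" for m n x h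
    proof (cases "h = 0")
      case True
      have "D k x 0 = 0" for k using D(2)[OF T(1)[OF x], of k 0 0] by simp
      then show ?thesis using True by simp
    next
      case False
      have xs: "x + \<zeta> *s h \<in> ball z r" if "cmod \<zeta> \<le> r / (4 * norm h)" for \<zeta>
      proof -
        have "norm (\<zeta> *s h) \<le> r / 4" using that False by (simp add: norm_vector_scalar_mult field_simps)
        then show ?thesis using T(2)[OF x] r by (auto simp: subset_iff dist_norm)
      qed
      have "cmod (D m x h - D n x h) \<le> (e * r / 4) / (r / (4 * norm h))"
      proof (rule directional_cauchy_bound[where f = "\<lambda>x. f m x - f n x" and D = "\<lambda>h. D m x h - D n x h" and z = x and \<Omega> = \<Omega>])
        show "(\<lambda>x. f m x - f n x) Cn_holomorphic_on \<Omega>" by (intro Cn_holomorphic_diff f)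
        show "((\<lambda>x. f m x - f n x) has_derivative (\<lambda>h. D m x h - D n x h)) (at x)"
          by (intro has_derivative_diff D T x)
        show "D m x (c *s v) - D n x (c *s v) = c * (D m x v - D n x v)" for c v
          using D(2)[OF T(1)[OF x]] by (simp add: algebra_simps)
      qed (use \<Omega> r False xs N mn in auto)
      also have "\<dots> = e * norm h" using r False by simp
      finally show ?thesis .
    qed
    then show ?thesis by blast
  qed
  have "convergent (\<lambda>k. D k x h)" if x: "x \<in> T" for x h
  proof (rule Cauchy_convergent, rule metric_CauchyI)
    fix e :: real assume e: "0 < e"
    have "e / 2 / (norm h + 1) > 0" using e by (intro divide_pos_pos add_nonneg_pos) auto
    from est[OF this] obtain N where "\<forall>m\<ge>N. \<forall>n\<ge>N. \<forall>x\<in>T. \<forall>h'. cmod (D m x h' - D n x h') \<le> e / 2 / (norm h + 1) * norm h'"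
      by blast
    then have N: "cmod (D m x h - D n x h) \<le> e / 2 / (norm h + 1) * norm h" if "m \<ge> N" "n \<ge> N" for m n
      using x that by blast
    have "norm h / (norm h + 1) \<le> 1" by (simp add: add_nonneg_pos)
    then have "e / 2 * (norm h / (norm h + 1)) \<le> e / 2 * 1" using e by (intro mult_left_mono) auto
    moreover have "e / 2 / (norm h + 1) * norm h = e / 2 * (norm h / (norm h + 1))" by simp
    ultimately have 1: "e / 2 / (norm h + 1) * norm h < e" using e by linarith
    show "\<exists>N. \<forall>m\<ge>N. \<forall>n\<ge>N. dist (D m x h) (D n x h) < e"
      unfolding dist_norm using N 1 le_less_trans by blast
  qed
  then obtain D' where D': "\<And>x h. x \<in> T \<Longrightarrow> (\<lambda>k. D k x h) \<longlonglongrightarrow> D' x h"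
    unfolding convergent_def by metis
  have zT: "z \<in> T" using r by (simp add: T_def)
  have "\<exists>G. \<forall>x\<in>T. (\<lambda>k. f k x) \<longlonglongrightarrow> G x \<and> (G has_derivative D' x) (at x within T)"
  proof (rule has_derivative_sequence[where f = f and f' = D and ?x0.0 = z and l = "g z"])
    show "convex T" by (simp add: T_def)
    show "(f k has_derivative D k x) (at x within T)" if "x \<in> T" for k x
      using D(1)[OF T(1)[OF that]] has_derivative_at_withinI by blast
    fix e :: real assume e: "e > 0"
    obtain N where N: "\<forall>m\<ge>N. \<forall>n\<ge>N. \<forall>x\<in>T. \<forall>h. cmod (D m x h - D n x h) \<le> e * norm h"
      using est[OF e] by blast
    have "cmod (D n x h - D' x h) \<le> e * norm h" if "n \<ge> N" "x \<in> T" for n x h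
    proof (rule LIMSEQ_le_const2)
      show "(\<lambda>m. cmod (D n x h - D m x h)) \<longlonglongrightarrow> cmod (D n x h - D' x h)"
        by (intro tendsto_intros D' that)
      show "\<exists>N. \<forall>m\<ge>N. cmod (D n x h - D m x h) \<le> e * norm h" using N that by blast
    qed
    then show "\<forall>\<^sub>F n in sequentially. \<forall>x\<in>T. \<forall>h. cmod (D n x h - D' x h) \<le> e * norm h"
      unfolding eventually_sequentially by blast
  next
    show "z \<in> T" by (rule zT)
    show "(\<lambda>k. f k z) \<longlonglongrightarrow> g z" by (rule lim[OF z])
  qed
  then obtain G where G: "\<And>x. x \<in> T \<Longrightarrow> (\<lambda>k. f k x) \<longlonglongrightarrow> G x" "\<And>x. x \<in> T \<Longrightarrow> (G has_derivative D' x) (at x within T)"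
    by blast
  have oT: "open T" by (simp add: T_def)
  have Gg: "G x = g x" if "x \<in> T" for x
    using LIMSEQ_unique[OF G(1)[OF that] lim[OF T(1)[OF that]]] .
  have "(G has_derivative D' z) (at z)" using G(2)[OF zT] unfolding at_within_open[OF zT oT] .
  then have "(g has_derivative D' z) (at z)"
    by (rule has_derivative_transform_within_open[OF _ oT zT]) (rule Gg)
  moreover have "D' z (c *s v) = c * D' z v" for c v
  proof (rule LIMSEQ_unique[OF D'[OF zT]])
    show "(\<lambda>k. D k z (c *s v)) \<longlonglongrightarrow> c * D' z v"
      using tendsto_mult[OF tendsto_const D'[OF zT, of v], of c] by (simp only: D(2)[OF z])
  qed
  ultimately show "\<exists>D. (g has_derivative D) (at z) \<and> (\<forall>c v. D (c *s v) = c * D v)" by blast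
qed

section \<open>The Bergman space\<close>

locale bergman_domain =
  fixes \<Omega> :: "(complex ^ 'n) set"
  assumes open_dom: "open \<Omega>" and bounded_dom: "bounded \<Omega>" and ne_dom: "\<Omega> \<noteq> {}"
begin

abbreviation "A \<equiv> bergman_space \<Omega>"
abbreviation "L \<equiv> L2_space \<Omega>"
abbreviation "ip \<equiv> L2_inner \<Omega>"

lemma sets_dom: "\<Omega> \<in> sets lebesgue" "\<Omega> \<in> sets borel"
  using open_dom by auto

lemma L_measurable: "f \<in> L \<Longrightarrow> f \<in> borel_measurable (lebesgue_on \<Omega>)"
  and L_integrable: "f \<in> L \<Longrightarrow> integrable (lebesgue_on \<Omega>) (\<lambda>z. (cmod (f z))\<^sup>2)"
  by (auto simp: L2_space_def)

lemma L_inner_integrable: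
  assumes "f \<in> L" "g \<in> L"
  shows "integrable (lebesgue_on \<Omega>) (\<lambda>z. f z * cnj (g z))"
proof (rule Bochner_Integration.integrable_bound)
  show "integrable (lebesgue_on \<Omega>) (\<lambda>z. (cmod (f z))\<^sup>2 + (cmod (g z))\<^sup>2)"
    using assms L_integrable by (intro Bochner_Integration.integrable_add)
  have "(\<lambda>z. cnj (g z)) \<in> borel_measurable (lebesgue_on \<Omega>)"
    using L_measurable[OF assms(2)] by (rule measurable_compose) (intro borel_measurable_continuous_onI continuous_intros)
  then show "(\<lambda>z. f z * cnj (g z)) \<in> borel_measurable (lebesgue_on \<Omega>)"
    using L_measurable[OF assms(1)] by (rule borel_measurable_times[rotated])
  have "cmod (f z) * cmod (g z) \<le> (cmod (f z))\<^sup>2 + (cmod (g z))\<^sup>2" for z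
    using sum_squares_bound[of "cmod (f z)" "cmod (g z)"] mult_nonneg_nonneg[OF norm_ge_zero norm_ge_zero, of "f z" "g z"]
    by linarith
  then show "AE z in lebesgue_on \<Omega>. norm (f z * cnj (g z)) \<le> norm ((cmod (f z))\<^sup>2 + (cmod (g z))\<^sup>2)"
    by (simp add: norm_mult)
qed

lemma ip_self_integral: "ip f f = of_real (LINT z|lebesgue_on \<Omega>. (cmod (f z))\<^sup>2)"
  by (simp add: L2_inner_def complex_norm_square[symmetric] flip: of_real_power)

sublocale L: semi_ip L ip
proof
  show "0 \<in> L" by (simp add: L2_space_def zero_fun_def)
  show "f + g \<in> L" if f: "f \<in> L" and g: "g \<in> L" for f g
  proof -
    have m: "(\<lambda>z. f z + g z) \<in> borel_measurable (lebesgue_on \<Omega>)"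
      using L_measurable[OF f] L_measurable[OF g] by (rule borel_measurable_add)
    have "integrable (lebesgue_on \<Omega>) (\<lambda>z. (cmod (f z + g z))\<^sup>2)"
    proof (rule Bochner_Integration.integrable_bound)
      show "integrable (lebesgue_on \<Omega>) (\<lambda>z. 2 * (cmod (f z))\<^sup>2 + 2 * (cmod (g z))\<^sup>2)"
        using f g L_integrable by (intro Bochner_Integration.integrable_add integrable_mult_right) auto
      show "(\<lambda>z. (cmod (f z + g z))\<^sup>2) \<in> borel_measurable (lebesgue_on \<Omega>)" using m by measurable
      have "(cmod (a + b))\<^sup>2 \<le> 2 * (cmod a)\<^sup>2 + 2 * (cmod b)\<^sup>2" for a b
      proof -
        have "(cmod (a + b))\<^sup>2 \<le> (cmod a + cmod b)\<^sup>2" by (intro power_mono norm_triangle_ineq) auto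
        also have "\<dots> \<le> 2 * (cmod a)\<^sup>2 + 2 * (cmod b)\<^sup>2"
          using sum_squares_bound[of "cmod a" "cmod b"] by (simp add: power2_sum)
        finally show ?thesis .
      qed
      then show "AE z in lebesgue_on \<Omega>. norm ((cmod (f z + g z))\<^sup>2) \<le> norm (2 * (cmod (f z))\<^sup>2 + 2 * (cmod (g z))\<^sup>2)"
        by simp
    qed
    then show ?thesis using m by (simp add: L2_space_def plus_fun_def)
  qed
  show "cscale c f \<in> L" if "f \<in> L" for c f
    using L_measurable[OF that] L_integrable[OF that]
    by (simp add: L2_space_def cscale_def norm_mult power_mult_distrib borel_measurable_times)
  show "ip (f + g) h = ip f h + ip g h" if "f \<in> L" "g \<in> L" "h \<in> L" for f g h
    using L_inner_integrable[OF that(1,3)] L_inner_integrable[OF that(2,3)]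
    by (simp add: L2_inner_def distrib_right)
  show "ip (cscale c f) g = c * ip f g" for c f g
    by (simp add: L2_inner_def cscale_def mult.assoc)
  show "ip g f = cnj (ip f g)" for f g
    unfolding L2_inner_def by (subst Bochner_Integration.integral_cnj[symmetric]) (simp add: mult.commute)
  show "0 \<le> Re (ip f f)" for f by (simp add: ip_self_integral)
qed

abbreviation nrm where "nrm \<equiv> L.nrm"

lemma nrm_sq_integral: "f \<in> L \<Longrightarrow> (nrm f)\<^sup>2 = (LINT z|lebesgue_on \<Omega>. (cmod (f z))\<^sup>2)"
  by (simp add: L.nrm_sq ip_self_integral)

lemma nn_integral_L:
  assumes "f \<in> L"
  shows "(\<integral>\<^sup>+z. ennreal ((cmod (f z))\<^sup>2) \<partial>lebesgue_on \<Omega>) = ennreal ((nrm f)\<^sup>2)"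
  unfolding nrm_sq_integral[OF assms] using L_integrable[OF assms] by (intro nn_integral_eq_integral) auto

lemma L_I:
  assumes m: "f \<in> borel_measurable (lebesgue_on \<Omega>)"
    and b: "(\<integral>\<^sup>+z. ennreal ((cmod (f z))\<^sup>2) \<partial>lebesgue_on \<Omega>) \<le> ennreal B"
  shows "f \<in> L" "0 \<le> B \<Longrightarrow> (nrm f)\<^sup>2 \<le> B"
proof -
  have "integrable (lebesgue_on \<Omega>) (\<lambda>z. (cmod (f z))\<^sup>2)"
    unfolding integrable_iff_bounded
  proof
    show "(\<lambda>z. (cmod (f z))\<^sup>2) \<in> borel_measurable (lebesgue_on \<Omega>)" using m by measurable
    have "(\<integral>\<^sup>+z. ennreal (norm ((cmod (f z))\<^sup>2)) \<partial>lebesgue_on \<Omega>) \<le> ennreal B" using b by simp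
    also have "\<dots> < \<infinity>" by simp
    finally show "(\<integral>\<^sup>+z. ennreal (norm ((cmod (f z))\<^sup>2)) \<partial>lebesgue_on \<Omega>) < \<infinity>" .
  qed
  then show fL: "f \<in> L" using m by (simp add: L2_space_def)
  show "(nrm f)\<^sup>2 \<le> B" if "0 \<le> B" using b unfolding nn_integral_L[OF fL] using that by simp
qed

lemma continuous_on_measurable:
  assumes "continuous_on \<Omega> f"
  shows "f \<in> borel_measurable (lebesgue_on \<Omega>)"
  using assms sets_dom by (intro continuous_imp_measurable_on_sets_lebesgue)

lemma L_mult_bounded:
  assumes f: "f \<in> L" and g: "continuous_on \<Omega> g" and b: "\<And>z. z \<in> \<Omega> \<Longrightarrow> cmod (g z) \<le> m"
  shows "g * f \<in> L" "0 \<le> m \<Longrightarrow> nrm (g * f) \<le> m * nrm f"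
proof -
  have ms: "g * f \<in> borel_measurable (lebesgue_on \<Omega>)"
    unfolding times_fun_def using continuous_on_measurable[OF g] L_measurable[OF f] by (rule borel_measurable_times)
  have le: "(\<integral>\<^sup>+z. ennreal ((cmod ((g * f) z))\<^sup>2) \<partial>lebesgue_on \<Omega>) \<le> ennreal (m\<^sup>2 * (nrm f)\<^sup>2)"
  proof -
    have "(\<integral>\<^sup>+z. ennreal ((cmod ((g * f) z))\<^sup>2) \<partial>lebesgue_on \<Omega>) \<le> (\<integral>\<^sup>+z. ennreal (m\<^sup>2) * ennreal ((cmod (f z))\<^sup>2) \<partial>lebesgue_on \<Omega>)"
    proof (rule nn_integral_mono)
      fix z assume "z \<in> space (lebesgue_on \<Omega>)"
      then have "z \<in> \<Omega>" by (simp add: space_restrict_space)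
      then have "(cmod (g z))\<^sup>2 \<le> m\<^sup>2" using b by (intro power_mono) auto
      then show "ennreal ((cmod ((g * f) z))\<^sup>2) \<le> ennreal (m\<^sup>2) * ennreal ((cmod (f z))\<^sup>2)"
        by (simp add: norm_mult power_mult_distrib mult_right_mono flip: ennreal_mult'')
    qed
    also have "\<dots> = ennreal (m\<^sup>2) * ennreal ((nrm f)\<^sup>2)"
      using L_measurable[OF f] by (subst nn_integral_cmult) (auto simp: nn_integral_L[OF f])
    finally show ?thesis by (simp add: ennreal_mult')
  qed
  show "g * f \<in> L" by (rule L_I(1)[OF ms le])
  show "nrm (g * f) \<le> m * nrm f" if "0 \<le> m"
  proof -
    have "(nrm (g * f))\<^sup>2 \<le> m\<^sup>2 * (nrm f)\<^sup>2" by (rule L_I(2)[OF ms le]) simp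
    then have "(nrm (g * f))\<^sup>2 \<le> (m * nrm f)\<^sup>2" unfolding power_mult_distrib .
    then show ?thesis by (rule power2_le_imp_le) (intro mult_nonneg_nonneg that L.nrm_ge0[OF f])
  qed
qed

lemma A_L: "f \<in> A \<Longrightarrow> f \<in> L" and A_hol: "f \<in> A \<Longrightarrow> f Cn_holomorphic_on \<Omega>" and A_out: "f \<in> A \<Longrightarrow> z \<notin> \<Omega> \<Longrightarrow> f z = 0"
  by (auto simp: bergman_space_def)

text \<open>Passes from the completed measure of the definitions to \<open>lborel\<close>, where
  Fubini and the linear changes of variables are available.\<close>

lemma nn_integral_dom:
  assumes "f \<in> borel_measurable borel"
  shows "(\<integral>\<^sup>+z. f z \<partial>lebesgue_on \<Omega>) = (\<integral>\<^sup>+z. f z * indicator \<Omega> z \<partial>lborel)"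
proof -
  have "(\<integral>\<^sup>+z. f z \<partial>lebesgue_on \<Omega>) = (\<integral>\<^sup>+z. f z * indicator \<Omega> z \<partial>lebesgue)"
    using sets_dom by (intro nn_integral_restrict_space) auto
  also have "\<dots> = (\<integral>\<^sup>+z. f z * indicator \<Omega> z \<partial>lborel)"
    by (rule nn_integral_completion)
  finally show ?thesis .
qed

lemma A_borel: "f \<in> A \<Longrightarrow> f \<in> borel_measurable borel"
proof -
  assume f: "f \<in> A"
  have "(\<lambda>z. indicator \<Omega> z *\<^sub>R f z) = f" using A_out[OF f] by (auto simp: fun_eq_iff indicator_def)
  then show ?thesis using borel_measurable_Cn_holomorphic[OF A_hol[OF f] open_dom] by simp
qed

lemma nn_integral_A:
  assumes f: "f \<in> A"
  shows "(\<integral>\<^sup>+z. ennreal ((cmod (f z))\<^sup>2) * indicator \<Omega> z \<partial>lborel) = ennreal ((nrm f)\<^sup>2)"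
proof -
  have "(\<lambda>z. ennreal ((cmod (f z))\<^sup>2)) \<in> borel_measurable borel" using A_borel[OF f] by measurable
  from nn_integral_dom[OF this] nn_integral_L[OF A_L[OF f]] show ?thesis by simp
qed

text \<open>The volume enters through any lower bound v, so that estimates such as
  \<open>anisotropic_volume_lower\<close> can be inserted directly.\<close>

lemma point_bound:
  assumes f: "f \<in> A" and D: "D \<in> sets borel" "\<And>c w. w \<in> D \<Longrightarrow> cmod c \<le> 1 \<Longrightarrow> c *s w \<in> D"
    "\<And>w. w \<in> D \<Longrightarrow> z + w \<in> \<Omega>" and v: "ennreal v \<le> emeasure lborel D" "0 \<le> v"
  shows "(cmod (f z))\<^sup>2 * v \<le> (nrm f)\<^sup>2"
proof -
  have "ennreal ((cmod (f z))\<^sup>2 * v) \<le> ennreal ((cmod (f z))\<^sup>2) * emeasure lborel D"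
    using v by (simp add: ennreal_mult mult_left_mono)
  also have "\<dots> \<le> ennreal ((nrm f)\<^sup>2)"
    using balanced_sub_mean[OF A_hol[OF f] open_dom D] unfolding nn_integral_A[OF f] .
  finally show ?thesis by simp
qed

text \<open>Point evaluations are bounded, uniformly near each point, since translates of one ball
  of half the radius stay inside the domain. This gives definiteness of the Bergman space and turns
  norm convergence into locally uniform convergence.\<close>

lemma local_bound:
  assumes z: "z \<in> \<Omega>"
  obtains r C where "0 < r" "ball z r \<subseteq> \<Omega>" "0 < C" "\<And>f x. f \<in> A \<Longrightarrow> x \<in> ball z r \<Longrightarrow> cmod (f x) \<le> C * nrm f"
proof -
  obtain s where s: "s > 0" "ball z s \<subseteq> \<Omega>" using open_dom z open_contains_ball by blast
  define r where "r = s / 2"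
  define v where "v = measure lborel (ball (0 :: complex ^ 'n) r)"
  have v: "v > 0" using s by (simp add: v_def r_def)
  have ev: "ennreal v \<le> emeasure lborel (ball (0 :: complex ^ 'n) r)"
    unfolding v_def using emeasure_lborel_ball_finite[of "0 :: complex ^ 'n" r]
    by (subst emeasure_eq_ennreal_measure) (auto simp: top.not_eq_extremum)
  have "cmod (f x) \<le> (1 / sqrt v) * nrm f" if f: "f \<in> A" and x: "x \<in> ball z r" for f x
  proof -
    have "(cmod (f x))\<^sup>2 * v \<le> (nrm f)\<^sup>2"
    proof (rule point_bound[OF f, of "ball 0 r"])
      fix c and w :: "complex ^ 'n" assume w: "w \<in> ball 0 r"
      show "c *s w \<in> ball 0 r" if "cmod c \<le> 1"
        using w mult_right_mono[OF that norm_ge_zero[of w]] by (simp add: norm_vector_scalar_mult)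
      have "dist z (x + w) \<le> dist z x + norm w" using dist_triangle[of z "x + w" x] by (simp add: dist_norm)
      then show "x + w \<in> \<Omega>" using w x s by (auto simp: r_def subset_iff)
    qed (use ev v in auto)
    then have "(cmod (f x) * sqrt v)\<^sup>2 \<le> (nrm f)\<^sup>2" using v by (simp add: power_mult_distrib)
    then have "cmod (f x) * sqrt v \<le> nrm f" using L.nrm_ge0[OF A_L[OF f]] by (rule power2_le_imp_le)
    then show ?thesis using v by (simp add: field_simps)
  qed
  moreover have "ball z r \<subseteq> \<Omega>" using s by (auto simp: r_def)
  ultimately show ?thesis using that[of r "1 / sqrt v"] s v by (simp add: r_def)
qed

sublocale A: def_ip A ip
proof
  show "0 \<in> A" using L.zero_in Cn_holomorphic_const[of 0] by (simp add: bergman_space_def zero_fun_def)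
  show "f + g \<in> A" if "f \<in> A" "g \<in> A" for f g
    using L.add_in Cn_holomorphic_add that by (auto simp: bergman_space_def plus_fun_def)
  show "cscale c f \<in> A" if "f \<in> A" for c f
    using L.scale_in[of f c] Cn_holomorphic_mult[OF Cn_holomorphic_const] that by (auto simp: bergman_space_def cscale_def)
  show "f = 0" if f: "f \<in> A" and "Re (ip f f) = 0" for f
  proof
    fix z
    have n: "nrm f = 0" using L.nrm_sq[OF A_L[OF f]] that by simp
    show "f z = 0 z"
    proof (cases "z \<in> \<Omega>")
      case True
      obtain r C where "0 < r" "\<And>f x. f \<in> A \<Longrightarrow> x \<in> ball z r \<Longrightarrow> cmod (f x) \<le> C * nrm f"
        using local_bound[OF True] by metis
      then have "cmod (f z) \<le> C * nrm f" using f by simp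
      then show ?thesis using n by simp
    qed (simp add: A_out[OF f])
  qed
  show "ip (f + g) h = ip f h + ip g h" if "f \<in> A" "g \<in> A" "h \<in> A" for f g h
    by (rule L.ip_add[OF A_L[OF that(1)] A_L[OF that(2)] A_L[OF that(3)]])
  show "ip (cscale c f) g = c * ip f g" if "f \<in> A" "g \<in> A" for c f g
    by (rule L.ip_scale[OF A_L[OF that(1)] A_L[OF that(2)]])
  show "ip g f = cnj (ip f g)" if "f \<in> A" "g \<in> A" for f g
    by (rule L.ip_commute[OF A_L[OF that(1)] A_L[OF that(2)]])
  show "0 \<le> Re (ip f f)" if "f \<in> A" for f
    by (rule L.ip_ge0[OF A_L[OF that]])
qed

lemma A_mult:
  assumes f: "f \<in> A" and g: "g Cn_holomorphic_on \<Omega>" and b: "\<And>z. z \<in> \<Omega> \<Longrightarrow> cmod (g z) \<le> m"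
  shows "g * f \<in> A"
  using L_mult_bounded(1)[OF A_L[OF f] Cn_holomorphic_continuous_on[OF g] b] Cn_holomorphic_mult[OF g A_hol[OF f]] A_out[OF f]
  by (auto simp: bergman_space_def times_fun_def)

lemma A_bounded_function:
  assumes g: "g Cn_holomorphic_on \<Omega>" and b: "\<And>z. z \<in> \<Omega> \<Longrightarrow> cmod (g z) \<le> m"
  shows "(\<lambda>z. if z \<in> \<Omega> then g z else 0) \<in> A"
proof -
  define f where "f z = (if z \<in> \<Omega> then g z else 0)" for z
  have hol: "f Cn_holomorphic_on \<Omega>"
    by (rule Cn_holomorphic_cong[OF open_dom _ g]) (simp add: f_def)
  have "f \<in> L"
  proof (rule L_I(1)[OF continuous_on_measurable[OF Cn_holomorphic_continuous_on[OF hol]]])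
    have fin: "emeasure lborel \<Omega> < \<infinity>" using bounded_dom by (rule emeasure_bounded_finite)
    have "(\<integral>\<^sup>+z. ennreal ((cmod (f z))\<^sup>2) \<partial>lebesgue_on \<Omega>) \<le> (\<integral>\<^sup>+z. ennreal (m\<^sup>2) \<partial>lebesgue_on \<Omega>)"
    proof (rule nn_integral_mono)
      fix z assume "z \<in> space (lebesgue_on \<Omega>)"
      then have "cmod (f z) \<le> m" using b by (simp add: space_restrict_space f_def)
      then show "ennreal ((cmod (f z))\<^sup>2) \<le> ennreal (m\<^sup>2)" by (intro ennreal_leI power_mono) auto
    qed
    also have "\<dots> = (\<integral>\<^sup>+z. ennreal (m\<^sup>2) * indicator \<Omega> z \<partial>lborel)" by (rule nn_integral_dom) simp
    also have "\<dots> = ennreal (m\<^sup>2) * emeasure lborel \<Omega>"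
      using sets_dom by (intro nn_integral_cmult_indicator) auto
    also have "emeasure lborel \<Omega> = ennreal (measure lborel \<Omega>)" using fin by (intro emeasure_eq_ennreal_measure) auto
    finally show "(\<integral>\<^sup>+z. ennreal ((cmod (f z))\<^sup>2) \<partial>lebesgue_on \<Omega>) \<le> ennreal (m\<^sup>2 * measure lborel \<Omega>)"
      by (simp add: ennreal_mult')
  qed
  then show ?thesis using hol by (simp add: bergman_space_def f_def[abs_def])
qed

text \<open>Hilbert space minimisation with completeness replaced by function theory: a minimising
  sequence is Cauchy by the parallelogram law, converges locally uniformly by
  \<open>local_bound\<close>, and Fatou's lemma bounds the distance to the limit. Two cases occur
  later: empty Z for the projection, a single point for the kernel.\<close>

lemma nrm_minimizer:
  assumes g: "g \<in> L" and A': "A' = {f \<in> A. \<forall>z\<in>Z. f z = 0}"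
  obtains h where "h \<in> A'" "\<And>k. k \<in> A' \<Longrightarrow> nrm (g - h) \<le> nrm (g - k)"
proof -
  have A'A: "f \<in> A" if "f \<in> A'" for f using that by (simp add: A')
  have A'L: "f \<in> L" if "f \<in> A'" for f using A_L A'A that by blast
  define d where "d = Inf ((\<lambda>h. nrm (g - h)) ` A')"
  have zero: "0 \<in> A'" using A.zero_in by (simp add: A')
  have bdd: "bdd_below ((\<lambda>h. nrm (g - h)) ` A')"
    using L.nrm_ge0 L.diff_in g A'L by (intro bdd_belowI[of _ 0]) auto
  have dle: "d \<le> nrm (g - h)" if "h \<in> A'" for h
    unfolding d_def using that bdd by (intro cINF_lower)
  have d0: "0 \<le> d" unfolding d_def
    using zero L.nrm_ge0 L.diff_in g A'L by (intro cINF_greatest) auto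
  have "\<exists>h\<in>A'. nrm (g - h) < d + inverse (real (Suc k))" for k
  proof -
    have "Inf ((\<lambda>h. nrm (g - h)) ` A') < d + inverse (real (Suc k))" by (simp add: d_def)
    then show ?thesis using cINF_less_iff[OF _ bdd] zero by blast
  qed
  then obtain H where H: "\<And>k. H k \<in> A'" "\<And>k. nrm (g - H k) < d + inverse (real (Suc k))" by metis
  have HL: "H k \<in> L" and HA: "H k \<in> A" for k using H(1) A'L A'A by auto
  have lim: "(\<lambda>k. nrm (g - H k)) \<longlonglongrightarrow> d"
  proof (rule real_tendsto_sandwich)
    show "\<forall>\<^sub>F k in sequentially. d \<le> nrm (g - H k)" using dle H(1) by simp
    show "\<forall>\<^sub>F k in sequentially. nrm (g - H k) \<le> d + inverse (real (Suc k))"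
      using H(2) by (auto intro!: always_eventually less_imp_le)
    have "(\<lambda>k. d + inverse (real (Suc k))) \<longlonglongrightarrow> d + 0" by (intro tendsto_intros LIMSEQ_inverse_real_of_nat)
    then show "(\<lambda>k. d + inverse (real (Suc k))) \<longlonglongrightarrow> d" by simp
  qed simp
  have par: "(nrm (H m - H n))\<^sup>2 \<le> 2 * (nrm (g - H m))\<^sup>2 + 2 * (nrm (g - H n))\<^sup>2 - 4 * d\<^sup>2" for m n
  proof -
    define a b where "a = g - H m" and "b = g - H n"
    have ab: "a \<in> L" "b \<in> L" unfolding a_def b_def using g HL by (auto intro: L.diff_in)
    \<comment> \<open>The midpoint stays in A', so its distance from g is at least d; this is the
      term 4 d^2 in the parallelogram law.\<close>
    define c where "c = cscale (1/2) (H m + H n)"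
    have "c \<in> A'" using H(1)[of m] H(1)[of n] by (auto simp: A' c_def A.scale_in A.add_in) (auto simp: cscale_def)
    then have "d\<^sup>2 \<le> (nrm (g - c))\<^sup>2" using dle d0 by (intro power_mono) auto
    moreover have "a + b = cscale 2 (g - c)" by (simp add: a_def b_def c_def cscale_def fun_eq_iff field_simps)
    then have "nrm (a + b) = 2 * nrm (g - c)" using g \<open>c \<in> A'\<close> A'L by (simp only: L.nrm_scale L.diff_in) simp
    ultimately have "4 * d\<^sup>2 \<le> (nrm (a + b))\<^sup>2" by (simp add: power_mult_distrib)
    moreover have "(nrm (a + b))\<^sup>2 + (nrm (a - b))\<^sup>2 = 2 * (nrm a)\<^sup>2 + 2 * (nrm b)\<^sup>2"
      unfolding L.nrm_add_sq[OF ab] L.nrm_diff_sq[OF ab] by simp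
    moreover have "(nrm (a - b))\<^sup>2 = (nrm (H m - H n))\<^sup>2"
    proof -
      have "a - b = H n - H m" by (simp add: a_def b_def fun_eq_iff)
      then show ?thesis using L.nrm_commute[OF HL HL] by metis
    qed
    ultimately show ?thesis unfolding a_def[symmetric] b_def[symmetric] by linarith
  qed
  have cauchy: "\<exists>N. \<forall>m\<ge>N. \<forall>n\<ge>N. nrm (H m - H n) \<le> e" if e: "e > 0" for e
  proof -
    have "(\<lambda>k. (nrm (g - H k))\<^sup>2) \<longlonglongrightarrow> d\<^sup>2" by (intro tendsto_intros lim)
    then have "\<forall>\<^sub>F k in sequentially. (nrm (g - H k))\<^sup>2 < d\<^sup>2 + e\<^sup>2 / 4" using e by (intro order_tendstoD) auto
    then obtain N where N: "\<And>k. k \<ge> N \<Longrightarrow> (nrm (g - H k))\<^sup>2 < d\<^sup>2 + e\<^sup>2 / 4" unfolding eventually_sequentially by blast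
    have "nrm (H m - H n) \<le> e" if "m \<ge> N" "n \<ge> N" for m n
    proof -
      have "(nrm (H m - H n))\<^sup>2 \<le> e\<^sup>2" using par[of m n] N[OF that(1)] N[OF that(2)] by linarith
      then show ?thesis by (rule power2_le_imp_le) (use e in simp)
    qed
    then show ?thesis by blast
  qed
  have loc: "\<exists>r>0. ball z r \<subseteq> \<Omega> \<and> (\<forall>e>0. \<exists>N. \<forall>m\<ge>N. \<forall>n\<ge>N. \<forall>x\<in>ball z r. cmod (H m x - H n x) \<le> e)" if z: "z \<in> \<Omega>" for z
  proof -
    obtain r C where r: "0 < r" "ball z r \<subseteq> \<Omega>" "0 < C" "\<And>f x. f \<in> A \<Longrightarrow> x \<in> ball z r \<Longrightarrow> cmod (f x) \<le> C * nrm f"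
      using local_bound[OF z] by metis
    have "\<exists>N. \<forall>m\<ge>N. \<forall>n\<ge>N. \<forall>x\<in>ball z r. cmod (H m x - H n x) \<le> e" if e: "e > 0" for e
    proof -
      obtain N where N: "\<And>m n. m \<ge> N \<Longrightarrow> n \<ge> N \<Longrightarrow> nrm (H m - H n) \<le> e / C"
        using cauchy[of "e / C"] e r by (metis divide_pos_pos)
      have "cmod (H m x - H n x) \<le> e" if "m \<ge> N" "n \<ge> N" "x \<in> ball z r" for m n x
      proof -
        have "cmod ((H m - H n) x) \<le> C * nrm (H m - H n)" using HA that by (intro r A.diff_in) auto
        also have "\<dots> \<le> C * (e / C)" using N that r by (intro mult_left_mono) auto
        finally show ?thesis using r by simp
      qed
      then show ?thesis by blast
    qed
    then show ?thesis using r by blast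
  qed
  have conv: "convergent (\<lambda>k. H k z)" if z: "z \<in> \<Omega>" for z
  proof (rule Cauchy_convergent, rule metric_CauchyI)
    fix e :: real assume e: "0 < e"
    obtain r where r: "r > 0" "\<forall>e>0. \<exists>N. \<forall>m\<ge>N. \<forall>n\<ge>N. \<forall>x\<in>ball z r. cmod (H m x - H n x) \<le> e"
      using loc[OF z] by blast
    have "e / 2 > 0" using e by simp
    then obtain N where "\<forall>m\<ge>N. \<forall>n\<ge>N. \<forall>x\<in>ball z r. cmod (H m x - H n x) \<le> e / 2" using r(2) by blast
    then have "\<forall>m\<ge>N. \<forall>n\<ge>N. cmod (H m z - H n z) \<le> e / 2" using r(1) by simp
    then show "\<exists>N. \<forall>m\<ge>N. \<forall>n\<ge>N. dist (H m z) (H n z) < e"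
      unfolding dist_norm using e by (intro exI[of _ N]) (smt (verit) field_sum_of_halves)
  qed
  define h where "h z = (if z \<in> \<Omega> then lim (\<lambda>k. H k z) else 0)" for z
  have hlim: "(\<lambda>k. H k z) \<longlonglongrightarrow> h z" if "z \<in> \<Omega>" for z
    using conv[OF that] that by (simp add: h_def convergent_LIMSEQ_iff)
  have hhol: "h Cn_holomorphic_on \<Omega>"
    by (rule Cn_holomorphic_uniform_limit[OF A_hol[OF HA] open_dom hlim loc])
  have hm: "h \<in> borel_measurable (lebesgue_on \<Omega>)"
    by (rule continuous_on_measurable[OF Cn_holomorphic_continuous_on[OF hhol]])
  have ghm: "g - h \<in> borel_measurable (lebesgue_on \<Omega>)"
    unfolding fun_diff_def using L_measurable[OF g] hm by (rule borel_measurable_diff)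
  have "(\<integral>\<^sup>+z. ennreal ((cmod ((g - h) z))\<^sup>2) \<partial>lebesgue_on \<Omega>)
      = (\<integral>\<^sup>+z. liminf (\<lambda>k. ennreal ((cmod ((g - H k) z))\<^sup>2)) \<partial>lebesgue_on \<Omega>)"
  proof (rule nn_integral_cong)
    fix z assume "z \<in> space (lebesgue_on \<Omega>)"
    then have "z \<in> \<Omega>" by (simp add: space_restrict_space)
    then have "(\<lambda>k. ennreal ((cmod ((g - H k) z))\<^sup>2)) \<longlonglongrightarrow> ennreal ((cmod ((g - h) z))\<^sup>2)"
      by (auto intro!: tendsto_intros hlim)
    then show "ennreal ((cmod ((g - h) z))\<^sup>2) = liminf (\<lambda>k. ennreal ((cmod ((g - H k) z))\<^sup>2))"
      by (rule lim_imp_Liminf[OF sequentially_bot, symmetric])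
  qed
  \<comment> \<open>Fatou's lemma turns pointwise convergence into the bound for the limit, so
    convergence in norm does not have to be established.\<close>
  also have "\<dots> \<le> liminf (\<lambda>k. \<integral>\<^sup>+z. ennreal ((cmod ((g - H k) z))\<^sup>2) \<partial>lebesgue_on \<Omega>)"
  proof (rule nn_integral_liminf)
    fix k
    have "g - H k \<in> borel_measurable (lebesgue_on \<Omega>)" using L.diff_in[OF g HL] by (rule L_measurable)
    then show "(\<lambda>z. ennreal ((cmod ((g - H k) z))\<^sup>2)) \<in> borel_measurable (lebesgue_on \<Omega>)" by measurable
  qed
  also have "(\<lambda>k. \<integral>\<^sup>+z. ennreal ((cmod ((g - H k) z))\<^sup>2) \<partial>lebesgue_on \<Omega>) = (\<lambda>k. ennreal ((nrm (g - H k))\<^sup>2))"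
    using L.diff_in[OF g HL] by (simp only: nn_integral_L)
  also have "liminf \<dots> = ennreal (d\<^sup>2)"
    by (rule lim_imp_Liminf) (auto intro!: tendsto_intros lim)
  finally have le: "(\<integral>\<^sup>+z. ennreal ((cmod ((g - h) z))\<^sup>2) \<partial>lebesgue_on \<Omega>) \<le> ennreal (d\<^sup>2)" .
  have ghL: "g - h \<in> L" and ghd: "(nrm (g - h))\<^sup>2 \<le> d\<^sup>2" 
    by (rule L_I(1)[OF ghm le], rule L_I(2)[OF ghm le]) simp
  \<comment> \<open>Up to here only g - h is known to be square integrable; h inherits it from
    g.\<close>
  have "h = g - (g - h)" by (simp add: fun_eq_iff)
  then have hL: "h \<in> L" using L.diff_in[OF g ghL] by metis
  have hA: "h \<in> A" using hL hhol by (simp add: bergman_space_def h_def)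
  have "h z = 0" if "z \<in> Z" for z
  proof (cases "z \<in> \<Omega>")
    case True
    have "H k z = 0" for k using H(1)[of k] that by (simp add: A')
    then show ?thesis using hlim[OF True] by (simp add: LIMSEQ_const_iff)
  qed (simp add: h_def)
  then have "h \<in> A'" using hA by (simp add: A')
  moreover have "nrm (g - h) \<le> nrm (g - k)" if "k \<in> A'" for k
    using power2_le_imp_le[OF ghd d0] dle[OF that] by linarith
  ultimately show ?thesis using that by blast
qed

text \<open>If the error g - h had a nonzero component along some k, moving h by that component
  would bring it closer to g.\<close>

lemma orthogonal_projection:
  assumes g: "g \<in> L" and A': "A' = {f \<in> A. \<forall>z\<in>Z. f z = 0}"
  obtains h where "h \<in> A'" "\<And>k. k \<in> A' \<Longrightarrow> ip (g - h) k = 0"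
proof -
  obtain h where h: "h \<in> A'" "\<And>k. k \<in> A' \<Longrightarrow> nrm (g - h) \<le> nrm (g - k)"
    using nrm_minimizer[OF g A'] by blast
  have A'L: "f \<in> L" if "f \<in> A'" for f using that A_L by (simp add: A')
  have hL: "g - h \<in> L" using g h(1) A'L L.diff_in by blast
  have "ip (g - h) k = 0" if k: "k \<in> A'" for k
  proof (cases "k = 0")
    case True
    then show ?thesis using L.ip_zero_right[OF hL] by simp
  next
    case False
    have kA: "k \<in> A" and kL: "k \<in> L" using k A'L by (auto simp: A')
    define N where "N = (nrm k)\<^sup>2"
    have N: "N > 0" using A.nrm_pos[OF kA False] by (simp add: N_def)
    define w where "w = ip (g - h) k"
    define c where "c = w / of_real N"
    have "h + cscale c k \<in> A'" using h(1) k by (auto simp: A' A.add_in A.scale_in) (simp add: cscale_def)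
    then have le: "nrm (g - h) \<le> nrm (g - (h + cscale c k))" by (rule h(2))
    have eq: "g - (h + cscale c k) = (g - h) - cscale c k" by (simp add: fun_eq_iff)
    have "(nrm (g - h))\<^sup>2 \<le> (nrm ((g - h) - cscale c k))\<^sup>2"
      using le L.nrm_ge0[OF hL] unfolding eq by (rule power_mono)
    also have "\<dots> = (nrm (g - h))\<^sup>2 - 2 * Re (cnj c * w) + (cmod c * nrm k)\<^sup>2"
      using L.nrm_diff_sq[OF hL L.scale_in[OF kL]] L.ip_scale_right[OF kL hL] L.nrm_scale[OF kL] by (simp add: w_def)
    also have "cnj c * w = of_real ((cmod w)\<^sup>2 / N)"
      using complex_norm_square[of w] by (simp add: c_def mult.commute)
    also have "(cmod c * nrm k)\<^sup>2 = (cmod w)\<^sup>2 / N"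
      using N by (simp add: c_def norm_divide power_mult_distrib power_divide N_def[symmetric]) (simp add: power2_eq_square)
    finally have "(cmod w)\<^sup>2 / N \<le> 0" by simp
    then have "w = 0" using N by (simp add: divide_le_0_iff)
    then show ?thesis by (simp add: w_def)
  qed
  then show ?thesis using that h(1) by blast
qed

abbreviation "P \<equiv> bergman_projection \<Omega>"

lemma projection_unique:
  assumes f: "f \<in> L" and g: "g \<in> A" "\<And>h. h \<in> A \<Longrightarrow> ip (f - g) h = 0"
  shows "P f = g"
  unfolding bergman_projection_def
proof (rule the_equality)
  fix g' assume g': "g' \<in> A \<and> (\<forall>h\<in>A. ip (f - g') h = 0)"
  have "ip h g' = ip h g" if h: "h \<in> A" for h
  proof -
    have "ip f h - ip g' h = 0" "ip f h - ip g h = 0"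
      using g g' h f A_L by (auto simp: L.ip_diff[symmetric])
    then have "ip g' h = ip g h" by simp
    then show ?thesis using h g g' A.ip_commute by metis
  qed
  then show "g' = g" using A.ip_ext g g' by blast
qed (use g in auto)

lemma projection:
  assumes f: "f \<in> L"
  shows "P f \<in> A" "h \<in> A \<Longrightarrow> ip (f - P f) h = 0"
proof -
  obtain g where "g \<in> A" "\<And>k. k \<in> A \<Longrightarrow> ip (f - g) k = 0"
    using orthogonal_projection[OF f, of A "{}"] by auto
  then show "P f \<in> A" "h \<in> A \<Longrightarrow> ip (f - P f) h = 0" using projection_unique[OF f, of g] by auto
qed

lemma projection_add: "f \<in> L \<Longrightarrow> g \<in> L \<Longrightarrow> P (f + g) = P f + P g"
proof (rule projection_unique)
  assume f: "f \<in> L" and g: "g \<in> L"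
  show "P f + P g \<in> A" using f g by (intro A.add_in projection)
  fix h assume h: "h \<in> A"
  have eq: "f + g - (P f + P g) = (f - P f) + (g - P g)" by (simp add: fun_eq_iff)
  have "ip ((f - P f) + (g - P g)) h = ip (f - P f) h + ip (g - P g) h"
    using f g h projection A_L by (intro L.ip_add L.diff_in) auto
  then show "ip (f + g - (P f + P g)) h = 0"
    unfolding eq using projection(2)[OF f h] projection(2)[OF g h] by (simp only: add_0)
qed (rule L.add_in)

lemma projection_scale: "f \<in> L \<Longrightarrow> P (cscale c f) = cscale c (P f)"
proof (rule projection_unique)
  assume f: "f \<in> L"
  show "cscale c (P f) \<in> A" using f by (intro A.scale_in projection)
  fix h assume h: "h \<in> A"
  have eq: "cscale c f - cscale c (P f) = cscale c (f - P f)" by (simp add: fun_eq_iff cscale_def algebra_simps)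
  have "ip (cscale c (f - P f)) h = c * ip (f - P f) h"
    using f h projection A_L by (intro L.ip_scale L.diff_in) auto
  then show "ip (cscale c f - cscale c (P f)) h = 0"
    unfolding eq using projection(2)[OF f h] by (simp only: mult_zero_right)
qed (rule L.scale_in)

lemma projection_fix: "f \<in> A \<Longrightarrow> P f = f"
  by (rule projection_unique) (auto simp: A_L L.ip_zero)

text \<open>Let q be the projection of the constant 1 onto the functions vanishing at z. Then p = 1
  - q is orthogonal to all of these and p(z) = 1. Subtracting f(z) p from f leaves such a function,
  so f(z) is the inner product of f with p, divided by the squared norm of p.\<close>

lemma reproducing_kernel:
  assumes z: "z \<in> \<Omega>"
  obtains K where "K \<in> A" "\<And>f. f \<in> A \<Longrightarrow> ip f K = f z"
proof -
  define f0 where "f0 x = (if x \<in> \<Omega> then 1 else 0 :: complex)" for x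
  have f0: "f0 \<in> A" using A_bounded_function[OF Cn_holomorphic_const[of 1], of 1] by (simp add: f0_def[abs_def])
  obtain q where q': "q \<in> {f \<in> A. \<forall>x\<in>{z}. f x = 0}" "\<And>k. k \<in> {f \<in> A. \<forall>x\<in>{z}. f x = 0} \<Longrightarrow> ip (f0 - q) k = 0"
    using orthogonal_projection[OF A_L[OF f0] refl, of "{z}"] by blast
  then have q: "q \<in> A" "q z = 0" "\<And>k. k \<in> A \<Longrightarrow> k z = 0 \<Longrightarrow> ip (f0 - q) k = 0"
    by simp_all
  define p where "p = f0 - q"
  have pA: "p \<in> A" unfolding p_def using f0 q by (intro A.diff_in)
  have pz: "p z = 1" using z q by (simp add: p_def f0_def)
  have "p \<noteq> 0" using pz by auto
  then have N: "(nrm p)\<^sup>2 > 0" using A.nrm_pos[OF pA] by simp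
  define K where "K = cscale (of_real (1 / (nrm p)\<^sup>2)) p"
  have "ip f K = f z" if f: "f \<in> A" for f
  proof -
    define k where "k = f - cscale (f z) p"
    have k: "k \<in> A" unfolding k_def using f pA by (intro A.diff_in A.scale_in)
    have "k z = 0" using pz by (simp add: k_def cscale_def)
    then have "ip p k = 0" unfolding p_def by (intro q k)
    then have "ip k p = 0" using A.ip_commute[OF pA k] by simp
    then have "ip f p = f z * ip p p"
      unfolding k_def using f pA by (simp add: A.ip_diff A.ip_scale A.scale_in)
    then show ?thesis
      unfolding K_def using f pA N by (simp add: A.ip_scale_right A.ip_self[OF pA])
  qed
  moreover have "K \<in> A" unfolding K_def using pA by (rule A.scale_in)
  ultimately show ?thesis using that by blast
qed

end

section \<open>Hankel operators with conjugate holomorphic symbols\<close>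

locale hankel_symbol = bergman_domain \<Omega> for \<Omega> :: "(complex ^ 'n) set" +
  fixes \<phi> :: "complex ^ 'n \<Rightarrow> complex" and b :: real
  assumes phi_hol: "\<phi> Cn_holomorphic_on \<Omega>" and phi_bound: "\<And>z. z \<in> \<Omega> \<Longrightarrow> cmod (\<phi> z) \<le> b"
begin

abbreviation "H \<equiv> hankel_operator \<Omega> (\<lambda>z. cnj (\<phi> z))"

lemma conj_mult_L: "f \<in> L \<Longrightarrow> (\<lambda>z. cnj (\<phi> z)) * f \<in> L"
  by (rule L_mult_bounded(1)[where m = b])
    (use phi_bound Cn_holomorphic_continuous_on[OF phi_hol] in \<open>auto intro: continuous_on_cnj\<close>)

lemma mult_L: "f \<in> L \<Longrightarrow> \<phi> * f \<in> L"
  by (rule L_mult_bounded(1)[where m = b]) (use phi_bound Cn_holomorphic_continuous_on[OF phi_hol] in auto)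

lemma mult_A: "f \<in> A \<Longrightarrow> \<phi> * f \<in> A"
  by (rule A_mult[where m = b]) (use phi_bound phi_hol in auto)

lemma diff_mult_A:
  assumes z: "z \<in> \<Omega>" and f: "f \<in> A"
  shows "(\<lambda>x. \<phi> x - \<phi> z) * f \<in> A"
proof (rule A_mult[OF f])
  show "(\<lambda>x. \<phi> x - \<phi> z) Cn_holomorphic_on \<Omega>"
    by (intro Cn_holomorphic_diff phi_hol Cn_holomorphic_const)
  show "cmod (\<phi> x - \<phi> z) \<le> b + b" if "x \<in> \<Omega>" for x
    using norm_triangle_ineq4[of "\<phi> x" "\<phi> z"] phi_bound[OF that] phi_bound[OF z] by linarith
qed

lemma ip_conj_mult: "ip ((\<lambda>z. cnj (\<phi> z)) * f) g = ip f (\<phi> * g)"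
  by (simp add: L2_inner_def mult_ac)

lemma H_L: "f \<in> A \<Longrightarrow> H f \<in> L"
  unfolding hankel_operator_def by (intro L.diff_in conj_mult_L A_L projection)

lemma H_orthogonal: "f \<in> A \<Longrightarrow> h \<in> A \<Longrightarrow> ip (H f) h = 0"
  unfolding hankel_operator_def by (intro projection conj_mult_L A_L)

lemma H_add:
  assumes "f \<in> A" "g \<in> A"
  shows "H (f + g) = H f + H g"
proof -
  have "(\<lambda>z. cnj (\<phi> z)) * (f + g) = (\<lambda>z. cnj (\<phi> z)) * f + (\<lambda>z. cnj (\<phi> z)) * g"
    by (simp add: fun_eq_iff algebra_simps)
  moreover have "P ((\<lambda>z. cnj (\<phi> z)) * f + (\<lambda>z. cnj (\<phi> z)) * g) = P ((\<lambda>z. cnj (\<phi> z)) * f) + P ((\<lambda>z. cnj (\<phi> z)) * g)"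
    using assms by (intro projection_add conj_mult_L A_L)
  ultimately show ?thesis unfolding hankel_operator_def by (simp only: add_diff_add)
qed

lemma H_scale:
  assumes "f \<in> A"
  shows "H (cscale c f) = cscale c (H f)"
proof -
  have "(\<lambda>z. cnj (\<phi> z)) * cscale c f = cscale c ((\<lambda>z. cnj (\<phi> z)) * f)"
    by (simp add: fun_eq_iff cscale_def)
  moreover have "P (cscale c ((\<lambda>z. cnj (\<phi> z)) * f)) = cscale c (P ((\<lambda>z. cnj (\<phi> z)) * f))"
    using assms by (intro projection_scale conj_mult_L A_L)
  ultimately have "H (cscale c f) = cscale c ((\<lambda>z. cnj (\<phi> z)) * f) - cscale c (P ((\<lambda>z. cnj (\<phi> z)) * f))"
    unfolding hankel_operator_def by (simp only:)
  then show ?thesis unfolding hankel_operator_def by (simp add: fun_eq_iff cscale_def algebra_simps)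
qed

abbreviation "HH \<equiv> \<lambda>f. adjoint_op A ip H (H f)"

text \<open>The adjoint applied to H f is P (\<phi> H f): the projected part of H h drops out
  because H f is orthogonal to the Bergman space. Definiteness gives the uniqueness required by the
  description in \<open>adjoint_op\<close>.\<close>

lemma HH:
  assumes f: "f \<in> A"
  shows "HH f \<in> A" "h \<in> A \<Longrightarrow> ip h (HH f) = ip (H h) (H f)"
proof -
  define g where "g = P (\<phi> * H f)"
  have m: "\<phi> * H f \<in> L" using mult_L H_L f by blast
  have g: "g \<in> A" unfolding g_def using m by (rule projection)
  have eq: "ip (H h) (H f) = ip h g" if h: "h \<in> A" for h
  proof -
    define u where "u = (\<lambda>z. cnj (\<phi> z)) * h"
    have u: "u \<in> L" unfolding u_def using h by (intro conj_mult_L A_L)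
    have Pu: "P u \<in> A" using u by (rule projection)
    have HfL: "H f \<in> L" using f by (rule H_L)
    have "ip (H h) (H f) = ip u (H f) - ip (P u) (H f)"
      unfolding hankel_operator_def[of \<Omega> _ h] u_def[symmetric] using u Pu HfL A_L by (intro L.ip_diff) auto
    also have "ip (P u) (H f) = 0"
      using H_orthogonal[OF f Pu] L.ip_commute[OF HfL A_L[OF Pu]] by simp
    also have "ip u (H f) - 0 = ip h (\<phi> * H f)" unfolding u_def by (simp add: ip_conj_mult)
    also have "\<dots> = ip h g"
    proof -
      have "ip (\<phi> * H f - g) h = 0" unfolding g_def using m h by (rule projection)
      then have "ip (\<phi> * H f) h = ip g h" using m g h A_L by (simp add: L.ip_diff)
      then show ?thesis using L.ip_commute[OF m A_L[OF h]] L.ip_commute[OF A_L[OF g] A_L[OF h]] by simp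
    qed
    finally show ?thesis .
  qed
  have "HH f = g"
    unfolding adjoint_op_def
  proof (rule the_equality)
    show "g \<in> A \<and> (\<forall>h\<in>A. ip (H h) (H f) = ip h g)" using g eq by blast
    fix g' assume "g' \<in> A \<and> (\<forall>h\<in>A. ip (H h) (H f) = ip h g')"
    then show "g' = g" using A.ip_ext g eq by metis
  qed
  then show "HH f \<in> A" "h \<in> A \<Longrightarrow> ip h (HH f) = ip (H h) (H f)" using g eq by auto
qed

lemma HH_form: "f \<in> A \<Longrightarrow> g \<in> A \<Longrightarrow> ip (HH f) g = ip (H f) (H g)"
  using HH[of f] L.ip_commute A_L H_L by metis

text \<open>The norm bound is a premise because \<open>is_op_powr\<close> already contains one for
  the operator whose power is taken.\<close>

lemma HH_operator:
  assumes "\<exists>M. \<forall>f\<in>A. nrm (HH f) \<le> M * nrm f"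
  shows "ip_operator A ip HH"
proof unfold_locales
  fix f g assume f: "f \<in> A" and g: "g \<in> A"
  show "HH (f + g) = HH f + HH g"
  proof (rule A.ip_ext)
    fix h assume h: "h \<in> A"
    show "ip h (HH (f + g)) = ip h (HH f + HH g)"
      using HH(2)[OF A.add_in[OF f g] h] HH(2)[OF f h] HH(2)[OF g h] H_add[OF f g]
        A.ip_add_right[OF HH(1)[OF f] HH(1)[OF g] h] L.ip_add_right[OF H_L[OF f] H_L[OF g] H_L[OF h]]
      by (simp only:)
  qed (use f g in \<open>auto intro!: A.add_in HH\<close>)
  show "ip (HH f) g = ip f (HH g)" using HH_form[OF f g] HH(2)[OF g f] by simp
next
  fix f c assume f: "f \<in> A"
  show "HH (cscale c f) = cscale c (HH f)"
  proof (rule A.ip_ext)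
    fix h assume h: "h \<in> A"
    show "ip h (HH (cscale c f)) = ip h (cscale c (HH f))"
      using HH(2)[OF A.scale_in[OF f] h, of c] HH(2)[OF f h] H_scale[OF f, of c]
        A.ip_scale_right[OF HH(1)[OF f] h, of c] L.ip_scale_right[OF H_L[OF f] H_L[OF h], of c]
      by (simp only:)
  qed (use f in \<open>auto intro!: A.scale_in HH\<close>)
qed (use HH assms in auto)

text \<open>The kernel is an eigenvector of the Toeplitz operator with conjugate symbol: testing
  against h gives the conjugate of \<phi>(z) h(z). Hence the projection merely replaces \<phi> by
  its value at z.\<close>

lemma H_kernel:
  assumes K: "K \<in> A" "\<And>f. f \<in> A \<Longrightarrow> ip f K = f z" and z: "z \<in> \<Omega>"
  shows "H K = (\<lambda>x. cnj (\<phi> x - \<phi> z)) * K"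
proof -
  define u where "u = (\<lambda>x. cnj (\<phi> x)) * K"
  have u: "u \<in> L" unfolding u_def using K by (intro conj_mult_L A_L)
  have "P u = cscale (cnj (\<phi> z)) K"
  proof (rule projection_unique[OF u])
    show c: "cscale (cnj (\<phi> z)) K \<in> A" using K by (intro A.scale_in)
    fix h assume h: "h \<in> A"
    have "ip u h = ip K (\<phi> * h)" unfolding u_def by (rule ip_conj_mult)
    also have "\<dots> = cnj (ip (\<phi> * h) K)" using mult_A[OF h] K A.ip_commute by blast
    also have "\<dots> = cnj (\<phi> z) * cnj (h z)" using K(2)[OF mult_A[OF h]] by simp
    also have "cnj (h z) = ip K h" using K h A.ip_commute by metis
    finally have 1: "ip u h = cnj (\<phi> z) * ip K h" .
    have 2: "ip (cscale (cnj (\<phi> z)) K) h = cnj (\<phi> z) * ip K h" by (rule A.ip_scale[OF K(1) h])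
    show "ip (u - cscale (cnj (\<phi> z)) K) h = 0"
      using L.ip_diff[OF u A_L[OF c] A_L[OF h]] 1 2 by simp
  qed
  then have "H K = u - cscale (cnj (\<phi> z)) K" unfolding hankel_operator_def u_def by simp
  then show ?thesis by (simp add: u_def cscale_def fun_eq_iff algebra_simps)
qed

text \<open>Conjugating the factor \<phi> - \<phi>(z) leaves the modulus unchanged, so the norm of H
  K is that of a holomorphic function, to which Cauchy estimates apply.\<close>

lemma HH_kernel_form:
  assumes K: "K \<in> A" "\<And>f. f \<in> A \<Longrightarrow> ip f K = f z" and z: "z \<in> \<Omega>"
  shows "Re (ip (HH K) K) = (nrm ((\<lambda>x. \<phi> x - \<phi> z) * K))\<^sup>2"
proof -
  have G: "(\<lambda>x. \<phi> x - \<phi> z) * K \<in> A" by (rule diff_mult_A[OF z K(1)])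
  have HK: "H K = (\<lambda>x. cnj (\<phi> x - \<phi> z)) * K" by (rule H_kernel[OF K z])
  have "H K x = cnj (\<phi> x - \<phi> z) * K x" for x using fun_cong[OF HK, of x] by simp
  then have "cmod (H K x) = cmod (((\<lambda>x. \<phi> x - \<phi> z) * K) x)" for x
    by (simp only: norm_mult complex_mod_cnj times_fun_def)
  then have "Re (ip (H K) (H K)) = (LINT x|lebesgue_on \<Omega>. (cmod (((\<lambda>x. \<phi> x - \<phi> z) * K) x))\<^sup>2)"
    by (simp only: ip_self_integral Re_complex_of_real)
  then show ?thesis using nrm_sq_integral[OF A_L[OF G]] HH_form[OF K(1) K(1)] by (simp only:)
qed

text \<open>Since \<open>\<langle>K\<^sub>z, e\<rangle>\<close> is the conjugate of \<open>e(z)\<close>, the sum over the eigenvectors integrates to the trace.\<close>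

lemma schatten_kernel_estimate:
  assumes sch: "schatten_class A L ip p H" and p: "0 < p" "p \<le> 2 * real N" and N: "0 < N"
  obtains W C where "0 < C" "(\<integral>\<^sup>+z. W z \<partial>lebesgue_on \<Omega>) < \<infinity>"
    "\<And>z K. z \<in> \<Omega> \<Longrightarrow> K \<in> A \<Longrightarrow> (\<And>f. f \<in> A \<Longrightarrow> ip f K = f z) \<Longrightarrow>
       ennreal ((nrm ((\<lambda>x. \<phi> x - \<phi> z) * K)) ^ (2 * N)) \<le> ennreal (C * (nrm K) ^ (2 * (N - 1))) * W z"
proof -
  obtain B where B: "is_op_powr A ip HH (p / 2) B" "sa_trace_class A ip B"
    using sch unfolding schatten_class_def by blast
  have "\<exists>M. \<forall>f\<in>A. nrm (HH f) \<le> M * nrm f" using B(1) unfolding is_op_powr_def by blast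
  then interpret HH: ip_operator A ip HH by (rule HH_operator)
  have BA: "bounded_operator A A ip B" using B(1) unfolding is_op_powr_def by blast
  have BS: "B f \<in> A" if "f \<in> A" for f using BA that unfolding bounded_operator_def by blast
  interpret BB: compact_sa_operator A ip B
  proof unfold_locales
    show "B (f + g) = B f + B g" if fg: "f \<in> A" "g \<in> A" for f g
    proof -
      \<comment> \<open>\<open>bounded_operator\<close> only says that this difference is a null
        vector; it lies in the Bergman space, where null vectors are zero.\<close>
      have m: "B (f + g) - (B f + B g) \<in> A"
        by (rule A.diff_in[OF BS[OF A.add_in[OF fg(1) fg(2)]] A.add_in[OF BS[OF fg(1)] BS[OF fg(2)]]])
      have "nrm (B (f + g) - (B f + B g)) = 0" using BA fg unfolding bounded_operator_def by blast
      then have "B (f + g) - (B f + B g) = 0" using A.nrm_eq0[OF m] by blast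
      then show ?thesis by (simp only: right_minus_eq)
    qed
    show "B (cscale c f) = cscale c (B f)" if f: "f \<in> A" for c f
    proof -
      have m: "B (cscale c f) - cscale c (B f) \<in> A"
        by (rule A.diff_in[OF BS[OF A.scale_in[OF f]] A.scale_in[OF BS[OF f]]])
      have "nrm (B (cscale c f) - cscale c (B f)) = 0" using BA f unfolding bounded_operator_def by blast
      then have "B (cscale c f) - cscale c (B f) = 0" using A.nrm_eq0[OF m] by blast
      then show ?thesis by (simp only: right_minus_eq)
    qed
    show "\<exists>M. \<forall>f\<in>A. nrm (B f) \<le> M * nrm f" using BA unfolding bounded_operator_def by blast
    show "ip (B f) g = ip f (B g)" if "f \<in> A" "g \<in> A" for f g
      using B(2) that unfolding sa_trace_class_def self_adjoint_op_def by blast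
    show "compact_op A ip B" using B(2) unfolding sa_trace_class_def by blast
  qed (rule BS)
  have pos: "0 \<le> Re (ip (HH f) f)" if "f \<in> A" for f
    unfolding HH_form[OF that that] using L.ip_ge0[OF H_L[OF that]] .
  have p2: "p / 2 \<le> real N" using p by simp
  have "\<exists>C>0. \<forall>f\<in>A. (Re (ip (HH f) f)) ^ N \<le> C * (nrm f) ^ (2 * (N - 1)) * cmod (ip (B f) f)"
  proof (rule HH.power_form_bound[OF pos B(1) N p2])
    fix C assume c: "0 < C"
      "\<And>f. f \<in> A \<Longrightarrow> (Re (ip (HH f) f)) ^ N \<le> C * (nrm f) ^ (2 * (N - 1)) * cmod (ip (B f) f)"
    show ?thesis by (intro exI[of _ C] conjI ballI c)
  qed
  then obtain C where C: "0 < C"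
    "\<forall>f\<in>A. (Re (ip (HH f) f)) ^ N \<le> C * (nrm f) ^ (2 * (N - 1)) * cmod (ip (B f) f)"
    by (elim exE conjE)
  have sum: "(\<lambda>l. real (vector_space.dim cscale (eigenspace A B l)) * cmod l)
      summable_on {l. \<exists>f\<in>eigenspace A B l. f \<noteq> 0}"
    using B(2) unfolding sa_trace_class_def by blast
  obtain E m where E: "E \<subseteq> A" "countable E" "\<And>e. e \<in> E \<Longrightarrow> nrm e = 1" "\<And>e. 0 \<le> m e"
    "(\<integral>\<^sup>+e. ennreal (m e) \<partial>count_space E) < \<infinity>"
    "\<And>f. f \<in> A \<Longrightarrow> ennreal (cmod (ip (B f) f)) \<le> (\<integral>\<^sup>+e. ennreal (m e * (cmod (ip f e))\<^sup>2) \<partial>count_space E)"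
  proof (rule BB.trace_class_form_bound[OF sum])
    fix E m assume h: "E \<subseteq> A" "countable E" "\<And>e. e \<in> E \<Longrightarrow> nrm e = 1" "\<And>e. 0 \<le> m e"
      "(\<integral>\<^sup>+e. ennreal (m e) \<partial>count_space E) < \<infinity>"
      "\<And>f. f \<in> A \<Longrightarrow> ennreal (cmod (ip (B f) f)) \<le> (\<integral>\<^sup>+e. ennreal (m e * (cmod (ip f e))\<^sup>2) \<partial>count_space E)"
    show thesis by (rule that[OF h])
  qed
  define W where "W z = (\<integral>\<^sup>+e. ennreal (m e * (cmod (e z))\<^sup>2) \<partial>count_space E)" for z
  have EA: "e \<in> A" if "e \<in> E" for e using E(1) that by (rule subsetD)
  have "(\<integral>\<^sup>+z. W z \<partial>lebesgue_on \<Omega>) = (\<integral>\<^sup>+e. \<integral>\<^sup>+z. ennreal (m e * (cmod (e z))\<^sup>2) \<partial>lebesgue_on \<Omega> \<partial>count_space E)"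
    unfolding W_def
  proof (rule nn_integral_count_space_nn_integral[OF E(2)])
    fix e assume "e \<in> E"
    then have "e \<in> borel_measurable (lebesgue_on \<Omega>)" using EA A_L L_measurable by blast
    then show "(\<lambda>z. ennreal (m e * (cmod (e z))\<^sup>2)) \<in> borel_measurable (lebesgue_on \<Omega>)" by measurable
  qed
  also have "\<dots> = (\<integral>\<^sup>+e. ennreal (m e) \<partial>count_space E)"
  proof (rule nn_integral_cong)
    fix e assume "e \<in> space (count_space E)"
    then have e: "e \<in> E" by simp
    have eL: "e \<in> L" using EA[OF e] by (rule A_L)
    have em: "(\<lambda>z. ennreal ((cmod (e z))\<^sup>2)) \<in> borel_measurable (lebesgue_on \<Omega>)"
      using L_measurable[OF eL] by measurable
    have "(\<integral>\<^sup>+z. ennreal (m e * (cmod (e z))\<^sup>2) \<partial>lebesgue_on \<Omega>) = (\<integral>\<^sup>+z. ennreal (m e) * ennreal ((cmod (e z))\<^sup>2) \<partial>lebesgue_on \<Omega>)"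
      using E(4) by (simp add: ennreal_mult)
    also have "\<dots> = ennreal (m e) * ennreal ((nrm e)\<^sup>2)"
      using nn_integral_cmult[OF em] nn_integral_L[OF eL] by simp
    also have "\<dots> = ennreal (m e)" using E(3)[OF e] by simp
    finally show "(\<integral>\<^sup>+z. ennreal (m e * (cmod (e z))\<^sup>2) \<partial>lebesgue_on \<Omega>) = ennreal (m e)" .
  qed
  finally have fin: "(\<integral>\<^sup>+z. W z \<partial>lebesgue_on \<Omega>) < \<infinity>" using E(5) by simp
  show ?thesis
  proof (rule that[OF C(1) fin])
    fix z K assume z: "z \<in> \<Omega>" and K: "K \<in> A" "\<And>f. f \<in> A \<Longrightarrow> ip f K = f z"
    have eK: "cmod (ip K e) = cmod (e z)" if "e \<in> E" for e
    proof -
      have "ip K e = cnj (ip e K)" using EA[OF that] K(1) by (rule A.ip_commute)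
      then show ?thesis using K(2)[OF EA[OF that]] by simp
    qed
    have "ennreal (cmod (ip (B K) K)) \<le> (\<integral>\<^sup>+e. ennreal (m e * (cmod (ip K e))\<^sup>2) \<partial>count_space E)"
      by (rule E(6)[OF K(1)])
    also have "\<dots> = W z" unfolding W_def by (intro nn_integral_cong) (simp add: eK)
    finally have BW: "ennreal (cmod (ip (B K) K)) \<le> W z" .
    have "(nrm ((\<lambda>x. \<phi> x - \<phi> z) * K)) ^ (2 * N) = (Re (ip (HH K) K)) ^ N"
      using HH_kernel_form[OF K z] by (simp add: power_mult)
    also have "\<dots> \<le> C * (nrm K) ^ (2 * (N - 1)) * cmod (ip (B K) K)" using C(2) K(1) by (rule bspec)
    finally have "ennreal ((nrm ((\<lambda>x. \<phi> x - \<phi> z) * K)) ^ (2 * N)) \<le> ennreal (C * (nrm K) ^ (2 * (N - 1)) * cmod (ip (B K) K))"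
      by (rule ennreal_leI)
    also have "\<dots> = ennreal (C * (nrm K) ^ (2 * (N - 1))) * ennreal (cmod (ip (B K) K))"
      using C(1) A.nrm_ge0[OF K(1)] by (intro ennreal_mult) auto
    also have "\<dots> \<le> ennreal (C * (nrm K) ^ (2 * (N - 1))) * W z" using BW by (rule mult_left_mono) simp
    finally show "ennreal ((nrm ((\<lambda>x. \<phi> x - \<phi> z) * K)) ^ (2 * N)) \<le> ennreal (C * (nrm K) ^ (2 * (N - 1))) * W z" .
  qed
qed

end

text \<open>Multiplication by a constant stays in the Bergman space, so H vanishes there. The zero
  operator then serves as the power, with M = 0 and zero polynomials.\<close>

lemma (in hankel_symbol) schatten_class_constant:
  assumes c: "\<And>z. z \<in> \<Omega> \<Longrightarrow> \<phi> z = c"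
  shows "schatten_class A L ip p H"
proof -
  have H0: "H f = 0" if f: "f \<in> A" for f
  proof -
    have "(\<lambda>z. cnj (\<phi> z)) * f = cscale (cnj c) f"
    proof
      fix z show "((\<lambda>z. cnj (\<phi> z)) * f) z = cscale (cnj c) f z"
        using c[of z] A_out[OF f, of z] by (cases "z \<in> \<Omega>") (auto simp: cscale_def)
    qed
    moreover have "P (cscale (cnj c) f) = cscale (cnj c) f" using f by (intro projection_fix A.scale_in)
    ultimately show ?thesis unfolding hankel_operator_def by simp
  qed
  have HH0: "HH f = 0" if f: "f \<in> A" for f
  proof (rule A.ip_ext[OF HH(1)[OF f] A.zero_in])
    fix h assume h: "h \<in> A"
    show "ip h (HH f) = ip h 0"
      using HH(2)[OF f h] H0[OF f] H0[OF h] L.ip_zero[OF L.zero_in] A.ip_zero_right[OF h] by simp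
  qed
  define B :: "(complex ^ 'n \<Rightarrow> complex) \<Rightarrow> complex ^ 'n \<Rightarrow> complex" where "B f = 0" for f
  have n0: "nrm 0 = 0" by (rule A.nrm_zero)
  have sc0: "cscale k 0 = (0 :: complex ^ 'n \<Rightarrow> complex)" for k by (simp add: cscale_def fun_eq_iff)
  have bo: "bounded_operator A S' ip T" if "\<And>f. f \<in> A \<Longrightarrow> T f = 0" "0 \<in> S'" for T S'
    unfolding bounded_operator_def
  proof (intro conjI ballI allI exI[of _ 0])
    fix f g k assume f: "f \<in> A"
    show "T f \<in> S'" using that f by simp
    show "nrm (T (f + g) - (T f + T g)) = 0" if g: "g \<in> A"
      using \<open>\<And>f. f \<in> A \<Longrightarrow> T f = 0\<close>[OF A.add_in[OF f g]] \<open>\<And>f. f \<in> A \<Longrightarrow> T f = 0\<close>[OF f] \<open>\<And>f. f \<in> A \<Longrightarrow> T f = 0\<close>[OF g] n0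
      by (simp only: diff_self add_0)
    show "nrm (T (cscale k f) - cscale k (T f)) = 0"
      using that(1)[OF A.scale_in[OF f, of k]] that(1)[OF f] n0 by (simp only: sc0 diff_self)
    show "nrm (T f) \<le> 0 * nrm f" using that(1)[OF f] n0 by simp
  qed
  have "bounded_operator A A ip B" by (rule bo) (auto simp: B_def A.zero_in)
  moreover have "\<forall>f\<in>A. nrm (HH f) \<le> 0 * nrm f"
  proof
    fix f assume "f \<in> A" then show "nrm (HH f) \<le> 0 * nrm f" using HH0[of f] n0 by simp
  qed
  \<comment> \<open>The interval is a single point, where \<open>0 powr (p / 2)\<close> is 0 by the
    convention for \<open>powr\<close>.\<close>
  moreover have "uniform_limit {0..0} (\<lambda>k t. poly ((\<lambda>k::nat. 0) k) t) (\<lambda>t::real. t powr (p / 2)) sequentially"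
    by (rule uniform_limitI) (auto simp: dist_real_def)
  moreover have "\<forall>\<epsilon>>0. \<forall>\<^sub>F k in sequentially. \<forall>f\<in>A. nrm (op_poly ((\<lambda>k::nat. 0) k) HH f - B f) \<le> \<epsilon> * nrm f"
  proof (intro allI impI always_eventually ballI)
    fix \<epsilon> :: real and k f assume e: "\<epsilon> > 0" and f: "f \<in> A"
    have "op_poly 0 HH f = 0" by (simp add: op_poly_def cscale_def fun_eq_iff)
    then show "nrm (op_poly ((\<lambda>k::nat. 0) k) HH f - B f) \<le> \<epsilon> * nrm f"
      using n0 e A.nrm_ge0[OF f] by (simp add: B_def)
  qed
  ultimately have "is_op_powr A ip HH (p / 2) B"
    unfolding is_op_powr_def by (intro conjI exI[of _ "0::real"] exI[of _ "\<lambda>k::nat. 0"] order_refl)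
  moreover have "sa_trace_class A ip B"
    unfolding sa_trace_class_def
  proof (intro conjI)
    show "self_adjoint_op A ip B"
      unfolding self_adjoint_op_def B_def using A.ip_zero A.ip_zero_right by simp
    show "compact_op A ip B"
      unfolding compact_op_def B_def
    proof (intro allI impI bexI[of _ 0] exI[of _ id] conjI)
      show "(\<lambda>k. nrm (0 - 0)) \<longlonglongrightarrow> 0" using n0 by simp
    qed (auto simp: strict_mono_def A.zero_in)
    \<comment> \<open>The only possible eigenvalue is 0, so the sum has at most one term, whatever
      the dimension of the eigenspace.\<close>
    have "{l. \<exists>f\<in>eigenspace A B l. f \<noteq> 0} \<subseteq> {0}"
    proof
      fix l assume "l \<in> {l. \<exists>f\<in>eigenspace A B l. f \<noteq> 0}"
      then obtain f where f: "f \<in> eigenspace A B l" "f \<noteq> 0" by (elim CollectE bexE)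
      have "0 = cscale l f" using f(1) unfolding eigenspace_def mem_Collect_eq B_def by (rule conjunct2)
      moreover obtain x where "f x \<noteq> 0"
      proof -
        have "\<not> (\<forall>x. f x = 0)" using f(2) by (intro notI) (simp add: fun_eq_iff)
        then show thesis using that by blast
      qed
      moreover have "l * f x = 0" if "0 = cscale l f" for x using fun_cong[OF that, of x] by (simp add: cscale_def)
      ultimately show "l \<in> {0}" by (metis mult_eq_0_iff singletonI)
    qed
    then have "finite {l. \<exists>f\<in>eigenspace A B l. f \<noteq> 0}" by (rule finite_subset) simp
    then show "(\<lambda>l. real (vector_space.dim cscale (eigenspace A B l)) * cmod l)
        summable_on {l. \<exists>f\<in>eigenspace A B l. f \<noteq> 0}" by (rule summable_on_finite)
  qed
  ultimately have "\<exists>B. is_op_powr A ip HH (p / 2) B \<and> sa_trace_class A ip B" by (intro exI conjI)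
  moreover have "bounded_operator A L ip H" by (rule bo[OF _ L.zero_in]) (rule H0)
  ultimately show ?thesis unfolding schatten_class_def by (intro conjI)
qed

section \<open>Strict convexity at a farthest boundary point\<close>

lemma norm_plus_sq: "(norm (x + y))\<^sup>2 = (norm x)\<^sup>2 + 2 * (x \<bullet> y) + (norm y)\<^sup>2" for x y :: "'a::real_inner"
  by (simp add: power2_norm_eq_inner inner_add inner_commute)

text \<open>\<open>r1\<close> and \<open>r2\<close> are the first and second derivatives of the
  local defining function \<open>r\<close>. The ball of radius \<open>norm q\<close> about 0 touches
  the domain at q from outside, and all convexity below is inherited from it.\<close>

locale farthest_point =
  fixes \<Omega> U :: "'a::euclidean_space set" and r :: "'a \<Rightarrow> real"
    and r1 :: "'a \<Rightarrow> 'a \<Rightarrow>\<^sub>L real" and r2 :: "'a \<Rightarrow> 'a \<Rightarrow>\<^sub>L 'a \<Rightarrow>\<^sub>L real" and q :: 'a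
  assumes dom_open: "open \<Omega>" and U_open: "open U" and q_U: "q \<in> U" and q_frontier: "q \<in> frontier \<Omega>"
    and dom_U: "\<Omega> \<inter> U = {x \<in> U. r x < 0}"
    and r1: "\<And>x. x \<in> U \<Longrightarrow> (r has_derivative blinfun_apply (r1 x)) (at x)"
    and r2: "\<And>x. x \<in> U \<Longrightarrow> (r1 has_derivative blinfun_apply (r2 x)) (at x)"
    and r2_cont: "continuous_on U r2"
    and r1_nz: "r1 q \<noteq> 0"
    and far: "\<And>x. x \<in> \<Omega> \<Longrightarrow> norm x \<le> norm q" and q_nz: "q \<noteq> 0"
begin

definition d :: "'a \<Rightarrow> 'a \<Rightarrow> real" where "d x v = blinfun_apply (r1 x) v"
definition h :: "'a \<Rightarrow> 'a \<Rightarrow> 'a \<Rightarrow> real" where "h x u v = blinfun_apply (blinfun_apply (r2 x) u) v"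

lemma d_linear: "d x (u + v) = d x u + d x v" "d x (u - v) = d x u - d x v" "d x (a *\<^sub>R v) = a * d x v" "d x 0 = 0" "d x (- v) = - d x v"
  by (simp_all add: d_def blinfun.bilinear_simps)

lemma h_linear: "h x (u + u') v = h x u v + h x u' v" "h x u (v + v') = h x u v + h x u v'"
  "h x (a *\<^sub>R u) v = a * h x u v" "h x u (a *\<^sub>R v) = a * h x u v"
  by (simp_all add: h_def blinfun.bilinear_simps)

lemma d_bound: "\<bar>d x v\<bar> \<le> norm (r1 x) * norm v"
  unfolding d_def using norm_blinfun[of "r1 x" v] by simp

lemma d_diff_bound: "\<bar>d x v - d y v\<bar> \<le> norm (r1 x - r1 y) * norm v"
  unfolding d_def using norm_blinfun[of "r1 x - r1 y" v] by (simp add: blinfun.bilinear_simps)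

lemma h_bound: "\<bar>h x u v\<bar> \<le> norm (r2 x) * norm u * norm v"
proof -
  have "\<bar>h x u v\<bar> \<le> norm (blinfun_apply (r2 x) u) * norm v"
    unfolding h_def using norm_blinfun[of "blinfun_apply (r2 x) u" v] by simp
  also have "\<dots> \<le> norm (r2 x) * norm u * norm v" by (intro mult_right_mono norm_blinfun) auto
  finally show ?thesis .
qed

lemma h_diff_bound: "\<bar>h x v v - h y v v\<bar> \<le> norm (r2 x - r2 y) * (norm v)\<^sup>2"
proof -
  have "\<bar>h x v v - h y v v\<bar> \<le> norm (blinfun_apply (r2 x - r2 y) v) * norm v"
    unfolding h_def using norm_blinfun[of "blinfun_apply (r2 x - r2 y) v" v] by (simp add: blinfun.bilinear_simps)
  also have "\<dots> \<le> norm (r2 x - r2 y) * norm v * norm v" by (intro mult_right_mono norm_blinfun) auto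
  finally show ?thesis by (simp add: power2_eq_square)
qed

lemma r1_cont: "continuous_on U r1"
  by (intro continuous_at_imp_continuous_on ballI has_derivative_continuous[OF r2])

lemma r_cont: "continuous_on U r"
  by (intro continuous_at_imp_continuous_on ballI has_derivative_continuous[OF r1])

lemma r_line: "x + t *\<^sub>R y \<in> U \<Longrightarrow> ((\<lambda>t. r (x + t *\<^sub>R y)) has_field_derivative d (x + t *\<^sub>R y) y) (at t)"
proof -
  assume "x + t *\<^sub>R y \<in> U"
  have "((\<lambda>t. x + t *\<^sub>R y) has_derivative (\<lambda>s. s *\<^sub>R y)) (at t)" by (auto intro!: derivative_eq_intros)
  from has_derivative_compose[OF this r1[OF \<open>x + t *\<^sub>R y \<in> U\<close>]]
  show ?thesis by (simp add: has_field_derivative_def d_def blinfun.bilinear_simps mult.commute[of _ "blinfun_apply _ _"])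
qed

lemma d_line: "x + t *\<^sub>R y \<in> U \<Longrightarrow> ((\<lambda>t. d (x + t *\<^sub>R y) y) has_field_derivative h (x + t *\<^sub>R y) y y) (at t)"
proof -
  assume "x + t *\<^sub>R y \<in> U"
  have "((\<lambda>t. x + t *\<^sub>R y) has_derivative (\<lambda>s. s *\<^sub>R y)) (at t)" by (auto intro!: derivative_eq_intros)
  from has_derivative_compose[OF this r2[OF \<open>x + t *\<^sub>R y \<in> U\<close>]]
  have "((\<lambda>t. r1 (x + t *\<^sub>R y)) has_derivative (\<lambda>s. blinfun_apply (r2 (x + t *\<^sub>R y)) (s *\<^sub>R y))) (at t)" .
  from blinfun.FDERIV[OF this has_derivative_const[of y]]
  show ?thesis by (simp add: has_field_derivative_def d_def h_def blinfun.bilinear_simps mult.commute[of _ "blinfun_apply _ _"])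
qed

lemma taylor:
  assumes "\<And>t. 0 \<le> t \<Longrightarrow> t \<le> 1 \<Longrightarrow> x + t *\<^sub>R y \<in> U"
  obtains t where "0 < t" "t < 1" "r (x + y) = r x + d x y + h (x + t *\<^sub>R y) y y / 2"
proof -
  define diff where "diff m t = (if m = 0 then r (x + t *\<^sub>R y) else if m = 1 then d (x + t *\<^sub>R y) y else h (x + t *\<^sub>R y) y y)" for m :: nat and t
  have "\<exists>t>0. t < 1 \<and> diff 0 1 = (\<Sum>m<2. diff m 0 / fact m * 1 ^ m) + diff 2 t / fact 2 * 1 ^ 2"
  proof (rule Maclaurin)
    show "\<forall>m t. m < 2 \<and> 0 \<le> t \<and> t \<le> 1 \<longrightarrow> (diff m has_real_derivative diff (Suc m) t) (at t)"
    proof (intro allI impI)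
      fix m :: nat and t :: real assume a: "m < 2 \<and> 0 \<le> t \<and> t \<le> 1"
      then have "x + t *\<^sub>R y \<in> U" using assms by blast
      then show "(diff m has_real_derivative diff (Suc m) t) (at t)"
        using r_line[of x t y] d_line[of x t y] a by (cases "m = 0") (auto simp: diff_def[abs_def] less_2_cases_iff)
    qed
  qed auto
  then obtain t where "t > 0" "t < 1" "diff 0 1 = (\<Sum>m<2. diff m 0 / fact m * 1 ^ m) + diff 2 t / fact 2 * 1 ^ 2" by blast
  then show ?thesis using that[of t] by (simp add: diff_def numeral_2_eq_2)
qed

lemma frontier_zero:
  assumes b: "b \<in> frontier \<Omega>" "b \<in> U"
  shows "r b = 0"
proof -
  have "b \<notin> \<Omega>" using b(1) dom_open by (simp add: frontier_def interior_open)
  then have "\<not> r b < 0" using b(2) dom_U by blast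
  moreover have "\<not> r b > 0"
  proof
    assume "r b > 0"
    moreover have "isCont r b" using r1[OF b(2)] has_derivative_continuous by blast
    ultimately have "\<forall>\<^sub>F x in nhds b. r x > 0 \<and> x \<in> U"
      using b(2) U_open by (intro eventually_conj order_tendstoD(1)[of r "r b"] eventually_nhds_in_open)
        (auto simp: isCont_def tendsto_at_iff_tendsto_nhds)
    then obtain V where V: "open V" "b \<in> V" "\<And>x. x \<in> V \<Longrightarrow> r x > 0 \<and> x \<in> U" unfolding eventually_nhds by blast
    have "b \<in> closure \<Omega>" using b(1) by (simp add: frontier_def)
    then have "V \<inter> \<Omega> \<noteq> {}" using V(1,2) open_Int_closure_eq_empty[OF V(1), of \<Omega>] by blast
    then obtain x where "x \<in> V" "x \<in> \<Omega>" by blast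
    moreover from this have "x \<in> {x \<in> U. r x < 0}" unfolding dom_U[symmetric] using V(3) by blast
    ultimately show False using V(3)[of x] by simp
  qed
  ultimately show ?thesis by simp
qed

lemma descent_in_domain:
  assumes b: "b \<in> U" "r b = 0" and v: "d b v < 0"
  obtains e where "0 < e" "\<And>t. 0 < t \<Longrightarrow> t < e \<Longrightarrow> b + t *\<^sub>R v \<in> \<Omega>"
proof -
  have "((\<lambda>t. r (b + t *\<^sub>R v)) has_field_derivative d b v) (at 0)"
    using r_line[of b 0 v] b by simp
  from DERIV_neg_dec_right[OF this v] obtain e1 where e1: "e1 > 0" "\<And>t. t > 0 \<Longrightarrow> t < e1 \<Longrightarrow> r (b + t *\<^sub>R v) < 0"
    using b(2) by auto
  have "open ((\<lambda>t. b + t *\<^sub>R v) -` U)" by (intro open_vimage U_open continuous_intros)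
  moreover have "0 \<in> (\<lambda>t. b + t *\<^sub>R v) -` U" using b by simp
  ultimately obtain e2 where e2: "e2 > 0" "ball 0 e2 \<subseteq> (\<lambda>t. b + t *\<^sub>R v) -` U" using open_contains_ball by blast
  have "b + t *\<^sub>R v \<in> \<Omega>" if "0 < t" "t < min e1 e2" for t
  proof -
    have "b + t *\<^sub>R v \<in> U" using e2(2) that by (auto simp: subset_iff)
    then show ?thesis using e1(2)[of t] that dom_U by auto
  qed
  then show ?thesis using that[of "min e1 e2"] e1(1) e2(1) by simp
qed

text \<open>A Lagrange multiplier argument: moving from q in a direction that decreases r enters the
  domain and so cannot increase the norm. The half-space where d q is negative thus lies in the one
  where the inner product with q is at most 0, which forces the gradient to be a positive multiple
  of q.\<close>

lemma gradient_radial: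
  obtains l where "0 < l" "\<And>v. d q v = l * (q \<bullet> v)"
proof -
  define g where "g = (\<Sum>b\<in>Basis. d q b *\<^sub>R b)"
  have g: "d q v = g \<bullet> v" for v
  proof -
    have "d q v = d q (\<Sum>b\<in>Basis. (v \<bullet> b) *\<^sub>R b)" by (simp add: euclidean_representation)
    also have "\<dots> = (\<Sum>b\<in>Basis. (v \<bullet> b) * d q b)" unfolding d_def by (simp add: blinfun.sum_right blinfun.scaleR_right)
    also have "\<dots> = g \<bullet> v" 
      unfolding g_def inner_sum_left by (intro sum.cong) (simp_all add: inner_commute mult.commute)
    finally show ?thesis .
  qed
  have half: "q \<bullet> v \<le> 0" if v: "g \<bullet> v < 0" for v
  proof -
    have v': "d q v < 0" using v g by simp
    obtain e where e: "0 < e" "\<And>t. 0 < t \<Longrightarrow> t < e \<Longrightarrow> q + t *\<^sub>R v \<in> \<Omega>"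
      using descent_in_domain[OF q_U frontier_zero[OF q_frontier q_U] v'] by blast
    define t where "t = e / 2"
    have t: "t > 0" using e by (simp add: t_def)
    have "norm (q + t *\<^sub>R v) \<le> norm q" using e by (intro far) (simp add: t_def)
    then have "(norm (q + t *\<^sub>R v))\<^sup>2 \<le> (norm q)\<^sup>2" by (intro power_mono) auto
    then have "2 * (t * (q \<bullet> v)) + t\<^sup>2 * (norm v)\<^sup>2 \<le> 0"
      using norm_plus_sq[of q "t *\<^sub>R v"] by (simp add: power_mult_distrib)
    moreover have "0 \<le> t\<^sup>2 * (norm v)\<^sup>2" by simp
    ultimately have "t * (q \<bullet> v) \<le> 0" by linarith
    then show ?thesis using t by (simp add: mult_le_0_iff)
  qed
  have g0: "g \<noteq> 0"
  proof
    assume "g = 0"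
    then have "blinfun_apply (r1 q) v = 0" for v using g[of v] by (simp add: d_def)
    then show False using r1_nz by (simp add: blinfun_eqI)
  qed
  have gg: "g \<bullet> g > 0" using g0 by simp
  \<comment> \<open>A direction orthogonal to g becomes a descent direction after subtracting a
    small multiple of g; let the multiple tend to 0.\<close>
  have perp: "q \<bullet> v \<le> 0" if v: "g \<bullet> v = 0" for v
  proof (rule field_le_epsilon)
    fix e :: real assume e: "0 < e"
    define s where "s = e / (\<bar>q \<bullet> g\<bar> + 1)"
    have s: "s > 0" using e by (simp add: s_def add_nonneg_pos)
    have "q \<bullet> (v - s *\<^sub>R g) \<le> 0" using gg s v by (intro half) (simp add: inner_diff_right)
    then have "q \<bullet> v \<le> s * (q \<bullet> g)" by (simp add: inner_diff_right)
    also have "\<dots> \<le> s * (\<bar>q \<bullet> g\<bar> + 1)" using s by (intro mult_left_mono) auto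
    also have "\<dots> = e" unfolding s_def by (simp add: add_nonneg_pos)
    finally show "q \<bullet> v \<le> 0 + e" by simp
  qed
  define m where "m = (q \<bullet> g) / (g \<bullet> g)"
  define v where "v = q - m *\<^sub>R g"
  have gv: "g \<bullet> v = 0" using gg by (simp add: v_def m_def inner_diff_right inner_commute)
  have "q \<bullet> v = v \<bullet> v" using gv by (simp add: v_def inner_diff_left inner_diff_right inner_commute)
  then have "v = 0" using perp[OF gv] inner_ge_zero[of v] by (metis antisym inner_eq_zero_iff)
  then have qm: "q = m *\<^sub>R g" by (simp add: v_def)
  have "q \<bullet> (- g) \<le> 0" using gg by (intro half) simp
  then have "0 \<le> m" using gg by (simp add: m_def)
  moreover have "m \<noteq> 0" using qm q_nz by auto
  ultimately have m: "0 < m" by simp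
  show ?thesis
  proof (rule that[of "1 / m"])
    show "0 < 1 / m" using m by simp
    show "d q v = 1 / m * (q \<bullet> v)" for v using m by (simp add: g) (simp add: qm)
  qed
qed

text \<open>If this failed, the curve \<open>q + \<epsilon>v - a\<epsilon>\<^sup>2q\<close> would enter the domain outside the ball of radius \<open>|q|\<close>.\<close>

lemma hessian_tangential:
  assumes l: "0 < l" "\<And>v. d q v = l * (q \<bullet> v)" and v: "q \<bullet> v = 0"
  shows "l * (norm v)\<^sup>2 \<le> h q v v"
proof (rule ccontr)
  assume "\<not> l * (norm v)\<^sup>2 \<le> h q v v"
  then have hv: "h q v v < l * (norm v)\<^sup>2" by simp
  define R2 where "R2 = (norm q)\<^sup>2"
  have R2: "R2 > 0" using q_nz by (simp add: R2_def)
  \<comment> \<open>The midpoint between the bounds a > h q v v / (2 l R2), which makes r negative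
    on the curve, and a < |v|^2 / (2 R2), which makes the curve leave the ball. There is room
    between them exactly when the claim fails.\<close>
  define a where "a = (h q v v + l * (norm v)\<^sup>2) / (4 * l * R2)"
  have a1: "h q v v / 2 - a * l * R2 < 0" and a2: "2 * a * R2 < (norm v)\<^sup>2"
    using hv l R2 by (simp_all add: a_def field_simps)
  define \<epsilon> where "\<epsilon> k = inverse (real (Suc k))" for k
  define w where "w k = v - (a * \<epsilon> k) *\<^sub>R q" for k
  have \<epsilon>: "\<epsilon> k > 0" for k by (simp add: \<epsilon>_def)
  have \<epsilon>0: "\<epsilon> \<longlonglongrightarrow> 0" unfolding \<epsilon>_def by (rule LIMSEQ_inverse_real_of_nat)
  have w0: "w \<longlonglongrightarrow> v"
  proof -
    have "(\<lambda>k. v - (a * \<epsilon> k) *\<^sub>R q) \<longlonglongrightarrow> v - (a * 0) *\<^sub>R q" by (intro tendsto_intros \<epsilon>0)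
    then show ?thesis by (simp add: w_def[abs_def])
  qed
  obtain \<eta> where \<eta>: "\<eta> > 0" "ball q \<eta> \<subseteq> U" using U_open q_U open_contains_ball by blast
  have y0: "(\<lambda>k. \<epsilon> k *\<^sub>R w k) \<longlonglongrightarrow> 0" using tendsto_scaleR[OF \<epsilon>0 w0] by simp
  then have "\<forall>\<^sub>F k in sequentially. norm (\<epsilon> k *\<^sub>R w k) < \<eta>" using \<eta>(1) tendstoD[OF y0 \<eta>(1)] by (simp add: dist_norm)
  then obtain N where N: "\<And>k. k \<ge> N \<Longrightarrow> norm (\<epsilon> k *\<^sub>R w k) < \<eta>" unfolding eventually_sequentially by blast
  have inU: "q + t *\<^sub>R (\<epsilon> k *\<^sub>R w k) \<in> U" if "k \<ge> N" "0 \<le> t" "t \<le> 1" for k t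
  proof -
    have "norm (t *\<^sub>R (\<epsilon> k *\<^sub>R w k)) \<le> 1 * norm (\<epsilon> k *\<^sub>R w k)"
      unfolding norm_scaleR[of t] using that by (intro mult_right_mono) auto
    then show ?thesis using N[OF that(1)] \<eta>(2) by (auto simp: dist_norm subset_iff)
  qed
  have "\<exists>t. 0 < t \<and> t < 1 \<and> r (q + \<epsilon> k *\<^sub>R w k) = r q + d q (\<epsilon> k *\<^sub>R w k) + h (q + t *\<^sub>R (\<epsilon> k *\<^sub>R w k)) (\<epsilon> k *\<^sub>R w k) (\<epsilon> k *\<^sub>R w k) / 2" if "k \<ge> N" for k
    using taylor[OF inU[OF that]] by metis
  then obtain \<tau> where \<tau>: "\<And>k. k \<ge> N \<Longrightarrow> 0 < \<tau> k \<and> \<tau> k < 1 \<and> r (q + \<epsilon> k *\<^sub>R w k) = r q + d q (\<epsilon> k *\<^sub>R w k) + h (q + \<tau> k *\<^sub>R (\<epsilon> k *\<^sub>R w k)) (\<epsilon> k *\<^sub>R w k) (\<epsilon> k *\<^sub>R w k) / 2"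
    by metis
  define \<xi> where "\<xi> k = q + \<tau> k *\<^sub>R (\<epsilon> k *\<^sub>R w k)" for k
  have \<xi>0: "\<xi> \<longlonglongrightarrow> q"
  proof -
    have "(\<lambda>k. \<xi> k - q) \<longlonglongrightarrow> 0"
    proof (rule Lim_null_comparison[OF _ tendsto_norm_zero[OF y0]])
      have "norm (\<xi> k - q) \<le> norm (\<epsilon> k *\<^sub>R w k)" if "k \<ge> N" for k
      proof -
        have "norm (\<xi> k - q) = \<bar>\<tau> k\<bar> * norm (\<epsilon> k *\<^sub>R w k)" unfolding \<xi>_def by (simp only: add_diff_cancel_left' norm_scaleR[of "\<tau> k"])
        also have "\<dots> \<le> 1 * norm (\<epsilon> k *\<^sub>R w k)" using \<tau>[OF that] by (intro mult_right_mono) auto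
        finally show ?thesis by simp
      qed
      then show "\<forall>\<^sub>F k in sequentially. norm (\<xi> k - q) \<le> norm (\<epsilon> k *\<^sub>R w k)" unfolding eventually_sequentially by blast
    qed
    then show ?thesis using LIM_zero_iff by blast
  qed
  have hl: "(\<lambda>k. h (\<xi> k) (w k) (w k)) \<longlonglongrightarrow> h q v v"
  proof -
    have "isCont r2 q" using r2_cont U_open q_U continuous_on_eq_continuous_at by blast
    then have "(\<lambda>k. r2 (\<xi> k)) \<longlonglongrightarrow> r2 q" using \<xi>0 by (rule isCont_tendsto_compose)
    then show ?thesis unfolding h_def by (intro blinfun.tendsto w0)
  qed
  have "(\<lambda>k. h (\<xi> k) (w k) (w k) / 2 - a * l * R2) \<longlonglongrightarrow> h q v v / 2 - a * l * R2" by (intro tendsto_intros hl) simp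
  then have ev1: "\<forall>\<^sub>F k in sequentially. h (\<xi> k) (w k) (w k) / 2 - a * l * R2 < 0" using a1 by (rule order_tendstoD)
  have "(\<lambda>k. 2 * a * R2 - a\<^sup>2 * (\<epsilon> k)\<^sup>2 * R2) \<longlonglongrightarrow> 2 * a * R2 - a\<^sup>2 * 0\<^sup>2 * R2" by (intro tendsto_intros \<epsilon>0)
  then have ev2: "\<forall>\<^sub>F k in sequentially. 2 * a * R2 - a\<^sup>2 * (\<epsilon> k)\<^sup>2 * R2 < (norm v)\<^sup>2" using a2 by (intro order_tendstoD(2)) auto
  have "\<forall>\<^sub>F k in sequentially. k \<ge> N \<and> h (\<xi> k) (w k) (w k) / 2 - a * l * R2 < 0 \<and> 2 * a * R2 - a\<^sup>2 * (\<epsilon> k)\<^sup>2 * R2 < (norm v)\<^sup>2"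
    by (intro eventually_conj ev1 ev2 eventually_ge_at_top)
  then obtain k where k: "k \<ge> N" "h (\<xi> k) (w k) (w k) / 2 - a * l * R2 < 0" "2 * a * R2 - a\<^sup>2 * (\<epsilon> k)\<^sup>2 * R2 < (norm v)\<^sup>2"
    unfolding eventually_sequentially by blast
  have qw: "q \<bullet> w k = - (a * \<epsilon> k * R2)" using v by (simp add: w_def inner_diff_right R2_def power2_norm_eq_inner)
  have "r (q + \<epsilon> k *\<^sub>R w k) = (\<epsilon> k)\<^sup>2 * (h (\<xi> k) (w k) (w k) / 2 - a * l * R2)"
    using \<tau>[OF k(1), folded \<xi>_def] frontier_zero[OF q_frontier q_U] qw
    by (simp add: d_linear h_linear l(2) power2_eq_square algebra_simps)
  also have "\<dots> < 0" using k(2) \<epsilon>[of k] by (intro mult_pos_neg) auto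
  finally have "q + \<epsilon> k *\<^sub>R w k \<in> \<Omega>" using dom_U inU[OF k(1), of 1] by auto
  then have "(norm (q + \<epsilon> k *\<^sub>R w k))\<^sup>2 \<le> (norm q)\<^sup>2" by (intro power_mono far) auto
  moreover have "(norm (q + \<epsilon> k *\<^sub>R w k))\<^sup>2 = (norm q)\<^sup>2 + (\<epsilon> k)\<^sup>2 * ((norm v)\<^sup>2 - (2 * a * R2 - a\<^sup>2 * (\<epsilon> k)\<^sup>2 * R2))"
  proof -
    have "(norm (w k))\<^sup>2 = (norm v)\<^sup>2 + (a * \<epsilon> k)\<^sup>2 * R2"
      using norm_plus_sq[of v "- (a * \<epsilon> k) *\<^sub>R q"] v
      by (simp add: w_def inner_commute R2_def power_mult_distrib)
    moreover have "(norm (q + \<epsilon> k *\<^sub>R w k))\<^sup>2 = (norm q)\<^sup>2 + 2 * \<epsilon> k * (q \<bullet> w k) + (\<epsilon> k)\<^sup>2 * (norm (w k))\<^sup>2"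
      using norm_plus_sq[of q "\<epsilon> k *\<^sub>R w k"] by (simp add: power_mult_distrib)
    ultimately show ?thesis unfolding qw by (simp add: power2_eq_square algebra_simps)
  qed
  ultimately have "(\<epsilon> k)\<^sup>2 * ((norm v)\<^sup>2 - (2 * a * R2 - a\<^sup>2 * (\<epsilon> k)\<^sup>2 * R2)) \<le> 0" by simp
  moreover have "0 < (\<epsilon> k)\<^sup>2 * ((norm v)\<^sup>2 - (2 * a * R2 - a\<^sup>2 * (\<epsilon> k)\<^sup>2 * R2))"
    using k(3) \<epsilon>[of k] by (intro mult_pos_pos) auto
  ultimately show False by simp
qed

text \<open>Split v into w orthogonal to q and a radial part s q. The tangential bound controls w,
  the mixed terms are absorbed into half of it, and everything in s^2 is charged to (d q v)^2 = (l
  R^2 s)^2.\<close>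

lemma hessian_at_q:
  assumes l: "0 < l" "\<And>v. d q v = l * (q \<bullet> v)"
  obtains \<kappa> where "0 < \<kappa>" "\<And>v. l / 2 * (norm v)\<^sup>2 - \<kappa> * (d q v)\<^sup>2 \<le> h q v v"
proof -
  define R where "R = norm q"
  have R: "R > 0" using q_nz by (simp add: R_def)
  define M where "M = norm (r2 q)"
  have M: "M \<ge> 0" by (simp add: M_def)
  define B where "B = 2 * M\<^sup>2 * R\<^sup>2 / l + M * R\<^sup>2 + l * R\<^sup>2 / 2"
  define \<kappa> where "\<kappa> = B / (l * R\<^sup>2)\<^sup>2"
  have B: "B > 0" unfolding B_def using M l R by (intro add_nonneg_pos add_nonneg_nonneg) auto
  have "l / 2 * (norm v)\<^sup>2 - \<kappa> * (d q v)\<^sup>2 \<le> h q v v" for v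
  proof -
    define s where "s = (q \<bullet> v) / R\<^sup>2"
    define w where "w = v - s *\<^sub>R q"
    have qq: "q \<bullet> q = R\<^sup>2" by (simp add: R_def power2_norm_eq_inner)
    have qw: "q \<bullet> w = 0" using R by (simp add: w_def s_def inner_diff_right qq)
    have v: "v = w + s *\<^sub>R q" by (simp add: w_def)
    have nv: "(norm v)\<^sup>2 = (norm w)\<^sup>2 + s\<^sup>2 * R\<^sup>2"
      unfolding v using norm_plus_sq[of w "s *\<^sub>R q"] qw by (simp add: inner_commute power_mult_distrib R_def)
    have hq: "h q v v = h q w w + s * h q w q + s * h q q w + s\<^sup>2 * h q q q"
      unfolding v by (simp add: h_linear power2_eq_square algebra_simps)
    have b1: "l * (norm w)\<^sup>2 \<le> h q w w" by (rule hessian_tangential[OF l qw])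
    have b2: "- (\<bar>s\<bar> * (M * norm w * R)) \<le> s * h q w q"
      using mult_left_mono[OF h_bound[of q w q], of "\<bar>s\<bar>"] by (simp add: M_def R_def abs_mult[symmetric])
    have b3: "- (\<bar>s\<bar> * (M * norm w * R)) \<le> s * h q q w"
      using mult_left_mono[OF h_bound[of q q w], of "\<bar>s\<bar>"] by (simp add: M_def R_def abs_mult[symmetric] mult_ac)
    have "- (M * R\<^sup>2) \<le> h q q q"
      using h_bound[of q q q] by (simp add: M_def R_def power2_eq_square mult.assoc)
    then have "s\<^sup>2 * - (M * R\<^sup>2) \<le> s\<^sup>2 * h q q q" by (intro mult_left_mono) auto
    then have b4: "- (s\<^sup>2 * (M * R\<^sup>2)) \<le> s\<^sup>2 * h q q q" by simp
    \<comment> \<open>The arithmetic-geometric mean inequality, weighted so that the mixed terms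
      cost only half of the tangential bound.\<close>
    have b5: "2 * (\<bar>s\<bar> * (M * norm w * R)) \<le> l / 2 * (norm w)\<^sup>2 + 2 * M\<^sup>2 * R\<^sup>2 / l * s\<^sup>2"
    proof -
      have "0 \<le> (l * norm w - 2 * M * R * \<bar>s\<bar>)\<^sup>2 / (2 * l)" using l by simp
      also have "\<dots> = l / 2 * (norm w)\<^sup>2 + 2 * M\<^sup>2 * R\<^sup>2 / l * s\<^sup>2 - 2 * (\<bar>s\<bar> * (M * norm w * R))"
        using l by (simp add: power2_eq_square field_simps)
      finally show ?thesis by simp
    qed
    have "l / 2 * (norm v)\<^sup>2 - B * s\<^sup>2 \<le> h q v v"
      unfolding hq nv using b1 b2 b3 b4 b5 by (simp add: B_def algebra_simps)
    moreover have "B * s\<^sup>2 = \<kappa> * (d q v)\<^sup>2"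
      using R l by (simp add: \<kappa>_def s_def l(2) power_mult_distrib power_divide)
    ultimately show ?thesis by simp
  qed
  moreover have "\<kappa> > 0" unfolding \<kappa>_def using B R l by simp
  ultimately show ?thesis using that by blast
qed

text \<open>Continuity of \<open>r1\<close> and \<open>r2\<close>. The points \<xi> and z are
  independent because in Taylor's formula the Hessian is taken at an intermediate point and the
  gradient at the base point.\<close>

lemma hessian_near_q:
  obtains c \<kappa> \<eta> where "0 < c" "0 < \<kappa>" "0 < \<eta>" "ball q \<eta> \<subseteq> U"
    "\<And>\<xi> z v. \<xi> \<in> ball q \<eta> \<Longrightarrow> z \<in> ball q \<eta> \<Longrightarrow> c * (norm v)\<^sup>2 - \<kappa> * (d z v)\<^sup>2 \<le> h \<xi> v v"
proof -
  obtain l where l: "0 < l" "\<And>v. d q v = l * (q \<bullet> v)" using gradient_radial by blast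
  obtain \<kappa> where \<kappa>: "0 < \<kappa>" "\<And>v. l / 2 * (norm v)\<^sup>2 - \<kappa> * (d q v)\<^sup>2 \<le> h q v v" using hessian_at_q[OF l] by blast
  have "isCont r2 q" "isCont r1 q" using r2_cont r1_cont U_open q_U continuous_on_eq_continuous_at by blast+
  \<comment> \<open>Replacing \<open>r2 q\<close> by \<open>r2 \<xi>\<close> and \<open>d q\<close>
    by \<open>d z\<close> costs l / 8 each, which leaves l / 4 of the l / 2 available at q.\<close>
  define e where "e = min (l / 8) (sqrt (l / (16 * \<kappa>)))"
  have e: "e > 0" using l \<kappa> by (simp add: e_def)
  obtain \<eta>0 where \<eta>0: "\<eta>0 > 0" "ball q \<eta>0 \<subseteq> U" using U_open q_U open_contains_ball by blast
  obtain \<eta>1 where \<eta>1: "\<eta>1 > 0" "\<And>x. dist x q < \<eta>1 \<Longrightarrow> dist (r2 x) (r2 q) < e"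
    using \<open>isCont r2 q\<close> e unfolding continuous_at_eps_delta by blast
  obtain \<eta>2 where \<eta>2: "\<eta>2 > 0" "\<And>x. dist x q < \<eta>2 \<Longrightarrow> dist (r1 x) (r1 q) < e"
    using \<open>isCont r1 q\<close> e unfolding continuous_at_eps_delta by blast
  define \<eta> where "\<eta> = min \<eta>0 (min \<eta>1 \<eta>2)"
  have "l / 4 * (norm v)\<^sup>2 - (2 * \<kappa>) * (d z v)\<^sup>2 \<le> h \<xi> v v" if \<xi>: "\<xi> \<in> ball q \<eta>" and z: "z \<in> ball q \<eta>" for \<xi> z v
  proof -
    have "norm (r2 \<xi> - r2 q) \<le> l / 8" using \<eta>1(2)[of \<xi>] \<xi> by (simp add: \<eta>_def dist_norm e_def norm_minus_commute)
    then have "norm (r2 \<xi> - r2 q) * (norm v)\<^sup>2 \<le> l / 8 * (norm v)\<^sup>2" by (intro mult_right_mono) auto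
    then have 1: "h q v v - l / 8 * (norm v)\<^sup>2 \<le> h \<xi> v v" using h_diff_bound[of \<xi> v q] by linarith
    have "norm (r1 z - r1 q) \<le> sqrt (l / (16 * \<kappa>))" using \<eta>2(2)[of z] z by (simp add: \<eta>_def dist_norm e_def norm_minus_commute)
    then have "(norm (r1 z - r1 q))\<^sup>2 \<le> (sqrt (l / (16 * \<kappa>)))\<^sup>2" by (intro power_mono) auto
    then have n1: "(norm (r1 z - r1 q))\<^sup>2 \<le> l / (16 * \<kappa>)" using l \<kappa> by simp
    have "(d q v - d z v)\<^sup>2 \<le> (norm (r1 z - r1 q) * norm v)\<^sup>2"
      using d_diff_bound[of z v q] by (intro abs_le_square_iff[THEN iffD1]) (simp add: abs_minus_commute)
    also have "\<dots> \<le> l / (16 * \<kappa>) * (norm v)\<^sup>2" unfolding power_mult_distrib using n1 by (intro mult_right_mono) auto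
    finally have dd: "(d q v - d z v)\<^sup>2 \<le> l / (16 * \<kappa>) * (norm v)\<^sup>2" .
    have "(d q v)\<^sup>2 \<le> 2 * (d z v)\<^sup>2 + 2 * (d q v - d z v)\<^sup>2"
      using zero_le_power2[of "2 * d z v - d q v"] by (simp add: power2_eq_square algebra_simps)
    then have "(d q v)\<^sup>2 \<le> 2 * (d z v)\<^sup>2 + 2 * (l / (16 * \<kappa>) * (norm v)\<^sup>2)" using dd by linarith
    then have "\<kappa> * (d q v)\<^sup>2 \<le> \<kappa> * (2 * (d z v)\<^sup>2 + 2 * (l / (16 * \<kappa>) * (norm v)\<^sup>2))" using \<kappa>(1) by (intro mult_left_mono) auto
    also have "\<dots> = 2 * \<kappa> * (d z v)\<^sup>2 + l / 8 * (norm v)\<^sup>2" using \<kappa>(1) by (simp add: field_simps)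
    finally show ?thesis using \<kappa>(2)[of v] 1 by (simp add: algebra_simps)
  qed
  moreover have "ball q \<eta> \<subseteq> U" using \<eta>0(2) by (auto simp: \<eta>_def)
  moreover have "\<eta> > 0" using \<eta>0 \<eta>1 \<eta>2 by (simp add: \<eta>_def)
  ultimately show ?thesis using that[of "l / 4" "2 * \<kappa>" \<eta>] l \<kappa> by simp
qed

text \<open>The estimate that makes \<open>z + ker(d z)\<close> a quantitative supporting hyperplane for the whole domain.\<close>

lemma support_estimate:
  obtains \<rho> c where "0 < \<rho>" "0 < c" "ball q \<rho> \<subseteq> U"
    "\<And>z w. z \<in> \<Omega> \<Longrightarrow> z \<in> ball q \<rho> \<Longrightarrow> w \<in> \<Omega> \<Longrightarrow> c * (norm (w - z))\<^sup>2 + 2 * r z \<le> - d z (w - z)"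
    "\<And>z w. z \<in> \<Omega> \<Longrightarrow> z \<in> ball q \<rho> \<Longrightarrow> w \<in> ball q \<rho> \<Longrightarrow> r w = 0 \<Longrightarrow> d w (z - w) \<noteq> 0"
proof -
  obtain c \<kappa> \<eta> where c: "0 < c" and \<kappa>: "0 < \<kappa>" and \<eta>: "0 < \<eta>" "ball q \<eta> \<subseteq> U"
    and hes: "\<And>\<xi> z v. \<xi> \<in> ball q \<eta> \<Longrightarrow> z \<in> ball q \<eta> \<Longrightarrow> c * (norm v)\<^sup>2 - \<kappa> * (d z v)\<^sup>2 \<le> h \<xi> v v"
    using hessian_near_q by blast
  obtain l where l: "0 < l" "\<And>v. d q v = l * (q \<bullet> v)" using gradient_radial by blast
  define R where "R = norm q"
  have R: "R > 0" using q_nz by (simp add: R_def)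
  have cr1: "isCont r1 q" using r1_cont U_open q_U continuous_on_eq_continuous_at by blast
  define L where "L = norm (r1 q) + 1"
  have L: "L > 0" by (simp add: L_def add_nonneg_pos)
  \<comment> \<open>Chosen so that \<kappa> |d z (w - z)| <= 1 for w and z this close to q; the
    quadratic loss in Taylor's formula is then at most half of the linear term.\<close>
  define \<eta>' where "\<eta>' = min \<eta> (1 / (2 * \<kappa> * L))"
  have \<eta>': "\<eta>' > 0" "\<eta>' \<le> \<eta>" using \<eta> \<kappa> L by (simp_all add: \<eta>'_def)
  define e where "e = min 1 (l * \<eta>'\<^sup>2 / (16 * R))"
  have e: "e > 0" using l \<eta>' R by (simp add: e_def)
  obtain \<eta>2 where \<eta>2: "\<eta>2 > 0" "\<And>x. dist x q < \<eta>2 \<Longrightarrow> dist (r1 x) (r1 q) < e"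
    using cr1 e unfolding continuous_at_eps_delta by blast
  define \<rho> where "\<rho> = min \<eta>' (min \<eta>2 (l * \<eta>'\<^sup>2 / (8 * L)))"
  have \<rho>: "\<rho> > 0" using \<eta>' \<eta>2 l L by (simp add: \<rho>_def)
  define c0 where "c0 = min (c / 3) (l * \<eta>'\<^sup>2 / (16 * R\<^sup>2))"
  have c0: "c0 > 0" using c l \<eta>' R by (simp add: c0_def)
  have line: "x + t *\<^sub>R (y - x) \<in> ball q \<eta>" if "x \<in> ball q \<eta>" "y \<in> ball q \<eta>" "0 \<le> t" "t \<le> 1" for x y t
  proof -
    have "(1 - t) *\<^sub>R x + t *\<^sub>R y \<in> ball q \<eta>" using that convex_ball[of q \<eta>] by (intro convexD) auto
    moreover have "(1 - t) *\<^sub>R x + t *\<^sub>R y = x + t *\<^sub>R (y - x)" by (simp add: algebra_simps)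
    ultimately show ?thesis by simp
  qed
  have tay: "r x + d x (y - x) + (c * (norm (y - x))\<^sup>2 - \<kappa> * (d x (y - x))\<^sup>2) / 2 \<le> r y"
    if xy: "x \<in> ball q \<eta>" "y \<in> ball q \<eta>" for x y
  proof -
    have "x + t *\<^sub>R (y - x) \<in> U" if "0 \<le> t" "t \<le> 1" for t using line[OF xy that] \<eta>(2) by blast
    then obtain t where t: "0 < t" "t < 1" "r (x + (y - x)) = r x + d x (y - x) + h (x + t *\<^sub>R (y - x)) (y - x) (y - x) / 2"
      using taylor[of x "y - x"] by blast
    have "x + t *\<^sub>R (y - x) \<in> ball q \<eta>" using line[OF xy] t by simp
    from hes[OF this xy(1), of "y - x"] show ?thesis using t(3) by simp
  qed
  have main: "c0 * (norm (w - z))\<^sup>2 + 2 * r z \<le> - d z (w - z)" if z: "z \<in> \<Omega>" "z \<in> ball q \<rho>" and w: "w \<in> \<Omega>" for z w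
  proof -
    have z\<eta>: "z \<in> ball q \<eta>" using z(2) \<eta>' by (simp add: \<rho>_def)
    have rz: "r z < 0" using z(1) z\<eta> \<eta>(2) dom_U by blast
    have nr: "norm (r1 z - r1 q) < e" using \<eta>2(2)[of z] z(2) by (simp add: \<rho>_def dist_norm norm_minus_commute)
    show ?thesis
    \<comment> \<open>Near q the estimate comes from Taylor's formula. Away from q it comes from the
      ball containing the domain, whose points stay at a definite distance from the tangent plane at
      q. \<open>c0\<close> is the smaller of the two resulting constants.\<close>
    proof (cases "w \<in> ball q \<eta>'")
      case True
      then have w\<eta>: "w \<in> ball q \<eta>" using \<eta>' by simp
      have rw: "r w < 0" using w w\<eta> \<eta>(2) dom_U by blast
      define x where "x = - d z (w - z)"
      have "norm (r1 z) \<le> L" using nr norm_triangle_sub[of "r1 z" "r1 q"] by (simp add: L_def e_def)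
      moreover have "norm (w - z) \<le> 2 * \<eta>'"
      proof -
        have "dist w z \<le> dist w q + dist q z" by (rule dist_triangle)
        then show ?thesis using True z(2) by (simp add: dist_norm \<rho>_def norm_minus_commute)
      qed
      ultimately have "norm (r1 z) * norm (w - z) \<le> L * (2 * \<eta>')" using L by (intro mult_mono) auto
      then have "\<bar>x\<bar> \<le> L * (2 * \<eta>')" using d_bound[of z "w - z"] by (simp add: x_def)
      also have "\<dots> \<le> L * (2 * (1 / (2 * \<kappa> * L)))" using L by (intro mult_left_mono) (auto simp: \<eta>'_def)
      also have "\<dots> = 1 / \<kappa>" using L \<kappa> by simp
      finally have "\<kappa> * \<bar>x\<bar> \<le> 1" using \<kappa> by (simp add: field_simps)
      then have "\<kappa> * \<bar>x\<bar> * \<bar>x\<bar> \<le> 1 * \<bar>x\<bar>" by (intro mult_right_mono) auto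
      then have x2: "\<kappa> * x\<^sup>2 \<le> \<bar>x\<bar>" by (simp add: power2_eq_square mult.assoc)
      have "r z - x + (c * (norm (w - z))\<^sup>2 - \<kappa> * x\<^sup>2) / 2 < 0"
        using tay[OF z\<eta> w\<eta>] rw by (simp add: x_def)
      then have key: "r z + c * (norm (w - z))\<^sup>2 / 2 < x + \<bar>x\<bar> / 2" using x2 by (simp add: field_simps)
      have "c / 3 * (norm (w - z))\<^sup>2 + 2 * r z \<le> x"
      \<comment> \<open>For negative x the loss |x| / 2 leaves x / 2 on the right; doubling the
        inequality is the origin of the factor 2 in 2 r z.\<close>
      proof (cases "x \<ge> 0")
        case True
        then show ?thesis using key rz by (simp add: field_simps)
      next
        case False
        then have "r z + c * (norm (w - z))\<^sup>2 / 2 < x / 2" using key by simp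
        moreover have "0 \<le> c * (norm (w - z))\<^sup>2" using c by simp
        ultimately show ?thesis by (simp add: field_simps)
      qed
      moreover have "c0 * (norm (w - z))\<^sup>2 \<le> c / 3 * (norm (w - z))\<^sup>2" by (intro mult_right_mono) (auto simp: c0_def)
      ultimately show ?thesis by (simp add: x_def)
    next
      case False
      then have wq: "\<eta>' \<le> norm (w - q)" by (simp add: dist_norm norm_minus_commute)
      have "(norm w)\<^sup>2 \<le> R\<^sup>2" unfolding R_def by (intro power_mono far w) auto
      then have "(norm (w - q))\<^sup>2 \<le> 2 * R\<^sup>2 - 2 * (q \<bullet> w)"
        by (simp add: power2_norm_eq_inner inner_diff inner_commute R_def)
      also have "\<dots> = - 2 * (q \<bullet> (w - q))" by (simp add: inner_diff_right R_def power2_norm_eq_inner)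
      finally have "(norm (w - q))\<^sup>2 \<le> - 2 * (q \<bullet> (w - q))" .
      moreover have "\<eta>'\<^sup>2 \<le> (norm (w - q))\<^sup>2" using wq \<eta>'(1) by (intro power_mono) auto
      ultimately have "\<eta>'\<^sup>2 \<le> - 2 * (q \<bullet> (w - q))" by linarith
      then have "l * \<eta>'\<^sup>2 \<le> l * (- 2 * (q \<bullet> (w - q)))" using l by (intro mult_left_mono) auto
      then have 1: "l * \<eta>'\<^sup>2 / 2 \<le> - d q (w - q)" by (simp add: l(2))
      have nwz: "norm (w - z) \<le> 2 * R"
        using norm_triangle_ineq4[of w z] far[OF w] far[OF z(1)] by (simp add: R_def)
      have "norm (r1 z - r1 q) * norm (w - z) \<le> l * \<eta>'\<^sup>2 / (16 * R) * (2 * R)"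
        using nr nwz R l by (intro mult_mono) (auto simp: e_def)
      then have 2: "\<bar>d z (w - z) - d q (w - z)\<bar> \<le> l * \<eta>'\<^sup>2 / 8"
        using d_diff_bound[of z "w - z" q] R by simp
      have "norm (r1 q) * norm (z - q) \<le> L * (l * \<eta>'\<^sup>2 / (8 * L))"
        using z(2) L by (intro mult_mono) (auto simp: L_def \<rho>_def dist_norm norm_minus_commute)
      then have 3: "\<bar>d q (z - q)\<bar> \<le> l * \<eta>'\<^sup>2 / 8" using d_bound[of q "z - q"] L by simp
      have "d q (w - z) = d q (w - q) - d q (z - q)" by (simp add: d_linear)
      then have 4: "l * \<eta>'\<^sup>2 / 4 \<le> - d z (w - z)" using 1 2 3 by linarith
      have "c0 * (norm (w - z))\<^sup>2 \<le> l * \<eta>'\<^sup>2 / (16 * R\<^sup>2) * (2 * R)\<^sup>2"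
        using nwz c0 R l by (intro mult_mono power_mono) (auto simp: c0_def)
      also have "\<dots> = l * \<eta>'\<^sup>2 / 4" using R by (simp add: power2_eq_square)
      finally show ?thesis using 4 rz by linarith
    qed
  qed
  \<comment> \<open>If z - w were tangential at the boundary point w, Taylor's formula at w would
    give r z >= 0.\<close>
  have nz: "d w (z - w) \<noteq> 0" if z: "z \<in> \<Omega>" "z \<in> ball q \<rho>" and w: "w \<in> ball q \<rho>" "r w = 0" for z w
  proof
    assume d0: "d w (z - w) = 0"
    have zw: "z \<in> ball q \<eta>" "w \<in> ball q \<eta>" using z(2) w(1) \<eta>' by (auto simp: \<rho>_def)
    have "r z < 0" using z(1) zw(1) \<eta>(2) dom_U by blast
    moreover have "c * (norm (z - w))\<^sup>2 / 2 \<le> r z" using tay[OF zw(2,1)] d0 w(2) by simp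
    moreover have "0 \<le> c * (norm (z - w))\<^sup>2" using c by simp
    ultimately show False by linarith
  qed
  have "ball q \<rho> \<subseteq> U" using \<eta>(2) \<eta>'(2) by (auto simp: \<rho>_def)
  then show ?thesis using that[OF \<rho> c0 _ main nz] by blast
qed

end

section \<open>The Bergman kernel near a strictly convex boundary point\<close>

lemma isCont_nhds: "isCont g x \<Longrightarrow> (g \<longlongrightarrow> g x) (nhds x)"
  by (simp add: isCont_def tendsto_at_iff_tendsto_nhds)

locale bergman_farthest = bergman_domain \<Omega> + farthest_point \<Omega> U r r1 r2 q
  for \<Omega> U :: "(complex ^ 'n) set" and r r1 r2 q
begin

text \<open>Component j is twice the Wirtinger derivative of r with respect to z_j.
  \<open>linform (a z)\<close> is the complex linear form with real part \<open>d z\<close>, so its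
  kernel is the complex tangent space of the level set of r.\<close>

definition a :: "complex ^ 'n \<Rightarrow> complex ^ 'n" where
  "a z = (\<chi> j. of_real (d z (axis j 1)) - \<i> * of_real (d z (axis j \<i>)))"

lemma Re_linform_a: "Re (linform (a z) w) = d z w"
proof -
  have w: "w = (\<Sum>j\<in>UNIV. axis j (w $ j))"
  proof (rule vec_eq_iff[THEN iffD2], rule allI)
    fix i
    have "(\<Sum>j\<in>UNIV. axis j (w $ j)) $ i = (\<Sum>j\<in>UNIV. if j = i then w $ i else 0)"
      unfolding sum_component by (intro sum.cong) (auto simp: axis_def)
    then show "w $ i = (\<Sum>j\<in>UNIV. axis j (w $ j)) $ i" by simp
  qed
  have ax: "axis j x = Re x *\<^sub>R axis j 1 + Im x *\<^sub>R axis j (\<i> :: complex)" for j :: 'n and x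
    by (simp add: vec_eq_iff axis_def complex_eq_iff)
  have "d z w = (\<Sum>j\<in>UNIV. d z (axis j (w $ j)))"
    by (subst w) (simp only: d_def blinfun.sum_right)
  also have "\<dots> = (\<Sum>j\<in>UNIV. Re (w $ j) * d z (axis j 1) + Im (w $ j) * d z (axis j \<i>))"
  proof (rule sum.cong[OF refl])
    fix j
    show "d z (axis j (w $ j)) = Re (w $ j) * d z (axis j 1) + Im (w $ j) * d z (axis j \<i>)"
      by (subst ax) (simp only: d_linear)
  qed
  also have "\<dots> = Re (linform (a z) w)"
    unfolding linform_def Re_sum by (rule sum.cong[OF refl]) (simp add: a_def)
  finally show ?thesis by simp
qed

lemma a_cont: "continuous_on U a"
  unfolding a_def d_def
  by (intro continuous_on_vec_lambda continuous_intros r1_cont)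

lemma a_nz: "\<exists>k. a q $ k \<noteq> 0"
proof (rule ccontr)
  assume "\<not> ?thesis"
  then have "linform (a q) v = 0" for v by (simp add: linform_def)
  then have "d q v = 0" for v using Re_linform_a[of q v] by simp
  then have "r1 q = 0" by (intro blinfun_eqI) (simp add: d_def)
  then show False using r1_nz by simp
qed

lemma r_neg: "z \<in> \<Omega> \<Longrightarrow> z \<in> U \<Longrightarrow> r z < 0" and dom_I: "z \<in> U \<Longrightarrow> r z < 0 \<Longrightarrow> z \<in> \<Omega>"
  using dom_U by blast+

text \<open>One radius on which all constants are uniform. The index k marks a component of the
  complex gradient that stays away from zero; tangent vectors and dilations are built by solving for
  it.\<close>

lemma uniform_data:
  obtains \<rho> c k \<alpha> \<Lambda> M where "0 < \<rho>" "0 < c" "0 < \<alpha>" "0 < M" "ball q \<rho> \<subseteq> U"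
    "\<And>z. z \<in> ball q \<rho> \<Longrightarrow> \<alpha> \<le> cmod (a z $ k)" "\<And>z. z \<in> ball q \<rho> \<Longrightarrow> norm (a z) \<le> \<Lambda>"
    "\<And>z. z \<in> ball q \<rho> \<Longrightarrow> norm (r2 z) \<le> M" "\<And>z. z \<in> ball q \<rho> \<Longrightarrow> - r z < 1"
    "\<And>z w. z \<in> \<Omega> \<Longrightarrow> z \<in> ball q \<rho> \<Longrightarrow> w \<in> \<Omega> \<Longrightarrow> c * (norm (w - z))\<^sup>2 + 2 * r z \<le> - d z (w - z)"
    "\<And>z w. z \<in> \<Omega> \<Longrightarrow> z \<in> ball q \<rho> \<Longrightarrow> w \<in> ball q \<rho> \<Longrightarrow> r w = 0 \<Longrightarrow> d w (z - w) \<noteq> 0"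
proof -
  obtain \<rho>0 c where s: "0 < \<rho>0" "0 < c" "ball q \<rho>0 \<subseteq> U"
    "\<And>z w. z \<in> \<Omega> \<Longrightarrow> z \<in> ball q \<rho>0 \<Longrightarrow> w \<in> \<Omega> \<Longrightarrow> c * (norm (w - z))\<^sup>2 + 2 * r z \<le> - d z (w - z)"
    "\<And>z w. z \<in> \<Omega> \<Longrightarrow> z \<in> ball q \<rho>0 \<Longrightarrow> w \<in> ball q \<rho>0 \<Longrightarrow> r w = 0 \<Longrightarrow> d w (z - w) \<noteq> 0"
    using support_estimate by blast
  obtain k where k: "a q $ k \<noteq> 0" using a_nz by blast
  have ca: "isCont a q" and c2: "isCont r2 q" and cr: "isCont r q"
    using a_cont r2_cont r_cont U_open q_U continuous_on_eq_continuous_at by blast+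
  have ck: "isCont (\<lambda>z. cmod (a z $ k)) q" and cn: "isCont (\<lambda>z. norm (a z)) q" and cm: "isCont (\<lambda>z. norm (r2 z)) q"
    using ca c2 by (auto intro!: continuous_intros)
  have "\<forall>\<^sub>F z in nhds q. cmod (a q $ k) / 2 < cmod (a z $ k)"
    by (rule order_tendstoD(1)[OF isCont_nhds[OF ck]]) (use k in simp)
  moreover have "\<forall>\<^sub>F z in nhds q. norm (a z) < norm (a q) + 1"
    by (rule order_tendstoD(2)[OF isCont_nhds[OF cn]]) simp
  moreover have "\<forall>\<^sub>F z in nhds q. norm (r2 z) < norm (r2 q) + 1"
    by (rule order_tendstoD(2)[OF isCont_nhds[OF cm]]) simp
  moreover have "\<forall>\<^sub>F z in nhds q. - 1 < r z"
    by (rule order_tendstoD(1)[OF isCont_nhds[OF cr]]) (use frontier_zero[OF q_frontier q_U] in simp)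
  ultimately have "\<forall>\<^sub>F z in nhds q. cmod (a q $ k) / 2 < cmod (a z $ k) \<and> norm (a z) < norm (a q) + 1
      \<and> norm (r2 z) < norm (r2 q) + 1 \<and> - 1 < r z"
    by eventually_elim blast
  then obtain e where e: "e > 0" "\<And>z. dist z q < e \<Longrightarrow> cmod (a q $ k) / 2 < cmod (a z $ k) \<and> norm (a z) < norm (a q) + 1
      \<and> norm (r2 z) < norm (r2 q) + 1 \<and> - 1 < r z"
    unfolding eventually_nhds_metric by blast
  define \<rho> where "\<rho> = min \<rho>0 e"
  have sub: "z \<in> ball q \<rho>0" "dist z q < e" if "z \<in> ball q \<rho>" for z
    using that by (auto simp: \<rho>_def dist_commute)
  show ?thesis
  proof (rule that[of \<rho> c "cmod (a q $ k) / 2" "norm (r2 q) + 1" k "norm (a q) + 1"])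
    show "0 < \<rho>" using s e by (simp add: \<rho>_def)
    show "0 < norm (r2 q) + 1" by (simp add: add_nonneg_pos)
    show "ball q \<rho> \<subseteq> U" using s(3) by (auto simp: \<rho>_def)
    fix z assume z: "z \<in> ball q \<rho>"
    show "cmod (a q $ k) / 2 \<le> cmod (a z $ k)" "norm (a z) \<le> norm (a q) + 1" "norm (r2 z) \<le> norm (r2 q) + 1" "- r z < 1"
      using e(2)[OF sub(2)[OF z]] by linarith+
    fix w
    show "c * (norm (w - z))\<^sup>2 + 2 * r z \<le> - d z (w - z)" if "z \<in> \<Omega>" "w \<in> \<Omega>"
      using s(4) that sub(1)[OF z] by blast
    show "d w (z - w) \<noteq> 0" if "z \<in> \<Omega>" "w \<in> ball q \<rho>" "r w = 0"
      using s(5) that sub(1) z by blast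
  qed (use s k in auto)
qed

end

locale bergman_farthest_data = bergman_farthest \<Omega> U r r1 r2 q
  for \<Omega> U :: "(complex ^ 'n) set" and r r1 r2 q +
  fixes \<rho> c \<alpha> \<Lambda> M :: real and k :: 'n
  assumes \<rho>: "0 < \<rho>" and c: "0 < c" and \<alpha>: "0 < \<alpha>" and M: "0 < M" and ball_U: "ball q \<rho> \<subseteq> U"
    and a_lower: "\<And>z. z \<in> ball q \<rho> \<Longrightarrow> \<alpha> \<le> cmod (a z $ k)"
    and a_upper: "\<And>z. z \<in> ball q \<rho> \<Longrightarrow> norm (a z) \<le> \<Lambda>"
    and r2_upper: "\<And>z. z \<in> ball q \<rho> \<Longrightarrow> norm (r2 z) \<le> M"
    and r_lower: "\<And>z. z \<in> ball q \<rho> \<Longrightarrow> - r z < 1"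
    and support: "\<And>z w. z \<in> \<Omega> \<Longrightarrow> z \<in> ball q \<rho> \<Longrightarrow> w \<in> \<Omega> \<Longrightarrow> c * (norm (w - z))\<^sup>2 + 2 * r z \<le> - d z (w - z)"
    and transversal: "\<And>z w. z \<in> \<Omega> \<Longrightarrow> z \<in> ball q \<rho> \<Longrightarrow> w \<in> ball q \<rho> \<Longrightarrow> r w = 0 \<Longrightarrow> d w (z - w) \<noteq> 0"
begin

text \<open>With t = - r z, Taylor's formula gives r (z + w) <= - t + t / 4 + t / 2 < 0: the domain
  contains a region of size t across and sqrt t along the complex tangent space.\<close>

lemma inner_region:
  obtains \<beta> where "0 < \<beta>"
    "\<And>z w. z \<in> \<Omega> \<Longrightarrow> z \<in> ball q (\<rho> / 2) \<Longrightarrow> cmod (linform (a z) w) < 1 / 4 * - r z \<Longrightarrow> (norm w)\<^sup>2 < \<beta> * - r z \<Longrightarrow> z + w \<in> \<Omega>"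
proof -
  \<comment> \<open>1 / M bounds the Hessian term by t, and \<rho>^2 / 4 keeps z + w inside the
    ball, as t < 1.\<close>
  define \<beta> where "\<beta> = min (1 / M) (\<rho>\<^sup>2 / 4)"
  have \<beta>: "\<beta> > 0" using M \<rho> by (simp add: \<beta>_def)
  have "z + w \<in> \<Omega>" if z: "z \<in> \<Omega>" "z \<in> ball q (\<rho> / 2)" and w: "cmod (linform (a z) w) < 1 / 4 * - r z" "(norm w)\<^sup>2 < \<beta> * - r z" for z w
  proof -
    have zr: "z \<in> ball q \<rho>" using z(2) \<rho> by simp
    define t where "t = - r z"
    have t: "0 < t" "t < 1" using r_neg[OF z(1)] zr ball_U r_lower[OF zr] by (auto simp: t_def)
    have "(norm w)\<^sup>2 < \<beta> * 1" using w(2) t \<beta> mult_strict_left_mono[of t 1 \<beta>] unfolding t_def[symmetric] by linarith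
    also have "\<dots> \<le> (\<rho> / 2)\<^sup>2" by (simp add: \<beta>_def power_divide)
    finally have nw: "norm w < \<rho> / 2" using \<rho> by (intro power2_less_imp_less[of "norm w"]) auto
    have inb: "z + s *\<^sub>R w \<in> ball q \<rho>" if "0 \<le> s" "s \<le> 1" for s
    proof -
      have "norm (s *\<^sub>R w) \<le> 1 * norm w" unfolding norm_scaleR using that by (intro mult_right_mono) auto
      then have "dist q (z + s *\<^sub>R w) \<le> dist q z + norm w" using dist_triangle[of q "z + s *\<^sub>R w" z] by (simp add: dist_norm)
      then show ?thesis using z(2) nw by simp
    qed
    obtain s where s: "0 < s" "s < 1" "r (z + w) = r z + d z w + h (z + s *\<^sub>R w) w w / 2"
      using taylor[of z w] inb ball_U by blast
    have "d z w \<le> cmod (linform (a z) w)" unfolding Re_linform_a[symmetric] by (rule complex_Re_le_cmod)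
    then have 1: "d z w \<le> t / 4" using w(1) by (simp add: t_def)
    have "h (z + s *\<^sub>R w) w w \<le> M * norm w * norm w"
    proof -
      have "h (z + s *\<^sub>R w) w w \<le> norm (r2 (z + s *\<^sub>R w)) * norm w * norm w" using h_bound[of "z + s *\<^sub>R w" w w] by linarith
      also have "\<dots> \<le> M * norm w * norm w" using r2_upper[OF inb[of s]] s by (intro mult_right_mono) auto
      finally show ?thesis .
    qed
    also have "\<dots> \<le> M * (\<beta> * t)"
      unfolding mult.assoc using w(2) M by (intro mult_left_mono) (auto simp: t_def power2_eq_square)
    also have "\<dots> \<le> M * (1 / M * t)" using M t by (intro mult_left_mono mult_right_mono) (auto simp: \<beta>_def)
    also have "\<dots> = t" using M by simp
    finally have "r (z + w) < 0" using s(3) 1 t by (simp add: t_def)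
    moreover have "z + w \<in> U" using inb[of 1] ball_U by auto
    ultimately show ?thesis by (rule dom_I[rotated])
  qed
  then show ?thesis using that \<beta> by blast
qed

lemma dyadic_scale:
  fixes L t :: real
  assumes "0 < t" "t \<le> L"
  obtains m :: nat where "2 ^ m * t \<le> L" "L < 2 ^ Suc m * t"
proof -
  obtain n where n: "L / t < 2 ^ n" using real_arch_pow[of 2 "L / t"] by auto
  define l where "l = (LEAST n. L / t < 2 ^ n)"
  have l: "L / t < 2 ^ l" unfolding l_def using n by (rule LeastI)
  have "l \<noteq> 0" using l assms by (intro notI) (simp add: field_simps)
  then obtain m where m: "l = Suc m" using not0_implies_Suc by blast
  have "\<not> L / t < 2 ^ m" using not_less_Least[of m "\<lambda>n. L / t < 2 ^ n"] m by (simp add: l_def)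
  then show ?thesis using that[of m] l assms m by (simp add: field_simps)
qed

text \<open>The test function is \<open>(3t - linform (a z) (w - z))\<^sup>-\<^sup>(\<^sup>n\<^sup>+\<^sup>1\<^sup>)\<close> with \<open>t = - r z\<close>, modelled on the kernel of the ball;
  its norm is estimated over the dyadic shells of the denominator.\<close>

lemma kernel_lower_bound:
  obtains \<kappa> where "0 < \<kappa>"
    "\<And>z K. z \<in> \<Omega> \<Longrightarrow> z \<in> ball q \<rho> \<Longrightarrow> K \<in> A \<Longrightarrow> (\<And>f. f \<in> A \<Longrightarrow> ip f K = f z) \<Longrightarrow> \<kappa> \<le> (nrm K)\<^sup>2 * (- r z) ^ Suc CARD('n)"
proof -
  define N where "N = Suc CARD('n)"
  have b3: "0 \<le> (3::real)" and c1: "0 \<le> 1 / c" using c by auto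
  obtain V where V: "0 < V" "\<And>(a :: complex ^ 'n) t. \<alpha> \<le> cmod (a $ k) \<Longrightarrow> norm a \<le> \<Lambda> \<Longrightarrow> 0 < t \<Longrightarrow>
     emeasure lborel {w. cmod (linform a w) \<le> 3 * t \<and> (norm w)\<^sup>2 \<le> 1 / c * t} \<le> ennreal (V * t ^ N)"
  proof (rule anisotropic_volume_upper[OF \<alpha> b3 c1, of k \<Lambda>])
    fix V :: real
    assume 1: "0 < V" and 2: "\<And>(a :: complex ^ 'n) t. \<alpha> \<le> cmod (a $ k) \<Longrightarrow> norm a \<le> \<Lambda> \<Longrightarrow> 0 < t \<Longrightarrow>
      emeasure lborel {w. cmod (linform a w) \<le> 3 * t \<and> (norm w)\<^sup>2 \<le> 1 / c * t} \<le> ennreal (V * t ^ Suc CARD('n))"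
    show thesis by (rule that[OF 1]) (simp only: N_def 2)
  qed
  \<comment> \<open>9^N comes from the value of the test function at z, where the denominator is 3
    t. The rest bounds its squared norm: 2^N from the doubled scale \<open>T m\<close> of a shell,
    and 2 from the geometric series.\<close>
  define \<kappa> where "\<kappa> = 1 / (9 ^ N * (V * 2 ^ N * 2))"
  have \<kappa>: "\<kappa> > 0" using V by (simp add: \<kappa>_def)
  have "\<kappa> \<le> (nrm K)\<^sup>2 * (- r z) ^ N" if z: "z \<in> \<Omega>" "z \<in> ball q \<rho>" and K: "K \<in> A" "\<And>f. f \<in> A \<Longrightarrow> ip f K = f z" for z K
  proof -
    define t where "t = - r z"
    have t: "0 < t" using r_neg[OF z(1)] z(2) ball_U by (auto simp: t_def)
    \<comment> \<open>\<open>support\<close> bounds the real part of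
      \<open>linform (a z) (w - z)\<close> above by 2 t - c |w - z|^2, so the shift by 3 t leaves Re
      (l w) >= t + c |w - z|^2: l has no zero in the domain, and its size controls |w -
      z|^2.\<close>
    define l where "l w = 3 * of_real t - linform (a z) (w - z)" for w
    have Rel: "t + c * (norm (w - z))\<^sup>2 \<le> Re (l w)" if "w \<in> \<Omega>" for w
      using support[OF z that] by (simp add: l_def Re_linform_a t_def)
    have lt: "t \<le> cmod (l w)" and lc: "c * (norm (w - z))\<^sup>2 \<le> cmod (l w)" if "w \<in> \<Omega>" for w
    proof -
      have "0 \<le> c * (norm (w - z))\<^sup>2" using c by simp
      then show "t \<le> cmod (l w)" "c * (norm (w - z))\<^sup>2 \<le> cmod (l w)"
        using Rel[OF that] complex_Re_le_cmod[of "l w"] t by linarith+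
    qed
    define f where "f w = (1 / l w) ^ N" for w
    have lhol: "(\<lambda>w. 1 / l w) Cn_holomorphic_on \<Omega>"
      unfolding Cn_holomorphic_on_def
    proof
      fix w assume w: "w \<in> \<Omega>"
      have ld: "(l has_derivative (\<lambda>v. - linform (a z) v)) (at w)"
        unfolding l_def
        by (rule has_derivative_eq_rhs[OF has_derivative_diff[OF has_derivative_const bounded_linear.has_derivative[OF bounded_linear_linform has_derivative_diff[OF has_derivative_ident has_derivative_const]]]])
          simp
      have l0: "l w \<noteq> 0" using lt[OF w] t by auto
      from Deriv.has_derivative_inverse[OF l0 ld]
      have "((\<lambda>w. 1 / l w) has_derivative (\<lambda>v. - (inverse (l w) * (- linform (a z) v) * inverse (l w)))) (at w)"
        by (simp add: inverse_eq_divide)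
      then show "\<exists>D. ((\<lambda>w. 1 / l w) has_derivative D) (at w) \<and> (\<forall>c v. D (c *s v) = c * D v)"
        by (intro exI conjI) (assumption, simp add: linform_scale)
    qed
    have fhol: "f Cn_holomorphic_on \<Omega>"
    proof -
      have "(\<lambda>w. (1 / l w) ^ m) Cn_holomorphic_on \<Omega>" for m
      proof (induction m)
        case (Suc m)
        then show ?case unfolding power_Suc by (rule Cn_holomorphic_mult[OF lhol])
      qed (simp add: Cn_holomorphic_const)
      then show ?thesis by (simp add: f_def[abs_def])
    qed
    have fb: "cmod (f w) \<le> (1 / t) ^ N" if "w \<in> \<Omega>" for w
    proof -
      have "1 / cmod (l w) \<le> 1 / t" using lt[OF that] t by (intro frac_le) auto
      then show ?thesis unfolding f_def norm_power norm_divide norm_one by (rule power_mono) simp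
    qed
    define g where "g w = (if w \<in> \<Omega> then f w else 0)" for w
    have gA: "g \<in> A" unfolding g_def[abs_def] using fhol fb by (rule A_bounded_function)
    define T where "T m = 2 ^ Suc m * t" for m :: nat
    have T: "T m > 0" for m using t by (simp add: T_def)
    \<comment> \<open>Contains the shell where |l| lies between T m / 2 and T m, translated by - z:
      both the linear form and the squared norm are of size at most a constant times T m
      there.\<close>
    define D where "D m = {v. cmod (linform (a z) v) \<le> 3 * T m \<and> (norm v)\<^sup>2 \<le> 1 / c * T m}" for m
    have Dm: "D m \<in> sets borel" for m
    proof -
      have "closed (D m)" unfolding D_def
        by (intro closed_Collect_conj closed_Collect_le continuous_intros linear_continuous_on[OF bounded_linear_linform])
      then show ?thesis by simp
    qed
    define e where "e m = (1 / (2 ^ m * t)) ^ (2 * N)" for m :: nat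
    have pt: "ennreal ((cmod (g w))\<^sup>2) * indicator \<Omega> w \<le> (\<Sum>m. ennreal (e m) * indicator (D m) (- z + w))" for w
    proof (cases "w \<in> \<Omega>")
      case True
      obtain m :: nat where m: "2 ^ m * t \<le> cmod (l w)" "cmod (l w) < 2 ^ Suc m * t"
        using dyadic_scale[OF t lt[OF True]] by blast
      have "cmod (linform (a z) (w - z)) \<le> 3 * t + cmod (l w)"
        using norm_triangle_ineq4[of "3 * of_real t" "l w"] t by (simp add: l_def norm_mult)
      also have "\<dots> \<le> 3 * T m"
      proof -
        have "1 * t \<le> 2 ^ m * t" using t by (intro mult_right_mono one_le_power) auto
        then have "3 * t \<le> 2 * T m" unfolding T_def power_Suc using t by linarith
        then show ?thesis using m(2) by (simp add: T_def)
      qed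
      finally have 1: "cmod (linform (a z) (w - z)) \<le> 3 * T m" .
      have "c * (norm (w - z))\<^sup>2 \<le> T m" using lc[OF True] m(2) by (simp add: T_def)
      then have "(norm (w - z))\<^sup>2 \<le> 1 / c * T m" using c by (simp add: field_simps)
      then have inD: "- z + w \<in> D m" using 1 by (simp add: D_def)
      have "(cmod (g w))\<^sup>2 = (1 / cmod (l w)) ^ (2 * N)"
        using True by (simp add: g_def f_def norm_power norm_divide power_mult[symmetric] mult.commute)
      also have "\<dots> \<le> e m"
        unfolding e_def using m(1) t lt[OF True] by (intro power_mono divide_left_mono mult_pos_pos) auto
      finally have "ennreal ((cmod (g w))\<^sup>2) * indicator \<Omega> w \<le> ennreal (e m) * indicator (D m) (- z + w)"
        using True inD by (simp add: ennreal_leI)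
      also have "\<dots> = (\<Sum>i\<in>{m}. ennreal (e i) * indicator (D i) (- z + w))"
        by (subst sum.insert) (simp_all only: finite.emptyI empty_iff not_False_eq_True sum.empty add_0_right)
      also have "\<dots> \<le> (\<Sum>m. ennreal (e m) * indicator (D m) (- z + w))"
        by (rule sum_le_suminf) auto
      finally show ?thesis .
    qed simp
    have em: "(\<lambda>v. ennreal (e m) * indicator (D m) v) \<in> borel_measurable borel" for m
      using Dm[of m] by measurable
    have emz: "(\<lambda>w. ennreal (e m) * indicator (D m) (- z + w)) \<in> borel_measurable lborel" for m
      using measurable_compose[OF borel_measurable_add[OF borel_measurable_const[of "- z"] measurable_ident] em[of m]] by simp
    have "ennreal ((nrm g)\<^sup>2) = (\<integral>\<^sup>+w. ennreal ((cmod (g w))\<^sup>2) * indicator \<Omega> w \<partial>lborel)"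
      by (rule nn_integral_A[OF gA, symmetric])
    also have "\<dots> \<le> (\<integral>\<^sup>+w. (\<Sum>m. ennreal (e m) * indicator (D m) (- z + w)) \<partial>lborel)"
      by (intro nn_integral_mono pt)
    also have "\<dots> = (\<Sum>m. \<integral>\<^sup>+w. ennreal (e m) * indicator (D m) (- z + w) \<partial>lborel)"
      by (rule nn_integral_suminf[OF emz])
    also have "\<dots> = (\<Sum>m. ennreal (e m) * emeasure lborel (D m))"
    proof (rule arg_cong[where f = suminf], rule ext)
      fix m
      have "(\<integral>\<^sup>+w. ennreal (e m) * indicator (D m) (- z + w) \<partial>lborel) = (\<integral>\<^sup>+v. ennreal (e m) * indicator (D m) v \<partial>lborel)"
        by (rule nn_integral_lborel_translate[OF em])
      also have "\<dots> = ennreal (e m) * emeasure lborel (D m)" using Dm by (intro nn_integral_cmult_indicator) simp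
      finally show "(\<integral>\<^sup>+w. ennreal (e m) * indicator (D m) (- z + w) \<partial>lborel) = ennreal (e m) * emeasure lborel (D m)" .
    qed
    also have "\<dots> \<le> (\<Sum>m. ennreal (V * 2 ^ N * (1 / t) ^ N * (1 / 2) ^ m))"
    proof (rule suminf_le)
      fix m
      have "ennreal (e m) * emeasure lborel (D m) \<le> ennreal (e m) * ennreal (V * T m ^ N)"
        unfolding D_def using a_lower[OF z(2)] a_upper[OF z(2)] T by (intro mult_left_mono V(2)) auto
      also have "\<dots> = ennreal (e m * (V * T m ^ N))" using t by (intro ennreal_mult''[symmetric]) (simp add: T_def V(1) less_imp_le)
      also have "\<dots> \<le> ennreal (V * 2 ^ N * (1 / t) ^ N * (1 / 2) ^ m)"
      proof (rule ennreal_leI)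
        define x where "x = 2 ^ m * t"
        have x: "x > 0" using t by (simp add: x_def)
        have "e m * (V * T m ^ N) = V * 2 ^ N * (1 / x) ^ N"
        proof -
          have "T m = 2 * x" by (simp add: T_def x_def)
          moreover have "(1 / x) ^ (2 * N) * x ^ N = (1 / x) ^ N"
            using x by (simp add: mult_2 power_add power_divide)
          moreover have "e m = (1 / x) ^ (2 * N)" by (simp only: e_def x_def)
          ultimately have "e m * (V * T m ^ N) = (1 / x) ^ (2 * N) * (V * (2 * x) ^ N)"
            and h: "(1 / x) ^ (2 * N) * x ^ N = (1 / x) ^ N" by (simp_all only:)
          note this(1)
          also have "(1 / x) ^ (2 * N) * (V * (2 * x) ^ N) = V * 2 ^ N * ((1 / x) ^ (2 * N) * x ^ N)"
            by (simp only: power_mult_distrib mult_ac)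
          finally show ?thesis by (simp only: h)
        qed
        also have "(1 / x) ^ N = (1 / t) ^ N * ((1 / 2) ^ m) ^ N"
          by (simp add: x_def power_divide power_mult_distrib power_one_over)
        \<comment> \<open>The integrand contributes (2^m t)^(-2N) and the volume (2^m t)^N, so the
          shells decay like 2^(-mN); the weaker 2^(-m) suffices.\<close>
        also have "((1 / 2 :: real) ^ m) ^ N \<le> (1 / 2) ^ m"
        proof -
          have "((1 / 2 :: real) ^ m) ^ N \<le> ((1 / 2) ^ m) ^ 1"
            by (intro power_decreasing) (auto simp: N_def power_le_one)
          then show ?thesis by simp
        qed
        finally show "e m * (V * T m ^ N) \<le> V * 2 ^ N * (1 / t) ^ N * (1 / 2) ^ m"
          using V t by (simp add: mult_left_mono mult.assoc)
      qed
      finally show "ennreal (e m) * emeasure lborel (D m) \<le> ennreal (V * 2 ^ N * (1 / t) ^ N * (1 / 2) ^ m)" .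
    qed auto
    also have "\<dots> = ennreal (V * 2 ^ N * (1 / t) ^ N * 2)"
    proof -
      have "(\<lambda>m. V * 2 ^ N * (1 / t) ^ N * (1 / 2) ^ m) sums (V * 2 ^ N * (1 / t) ^ N * (1 / (1 - 1 / 2)))"
        by (intro sums_mult geometric_sums) simp
      then have s: "(\<lambda>m. V * 2 ^ N * (1 / t) ^ N * (1 / 2) ^ m) sums (V * 2 ^ N * (1 / t) ^ N * 2)" by simp
      have "(\<lambda>m. ennreal (V * 2 ^ N * (1 / t) ^ N * (1 / 2) ^ m)) sums ennreal (V * 2 ^ N * (1 / t) ^ N * 2)"
        using s V t by (subst sums_ennreal) auto
      then show ?thesis by (rule sums_unique[symmetric])
    qed
    finally have ng: "(nrm g)\<^sup>2 \<le> V * 2 ^ N * 2 * (1 / t) ^ N"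
      using V t by (simp add: mult_ac)
    have "g z = (1 / (3 * of_real t)) ^ N" using z by (simp add: g_def f_def l_def linform_def)
    then have gz: "(cmod (g z))\<^sup>2 = (1 / 9) ^ N * ((1 / t) ^ N * (1 / t) ^ N)"
    proof -
      have "cmod (g z) = (1 / (3 * t)) ^ N" using \<open>g z = (1 / (3 * of_real t)) ^ N\<close> t by (simp add: norm_power norm_divide norm_mult)
      then have "(cmod (g z))\<^sup>2 = ((1 / (3 * t)) * (1 / (3 * t))) ^ N" by (simp only: power2_eq_square power_mult_distrib)
      also have "(1 / (3 * t)) * (1 / (3 * t)) = 1 / 9 * (1 / t * (1 / t))" by simp
      finally show ?thesis by (simp only: power_mult_distrib)
    qed
    \<comment> \<open>Duality: |g(z)|^2 is of order t^(-2N) and the squared norm of g at most of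
      order t^(-N), so the squared norm of K is at least of order t^(-N).\<close>
    have "cmod (g z) \<le> nrm g * nrm K" using A.cauchy_schwarz[OF gA K(1)] K(2)[OF gA] by simp
    then have "(cmod (g z))\<^sup>2 \<le> (nrm g)\<^sup>2 * (nrm K)\<^sup>2" unfolding power_mult_distrib[symmetric] by (intro power_mono) auto
    also have "\<dots> \<le> V * 2 ^ N * 2 * (1 / t) ^ N * (nrm K)\<^sup>2" using ng by (rule mult_right_mono) simp
    finally have "(1 / t) ^ N * ((1 / 9) ^ N * (1 / t) ^ N) \<le> (1 / t) ^ N * (V * 2 ^ N * 2 * (nrm K)\<^sup>2)"
      unfolding gz by (simp only: mult_ac)
    then have "(1 / 9) ^ N * (1 / t) ^ N \<le> V * 2 ^ N * 2 * (nrm K)\<^sup>2"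
      by (rule mult_left_le_imp_le) (use t in simp)
    then have "(1 / 9) ^ N * (1 / t) ^ N * t ^ N \<le> V * 2 ^ N * 2 * (nrm K)\<^sup>2 * t ^ N" using t by (intro mult_right_mono) auto
    moreover have "(1 / 9 :: real) ^ N * (1 / t) ^ N * t ^ N = 1 / 9 ^ N" using t by (simp add: power_divide)
    ultimately have "1 / 9 ^ N \<le> (V * 2 ^ N * 2) * ((nrm K)\<^sup>2 * t ^ N)" by (simp add: mult_ac)
    then show ?thesis unfolding \<kappa>_def t_def[symmetric] using V by (simp add: field_simps)
  qed
  then show ?thesis using that \<kappa> unfolding N_def by blast
qed

text \<open>An anisotropic Cauchy estimate. Every point of a disc of radius about sqrt t in
  direction \<tau> has around it a balanced region of volume about t^(n+1) inside the domain, which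
  bounds |G|^2 on the disc by the squared norm times t^(-n-1). The radius of the disc contributes
  one more factor 1 / t.\<close>

lemma tangential_derivative_bound:
  obtains \<kappa> where "0 < \<kappa>"
    "\<And>z G D \<tau>. z \<in> \<Omega> \<Longrightarrow> z \<in> ball q (\<rho> / 2) \<Longrightarrow> G \<in> A \<Longrightarrow> (G has_derivative D) (at z) \<Longrightarrow> (\<And>c v. D (c *s v) = c * D v) \<Longrightarrow>
       linform (a z) \<tau> = 0 \<Longrightarrow> \<kappa> * (cmod (D \<tau>))\<^sup>2 * (- r z) ^ (CARD('n) + 2) \<le> (norm \<tau>)\<^sup>2 * (nrm G)\<^sup>2"
proof -
  obtain \<beta> where \<beta>: "0 < \<beta>"
    "\<And>z w. z \<in> \<Omega> \<Longrightarrow> z \<in> ball q (\<rho> / 2) \<Longrightarrow> cmod (linform (a z) w) < 1 / 4 * - r z \<Longrightarrow> (norm w)\<^sup>2 < \<beta> * - r z \<Longrightarrow> z + w \<in> \<Omega>"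
    using inner_region by blast
  \<comment> \<open>The region takes a quarter of \<beta> and the disc has the matching radius R, so
    a sum of one vector from each has norm below 2 R = sqrt (\<beta> t).\<close>
  have b4: "0 < \<beta> / 4" and q4: "0 < (1/4 :: real)" using \<beta> by auto
  obtain V where V: "0 < V" "\<And>(a :: complex ^ 'n) t. \<alpha> \<le> cmod (a $ k) \<Longrightarrow> norm a \<le> \<Lambda> \<Longrightarrow> 0 < t \<Longrightarrow> t \<le> 1 \<Longrightarrow>
     ennreal (V * t ^ Suc CARD('n)) \<le> emeasure lborel {w. cmod (linform a w) < 1 / 4 * t \<and> (norm w)\<^sup>2 < \<beta> / 4 * t}"
    by (rule anisotropic_volume_lower[OF \<alpha> q4 b4, of k \<Lambda>]) (rule that, assumption, blast)
  define \<kappa> where "\<kappa> = V * \<beta> / 4"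
  have \<kappa>: "\<kappa> > 0" using V \<beta> by (simp add: \<kappa>_def)
  have "\<kappa> * (cmod (D \<tau>))\<^sup>2 * (- r z) ^ (CARD('n) + 2) \<le> (norm \<tau>)\<^sup>2 * (nrm G)\<^sup>2"
    if z: "z \<in> \<Omega>" "z \<in> ball q (\<rho> / 2)" and G: "G \<in> A" and D: "(G has_derivative D) (at z)" "\<And>c v. D (c *s v) = c * D v"
      and \<tau>: "linform (a z) \<tau> = 0" for z G D \<tau>
  proof (cases "\<tau> = 0")
    case True
    have "D 0 = 0" using D(2)[of 0 0] by simp
    then show ?thesis using True by simp
  next
    case False
    have zr: "z \<in> ball q \<rho>" using z(2) \<rho> by simp
    define t where "t = - r z"
    have t: "0 < t" "t < 1" using r_neg[OF z(1)] zr ball_U r_lower[OF zr] by (auto simp: t_def)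
    define R where "R = sqrt (\<beta> * t) / 2"
    have R: "R > 0" using \<beta> t by (simp add: R_def)
    have R2: "R\<^sup>2 = \<beta> / 4 * t" using \<beta> t by (simp add: R_def power_divide)
    define s where "s = R / norm \<tau>"
    have s: "s > 0" using R False by (simp add: s_def)
    define W where "W = {w. cmod (linform (a z) w) < 1 / 4 * t \<and> (norm w)\<^sup>2 < \<beta> / 4 * t}"
    have Wb: "W \<in> sets borel"
    proof -
      have "open W" unfolding W_def
        by (intro open_Collect_conj open_Collect_less continuous_intros linear_continuous_on[OF bounded_linear_linform])
      then show ?thesis by simp
    qed
    have Wn: "norm w < R" if "w \<in> W" for w
      using that R unfolding W_def R2[symmetric] by (intro power2_less_imp_less[of "norm w"]) auto
    have Wl: "cmod (linform (a z) w) < 1 / 4 * t" if "w \<in> W" for w using that by (simp add: W_def)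
    have W2: "(norm w)\<^sup>2 < \<beta> / 4 * t" if "w \<in> W" for w using that by (simp add: W_def)
    have W0: "0 \<in> W" using t \<beta> by (simp add: W_def linform_def)
    have sub: "z + (\<zeta> *s \<tau> + w) \<in> \<Omega>" if "cmod \<zeta> \<le> s" "w \<in> W" for \<zeta> w
    proof (rule \<beta>(2)[OF z])
      show "cmod (linform (a z) (\<zeta> *s \<tau> + w)) < 1 / 4 * - r z"
        using Wl[OF that(2)] by (simp add: linform_add linform_scale \<tau> t_def)
      have "norm (\<zeta> *s \<tau>) \<le> R"
        using mult_right_mono[OF that(1) norm_ge_zero[of \<tau>]] False by (simp add: norm_vector_scalar_mult s_def)
      then have "norm (\<zeta> *s \<tau> + w) < 2 * R" using norm_triangle_ineq[of "\<zeta> *s \<tau>" w] Wn[OF that(2)] by linarith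
      then have "(norm (\<zeta> *s \<tau> + w))\<^sup>2 < (2 * R)\<^sup>2" by (intro power_strict_mono) auto
      also have "(2 * R)\<^sup>2 = \<beta> * - r z" by (simp add: power_mult_distrib R2 t_def)
      finally show "(norm (\<zeta> *s \<tau> + w))\<^sup>2 < \<beta> * - r z" .
    qed
    define v where "v = V * t ^ Suc CARD('n)"
    have v: "v > 0" using V t by (simp add: v_def)
    have vW: "ennreal v \<le> emeasure lborel W"
      unfolding v_def W_def using a_lower[OF zr] a_upper[OF zr] t by (intro V(2)) auto
    have Gx: "cmod (G (z + \<zeta> *s \<tau>)) \<le> nrm G / sqrt v" if "cmod \<zeta> \<le> s" for \<zeta>
    proof -
      have "(cmod (G (z + \<zeta> *s \<tau>)))\<^sup>2 * v \<le> (nrm G)\<^sup>2"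
      proof (rule point_bound[OF G Wb _ _ vW])
        fix c w assume w: "w \<in> W" 
        show "z + \<zeta> *s \<tau> + w \<in> \<Omega>" using sub[OF that w] by (simp add: add.assoc)
        assume c: "cmod c \<le> 1"
        have "cmod (linform (a z) (c *s w)) \<le> 1 * cmod (linform (a z) w)"
          unfolding linform_scale norm_mult using c by (intro mult_right_mono) auto
        moreover have "(norm (c *s w))\<^sup>2 \<le> (norm w)\<^sup>2"
          unfolding norm_vector_scalar_mult using mult_right_mono[OF c norm_ge_zero[of w]] by (intro power_mono) auto
        ultimately show "c *s w \<in> W"
          using Wl[OF w] W2[OF w] unfolding W_def mem_Collect_eq by (intro conjI) linarith+
      qed (use v in auto)
      then have "(cmod (G (z + \<zeta> *s \<tau>)) * sqrt v)\<^sup>2 \<le> (nrm G)\<^sup>2" using v by (simp add: power_mult_distrib)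
      then have "cmod (G (z + \<zeta> *s \<tau>)) * sqrt v \<le> nrm G" using A.nrm_ge0[OF G] by (rule power2_le_imp_le)
      then show ?thesis using v by (simp add: field_simps)
    qed
    have "cmod (D \<tau>) \<le> (nrm G / sqrt v) / s"
    proof (rule directional_cauchy_bound[OF A_hol[OF G] open_dom D s])
      show "z + \<zeta> *s \<tau> \<in> \<Omega>" if "cmod \<zeta> \<le> s" for \<zeta> using sub[OF that W0] by simp
      show "cmod (G (z + \<zeta> *s \<tau>)) \<le> nrm G / sqrt v" if "cmod \<zeta> = s" for \<zeta> using Gx that by simp
    qed
    then have "(cmod (D \<tau>))\<^sup>2 \<le> ((nrm G / sqrt v) / s)\<^sup>2" by (intro power_mono) auto
    also have "\<dots> = (nrm G)\<^sup>2 * (norm \<tau>)\<^sup>2 / (v * R\<^sup>2)"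
      using v by (simp add: power_divide power_mult_distrib s_def)
    finally have "(cmod (D \<tau>))\<^sup>2 * (v * R\<^sup>2) \<le> (nrm G)\<^sup>2 * (norm \<tau>)\<^sup>2"
      using v R by (simp add: pos_le_divide_eq)
    moreover have "v * R\<^sup>2 = \<kappa> * t ^ (CARD('n) + 2)" by (simp add: v_def R2 \<kappa>_def)
    ultimately show ?thesis by (simp add: t_def mult_ac)
  qed
  then show ?thesis using that \<kappa> by blast
qed

end

section \<open>The defining function is not integrable to the power minus one\<close>

lemma nn_integral_inverse_infinite:
  fixes a s0 L :: real
  assumes "0 < L" "0 < a"
  shows "(\<integral>\<^sup>+s. ennreal (1 / (L * (s - s0))) * indicator {s0<..<s0 + a} s \<partial>lborel) = \<infinity>"
proof -
  define J where "J = (\<integral>\<^sup>+s. ennreal (1 / (L * (s - s0))) * indicator {s0<..<s0 + a} s \<partial>lborel)"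
  have le: "ennreal (m / L) \<le> J" if m: "0 < m" for m :: real
  proof -
    \<comment> \<open>Makes the integral of 1 / (L (s - s0)) from u to s0 + a / 2 equal to m / L, by
      the logarithm; m is arbitrary.\<close>
    define u where "u = s0 + a / 2 * exp (- m)"
    have u: "s0 < u" "u < s0 + a / 2" using assms m by (auto simp: u_def)
    have "(\<integral>\<^sup>+s. ennreal (1 / (L * (s - s0))) * indicator {u..s0 + a / 2} s \<partial>lborel)
        = ennreal (ln (s0 + a / 2 - s0) / L - ln (u - s0) / L)"
    proof (rule nn_integral_FTC_Icc)
      show "(\<lambda>s. 1 / (L * (s - s0))) \<in> borel_measurable borel" by measurable
      fix s assume s: "s \<in> {u..s0 + a / 2}"
      show "((\<lambda>s. ln (s - s0) / L) has_real_derivative 1 / (L * (s - s0))) (at s)"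
        using s u assms by (auto intro!: derivative_eq_intros simp: field_simps)
      show "0 \<le> 1 / (L * (s - s0))" using s u assms by simp
    qed (use u in simp)
    moreover have "ln (s0 + a / 2 - s0) / L - ln (u - s0) / L = m / L"
    proof -
      have us: "u - s0 = a / 2 * exp (- m)" by (simp add: u_def)
      have "ln (a / 2 * exp (- m)) = ln (a / 2) + ln (exp (- m))" using assms by (intro ln_mult_pos) auto
      then show ?thesis unfolding us by (simp only: ln_exp diff_divide_distrib add_divide_distrib) simp
    qed
    moreover have "(\<integral>\<^sup>+s. ennreal (1 / (L * (s - s0))) * indicator {u..s0 + a / 2} s \<partial>lborel) \<le> J"
      unfolding J_def using u assms by (intro nn_integral_mono) (auto simp: indicator_def)
    ultimately show ?thesis by simp
  qed
  show ?thesis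
  proof (rule ccontr)
    assume "\<not> ?thesis"
    then have "J < \<infinity>" unfolding J_def[symmetric] by (simp add: top.not_eq_extremum)
    then obtain x where x: "0 \<le> x" "J = ennreal x" by (cases J) auto
    have "ennreal ((x + 1) * L / L) \<le> ennreal x" using le[of "(x + 1) * L"] x assms by simp
    then show False using x assms by simp
  qed
qed

context bergman_farthest_data begin

text \<open>Integrate over translates along a direction transversal to the boundary; on each line the
  integrand dominates \<open>1 / (L (s - s0))\<close> beyond the boundary crossing \<open>s0\<close>.\<close>

lemma not_integrable_inverse:
  assumes b: "b \<in> frontier \<Omega>" "b \<in> ball q \<rho>" and \<epsilon>: "0 < \<epsilon>" "ball b \<epsilon> \<subseteq> ball q \<rho>"
  shows "(\<integral>\<^sup>+x. ennreal (1 / - r x) * indicator (\<Omega> \<inter> ball b \<epsilon>) x \<partial>lborel) = \<infinity>"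
proof -
  have bU: "b \<in> U" using b ball_U by blast
  have rb: "r b = 0" using b(1) bU by (rule frontier_zero)
  \<comment> \<open>A complex multiple of the k-th unit vector. The value -2 leaves room on both
    sides: near b the derivative along v stays between -3 and -1, whence L = 3.\<close>
  obtain v where v: "d b v = -2"
  proof -
    have "linform (a b) (axis k 1) \<noteq> 0" using a_lower[OF b(2)] \<alpha> by (auto simp: linform_axis)
    then have "linform (a b) ((-2 / linform (a b) (axis k 1)) *s axis k 1) = -2"
      by (simp only: linform_scale nonzero_eq_divide_eq[symmetric] times_divide_eq_left) simp
    then have "d b ((-2 / linform (a b) (axis k 1)) *s axis k 1) = Re (-2)" by (simp only: Re_linform_a[symmetric])
    then show ?thesis using that by simp
  qed
  have v0: "norm v > 0" using v by (auto simp: d_linear)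
  have cr1: "isCont r1 b" using r1_cont U_open bU continuous_on_eq_continuous_at by blast
  have cr: "isCont r b" using r_cont U_open bU continuous_on_eq_continuous_at by blast
  obtain e1 where e1: "e1 > 0" "\<And>x. dist x b < e1 \<Longrightarrow> dist (r1 x) (r1 b) < 1 / norm v"
    using cr1 v0 unfolding continuous_at_eps_delta by (metis zero_less_divide_1_iff)
  define e where "e = min \<epsilon> e1"
  have e: "e > 0" using \<epsilon> e1 by (simp add: e_def)
  define L :: real where "L = 3"
  have dv: "d x v \<le> -1" "- d x v \<le> L" if "x \<in> ball b e" for x
  proof -
    have "norm (r1 x - r1 b) < 1 / norm v" using e1(2)[of x] that by (simp add: e_def dist_norm norm_minus_commute)
    then have "norm (r1 x - r1 b) * norm v \<le> 1" using v0 by (simp add: field_simps)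
    then have "\<bar>d x v - d b v\<bar> \<le> 1" using d_diff_bound[of x v b] by linarith
    then show "d x v \<le> -1" "- d x v \<le> L" using v by (auto simp: L_def)
  qed
  have eU: "x \<in> U" if "x \<in> ball b e" for x using that \<epsilon>(2) ball_U by (auto simp: e_def)
  define S where "S = e / (4 * norm v)"
  have S: "S > 0" using e v0 by (simp add: S_def)
  \<comment> \<open>Along v the function r decreases at rate at least 1, so |r x| < S forces a zero
    of r on the line at a parameter between -S and S.\<close>
  obtain e2 where e2: "e2 > 0" "\<And>x. dist x b < e2 \<Longrightarrow> \<bar>r x\<bar> < S"
    using cr S unfolding continuous_at_eps_delta by (metis dist_real_def rb diff_zero)
  define B where "B = ball b (min e2 (e / 2))"
  have inb: "x + s *\<^sub>R v \<in> ball b e" if "x \<in> B" "\<bar>s\<bar> \<le> S" for x s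
  proof -
    have "norm (s *\<^sub>R v) \<le> S * norm v" using that(2) by (simp add: mult_right_mono)
    also have "\<dots> = e / 4" using v0 by (simp add: S_def)
    finally have "norm (s *\<^sub>R v) \<le> e / 4" .
    moreover have "dist b (x + s *\<^sub>R v) \<le> dist b x + norm (s *\<^sub>R v)" using dist_triangle[of b "x + s *\<^sub>R v" x] by (simp add: dist_norm)
    ultimately show ?thesis using that(1) e by (simp add: B_def)
  qed
  define G where "G = \<Omega> \<inter> ball b \<epsilon>"
  have Go: "open G" unfolding G_def using dom_open by blast
  have GU: "x \<in> U" "r x < 0" if "x \<in> G" for x
  proof -
    show "x \<in> U" using that \<epsilon>(2) ball_U by (auto simp: G_def)
    then show "r x < 0" using that r_neg by (auto simp: G_def)
  qed
  define u where "u x = ennreal (indicator G x *\<^sub>R (1 / - r x))" for x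
  have um[measurable]: "u \<in> borel_measurable borel"
  proof -
    have "continuous_on G (\<lambda>x. 1 / - r x)"
      using GU by (intro continuous_intros continuous_on_subset[OF r_cont]) force+
    then have "(\<lambda>x. indicator G x *\<^sub>R (1 / - r x)) \<in> borel_measurable borel"
      using Go by (intro borel_measurable_continuous_on_indicator) auto
    then show ?thesis unfolding u_def by measurable
  qed
  have line: "(\<integral>\<^sup>+s. u (x + s *\<^sub>R v) * indicator {-S..S} s \<partial>lborel) = \<infinity>" if x: "x \<in> B" for x
  proof -
    define g where "g s = r (x + s *\<^sub>R v)" for s
    have gd: "(g has_field_derivative d (x + s *\<^sub>R v) v) (at s)" if "\<bar>s\<bar> \<le> S" for s
      unfolding g_def using r_line[OF eU[OF inb[OF x that]]] .
    have rx: "\<bar>g 0\<bar> < S" using e2(2)[of x] x by (simp add: g_def B_def dist_commute)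
    have mvt: "\<exists>z. s < z \<and> z < t \<and> g t - g s = (t - s) * d (x + z *\<^sub>R v) v" if "s < t" "-S \<le> s" "t \<le> S" for s t
      using MVT2[OF that(1), of g "\<lambda>s. d (x + s *\<^sub>R v) v"] gd that by (auto simp: abs_le_iff)
    have up: "g t - g s \<le> - (t - s)" and lo: "- (L * (t - s)) \<le> g t - g s" if st: "s < t" "-S \<le> s" "t \<le> S" for s t
    proof -
      obtain z where z: "s < z" "z < t" "g t - g s = (t - s) * d (x + z *\<^sub>R v) v" using mvt[OF st] by blast
      have zb: "x + z *\<^sub>R v \<in> ball b e" using inb[OF x, of z] z st by auto
      have "(t - s) * d (x + z *\<^sub>R v) v \<le> (t - s) * -1" using dv(1)[OF zb] st by (intro mult_left_mono) auto
      then show "g t - g s \<le> - (t - s)" using z(3) by simp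
      have "(t - s) * - L \<le> (t - s) * d (x + z *\<^sub>R v) v" using dv(2)[OF zb] st by (intro mult_left_mono) auto
      then show "- (L * (t - s)) \<le> g t - g s" using z(3) by (simp add: mult.commute)
    qed
    have gS: "g S < 0" "g (-S) > 0" using up[of 0 S] up[of "-S" 0] rx S by auto
    have gc: "isCont g s" if "\<bar>s\<bar> \<le> S" for s using gd[OF that] by (rule DERIV_isCont)
    have "\<exists>s0. -S \<le> s0 \<and> s0 \<le> S \<and> g s0 = 0"
      by (rule IVT2) (use gS S in \<open>auto intro!: gc simp: abs_le_iff\<close>)
    then obtain s0 where s0: "-S \<le> s0" "s0 \<le> S" "g s0 = 0" by blast
    have s0S: "s0 < S" using s0 gS by (cases "s0 = S") auto
    have "(\<integral>\<^sup>+s. ennreal (1 / (L * (s - s0))) * indicator {s0<..<s0 + (S - s0)} s \<partial>lborel)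
       \<le> (\<integral>\<^sup>+s. u (x + s *\<^sub>R v) * indicator {-S..S} s \<partial>lborel)"
    proof (rule nn_integral_mono)
      fix s :: real
      show "ennreal (1 / (L * (s - s0))) * indicator {s0<..<s0 + (S - s0)} s \<le> u (x + s *\<^sub>R v) * indicator {-S..S} s"
      proof (cases "s0 < s \<and> s < S")
        case True
        then have sb: "x + s *\<^sub>R v \<in> ball b e" using inb[OF x, of s] s0 by auto
        have neg: "g s < 0" using up[of s0 s] True s0 by auto
        have "- g s \<le> L * (s - s0)" using lo[of s0 s] True s0 by auto
        then have "1 / (L * (s - s0)) \<le> 1 / - g s" using neg True by (intro divide_left_mono mult_pos_pos) (auto simp: L_def)
        moreover have "x + s *\<^sub>R v \<in> G"
          unfolding G_def using sb neg dom_I[OF eU[OF sb]] by (auto simp: g_def e_def)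
        ultimately show ?thesis using True s0 by (simp add: u_def g_def ennreal_leI)
      qed auto
    qed
    then show ?thesis using nn_integral_inverse_infinite[of L "S - s0" s0] s0S by (simp add: L_def top_unique)
  qed
  have Bm: "B \<in> sets borel" by (simp add: B_def)
  have Bpos: "emeasure lborel B > 0"
  proof -
    have "0 < measure lborel B" using e2 e by (simp add: B_def)
    then show ?thesis by (simp add: measure_def enn2real_positive_iff)
  qed
  have cm: "(\<lambda>p. fst p + snd p *\<^sub>R v) \<in> borel_measurable borel"
    by (intro borel_measurable_continuous_onI continuous_intros)
  have m2: "(\<lambda>(x, s). u (x + s *\<^sub>R v) * indicator {-S..S} s) \<in> borel_measurable (lborel \<Otimes>\<^sub>M lborel)"
  proof -
    have "(\<lambda>p. u (fst p + snd p *\<^sub>R v)) \<in> borel_measurable (borel \<Otimes>\<^sub>M borel)"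
      using measurable_compose[OF cm um] by (simp add: borel_prod)
    moreover have "(\<lambda>p. indicator {-S..S} (snd p) :: ennreal) \<in> borel_measurable ((borel :: (complex ^ 'n) measure) \<Otimes>\<^sub>M borel)"
      by measurable
    ultimately have "(\<lambda>p. u (fst p + snd p *\<^sub>R v) * indicator {-S..S} (snd p)) \<in> borel_measurable (borel \<Otimes>\<^sub>M borel)"
      by (rule borel_measurable_times_ennreal)
    then show ?thesis by (simp add: split_def cong: measurable_cong_sets)
  qed
  have "(\<integral>\<^sup>+x. \<infinity> * indicator B x \<partial>lborel) = \<infinity> * emeasure lborel B"
    using Bm by (intro nn_integral_cmult_indicator) simp
  then have "\<infinity> = (\<integral>\<^sup>+x. \<infinity> * indicator B x \<partial>lborel)"
    using Bpos by (simp only: infinity_ennreal_def ennreal_top_mult) simp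
  also have "\<dots> \<le> (\<integral>\<^sup>+x. \<integral>\<^sup>+s. u (x + s *\<^sub>R v) * indicator {-S..S} s \<partial>lborel \<partial>lborel)"
    by (intro nn_integral_mono) (auto simp: line split: split_indicator)
  also have "\<dots> = (\<integral>\<^sup>+s. \<integral>\<^sup>+x. u (x + s *\<^sub>R v) * indicator {-S..S} s \<partial>lborel \<partial>lborel)"
    by (rule lborel_pair.Fubini'[OF m2, symmetric])
  also have "\<dots> = (\<integral>\<^sup>+s. (\<integral>\<^sup>+x. u x \<partial>lborel) * indicator {-S..S} s \<partial>lborel)"
  proof (rule nn_integral_cong)
    fix s :: real
    have "(\<lambda>x. u (x + s *\<^sub>R v)) \<in> borel_measurable borel" by measurable
    then have "(\<integral>\<^sup>+x. u (x + s *\<^sub>R v) * indicator {-S..S} s \<partial>lborel) = (\<integral>\<^sup>+x. u (x + s *\<^sub>R v) \<partial>lborel) * indicator {-S..S} s"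
      by (intro nn_integral_multc) auto
    also have "(\<integral>\<^sup>+x. u (x + s *\<^sub>R v) \<partial>lborel) = (\<integral>\<^sup>+x. u x \<partial>lborel)"
      using nn_integral_lborel_translate[OF um, of "s *\<^sub>R v"] by (simp add: add.commute)
    finally show "(\<integral>\<^sup>+x. u (x + s *\<^sub>R v) * indicator {-S..S} s \<partial>lborel) = (\<integral>\<^sup>+x. u x \<partial>lborel) * indicator {-S..S} s" .
  qed
  also have "\<dots> = (\<integral>\<^sup>+x. u x \<partial>lborel) * ennreal (2 * S)"
    using S by (simp add: nn_integral_cmult_indicator)
  finally have "(\<integral>\<^sup>+x. u x \<partial>lborel) * ennreal (2 * S) = \<infinity>" by (simp add: top_unique)
  then have "(\<integral>\<^sup>+x. u x \<partial>lborel) = \<infinity>" by (simp add: ennreal_mult_eq_top_iff)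
  moreover have "(\<integral>\<^sup>+x. u x \<partial>lborel) = (\<integral>\<^sup>+x. ennreal (1 / - r x) * indicator (\<Omega> \<inter> ball b \<epsilon>) x \<partial>lborel)"
    by (intro nn_integral_cong) (auto simp: u_def G_def split: split_indicator)
  ultimately show ?thesis by simp
qed

end

locale hankel_farthest = bergman_farthest_data \<Omega> U r r1 r2 q \<rho> c \<alpha> \<Lambda> M k + hankel_symbol \<Omega> \<phi> b
  for \<Omega> U :: "(complex ^ 'n) set" and r r1 r2 q \<rho> c \<alpha> \<Lambda> M k \<phi> b +
  fixes f1 :: "complex ^ 'n \<Rightarrow> (complex ^ 'n) \<Rightarrow>\<^sub>L complex"
  assumes phi_deriv: "\<And>z. z \<in> \<Omega> \<Longrightarrow> (\<phi> has_derivative blinfun_apply (f1 z)) (at z)"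
    and f1_cont: "continuous_on (closure \<Omega>) f1"
begin

lemma f1_hom_dom: "z \<in> \<Omega> \<Longrightarrow> blinfun_apply (f1 z) (x *s v) = x * blinfun_apply (f1 z) v"
proof -
  assume z: "z \<in> \<Omega>"
  obtain D where D: "(\<phi> has_derivative D) (at z)" "\<And>c v. D (c *s v) = c * D v"
    using phi_hol z unfolding Cn_holomorphic_on_def by blast
  have "D = blinfun_apply (f1 z)" using D(1) phi_deriv[OF z] by (rule has_derivative_unique)
  then show ?thesis using D(2) by simp
qed

lemma f1_apply_cont: "continuous_on (closure \<Omega>) (\<lambda>z. blinfun_apply (f1 z) v)"
  by (intro continuous_intros f1_cont)

text \<open>Complex linearity passes from the domain to its boundary by continuity.\<close>

lemma f1_hom:
  assumes "z \<in> closure \<Omega>"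
  shows "blinfun_apply (f1 z) (x *s v) = x * blinfun_apply (f1 z) v"
proof -
  have "blinfun_apply (f1 z) (x *s v) - x * blinfun_apply (f1 z) v = 0"
    by (rule continuous_constant_on_closure[of \<Omega> "\<lambda>z. blinfun_apply (f1 z) (x *s v) - x * blinfun_apply (f1 z) v"])
      (use assms f1_hom_dom in \<open>auto intro!: continuous_intros f1_apply_cont\<close>)
  then show ?thesis by simp
qed

text \<open>With \<open>t = - r z\<close>, \<open>X = |K|\<^sup>2\<close> and \<open>Y = |(\<phi> - \<phi>(z)) K|\<^sup>2\<close>, the bounds \<open>Y \<ge> const |D\<phi> \<tau>|\<^sup>2 X\<^sup>2 t\<^sup>n\<^sup>+\<^sup>2\<close> and
  \<open>X \<ge> const t\<^sup>-\<^sup>n\<^sup>-\<^sup>1\<close> give \<open>Y\<^sup>n X\<^sup>1\<^sup>-\<^sup>n \<ge> const |D\<phi> \<tau>|\<^sup>2\<^sup>n t\<^sup>-\<^sup>1\<close>; here the exponent \<open>2n\<close> is critical.\<close>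

lemma tangential_derivative_zero:
  assumes sch: "schatten_class A L ip p H" and p: "0 < p" "p \<le> 2 * real CARD('n)"
    and b': "b' \<in> frontier \<Omega>" "b' \<in> ball q (\<rho> / 2)" and \<tau>: "linform (a b') \<tau> = 0"
  shows "blinfun_apply (f1 b') \<tau> = 0"
proof (rule ccontr)
  assume nz: "blinfun_apply (f1 b') \<tau> \<noteq> 0"
  define N where "N = CARD('n)"
  have N: "N > 0" by (simp add: N_def)
  obtain W C where C: "0 < C" and W: "(\<integral>\<^sup>+z. W z \<partial>lebesgue_on \<Omega>) < \<infinity>"
    and WC: "\<And>z K. z \<in> \<Omega> \<Longrightarrow> K \<in> A \<Longrightarrow> (\<And>f. f \<in> A \<Longrightarrow> ip f K = f z) \<Longrightarrow>
       ennreal ((nrm ((\<lambda>x. \<phi> x - \<phi> z) * K)) ^ (2 * N)) \<le> ennreal (C * (nrm K) ^ (2 * (N - 1))) * W z"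
  proof (rule schatten_kernel_estimate[OF sch p(1) p(2)[folded N_def] N])
    fix W C assume h: "0 < C" "(\<integral>\<^sup>+z. W z \<partial>lebesgue_on \<Omega>) < \<infinity>"
      "\<And>z K. z \<in> \<Omega> \<Longrightarrow> K \<in> A \<Longrightarrow> (\<And>f. f \<in> A \<Longrightarrow> ip f K = f z) \<Longrightarrow>
       ennreal ((nrm ((\<lambda>x. \<phi> x - \<phi> z) * K)) ^ (2 * N)) \<le> ennreal (C * (nrm K) ^ (2 * (N - 1))) * W z"
    show thesis by (rule that[OF h(1,2)]) (rule h(3))
  qed
  obtain \<kappa> where \<kappa>: "0 < \<kappa>"
    "\<And>z K. z \<in> \<Omega> \<Longrightarrow> z \<in> ball q \<rho> \<Longrightarrow> K \<in> A \<Longrightarrow> (\<And>f. f \<in> A \<Longrightarrow> ip f K = f z) \<Longrightarrow> \<kappa> \<le> (nrm K)\<^sup>2 * (- r z) ^ Suc N"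
  proof (rule kernel_lower_bound)
    fix \<kappa> assume h: "0 < \<kappa>"
      "\<And>z K. z \<in> \<Omega> \<Longrightarrow> z \<in> ball q \<rho> \<Longrightarrow> K \<in> A \<Longrightarrow> (\<And>f. f \<in> A \<Longrightarrow> ip f K = f z) \<Longrightarrow> \<kappa> \<le> (nrm K)\<^sup>2 * (- r z) ^ Suc CARD('n)"
    show thesis by (rule that[OF h(1)]) (unfold N_def, rule h(2))
  qed
  obtain \<kappa>' where \<kappa>': "0 < \<kappa>'"
    "\<And>z G D \<tau>. z \<in> \<Omega> \<Longrightarrow> z \<in> ball q (\<rho> / 2) \<Longrightarrow> G \<in> A \<Longrightarrow> (G has_derivative D) (at z) \<Longrightarrow> (\<And>c v. D (c *s v) = c * D v) \<Longrightarrow>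
       linform (a z) \<tau> = 0 \<Longrightarrow> \<kappa>' * (cmod (D \<tau>))\<^sup>2 * (- r z) ^ (N + 2) \<le> (norm \<tau>)\<^sup>2 * (nrm G)\<^sup>2"
  proof (rule tangential_derivative_bound)
    fix \<kappa> assume h: "0 < \<kappa>"
      "\<And>z G D \<tau>. z \<in> \<Omega> \<Longrightarrow> z \<in> ball q (\<rho> / 2) \<Longrightarrow> G \<in> A \<Longrightarrow> (G has_derivative D) (at z) \<Longrightarrow> (\<And>c v. D (c *s v) = c * D v) \<Longrightarrow>
       linform (a z) \<tau> = 0 \<Longrightarrow> \<kappa> * (cmod (D \<tau>))\<^sup>2 * (- r z) ^ (CARD('n) + 2) \<le> (norm \<tau>)\<^sup>2 * (nrm G)\<^sup>2"
    show thesis by (rule that[OF h(1)]) (unfold N_def, rule h(2))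
  qed
  have bU: "b' \<in> U" and br: "b' \<in> ball q \<rho>" using b'(2) ball_U \<rho> by auto
  have bcl: "b' \<in> closure \<Omega>" using b'(1) by (simp add: frontier_def)
  \<comment> \<open>Extends \<tau> continuously to complex tangent vectors at nearby points by
    correcting coordinate k.\<close>
  define tz where "tz z = \<tau> - axis k (linform (a z) \<tau> / a z $ k)" for z
  have tz0: "linform (a z) (tz z) = 0" if "z \<in> ball q \<rho>" for z
  proof -
    have "a z $ k \<noteq> 0" using a_lower[OF that] \<alpha> by auto
    then show ?thesis
      using bounded_linear.linear[OF bounded_linear_linform[of "a z"]] by (simp add: tz_def linear_diff linform_axis)
  qed
  have tzb: "tz b' = \<tau>" using \<tau> by (simp add: tz_def axis_def vec_eq_iff)
  have tzc: "continuous_on (ball q \<rho>) tz"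
  proof -
    have ac: "continuous_on (ball q \<rho>) (\<lambda>z. a z $ j)" for j
      by (intro continuous_intros continuous_on_subset[OF a_cont ball_U])
    have anz: "\<forall>z\<in>ball q \<rho>. a z $ k \<noteq> 0" using a_lower \<alpha> by force
    have "continuous_on (ball q \<rho>) (\<lambda>z. linform (a z) \<tau> / a z $ k)"
      unfolding linform_def by (intro continuous_intros ac anz)
    then have "continuous_on (ball q \<rho>) (\<lambda>z. (linform (a z) \<tau> / a z $ k) *s axis k 1)"
      by (rule bounded_linear.continuous_on[OF bounded_linear_scalar_mult_left])
    then have c: "continuous_on (ball q \<rho>) (\<lambda>z. \<tau> - (linform (a z) \<tau> / a z $ k) *s axis k 1)"
      by (rule continuous_on_diff[OF continuous_on_const])
    have ax: "axis k x = x *s axis k 1" for x :: complex by (simp add: vec_eq_iff axis_def)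
    have "tz z = \<tau> - (linform (a z) \<tau> / a z $ k) *s axis k 1" for z
      unfolding tz_def by (subst ax) (rule refl)
    then have "tz = (\<lambda>z. \<tau> - (linform (a z) \<tau> / a z $ k) *s axis k 1)" by (rule ext)
    then show ?thesis using c by (simp only:)
  qed
  define F where "F z = blinfun_apply (f1 z) (tz z)" for z
  have Fc: "continuous_on (closure \<Omega> \<inter> ball q \<rho>) F"
    unfolding F_def by (intro continuous_intros continuous_on_subset[OF f1_cont] continuous_on_subset[OF tzc]) auto
  define \<delta> where "\<delta> = cmod (F b') / 2"
  have \<delta>: "\<delta> > 0" using nz by (simp add: \<delta>_def F_def tzb)
  obtain e1 where e1: "e1 > 0" "\<And>z. z \<in> closure \<Omega> \<inter> ball q \<rho> \<Longrightarrow> dist z b' < e1 \<Longrightarrow> dist (F z) (F b') < \<delta>"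
    using Fc \<delta> bcl br unfolding continuous_on_iff by (metis IntI)
  obtain e2 where e2: "e2 > 0" "\<And>z. z \<in> ball q \<rho> \<Longrightarrow> dist z b' < e2 \<Longrightarrow> dist (tz z) (tz b') < 1"
    using tzc br unfolding continuous_on_iff by (metis zero_less_one)
  obtain e3 where e3: "e3 > 0" "ball b' e3 \<subseteq> ball q (\<rho> / 2)" using b'(2) open_ball open_contains_ball by blast
  define \<epsilon> where "\<epsilon> = min e1 (min e2 e3)"
  have \<epsilon>: "\<epsilon> > 0" "ball b' \<epsilon> \<subseteq> ball q (\<rho> / 2)" using e1 e2 e3 by (auto simp: \<epsilon>_def)
  have half: "ball q (\<rho> / 2) \<subseteq> ball q \<rho>" using \<rho> by auto
  define T where "T = norm \<tau> + 1"
  have T: "T > 0" by (simp add: T_def add_nonneg_pos)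
  define Q where "Q = (\<kappa>' * \<delta>\<^sup>2 / T\<^sup>2) ^ N * \<kappa> ^ Suc N / C"
  have Q: "Q > 0" using \<kappa> \<kappa>' \<delta> T C by (simp add: Q_def)
  have low: "ennreal (Q / - r z) \<le> W z" if z: "z \<in> \<Omega>" "z \<in> ball b' \<epsilon>" for z
  proof -
    have zq: "z \<in> ball q (\<rho> / 2)" using \<epsilon>(2) z(2) by (rule subsetD)
    have zr: "z \<in> ball q \<rho>" using half zq by (rule subsetD)
    define t where "t = - r z"
    have t: "0 < t" using r_neg[OF z(1)] zr ball_U by (auto simp: t_def)
    obtain K where K: "K \<in> A" "\<And>f. f \<in> A \<Longrightarrow> ip f K = f z" using reproducing_kernel[OF z(1)] by blast
    define X where "X = (nrm K)\<^sup>2"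
    have XK: "\<kappa> \<le> X * t ^ Suc N" unfolding X_def t_def by (rule \<kappa>(2)[OF z(1) zr K])
    have X: "X > 0"
    proof (rule ccontr)
      assume "\<not> X > 0"
      then have "X * t ^ Suc N \<le> 0" using t by (intro mult_nonpos_nonneg) auto
      then show False using XK \<kappa>(1) by linarith
    qed
    have Kz: "K z = of_real X" using K(2)[OF K(1)] A.ip_self[OF K(1)] by (simp add: X_def)
    define G where "G = (\<lambda>x. \<phi> x - \<phi> z) * K"
    have GA: "G \<in> A" unfolding G_def by (rule diff_mult_A[OF z(1) K(1)])
    define Y where "Y = (nrm G)\<^sup>2"
    obtain E where E: "(K has_derivative E) (at z)" "\<And>c v. E (c *s v) = c * E v"
      using A_hol[OF K(1)] z(1) unfolding Cn_holomorphic_on_def by blast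
    \<comment> \<open>The term with the derivative of K disappears since \<phi> - \<phi>(z) vanishes
      at z; what remains is K(z) D\<phi>, where K(z) = X.\<close>
    have GD: "(G has_derivative (\<lambda>v. of_real X * blinfun_apply (f1 z) v)) (at z)"
    proof -
      have "((\<lambda>x. (\<phi> x - \<phi> z) * K x) has_derivative (\<lambda>v. (\<phi> z - \<phi> z) * E v + (blinfun_apply (f1 z) v - 0) * K z)) (at z)"
        by (intro has_derivative_mult has_derivative_diff phi_deriv z E has_derivative_const)
      then show ?thesis by (simp add: G_def times_fun_def Kz mult.commute)
    qed
    have dF: "\<delta> \<le> cmod (F z)"
    proof -
      have "dist (F z) (F b') < \<delta>" using e1(2)[of z] z zr closure_subset by (auto simp: \<epsilon>_def dist_commute)
      then show ?thesis using norm_triangle_sub[of "F b'" "F z"] by (simp add: \<delta>_def dist_norm norm_minus_commute)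
    qed
    have nT: "norm (tz z) \<le> T"
    proof -
      have "dist (tz z) (tz b') < 1" using e2(2)[OF zr] z by (auto simp: \<epsilon>_def dist_commute)
      then show ?thesis using norm_triangle_sub[of "tz z" \<tau>] by (simp add: T_def dist_norm tzb)
    qed
    have "\<kappa>' * (cmod (of_real X * F z))\<^sup>2 * t ^ (N + 2) \<le> (norm (tz z))\<^sup>2 * Y"
      unfolding t_def Y_def F_def
      by (rule \<kappa>'(2)[OF z(1) zq GA GD _ tz0[OF zr]]) (simp add: f1_hom_dom[OF z(1)] mult.left_commute)
    also have "\<dots> \<le> T\<^sup>2 * Y" unfolding Y_def using nT by (intro mult_right_mono power_mono) auto
    finally have 1: "\<kappa>' * (X * cmod (F z))\<^sup>2 * t ^ (N + 2) \<le> T\<^sup>2 * Y" using X by (simp add: norm_mult)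
    have "\<kappa>' * (X * \<delta>)\<^sup>2 * t ^ (N + 2) \<le> \<kappa>' * (X * cmod (F z))\<^sup>2 * t ^ (N + 2)"
      using \<kappa>'(1) X dF \<delta> t by (intro mult_right_mono mult_left_mono power_mono) auto
    then have 2: "\<kappa>' * \<delta>\<^sup>2 / T\<^sup>2 * X\<^sup>2 * t ^ (N + 2) \<le> Y" using 1 T by (simp add: power_mult_distrib field_simps)
    have "(\<kappa>' * \<delta>\<^sup>2 / T\<^sup>2 * X\<^sup>2 * t ^ (N + 2)) ^ N \<le> Y ^ N"
      using 2 \<kappa>'(1) t by (intro power_mono) auto
    then have 3: "(\<kappa>' * \<delta>\<^sup>2 / T\<^sup>2) ^ N * X ^ (2 * N) * t ^ ((N + 2) * N) \<le> Y ^ N"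
      by (simp only: power_mult_distrib power_mult)
    have YN: "Y ^ N = nrm G ^ (2 * N)" and XN: "X ^ (N - 1) = nrm K ^ (2 * (N - 1))"
      by (simp_all add: Y_def X_def power_mult)
    have "ennreal (Y ^ N) \<le> ennreal (C * X ^ (N - 1)) * W z"
      unfolding YN XN G_def by (rule WC[OF z(1) K])
    moreover have "ennreal (Q / t) * ennreal (C * X ^ (N - 1)) \<le> ennreal (Y ^ N)"
    proof -
      \<comment> \<open>2N = (N - 1) + (N + 1): the first factor is the one standing beside W, the
        second is estimated by the lower bound for the kernel.\<close>
      have XX: "X ^ (2 * N) = X ^ (N - 1) * X ^ Suc N"
        unfolding power_add[symmetric] using N by (intro arg_cong[where f = "\<lambda>m. X ^ m"]) simp
      have "\<kappa> ^ Suc N \<le> (X * t ^ Suc N) ^ Suc N" using XK \<kappa>(1) by (intro power_mono) auto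
      also have "\<dots> = X ^ Suc N * (t ^ ((N + 2) * N) * t)"
      proof -
        \<comment> \<open>(N + 1)^2 exceeds (N + 2) N by exactly one; this surplus power of t is the
          origin of the factor 1 / t.\<close>
        have "(t ^ Suc N) ^ Suc N = t ^ ((N + 2) * N) * t"
          unfolding power_mult[symmetric] power_Suc2[symmetric] by (rule arg_cong[where f = "\<lambda>m. t ^ m"]) (simp add: algebra_simps)
        then show ?thesis by (simp only: power_mult_distrib)
      qed
      finally have 4: "\<kappa> ^ Suc N / t \<le> X ^ Suc N * t ^ ((N + 2) * N)" using t by (simp add: field_simps)
      have "Q / t * (C * X ^ (N - 1)) = (\<kappa>' * \<delta>\<^sup>2 / T\<^sup>2) ^ N * X ^ (N - 1) * (\<kappa> ^ Suc N / t)"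
        using C by (simp add: Q_def)
      also have "\<dots> \<le> (\<kappa>' * \<delta>\<^sup>2 / T\<^sup>2) ^ N * X ^ (N - 1) * (X ^ Suc N * t ^ ((N + 2) * N))"
        using 4 \<kappa>'(1) X by (intro mult_left_mono) auto
      also have "\<dots> = (\<kappa>' * \<delta>\<^sup>2 / T\<^sup>2) ^ N * X ^ (2 * N) * t ^ ((N + 2) * N)" unfolding XX by (simp only: mult_ac)
      also have "\<dots> \<le> Y ^ N" by (rule 3)
      finally have "Q / t * (C * X ^ (N - 1)) \<le> Y ^ N" .
      then have "ennreal (Q / t * (C * X ^ (N - 1))) \<le> ennreal (Y ^ N)" by (rule ennreal_leI)
      then show ?thesis using Q t C X by (subst ennreal_mult[symmetric]) auto
    qed
    ultimately have le: "ennreal (C * X ^ (N - 1)) * ennreal (Q / t) \<le> ennreal (C * X ^ (N - 1)) * W z"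
      by (metis mult.commute order_trans)
    have cx: "C * X ^ (N - 1) > 0" using C X by simp
    have "ennreal (1 / (C * X ^ (N - 1))) * (ennreal (C * X ^ (N - 1)) * ennreal (Q / t))
        \<le> ennreal (1 / (C * X ^ (N - 1))) * (ennreal (C * X ^ (N - 1)) * W z)" using le by (rule mult_left_mono) simp
    moreover have "ennreal (1 / (C * X ^ (N - 1))) * (ennreal (C * X ^ (N - 1)) * x) = x" for x
    proof -
      have "ennreal (1 / (C * X ^ (N - 1))) * ennreal (C * X ^ (N - 1)) = ennreal (1 / (C * X ^ (N - 1)) * (C * X ^ (N - 1)))"
        using cx by (intro ennreal_mult[symmetric]) auto
      also have "1 / (C * X ^ (N - 1)) * (C * X ^ (N - 1)) = 1"
        using cx by (simp only: times_divide_eq_left mult_1_left divide_self[OF less_imp_neq[OF cx, symmetric]])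
      finally show ?thesis by (simp add: mult.assoc[symmetric])
    qed
    ultimately show ?thesis unfolding t_def by simp
  qed
  define u where "u z = ennreal (1 / - r z) * indicator (\<Omega> \<inter> ball b' \<epsilon>) z" for z
  have inf: "(\<integral>\<^sup>+z. u z \<partial>lborel) = \<infinity>"
    unfolding u_def by (rule not_integrable_inverse[OF b'(1) br \<epsilon>(1)]) (use \<epsilon>(2) half in auto)
  have um: "u \<in> borel_measurable borel"
  proof -
    define G where "G = \<Omega> \<inter> ball b' \<epsilon>"
    have Go: "open G" unfolding G_def using dom_open by blast
    have GU: "x \<in> U" "r x < 0" if "x \<in> G" for x
    proof -
      show "x \<in> U" using that \<epsilon>(2) half ball_U unfolding G_def by blast
      then show "r x < 0" using that r_neg by (auto simp: G_def)
    qed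
    have "continuous_on G (\<lambda>x. 1 / - r x)"
      using GU by (intro continuous_intros continuous_on_subset[OF r_cont]) force+
    then have "(\<lambda>x. indicator G x *\<^sub>R (1 / - r x)) \<in> borel_measurable borel"
      using Go by (intro borel_measurable_continuous_on_indicator) auto
    then have "(\<lambda>x. ennreal (indicator G x *\<^sub>R (1 / - r x))) \<in> borel_measurable borel" by measurable
    moreover have "(\<lambda>x. ennreal (indicator G x *\<^sub>R (1 / - r x))) = u"
      by (auto simp: u_def G_def fun_eq_iff split: split_indicator)
    ultimately show ?thesis by simp
  qed
  have "ennreal Q * (\<integral>\<^sup>+z. u z \<partial>lborel) = (\<integral>\<^sup>+z. ennreal Q * u z \<partial>lborel)"
    using um by (simp add: nn_integral_cmult)
  also have "\<dots> = (\<integral>\<^sup>+z. (ennreal Q * u z) * indicator \<Omega> z \<partial>lborel)"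
    by (intro nn_integral_cong) (auto simp: u_def split: split_indicator)
  also have "\<dots> = (\<integral>\<^sup>+z. ennreal Q * u z \<partial>lebesgue_on \<Omega>)"
    by (rule nn_integral_dom[symmetric]) (use um in measurable)
  also have "\<dots> \<le> (\<integral>\<^sup>+z. W z \<partial>lebesgue_on \<Omega>)"
  proof (rule nn_integral_mono)
    fix z assume "z \<in> space (lebesgue_on \<Omega>)"
    then have z: "z \<in> \<Omega>" by (simp add: space_restrict_space)
    show "ennreal Q * u z \<le> W z"
    proof (cases "z \<in> ball b' \<epsilon>")
      case True
      have "ennreal Q * u z = ennreal (Q / - r z)"
        using z True Q by (simp add: u_def ennreal_mult'[symmetric] del: minus_divide_right)
      then show ?thesis using low[OF z True] by simp
    qed (simp add: u_def)
  qed
  also have "\<dots> < \<infinity>" by (rule W)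
  finally show False using inf Q by (simp add: ennreal_mult_eq_top_iff ennreal_mult_top)
qed

end

section \<open>Vanishing tangential derivatives force the symbol to be constant\<close>

lemma half_cancel: "0 < y \<Longrightarrow> x / (2 * y) * y = x / 2" for x y :: real
  by simp

locale tangential_symbol = hankel_farthest \<Omega> U r r1 r2 q \<rho> c \<alpha> \<Lambda> M k \<phi> b f1
  for \<Omega> U :: "(complex ^ 'n) set" and r r1 r2 q \<rho> c \<alpha> \<Lambda> M k \<phi> b f1 +
  fixes f0
  assumes f0_cont: "continuous_on (closure \<Omega>) f0" and f0_eq: "\<And>z. z \<in> \<Omega> \<Longrightarrow> f0 z = \<phi> z"
    and tangential: "\<And>b' \<tau>. b' \<in> frontier \<Omega> \<Longrightarrow> b' \<in> ball q (\<rho> / 2) \<Longrightarrow> linform (a b') \<tau> = 0 \<Longrightarrow> blinfun_apply (f1 b') \<tau> = 0"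
    and dim2: "2 \<le> CARD('n)"
begin

lemma half_ball: "z \<in> ball q (\<rho> / 2) \<Longrightarrow> z \<in> ball q \<rho>"
  using \<rho> by simp

lemma support_closure:
  assumes z: "z \<in> \<Omega>" "z \<in> ball q \<rho>" and w: "w \<in> closure \<Omega>"
  shows "c * (norm (w - z))\<^sup>2 + 2 * r z \<le> - d z (w - z)"
proof -
  have "closed {w. c * (norm (w - z))\<^sup>2 + 2 * r z \<le> - d z (w - z)}"
    unfolding d_def by (intro closed_Collect_le continuous_intros)
  moreover have "\<Omega> \<subseteq> {w. c * (norm (w - z))\<^sup>2 + 2 * r z \<le> - d z (w - z)}" using support[OF z] by blast
  ultimately have "closure \<Omega> \<subseteq> {w. c * (norm (w - z))\<^sup>2 + 2 * r z \<le> - d z (w - z)}" by (rule closure_minimal[rotated])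
  then show ?thesis using w by blast
qed

text \<open>In an almost tangential direction the linear term in \<open>support\<close> is, beyond
  distance \<eta>, at most half of the quadratic one, and r z is too small to balance the rest.
  Hence the complex line meets the closed domain only near z.\<close>

lemma slice_small:
  assumes z: "z \<in> \<Omega>" "z \<in> ball q \<rho>" and \<eta>: "0 < \<eta>" "- r z \<le> c * \<eta>\<^sup>2 / 8"
    and \<tau>: "cmod (linform (a z) \<tau>) \<le> c * \<eta> / 2 * norm \<tau>" and w: "z + \<zeta> *s \<tau> \<in> closure \<Omega>"
  shows "norm (\<zeta> *s \<tau>) \<le> \<eta>"
proof (rule ccontr)
  define x where "x = norm (\<zeta> *s \<tau>)"
  assume "\<not> norm (\<zeta> *s \<tau>) \<le> \<eta>"
  then have x: "x > \<eta>" by (simp add: x_def)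
  have "- d z (\<zeta> *s \<tau>) \<le> cmod (linform (a z) (\<zeta> *s \<tau>))"
    using abs_Re_le_cmod[of "linform (a z) (\<zeta> *s \<tau>)"] by (simp add: Re_linform_a)
  also have "\<dots> = cmod \<zeta> * cmod (linform (a z) \<tau>)" by (simp add: linform_scale norm_mult)
  also have "\<dots> \<le> cmod \<zeta> * (c * \<eta> / 2 * norm \<tau>)" using \<tau> by (rule mult_left_mono) simp
  also have "\<dots> = c * \<eta> / 2 * x" by (simp add: x_def norm_vector_scalar_mult)
  also have "\<dots> \<le> c * x / 2 * x" using x \<eta> c by (intro mult_right_mono) auto
  finally have 1: "- d z (\<zeta> *s \<tau>) \<le> c * x\<^sup>2 / 2" by (simp add: power2_eq_square)
  have 2: "c * x\<^sup>2 + 2 * r z \<le> - d z (\<zeta> *s \<tau>)" using support_closure[OF z w] by (simp add: x_def)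
  have "\<eta>\<^sup>2 < x\<^sup>2" using x \<eta> by (intro power_strict_mono) auto
  then have "c * \<eta>\<^sup>2 < c * x\<^sup>2" using c by (rule mult_strict_left_mono)
  moreover have "0 \<le> c * x\<^sup>2" using c by simp
  ultimately have "c * \<eta>\<^sup>2 / 8 < c * x\<^sup>2 / 4" by linarith
  then show False using 1 2 \<eta>(2) by linarith
qed

definition slice where "slice z \<tau> = {\<zeta>. z + \<zeta> *s \<tau> \<in> \<Omega>}"

lemma slice_open: "open (slice z \<tau>)"
  unfolding slice_def by (rule open_line[OF open_dom])

lemma slice_closure: "\<zeta> \<in> closure (slice z \<tau>) \<Longrightarrow> z + \<zeta> *s \<tau> \<in> closure \<Omega>"
proof -
  assume \<zeta>: "\<zeta> \<in> closure (slice z \<tau>)"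
  have "closed {\<zeta>. z + \<zeta> *s \<tau> \<in> closure \<Omega>}"
    using continuous_closed_vimage[of "closure \<Omega>" "\<lambda>\<zeta>. z + \<zeta> *s \<tau>"] continuous_line[of UNIV z \<tau>]
    by (simp add: vimage_def continuous_on_eq_continuous_at)
  moreover have "slice z \<tau> \<subseteq> {\<zeta>. z + \<zeta> *s \<tau> \<in> closure \<Omega>}" using closure_subset by (auto simp: slice_def)
  ultimately show ?thesis using closure_minimal \<zeta> by blast
qed

lemma slice_frontier: "\<zeta> \<in> frontier (slice z \<tau>) \<Longrightarrow> z + \<zeta> *s \<tau> \<in> frontier \<Omega>"
  using slice_closure[of \<zeta> z \<tau>] slice_open[of z \<tau>] open_dom
  by (auto simp: frontier_def interior_open slice_def)

lemma slice_bounded: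
  assumes small: "\<And>\<zeta>. z + \<zeta> *s \<tau> \<in> closure \<Omega> \<Longrightarrow> norm (\<zeta> *s \<tau>) \<le> \<eta>" and \<tau>: "\<tau> \<noteq> 0"
  shows "bounded (slice z \<tau>)"
proof -
  have "cmod \<zeta> \<le> \<eta> / norm \<tau>" if "\<zeta> \<in> slice z \<tau>" for \<zeta>
    using small[of \<zeta>] that closure_subset[of \<Omega>] \<tau> by (auto simp: slice_def norm_vector_scalar_mult field_simps)
  then show ?thesis by (auto simp: bounded_iff)
qed

text \<open>Here the dimension enters: a second coordinate j allows the vector with entries a_k in
  position j and - a_j in position k.\<close>

lemma tangent_vector:
  assumes z: "z \<in> ball q \<rho>"
  obtains \<tau> where "\<tau> \<noteq> 0" "linform (a z) \<tau> = 0"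
proof -
  have "\<exists>j. j \<noteq> k"
  proof (rule ccontr)
    assume "\<not> ?thesis"
    then have "(UNIV :: 'n set) = {k}" by blast
    then have "CARD('n) = 1" by (metis card_1_singleton_iff One_nat_def)
    then show False using dim2 by simp
  qed
  then obtain j where j: "j \<noteq> k" by blast
  define \<tau> where "\<tau> = axis j (a z $ k) + axis k (- (a z $ j))"
  have "linform (a z) \<tau> = 0" by (simp add: \<tau>_def linform_add linform_axis)
  moreover have "\<tau> $ j \<noteq> 0" using a_lower[OF z] \<alpha> j by (auto simp: \<tau>_def axis_def)
  then have "\<tau> \<noteq> 0" by auto
  ultimately show ?thesis using that by blast
qed

text \<open>\<open>f0\<close> need not be differentiable at a boundary point, but along a segment
  entering the domain the mean value theorem and the continuity of \<open>f1\<close> up to w still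
  give a first-order expansion.\<close>

lemma one_sided_derivative:
  assumes w: "w \<in> closure \<Omega>" and e: "0 < e" "\<And>t. 0 < t \<Longrightarrow> t < e \<Longrightarrow> w + t *\<^sub>R v \<in> \<Omega>" and \<delta>: "0 < \<delta>"
  obtains t where "0 < t" "t < e" "cmod (f0 (w + t *\<^sub>R v) - f0 w - t *\<^sub>R blinfun_apply (f1 w) v) \<le> \<delta> * t"
proof -
  have "\<delta> / (norm v + 1) > 0" using \<delta> by (intro divide_pos_pos add_nonneg_pos) auto
  then obtain e1 where e1: "e1 > 0" "\<And>x. x \<in> closure \<Omega> \<Longrightarrow> dist x w < e1 \<Longrightarrow> dist (f1 x) (f1 w) < \<delta> / (norm v + 1)"
    using f1_cont w unfolding continuous_on_iff by metis
  define t where "t = min (e / 2) (e1 / (2 * (norm v + 1)))"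
  have nv: "norm v + 1 > 0" by (simp add: add_nonneg_pos)
  have t: "0 < t" "t < e" using e e1 nv by (auto simp: t_def)
  have tv: "x * norm v < e1" if "0 \<le> x" "x \<le> t" for x
  proof -
    have "x * norm v \<le> (e1 / (2 * (norm v + 1))) * norm v" using that by (intro mult_right_mono) (auto simp: t_def)
    also have "\<dots> \<le> (e1 / (2 * (norm v + 1))) * (norm v + 1)" using e1 nv by (intro mult_left_mono) auto
    also have "\<dots> = e1 / 2" by (rule half_cancel[OF nv])
    finally show ?thesis using e1 by simp
  qed
  have cl: "w + x *\<^sub>R v \<in> closure \<Omega>" if "0 \<le> x" "x \<le> t" for x
    using that w e(2)[of x] t closure_subset by (cases "x = 0") auto
  define g where "g x = f0 (w + x *\<^sub>R v) - x *\<^sub>R blinfun_apply (f1 w) v" for x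
  have "\<exists>x\<in>{0<..<t}. norm (g t - g 0) \<le> norm ((\<lambda>s. s *\<^sub>R (blinfun_apply (f1 (w + x *\<^sub>R v)) v - blinfun_apply (f1 w) v)) (t - 0))"
  proof (rule mvt_general[OF t(1)])
    show "continuous_on {0..t} g"
      unfolding g_def
      by (intro continuous_intros continuous_on_compose2[OF f0_cont]) (use cl in auto)
    fix x assume x: "0 < x" "x < t"
    have in\<Omega>: "w + x *\<^sub>R v \<in> \<Omega>" using e(2) x t by simp
    have "(f0 has_derivative blinfun_apply (f1 (w + x *\<^sub>R v))) (at (w + x *\<^sub>R v))"
      by (rule has_derivative_transform_within_open[OF phi_deriv[OF in\<Omega>] open_dom in\<Omega>]) (simp add: f0_eq)
    moreover have "((\<lambda>x. w + x *\<^sub>R v) has_derivative (\<lambda>s. s *\<^sub>R v)) (at x)" by (auto intro!: derivative_eq_intros)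
    ultimately have "((\<lambda>x. f0 (w + x *\<^sub>R v)) has_derivative (\<lambda>s. blinfun_apply (f1 (w + x *\<^sub>R v)) (s *\<^sub>R v))) (at x)"
      using has_derivative_compose by blast
    then have "(g has_derivative (\<lambda>s. blinfun_apply (f1 (w + x *\<^sub>R v)) (s *\<^sub>R v) - s *\<^sub>R blinfun_apply (f1 w) v)) (at x)"
      unfolding g_def by (intro has_derivative_diff) (auto intro!: derivative_eq_intros)
    then show "(g has_derivative (\<lambda>s. s *\<^sub>R (blinfun_apply (f1 (w + x *\<^sub>R v)) v - blinfun_apply (f1 w) v))) (at x)"
      by (simp add: blinfun.bilinear_simps scaleR_diff_right)
  qed
  then obtain x where x: "0 < x" "x < t" "norm (g t - g 0) \<le> norm (t *\<^sub>R (blinfun_apply (f1 (w + x *\<^sub>R v)) v - blinfun_apply (f1 w) v))"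
    by auto
  have "norm (blinfun_apply (f1 (w + x *\<^sub>R v)) v - blinfun_apply (f1 w) v) \<le> norm (f1 (w + x *\<^sub>R v) - f1 w) * norm v"
    using norm_blinfun[of "f1 (w + x *\<^sub>R v) - f1 w" v] by (simp add: blinfun.bilinear_simps)
  also have "\<dots> \<le> \<delta> / (norm v + 1) * norm v"
  proof (rule mult_right_mono)
    have "dist (f1 (w + x *\<^sub>R v)) (f1 w) < \<delta> / (norm v + 1)"
      using e1(2)[of "w + x *\<^sub>R v"] cl[of x] tv[of x] x by (simp add: dist_norm)
    then show "norm (f1 (w + x *\<^sub>R v) - f1 w) \<le> \<delta> / (norm v + 1)" by (simp add: dist_norm)
  qed simp
  also have "\<dots> \<le> \<delta> / (norm v + 1) * (norm v + 1)" using \<delta> nv by (intro mult_left_mono) auto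
  also have "\<dots> = \<delta>" using nv by simp
  finally have "norm (blinfun_apply (f1 (w + x *\<^sub>R v)) v - blinfun_apply (f1 w) v) \<le> \<delta>" .
  then have "t * norm (blinfun_apply (f1 (w + x *\<^sub>R v)) v - blinfun_apply (f1 w) v) \<le> t * \<delta>" using t by (intro mult_left_mono) auto
  moreover have "norm (t *\<^sub>R (blinfun_apply (f1 (w + x *\<^sub>R v)) v - blinfun_apply (f1 w) v))
      = t * norm (blinfun_apply (f1 (w + x *\<^sub>R v)) v - blinfun_apply (f1 w) v)" using t by simp
  ultimately have "norm (g t - g 0) \<le> t * \<delta>" using x(3) by linarith
  moreover have "g t - g 0 = f0 (w + t *\<^sub>R v) - f0 w - t *\<^sub>R blinfun_apply (f1 w) v" by (simp add: g_def)
  ultimately show ?thesis using that[OF t] by (simp add: mult.commute)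
qed

text \<open>On the boundary near q, where the tangential derivatives vanish, D\<phi> is a multiple
  of \<open>linform (a w)\<close>; this is the factor, read off from coordinate k.\<close>

definition nu where "nu w = blinfun_apply (f1 w) (axis k 1) / a w $ k"

lemma f1_frontier:
  assumes w: "w \<in> frontier \<Omega>" "w \<in> ball q (\<rho> / 2)"
  shows "blinfun_apply (f1 w) v = nu w * linform (a w) v"
proof -
  have wcl: "w \<in> closure \<Omega>" using w(1) by (simp add: frontier_def)
  have ak: "a w $ k \<noteq> 0" using a_lower[OF half_ball[OF w(2)]] \<alpha> by auto
  define x where "x = linform (a w) v / a w $ k"
  have "linform (a w) (v - x *s axis k 1) = linform (a w) v - linform (a w) (x *s axis k 1)"
    by (rule linear_diff[OF bounded_linear.linear[OF bounded_linear_linform]])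
  also have "\<dots> = 0" using ak by (simp add: linform_scale linform_axis x_def)
  finally have "blinfun_apply (f1 w) (v - x *s axis k 1) = 0" by (rule tangential[OF w])
  then have "blinfun_apply (f1 w) v = x * blinfun_apply (f1 w) (axis k 1)"
    using f1_hom[OF wcl, of x "axis k 1"] by (simp add: blinfun.bilinear_simps)
  then show ?thesis by (simp add: nu_def x_def)
qed

text \<open>If the normal component \<open>nu\<close> were nonzero at \<open>b'\<close>, then \<open>Re (\<phi> / (i nu(b')))\<close> would have a nonzero
  derivative tangential to the boundary of a small slice, at the very point where it is maximal.\<close>

lemma normal_derivative_zero:
  assumes b': "b' \<in> frontier \<Omega>" "b' \<in> ball q (\<rho> / 2)"
  shows "nu b' = 0"
proof (rule ccontr)
  assume nz: "nu b' \<noteq> 0"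
  have bU: "b' \<in> U" using half_ball[OF b'(2)] ball_U by blast
  have bcl: "b' \<in> closure \<Omega>" using b'(1) by (simp add: frontier_def)
  have ac: "continuous_on (ball q \<rho>) (\<lambda>z. a z $ j)" for j
    by (intro continuous_intros continuous_on_subset[OF a_cont ball_U])
  have "continuous_on (closure \<Omega> \<inter> ball q \<rho>) nu"
    unfolding nu_def
    by (intro continuous_intros continuous_on_subset[OF f1_cont] continuous_on_subset[OF ac])
      (use a_lower \<alpha> in force)+
  then have "continuous_on (closure \<Omega> \<inter> ball q \<rho>) (\<lambda>w. Re (nu w / nu b'))"
    using nz by (intro continuous_intros) auto
  moreover have "Re (nu b' / nu b') = 1" using nz by simp
  ultimately obtain e0 where e0: "e0 > 0"
    "\<And>w. w \<in> closure \<Omega> \<inter> ball q \<rho> \<Longrightarrow> dist w b' < e0 \<Longrightarrow> dist (Re (nu w / nu b')) 1 < 1"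
    using bcl half_ball[OF b'(2)] unfolding continuous_on_iff by (metis IntI zero_less_one)
  obtain e1 where e1: "e1 > 0" "ball b' e1 \<subseteq> ball q (\<rho> / 2)" using b'(2) open_ball open_contains_ball by blast
  \<comment> \<open>One third, so that slices of size \<eta> through points within \<eta> of b' stay
    where Re (nu w / nu b') is positive.\<close>
  define \<eta> where "\<eta> = min e0 e1 / 3"
  have \<eta>: "\<eta> > 0" using e0 e1 by (simp add: \<eta>_def)
  have \<eta>2: "2 * \<eta> < e0" "2 * \<eta> < e1" using e0 e1 by (auto simp: \<eta>_def min_def)
  have near: "w \<in> ball q (\<rho> / 2)" "w \<in> closure \<Omega> \<Longrightarrow> 0 < Re (nu w / nu b')" if "dist w b' \<le> 2 * \<eta>" for w
  proof -
    have "w \<in> ball b' e1" using that \<eta>2 by (simp add: dist_commute)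
    then show wq: "w \<in> ball q (\<rho> / 2)" using e1(2) by blast
    show "0 < Re (nu w / nu b')" if "w \<in> closure \<Omega>"
      using e0(2)[of w] that half_ball[OF wq] \<open>dist w b' \<le> 2 * \<eta>\<close> \<eta>2 by (auto simp: dist_real_def)
  qed
  have "isCont r b'" using r1[OF bU] has_derivative_continuous by blast
  moreover have rb: "r b' = 0" by (rule frontier_zero[OF b'(1) bU])
  moreover have "c * \<eta>\<^sup>2 / 8 > 0" using c \<eta> by simp
  ultimately obtain e2 where e2: "e2 > 0" "\<And>x. dist x b' < e2 \<Longrightarrow> dist (r x) 0 < c * \<eta>\<^sup>2 / 8"
    unfolding continuous_at_eps_delta by metis
  have "0 < min \<eta> e2" using \<eta> e2 by simp
  then obtain z where z: "z \<in> \<Omega>" "dist z b' < min \<eta> e2" using bcl closure_approachable by blast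
  have zq: "z \<in> ball q (\<rho> / 2)" using z(2) \<eta> by (intro near) auto
  have zr: "z \<in> ball q \<rho>" by (rule half_ball[OF zq])
  have rz: "- r z \<le> c * \<eta>\<^sup>2 / 8" using e2(2)[of z] z(2) by (simp add: dist_real_def)
  obtain \<tau> where \<tau>: "\<tau> \<noteq> 0" "linform (a z) \<tau> = 0" using tangent_vector[OF zr] by blast
  have small: "norm (\<zeta> *s \<tau>) \<le> \<eta>" if "z + \<zeta> *s \<tau> \<in> closure \<Omega>" for \<zeta>
    by (rule slice_small[OF z(1) zr \<eta> rz _ that]) (use \<tau>(2) c \<eta> in simp)
  have close: "dist (z + \<zeta> *s \<tau>) b' \<le> 2 * \<eta>" if "z + \<zeta> *s \<tau> \<in> closure \<Omega>" for \<zeta>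
  proof -
    have "dist (z + \<zeta> *s \<tau>) b' \<le> norm (\<zeta> *s \<tau>) + dist z b'"
      using dist_triangle[of "z + \<zeta> *s \<tau>" b' z] by (simp add: dist_norm)
    then show ?thesis using small[OF that] z(2) by simp
  qed
  define S where "S = slice z \<tau>"
  have So: "open S" and Sb: "bounded S" unfolding S_def by (rule slice_open, rule slice_bounded[OF small \<tau>(1)])
  have S0: "0 \<in> S" using z(1) by (simp add: S_def slice_def)
  \<comment> \<open>Division by \<open>nu b'\<close> normalises the factor at w1 to g with Re g > 0,
    and division by i exchanges normal and tangential directions: to first order u changes by g y /
    i under a displacement with \<open>linform (a w1)\<close> equal to y.\<close>
  define u where "u \<zeta> = f0 (z + \<zeta> *s \<tau>) / (\<i> * nu b')" for \<zeta>
  have uc: "continuous_on (closure S) u"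
    unfolding u_def using nz
    by (intro continuous_intros continuous_on_compose2[OF f0_cont continuous_line]) (use slice_closure in \<open>auto simp: S_def\<close>)
  have uh: "u holomorphic_on S"
  proof -
    have "(\<lambda>\<zeta>. \<phi> (z + \<zeta> *s \<tau>) / (\<i> * nu b')) holomorphic_on S"
      using line_holomorphic[OF phi_hol open_dom, of z \<tau>] nz
      by (intro holomorphic_intros) (auto simp: S_def slice_def)
    then show ?thesis by (rule holomorphic_transform) (auto simp: u_def S_def slice_def f0_eq)
  qed
  have fne: "frontier S \<noteq> {}" using S0 Sb by (auto simp: frontier_eq_empty)
  have fcomp: "compact (frontier S)" using Sb by (rule compact_frontier_bounded)
  have fsub: "frontier S \<subseteq> closure S" by (simp add: frontier_def)
  obtain \<zeta>1 where \<zeta>1: "\<zeta>1 \<in> frontier S" "\<And>\<zeta>. \<zeta> \<in> frontier S \<Longrightarrow> Re (u \<zeta>) \<le> Re (u \<zeta>1)"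
    using continuous_attains_sup[OF fcomp fne, of "\<lambda>\<zeta>. Re (u \<zeta>)"] continuous_on_subset[OF uc fsub]
    by (auto intro: continuous_on_Re)
  have umax: "Re (u \<zeta>) \<le> Re (u \<zeta>1)" if "\<zeta> \<in> S" for \<zeta>
  proof -
    \<comment> \<open>The maximum modulus principle for exp u is the maximum principle for Re
      u.\<close>
    have "cmod (exp (u \<zeta>)) \<le> exp (Re (u \<zeta>1))"
    proof (rule maximum_modulus_frontier[of "\<lambda>\<zeta>. exp (u \<zeta>)" S])
      show "(\<lambda>\<zeta>. exp (u \<zeta>)) holomorphic_on interior S"
        using uh So by (intro holomorphic_intros) (simp add: interior_open)
      show "continuous_on (closure S) (\<lambda>\<zeta>. exp (u \<zeta>))" by (intro continuous_intros uc)
      show "cmod (exp (u \<zeta>)) \<le> exp (Re (u \<zeta>1))" if "\<zeta> \<in> frontier S" for \<zeta>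
        using \<zeta>1(2)[OF that] by (simp add: norm_exp_eq_Re)
    qed (use Sb that in auto)
    then show ?thesis by (simp add: norm_exp_eq_Re)
  qed
  define w1 where "w1 = z + \<zeta>1 *s \<tau>"
  have w1f: "w1 \<in> frontier \<Omega>" unfolding w1_def by (rule slice_frontier) (use \<zeta>1(1) in \<open>simp add: S_def\<close>)
  have w1cl: "w1 \<in> closure \<Omega>" using w1f by (simp add: frontier_def)
  have w1near: "dist w1 b' \<le> 2 * \<eta>" using close[of \<zeta>1] w1cl by (simp add: w1_def)
  have w1q: "w1 \<in> ball q (\<rho> / 2)" by (rule near(1)[OF w1near])
  have w1U: "w1 \<in> U" using half_ball[OF w1q] ball_U by blast
  have rw1: "r w1 = 0" by (rule frontier_zero[OF w1f w1U])
  define g where "g = nu w1 / nu b'"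
  have g: "Re g > 0" unfolding g_def by (rule near(2)[OF w1near w1cl])
  define A1 where "A1 = linform (a w1) \<tau>"
  \<comment> \<open>z - w1 is a multiple of \<tau>, so A1 = 0 would make it tangential at w1, which
    \<open>transversal\<close> excludes. Hence y can be prescribed freely in
    \<open>dirs\<close>.\<close>
  have A1: "A1 \<noteq> 0"
  proof
    assume "A1 = 0"
    have "z - w1 = (- \<zeta>1) *s \<tau>" by (simp add: w1_def vec_eq_iff)
    then have "linform (a w1) (z - w1) = 0" using \<open>A1 = 0\<close> by (simp only: linform_scale A1_def mult_zero_right)
    then have "d w1 (z - w1) = 0" using Re_linform_a[of w1 "z - w1"] by simp
    then show False using transversal[OF z(1) zr half_ball[OF w1q] rw1] by simp
  qed
  \<comment> \<open>Every y in the open left half plane is realised by a displacement V inside the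
    slice that enters the domain, and Re u cannot increase along it because its maximum is at
    \<open>\<zeta>1\<close>.\<close>
  have dirs: "Re (g * y / \<i>) \<le> 0" if y: "Re y < 0" for y
  proof (rule ccontr)
    assume "\<not> Re (g * y / \<i>) \<le> 0"
    then have pos: "Re (g * y / \<i>) > 0" by simp
    define V where "V = (y / A1) *s \<tau>"
    have lV: "linform (a w1) V = y" using A1 by (simp add: V_def linform_scale A1_def[symmetric])
    have "d w1 V < 0" using y Re_linform_a[of w1 V] lV by simp
    then obtain e where e: "0 < e" "\<And>t. 0 < t \<Longrightarrow> t < e \<Longrightarrow> w1 + t *\<^sub>R V \<in> \<Omega>"
      using descent_in_domain[OF w1U rw1] by blast
    define \<delta> where "\<delta> = Re (g * y / \<i>) / 2"
    have \<delta>: "\<delta> * cmod (nu b') > 0" using pos nz by (simp add: \<delta>_def)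
    obtain t where t: "0 < t" "t < e" "cmod (f0 (w1 + t *\<^sub>R V) - f0 w1 - t *\<^sub>R blinfun_apply (f1 w1) V) \<le> \<delta> * cmod (nu b') * t"
      using one_sided_derivative[OF w1cl e \<delta>] by blast
    define \<zeta>t where "\<zeta>t = \<zeta>1 + of_real t * (y / A1)"
    have wt: "w1 + t *\<^sub>R V = z + \<zeta>t *s \<tau>"
    proof (rule vec_eq_iff[THEN iffD2], rule allI)
      fix i
      have "(w1 + t *\<^sub>R V) $ i = w1 $ i + t *\<^sub>R (V $ i)" by simp
      also have "\<dots> = (z + \<zeta>t *s \<tau>) $ i"
        by (simp add: w1_def V_def \<zeta>t_def scaleR_conv_of_real algebra_simps)
      finally show "(w1 + t *\<^sub>R V) $ i = (z + \<zeta>t *s \<tau>) $ i" .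
    qed
    have "\<zeta>t \<in> S" using e(2)[OF t(1,2)] wt by (simp add: S_def slice_def)
    then have le: "Re (u \<zeta>t) \<le> Re (u \<zeta>1)" by (rule umax)
    have fV: "blinfun_apply (f1 w1) V = nu w1 * y" using f1_frontier[OF w1f w1q, of V] lV by simp
    define E where "E = f0 (w1 + t *\<^sub>R V) - f0 w1 - t *\<^sub>R blinfun_apply (f1 w1) V"
    have "u \<zeta>t - u \<zeta>1 = (f0 (w1 + t *\<^sub>R V) - f0 w1) / (\<i> * nu b')"
      unfolding u_def wt w1_def[symmetric] by (simp add: diff_divide_distrib)
    also have "f0 (w1 + t *\<^sub>R V) - f0 w1 = of_real t * (nu w1 * y) + E"
      by (simp add: E_def fV scaleR_conv_of_real)
    also have "\<dots> / (\<i> * nu b') = of_real t * (g * y / \<i>) + E / (\<i> * nu b')"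
      using nz by (simp add: g_def field_simps)
    finally have ud: "u \<zeta>t - u \<zeta>1 = of_real t * (g * y / \<i>) + E / (\<i> * nu b')" .
    have "Re (u \<zeta>t) - Re (u \<zeta>1) = Re (of_real t * (g * y / \<i>) + E / (\<i> * nu b'))"
      unfolding ud[symmetric] by (rule minus_complex.sel(1)[symmetric])
    also have "\<dots> = t * Re (g * y / \<i>) + Re (E / (\<i> * nu b'))"
      by (simp only: plus_complex.sel times_complex.sel Re_complex_of_real Im_complex_of_real mult_zero_left diff_zero)
    finally have "Re (u \<zeta>t) - Re (u \<zeta>1) = t * Re (g * y / \<i>) + Re (E / (\<i> * nu b'))" .
    moreover have "- Re (E / (\<i> * nu b')) \<le> \<delta> * t"
    proof -
      have "- Re (E / (\<i> * nu b')) \<le> cmod (E / (\<i> * nu b'))" using abs_Re_le_cmod[of "E / (\<i> * nu b')"] by linarith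
      also have "\<dots> = cmod E / cmod (nu b')" by (simp add: norm_divide norm_mult)
      also have "\<dots> \<le> \<delta> * t" using t(3) nz unfolding E_def[symmetric] by (simp add: field_simps)
      finally show ?thesis .
    qed
    moreover have "t * Re (g * y / \<i>) = 2 * (\<delta> * t)" by (simp add: \<delta>_def)
    moreover have "\<delta> * t > 0" using pos t by (simp add: \<delta>_def)
    ultimately show False using le by linarith
  qed
  \<comment> \<open>y = - \<epsilon> + i points almost along the boundary, and g y / i = g (1 + i
    \<epsilon>) has real part at least Re g / 2 > 0 for this \<epsilon>, against
    \<open>dirs\<close>.\<close>
  define \<epsilon> where "\<epsilon> = Re g / (2 * (\<bar>Im g\<bar> + 1))"
  have \<epsilon>: "\<epsilon> > 0" using g by (simp add: \<epsilon>_def add_nonneg_pos)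
  have "Re (g * (- of_real \<epsilon> + \<i>) / \<i>) \<le> 0" using \<epsilon> by (intro dirs) simp
  moreover have "g * (- of_real \<epsilon> + \<i>) / \<i> = g * (1 + \<i> * of_real \<epsilon>)" by (simp add: field_simps)
  ultimately have "Re g - \<epsilon> * Im g \<le> 0" by (simp add: mult.commute)
  moreover have "\<epsilon> * Im g \<le> Re g / 2"
  proof -
    have "\<epsilon> * Im g \<le> \<epsilon> * (\<bar>Im g\<bar> + 1)" using \<epsilon> by (intro mult_left_mono) auto
    also have "\<dots> = Re g / 2" unfolding \<epsilon>_def by (rule half_cancel) simp
    finally show ?thesis .
  qed
  ultimately show False using g by linarith
qed

lemma f1_frontier_zero: "w \<in> frontier \<Omega> \<Longrightarrow> w \<in> ball q (\<rho> / 2) \<Longrightarrow> blinfun_apply (f1 w) v = 0"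
  using f1_frontier normal_derivative_zero by simp

lemma f1_slice_zero:
  assumes z: "z \<in> \<Omega>" "z \<in> ball q (\<rho> / 4)" and rz: "- r z \<le> c * (\<rho> / 8)\<^sup>2 / 8"
    and \<tau>: "\<tau> \<noteq> 0" "cmod (linform (a z) \<tau>) \<le> c * (\<rho> / 8) / 2 * norm \<tau>"
  shows "blinfun_apply (f1 z) \<tau> = 0"
proof -
  have zr: "z \<in> ball q \<rho>" using z(2) \<rho> by simp
  have \<eta>: "0 < \<rho> / 8" using \<rho> by simp
  have small: "norm (\<zeta> *s \<tau>) \<le> \<rho> / 8" if "z + \<zeta> *s \<tau> \<in> closure \<Omega>" for \<zeta>
    by (rule slice_small[OF z(1) zr \<eta> rz \<tau>(2) that])
  define S where "S = slice z \<tau>"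
  have So: "open S" and Sb: "bounded S" unfolding S_def by (rule slice_open, rule slice_bounded[OF small \<tau>(1)])
  have S0: "0 \<in> S" using z(1) by (simp add: S_def slice_def)
  define F where "F \<zeta> = blinfun_apply (f1 (z + \<zeta> *s \<tau>)) \<tau>" for \<zeta>
  have Fd: "((\<lambda>\<zeta>. \<phi> (z + \<zeta> *s \<tau>)) has_field_derivative F \<zeta>) (at \<zeta>)" if "\<zeta> \<in> S" for \<zeta>
  proof -
    have "z + \<zeta> *s \<tau> \<in> \<Omega>" using that by (simp add: S_def slice_def)
    then show ?thesis unfolding F_def by (intro line_has_field_derivative phi_deriv f1_hom_dom)
  qed
  have "(\<lambda>\<zeta>. \<phi> (z + \<zeta> *s \<tau>)) holomorphic_on S"
    using line_holomorphic[OF phi_hol open_dom, of z \<tau>] by (simp add: S_def slice_def)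
  from holomorphic_deriv[OF this So] have Fh: "F holomorphic_on S"
    by (rule holomorphic_transform) (rule DERIV_imp_deriv[OF Fd])
  have "cmod (F 0) \<le> 0"
  proof (rule maximum_modulus_frontier[of F S])
    show "F holomorphic_on interior S" using Fh So by (simp add: interior_open)
    show "continuous_on (closure S) F"
      unfolding F_def
      by (intro continuous_on_compose2[OF f1_apply_cont continuous_line]) (use slice_closure in \<open>auto simp: S_def\<close>)
    fix \<zeta> assume \<zeta>: "\<zeta> \<in> frontier S"
    have fr: "z + \<zeta> *s \<tau> \<in> frontier \<Omega>" by (rule slice_frontier) (use \<zeta> in \<open>simp add: S_def\<close>)
    then have "norm (\<zeta> *s \<tau>) \<le> \<rho> / 8" by (intro small) (simp add: frontier_def)
    then have "z + \<zeta> *s \<tau> \<in> ball q (\<rho> / 2)"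
      using dist_triangle[of q "z + \<zeta> *s \<tau>" z] z(2) \<rho> by (simp add: dist_norm)
    then show "cmod (F \<zeta>) \<le> 0" unfolding F_def using f1_frontier_zero[OF fr] by simp
  qed (use Sb S0 in auto)
  then show ?thesis by (simp add: F_def)
qed

text \<open>Almost tangential directions form an open cone: a tangent \<tau> perturbed by a small
  multiple s v of any v still qualifies, and v is a combination of \<tau> and \<tau> + s v.\<close>

lemma f1_zero_near:
  assumes z: "z \<in> \<Omega>" "z \<in> ball q (\<rho> / 4)" and rz: "- r z \<le> c * (\<rho> / 8)\<^sup>2 / 8"
  shows "f1 z = 0"
proof (rule blinfun_eqI)
  fix v
  have zr: "z \<in> ball q \<rho>" using z(2) \<rho> by simp
  obtain \<tau> where \<tau>: "\<tau> \<noteq> 0" "linform (a z) \<tau> = 0" using tangent_vector[OF zr] by blast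
  define \<gamma> where "\<gamma> = c * (\<rho> / 8) / 2"
  have \<gamma>: "\<gamma> > 0" using c \<rho> by (simp add: \<gamma>_def)
  have n\<tau>: "norm \<tau> > 0" using \<tau> by simp
  \<comment> \<open>The first entry keeps |\<tau> + s v| above |\<tau>| / 2, the second keeps the
    linear form at most \<gamma> |\<tau>| / 2.\<close>
  define s where "s = min (norm \<tau> / (2 * (norm v + 1))) (\<gamma> * norm \<tau> / (2 * (cmod (linform (a z) v) + 1)))"
  have p1: "norm v + 1 > 0" "cmod (linform (a z) v) + 1 > 0" by (simp_all add: add_nonneg_pos)
  have s: "s > 0" using n\<tau> \<gamma> p1 by (simp add: s_def)
  have "s * norm v \<le> norm \<tau> / (2 * (norm v + 1)) * (norm v + 1)" using n\<tau> p1 s by (intro mult_mono) (auto simp: s_def)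
  then have sv: "s * norm v \<le> norm \<tau> / 2" by (simp only: half_cancel[OF p1(1)])
  have "s * cmod (linform (a z) v) \<le> \<gamma> * norm \<tau> / (2 * (cmod (linform (a z) v) + 1)) * (cmod (linform (a z) v) + 1)"
    using n\<tau> p1 s \<gamma> by (intro mult_mono) (auto simp: s_def)
  then have sl: "s * cmod (linform (a z) v) \<le> \<gamma> * norm \<tau> / 2" by (simp only: half_cancel[OF p1(2)])
  define \<sigma> where "\<sigma> = \<tau> + s *\<^sub>R v"
  have n\<sigma>: "norm \<sigma> \<ge> norm \<tau> / 2"
    using norm_triangle_ineq2[of \<tau> "- (s *\<^sub>R v)"] sv s by (simp add: \<sigma>_def)
  have "\<sigma> \<noteq> 0" using n\<sigma> n\<tau> by auto
  moreover have "cmod (linform (a z) \<sigma>) \<le> \<gamma> * norm \<sigma>"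
  proof -
    have "cmod (linform (a z) \<sigma>) = s * cmod (linform (a z) v)" using s \<tau>(2) by (simp add: \<sigma>_def linform_add linform_scaleR norm_mult)
    also have "\<dots> \<le> \<gamma> * (norm \<tau> / 2)" using sl by simp
    also have "\<dots> \<le> \<gamma> * norm \<sigma>" using n\<sigma> \<gamma> by (intro mult_left_mono) auto
    finally show ?thesis .
  qed
  ultimately have "blinfun_apply (f1 z) \<sigma> = 0" unfolding \<gamma>_def by (intro f1_slice_zero z rz)
  moreover have "blinfun_apply (f1 z) \<tau> = 0"
    by (rule f1_slice_zero[OF z rz \<tau>(1)]) (use \<tau>(2) c \<rho> in simp)
  ultimately show "blinfun_apply (f1 z) v = blinfun_apply 0 v" using s by (simp add: \<sigma>_def blinfun.bilinear_simps)
qed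

text \<open>Continuation from a neighbourhood of q to the connected domain. The interior Z of the
  zero set of D\<phi> is also closed in the domain, because a ball meeting Z is swept out by complex
  lines through a point of Z, on which the identity theorem in one variable applies.\<close>

lemma symbol_constant:
  assumes con: "connected \<Omega>"
  shows "\<phi> constant_on \<Omega>"
proof -
  define Z where "Z = interior {x \<in> \<Omega>. f1 x = 0}"
  have Zo: "open Z" by (simp add: Z_def)
  have Z\<Omega>: "Z \<subseteq> \<Omega>" and Zf: "f1 x = 0" if "x \<in> Z" for x
    using interior_subset[of "{x \<in> \<Omega>. f1 x = 0}"] that by (auto simp: Z_def)
  have Zsub: "Z \<subseteq> \<Omega>" using interior_subset[of "{x \<in> \<Omega>. f1 x = 0}"] by (auto simp: Z_def)
  have Zne: "Z \<noteq> {}"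
  proof -
    have "c * (\<rho> / 8)\<^sup>2 / 8 > 0" using c \<rho> by simp
    moreover have "isCont r q" using r1[OF q_U] has_derivative_continuous by blast
    moreover have "r q = 0" by (rule frontier_zero[OF q_frontier q_U])
    ultimately obtain e where e: "e > 0" "\<And>x. dist x q < e \<Longrightarrow> dist (r x) 0 < c * (\<rho> / 8)\<^sup>2 / 8"
      unfolding continuous_at_eps_delta by metis
    define e' where "e' = min e (\<rho> / 4)"
    have e': "e' > 0" using e \<rho> by (simp add: e'_def)
    have "q \<in> closure \<Omega>" using q_frontier by (simp add: frontier_def)
    then obtain z where z: "z \<in> \<Omega>" "dist z q < e'" using e' closure_approachable by blast
    have "\<Omega> \<inter> ball q e' \<subseteq> {x \<in> \<Omega>. f1 x = 0}"
    proof
      fix x assume x: "x \<in> \<Omega> \<inter> ball q e'"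
      have "f1 x = 0"
        by (rule f1_zero_near) (use x e(2)[of x] in \<open>auto simp: e'_def dist_commute dist_real_def\<close>)
      then show "x \<in> {x \<in> \<Omega>. f1 x = 0}" using x by blast
    qed
    then have "\<Omega> \<inter> ball q e' \<subseteq> Z" unfolding Z_def using open_dom by (intro interior_maximal open_Int) auto
    moreover have "z \<in> \<Omega> \<inter> ball q e'" using z by (simp add: dist_commute)
    ultimately show ?thesis by blast
  qed
  have spread: "z \<in> Z" if z: "z \<in> \<Omega>" and lim: "\<And>e. e > 0 \<Longrightarrow> ball z e \<inter> Z \<noteq> {}" for z
  proof -
    obtain e where e: "e > 0" "ball z e \<subseteq> \<Omega>" using open_dom z open_contains_ball by blast
    obtain y where y: "y \<in> ball z e" "y \<in> Z" using lim[OF e(1)] by blast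
    obtain \<delta> where \<delta>: "\<delta> > 0" "ball y \<delta> \<subseteq> ball z e \<inter> Z"
      using open_Int[OF open_ball Zo] y open_contains_ball by (metis IntI)
    have const\<delta>: "\<phi> x = \<phi> y" if x: "x \<in> ball y \<delta>" for x
    proof -
      have "\<exists>c. \<forall>x\<in>ball y \<delta>. \<phi> x = c"
      proof (rule has_derivative_zero_constant)
        fix x assume "x \<in> ball y \<delta>"
        then have "x \<in> Z" using \<delta>(2) by blast
        then have "(\<phi> has_derivative (\<lambda>h. 0)) (at x)" using phi_deriv[of x] Zsub Zf[of x] by (auto simp: zero_blinfun.rep_eq)
        then show "(\<phi> has_derivative (\<lambda>h. 0)) (at x within ball y \<delta>)" by (rule has_derivative_at_withinI)
      qed simp
      then show ?thesis using x \<delta>(1) by (metis centre_in_ball)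
    qed
    have const: "\<phi> p = \<phi> y" if p: "p \<in> ball z e" for p
    proof -
      \<comment> \<open>The part inside the ball of the complex line through y and p; it is convex,
        hence connected, and contains the parameter 1, which corresponds to p.\<close>
      define S where "S = {\<zeta>. y + \<zeta> *s (p - y) \<in> ball z e}"
      have So: "open S" unfolding S_def by (rule open_line) simp
      have Sc: "connected S"
      proof (rule convex_connected, rule convexI)
        fix s t u v assume st: "s \<in> S" "t \<in> S" and uv: "0 \<le> (u::real)" "0 \<le> v" "u + v = 1"
        have "u *\<^sub>R (y + s *s (p - y)) + v *\<^sub>R (y + t *s (p - y)) \<in> ball z e"
          using st uv convexD[OF convex_ball] unfolding S_def by blast
        moreover have "u *\<^sub>R (y + s *s (p - y)) + v *\<^sub>R (y + t *s (p - y)) = (u + v) *\<^sub>R y + (u *\<^sub>R s + v *\<^sub>R t) *s (p - y)"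
        proof (rule vec_eq_iff[THEN iffD2], rule allI)
          fix i
          have "u *\<^sub>R (y $ i + s * (p $ i - y $ i)) + v *\<^sub>R (y $ i + t * (p $ i - y $ i))
              = (u + v) *\<^sub>R (y $ i) + (u *\<^sub>R s + v *\<^sub>R t) * (p $ i - y $ i)"
            by (simp add: scaleR_conv_of_real algebra_simps)
          then show "(u *\<^sub>R (y + s *s (p - y)) + v *\<^sub>R (y + t *s (p - y))) $ i
              = ((u + v) *\<^sub>R y + (u *\<^sub>R s + v *\<^sub>R t) *s (p - y)) $ i"
            by (simp only: vector_add_component vector_scaleR_component vector_smult_component vector_minus_component)
        qed
        ultimately show "u *\<^sub>R s + v *\<^sub>R t \<in> S" using uv by (simp add: S_def)
      qed
      define S' where "S' = {\<zeta>. y + \<zeta> *s (p - y) \<in> ball y \<delta>}"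
      have S'o: "open S'" unfolding S'_def by (rule open_line) simp
      have S'0: "0 \<in> S'" using \<delta>(1) by (simp add: S'_def)
      have S'S: "S' \<subseteq> S" using \<delta>(2) by (auto simp: S_def S'_def)
      have hol: "(\<lambda>\<zeta>. \<phi> (y + \<zeta> *s (p - y))) holomorphic_on S"
        by (rule holomorphic_on_subset[OF line_holomorphic[OF phi_hol open_dom]]) (use e(2) in \<open>auto simp: S_def\<close>)
      have "(\<lambda>\<zeta>. \<phi> (y + \<zeta> *s (p - y))) 1 = (\<lambda>\<zeta>. \<phi> y) 1"
      proof (rule analytic_continuation_open[OF S'o So _ Sc S'S hol holomorphic_on_const])
        show "S' \<noteq> {}" using S'0 by blast
        show "\<phi> (y + \<zeta> *s (p - y)) = \<phi> y" if "\<zeta> \<in> S'" for \<zeta> using that by (intro const\<delta>) (simp add: S'_def)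
        show "1 \<in> S" using p by (simp add: S_def)
      qed
      then show ?thesis by simp
    qed
    have "ball z e \<subseteq> {x \<in> \<Omega>. f1 x = 0}"
    proof
      fix x assume x: "x \<in> ball z e"
      have "((\<lambda>_. \<phi> y) has_derivative (\<lambda>h. 0)) (at x)" by simp
      then have "(\<phi> has_derivative (\<lambda>h. 0)) (at x)"
        by (rule has_derivative_transform_within_open[OF _ open_ball x]) (simp add: const)
      moreover have "(\<phi> has_derivative blinfun_apply (f1 x)) (at x)" using phi_deriv x e(2) by blast
      ultimately have "blinfun_apply (f1 x) = (\<lambda>h. 0)" using has_derivative_unique by blast
      then have "f1 x = 0" by (intro blinfun_eqI) simp
      then show "x \<in> {x \<in> \<Omega>. f1 x = 0}" using x e(2) by blast
    qed
    then have "ball z e \<subseteq> Z" unfolding Z_def by (intro interior_maximal) auto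
    then show ?thesis using e(1) by auto
  qed
  have "open (\<Omega> - Z)"
    unfolding open_contains_ball
  proof
    fix z assume z: "z \<in> \<Omega> - Z"
    then obtain e where e: "e > 0" "ball z e \<inter> Z = {}" using spread by blast
    obtain e' where e': "e' > 0" "ball z e' \<subseteq> \<Omega>" using open_dom z open_contains_ball by blast
    have "ball z (min e e') \<subseteq> ball z e" "ball z (min e e') \<subseteq> ball z e'" by auto
    then have "ball z (min e e') \<subseteq> \<Omega> - Z" using e(2) e'(2) by blast
    then show "\<exists>e>0. ball z e \<subseteq> \<Omega> - Z" using e(1) e'(1) by (intro exI[of _ "min e e'"] conjI) auto
  qed
  then have "Z \<inter> \<Omega> = {} \<or> (\<Omega> - Z) \<inter> \<Omega> = {}"
    using connectedD[OF con Zo, of "\<Omega> - Z"] by blast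
  then have "\<Omega> \<subseteq> Z" using Zne Zsub by blast
  then have der: "(\<phi> has_derivative (\<lambda>h. 0)) (at z)" if "z \<in> \<Omega>" for z
    using phi_deriv[OF that] Zf[of z] that by (auto simp: zero_blinfun.rep_eq)
  obtain z0 where z0: "z0 \<in> \<Omega>" using ne_dom by blast
  have "\<phi> z = \<phi> z0" if "z \<in> \<Omega>" for z
    by (rule has_derivative_zero_unique_connected[OF open_dom con der that z0])
  then show ?thesis unfolding constant_on_def by blast
qed

end

theorem theorem1:
  fixes \<Omega> :: "(complex ^ 'n) set" and \<phi> :: "complex ^ 'n \<Rightarrow> complex" and p :: real
  assumes "CARD('n) \<ge> 2"
    and "C2_bounded_pseudoconvex_domain \<Omega>"
    and "\<phi> Cn_holomorphic_on \<Omega>" and "C2_on_closure \<Omega> \<phi>"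
    and "0 < p" and "p \<le> 2 * real CARD('n)"
  shows "schatten_class (bergman_space \<Omega>) (L2_space \<Omega>) (L2_inner \<Omega>) p
           (hankel_operator \<Omega> (\<lambda>z. cnj (\<phi> z)))
         \<longleftrightarrow> \<phi> constant_on \<Omega>"
proof -
  have dom: "open \<Omega>" "connected \<Omega>" "\<Omega> \<noteq> {}" "bounded \<Omega>" "C2_boundary \<Omega>"
    using assms(2) by (simp_all add: C2_bounded_pseudoconvex_domain_def)
  obtain f0 f1 where f0: "\<And>z. z \<in> \<Omega> \<Longrightarrow> f0 z = \<phi> z" "continuous_on (closure \<Omega>) f0"
    and f1: "\<And>z. z \<in> \<Omega> \<Longrightarrow> (\<phi> has_derivative blinfun_apply (f1 z)) (at z)" "continuous_on (closure \<Omega>) f1"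
    using assms(4) unfolding C2_on_closure_def by blast
  have comp: "compact (closure \<Omega>)" using dom(4) by simp
  have clne: "closure \<Omega> \<noteq> {}" using dom(3) by simp
  obtain b where b: "\<And>z. z \<in> \<Omega> \<Longrightarrow> cmod (\<phi> z) \<le> b"
  proof -
    have "bounded (f0 ` closure \<Omega>)" using f0(2) comp by (intro compact_imp_bounded compact_continuous_image)
    then obtain b where "\<And>z. z \<in> closure \<Omega> \<Longrightarrow> cmod (f0 z) \<le> b" unfolding bounded_iff by blast
    then show ?thesis using that f0(1) closure_subset by (metis subsetD)
  qed
  interpret hankel_symbol \<Omega> \<phi> b
    by unfold_locales (use dom assms(3) b in auto)
  show ?thesis
  proof
    assume "\<phi> constant_on \<Omega>"
    then show "schatten_class A L ip p H"
      unfolding constant_on_def using schatten_class_constant by blast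
  next
    assume sch: "schatten_class A L ip p H"
    obtain q where q: "q \<in> closure \<Omega>" "\<And>x. x \<in> closure \<Omega> \<Longrightarrow> norm x \<le> norm q"
      using continuous_attains_sup[OF comp clne, of norm] continuous_on_norm_id by blast
    have q0: "q \<noteq> 0"
    proof
      assume "q = 0"
      then have "\<Omega> \<subseteq> {0}" using q(2) closure_subset by fastforce
      then show False using dom(1,3) by (metis finite.emptyI finite_insert finite_subset not_open_singleton subset_singletonD)
    qed
    have "q \<notin> \<Omega>"
    proof
      assume "q \<in> \<Omega>"
      then obtain e where e: "e > 0" "ball q e \<subseteq> \<Omega>" using dom(1) open_contains_ball by blast
      define x where "x = q + (e / (2 * norm q)) *\<^sub>R q"
      have "x \<in> ball q e" using e q0 by (simp add: x_def dist_norm)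
      then have "norm x \<le> norm q" using e(2) q(2) closure_subset by blast
      moreover have "x = (1 + e / (2 * norm q)) *\<^sub>R q" by (simp add: x_def scaleR_add_left)
      then have "norm x = (1 + e / (2 * norm q)) * norm q" using e q0 by simp
      moreover have "(1 + e / (2 * norm q)) * norm q = norm q + e / 2" using q0 by (simp add: distrib_right)
      ultimately show False using e by linarith
    qed
    then have qf: "q \<in> frontier \<Omega>" using q(1) dom(1) by (simp add: frontier_def interior_open)
    have "\<exists>U (r :: complex ^ 'n \<Rightarrow> real). open U \<and> q \<in> U \<and> C2_on U r \<and> \<Omega> \<inter> U = {x \<in> U. r x < 0} \<and>
       (\<forall>x\<in>U. \<not> (r has_derivative (\<lambda>_. 0)) (at x))"
      using dom(5) qf unfolding C2_boundary_def by (rule bspec)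
    then obtain U and r :: "complex ^ 'n \<Rightarrow> real"
      where U: "open U" "q \<in> U" "C2_on U r" "\<Omega> \<inter> U = {x \<in> U. r x < 0}"
      and nz: "\<forall>x\<in>U. \<not> (r has_derivative (\<lambda>_. 0)) (at x)"
      by (elim exE conjE)
    obtain r1 r2 where r: "\<And>x. x \<in> U \<Longrightarrow> (r has_derivative blinfun_apply (r1 x)) (at x)"
      "\<And>x. x \<in> U \<Longrightarrow> (r1 has_derivative blinfun_apply (r2 x)) (at x)" "continuous_on U r2"
      using U(3) unfolding C2_on_def by blast
    have r1q: "r1 q \<noteq> 0" using bspec[OF nz U(2)] r(1)[OF U(2)] by (auto simp: zero_blinfun.rep_eq)
    have far: "norm x \<le> norm q" if "x \<in> \<Omega>" for x using q(2) that closure_subset by blast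
    interpret bergman_farthest \<Omega> U r r1 r2 q
      by unfold_locales (use dom(1) U qf r r1q far q0 in auto)
    show "\<phi> constant_on \<Omega>"
    proof (rule uniform_data)
      fix \<rho> c k \<alpha> \<Lambda> M
      assume data: "0 < \<rho>" "0 < c" "0 < \<alpha>" "0 < M" "ball q \<rho> \<subseteq> U"
        "\<And>z. z \<in> ball q \<rho> \<Longrightarrow> \<alpha> \<le> cmod (a z $ k)" "\<And>z. z \<in> ball q \<rho> \<Longrightarrow> norm (a z) \<le> \<Lambda>"
        "\<And>z. z \<in> ball q \<rho> \<Longrightarrow> norm (r2 z) \<le> M" "\<And>z. z \<in> ball q \<rho> \<Longrightarrow> - r z < 1"
        "\<And>z w. z \<in> \<Omega> \<Longrightarrow> z \<in> ball q \<rho> \<Longrightarrow> w \<in> \<Omega> \<Longrightarrow> c * (norm (w - z))\<^sup>2 + 2 * r z \<le> - d z (w - z)"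
        "\<And>z w. z \<in> \<Omega> \<Longrightarrow> z \<in> ball q \<rho> \<Longrightarrow> w \<in> ball q \<rho> \<Longrightarrow> r w = 0 \<Longrightarrow> d w (z - w) \<noteq> 0"
      interpret hankel_farthest \<Omega> U r r1 r2 q \<rho> c \<alpha> \<Lambda> M k \<phi> b f1
        by unfold_locales (fact data f1)+
      interpret tangential_symbol \<Omega> U r r1 r2 q \<rho> c \<alpha> \<Lambda> M k \<phi> b f1 f0
        by unfold_locales (fact f0 assms(1) tangential_derivative_zero[OF sch assms(5,6)])+
      show "\<phi> constant_on \<Omega>" by (rule symbol_constant[OF dom(2)])
    qed
  qed
qed

end
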